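(* Let $\varrho$ be a linear 2-representation of a finite group $G$ on an object $V$ of a $k$-linear 2-category $\mathcal C$ such that $(V^G,U)$ exists. Then there is an isomorphism of $k$-algebras $$i:\ \mathcal{D}\mathrm{im}(V^G)\ \xrightarrow{\ \cong\ }\ \Bigl(\bigoplus_{g\in G}\mathbb{T}r(\varrho(g))\Bigr)^G ,$$ where the right-hand side is the $G$-invariant part of the twisted group algebra $R_\varrho$. Moreover, for any 1-endomorphism $F$ of $V^G$ there is an isomorphism of bimodules $$i_F:\ \mathbb{T}r(F)\ \xrightarrow{\ \cong\ }\ \mathbb{T}r(UFA')^G ,$$ where $\mathbb{T}r(F)$ is a bimodule over $\mathcal{D}\mathrm{im}(V^G)$ by horizontal composition, $\mathbb{T}r(UFA')^G$ is a bimodule over $R_\varrho^G$, and the two algebras are identified by $i$.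
   Context: $k$ is an algebraically closed field and $G$ a finite group. $\mathcal C$ is a $k$-linear 2-category: its categories of 1-morphisms are additive and $k$-linear and composition is bilinear. $\circ$ is vertical composition, juxtaposition is horizontal composition. For a 1-endomorphism $F$ of $V$, $\mathbb{T}r(F)=2\mathrm{Hom}(\mathrm{id}_V,F)$; $\mathcal{D}\mathrm{im}(V)=\mathbb{T}r(\mathrm{id}_V)$, a commutative $k$-algebra under composition. A 2-representation $\varrho$ of $G$ on $V$: 1-endomorphisms $\varrho(g)$ (abbreviated $g$) of $V$ and 2-isomorphisms $\phi_{g,h}:\varrho(g)\varrho(h)\Rightarrow\varrho(gh)$, $\phi_1:\varrho(1)\Rightarrow\mathrm{id}_V$ with $\phi_{gh,k}\circ(\phi_{g,h}k)=\phi_{g,hk}\circ(g\phi_{h,k})$, $\phi_{1,g}=\phi_1 g$, $\phi_{g,1}=g\phi_1$. There result canonical isomorphisms $\mathrm{id}_V\cong ss^{-1}$ and $\phi_{g,h,l}:\varrho(g)\varrho(h)\varrho(l)\cong\varrho(ghl)$. Equivariant 1-morphisms. For $W,V$ with 2-representations of $G$, $1\mathrm{Hom}_G(W,V)$ has objects $(F,\{\tau_g\})$, $F:W\to V$, with flip 2-isomorphisms $\tau_g:gF\Rightarrow Fg$ such that $\tau_{gh}\circ(\phi_{g,h}F)=(F\phi_{g,h})\circ(\tau_g h)\circ(g\tau_h)$ and $\tau_1$ is the map $1F\cong F\cong F1$; morphisms are the ($G$-invariant) 2-morphisms commuting with the flips. If $F,H$ have flips $\tau,\sigma$ and $HF$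 is defined, it has flips $(H\tau_g)\circ(\sigma_gF)$. $1\mathrm{Hom}_G^{triv}(W,V)$ has objects $(F,\{\tau_g\},\{\epsilon_g\})$, where moreover $\epsilon_g:F\Rightarrow gF$ are 2-isomorphisms (a trivialization) with $(\phi_{g,h}F)\circ(g\epsilon_h)\circ\epsilon_g=\epsilon_{gh}$ and $(\phi_{s,g}F)\circ(s\epsilon_g)\circ\tau_s^{-1}=(\phi_{sgs^{-1},s}F)\circ\bigl((sgs^{-1})\tau_s^{-1}\bigr)\circ(\epsilon_{sgs^{-1}}s)$ as 2-morphisms $Fs\Rightarrow (sg)F$; morphisms must commute with flips and trivializations. The pair $(V^G,U)$: $V^G$ is an object of $\mathcal C$ with a 2-representation of $G$ and a trivialization $\epsilon_g:\mathrm{id}_{V^G}\Rightarrow g$ of its identity, and $U:V^G\to V$ is an equivariant 1-morphism with flips $\tau^U_g$, such that for every $W$ with 2-representation of $G$ the functor $1\mathrm{Hom}_G(W,V^G)\to 1\mathrm{Hom}_G^{triv}(W,V)$, $F\mapsto UF$, is an equivalence; here $UF$ is trivialized by $((\tau^U_g)^{-1}F)\circ(U\epsilon_gF)$. Put $\upsilon_g=(\tau^U_g)^{-1}\circ(U\epsilon_g):U\Rightarrow gU$. The adjoint $A'$ and the monoid $A$. Let $A=\bigoplus_{g\in G}\varrho(g)$, a trivialized equivariant 1-endomorphism of $V$ via the isomorphisms $\phi_{g,h,s^{-1}}:\varrho(g)\varrho(h)\varrho(s^{-1})\cong\varrho(ghs^{-1})$. Let $A':V\to V^G$ be the equivariant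 1-morphism with $UA'=A$ provided by the universal property. It is left adjoint to $U$ with unit $\iota:\mathrm{id}_V\Rightarrow A=UA'$ ($\phi_1^{-1}$ followed by inclusion of the summand $\varrho(1)$) and counit $\alpha':A'U\Rightarrow\mathrm{id}$ with $U\alpha'=\alpha:=\sum_g\upsilon_g^{-1}:AU\Rightarrow U$. Thus $A$ is a monoid with multiplication $\alpha A'$ and unit $\iota$. The twisted group algebra is $R_\varrho=\mathbb{T}r(A)=\bigoplus_g\mathbb{T}r(\varrho(g))$ with product $\xi\cdot\zeta=(\alpha A')\circ(\xi\zeta)$; equivalently, for $\xi\in\mathbb{T}r(\varrho(g))$, $\zeta\in\mathbb{T}r(\varrho(h))$, $\xi\cdot\zeta=\phi_{g,h}\circ(\xi\zeta)$. For a 1-endomorphism $F$ of $V^G$, $M=UFA'$ is an $A$-bimodule via $\alpha FA'$ and $UF\alpha'A'$, so $\mathbb{T}r(M)$ is an $R_\varrho$-bimodule. $G$-action. $s\in G$ sends $\mu\in\mathbb{T}r(M)$, for $M$ an equivariant 1-endomorphism of $V$ with flips $\tau_s$, to the composite $\mathrm{id}_V\cong ss^{-1}\xrightarrow{s\mu s^{-1}}sMs^{-1}\xrightarrow{\tau_s s^{-1}}Mss^{-1}\cong M$. For $M=A$ this sends $\xi\in\mathbb{T}r(\varrho(g))$ to $\mathrm{id}_V\cong ss^{-1}\xrightarrow{s\xi s^{-1}}sgs^{-1}\cong\varrho(sgs^{-1})$. A 1-endomorphism $F$ of $V^G$ is regarded as equivariant with flips $gF\xrightarrow{\epsilon_g^{-1}F}F\xrightarrow{F\epsilon_g}Fg$,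 so $UFA'$ is equivariant. *)

theory Defs
  imports "HOL-Algebra.Algebra"
begin

section \<open>Categories and equivalences\<close>

text \<open>
  Hom-sets need not be disjoint, so the action of a functor on arrows also takes the source and
  the target as arguments.
\<close>

record ('x, 'a) cat =
  Ob :: "'x set"
  Hom :: "'x \<Rightarrow> 'x \<Rightarrow> 'a set"
  Id :: "'x \<Rightarrow> 'a"
  Cmp :: "'a \<Rightarrow> 'a \<Rightarrow> 'a"

definition category :: "('x, 'a) cat \<Rightarrow> bool" where
  "category D \<longleftrightarrow>
    (\<forall>u\<in>Ob D. Id D u \<in> Hom D u u) \<and>
    (\<forall>u\<in>Ob D. \<forall>v\<in>Ob D. \<forall>w\<in>Ob D. \<forall>f\<in>Hom D u v. \<forall>g\<in>Hom D v w. Cmp D g f \<in> Hom D u w) \<and>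
    (\<forall>u\<in>Ob D. \<forall>v\<in>Ob D. \<forall>f\<in>Hom D u v. Cmp D f (Id D u) = f \<and> Cmp D (Id D v) f = f) \<and>
    (\<forall>u\<in>Ob D. \<forall>v\<in>Ob D. \<forall>w\<in>Ob D. \<forall>z\<in>Ob D. \<forall>f\<in>Hom D u v. \<forall>g\<in>Hom D v w. \<forall>h\<in>Hom D w z.
      Cmp D h (Cmp D g f) = Cmp D (Cmp D h g) f)"

definition is_functor ::
  "('x, 'a) cat \<Rightarrow> ('y, 'b) cat \<Rightarrow> ('x \<Rightarrow> 'y) \<Rightarrow> ('x \<Rightarrow> 'x \<Rightarrow> 'a \<Rightarrow> 'b) \<Rightarrow> bool" where
  "is_functor D E Fo Fa \<longleftrightarrow>
    (\<forall>u\<in>Ob D. Fo u \<in> Ob E) \<and>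
    (\<forall>u\<in>Ob D. \<forall>v\<in>Ob D. \<forall>f\<in>Hom D u v. Fa u v f \<in> Hom E (Fo u) (Fo v)) \<and>
    (\<forall>u\<in>Ob D. Fa u u (Id D u) = Id E (Fo u)) \<and>
    (\<forall>u\<in>Ob D. \<forall>v\<in>Ob D. \<forall>w\<in>Ob D. \<forall>f\<in>Hom D u v. \<forall>g\<in>Hom D v w.
      Fa u w (Cmp D g f) = Cmp E (Fa v w g) (Fa u v f))"

definition natural_iso ::
  "('x, 'a) cat \<Rightarrow> ('y, 'b) cat \<Rightarrow> ('x \<Rightarrow> 'y) \<Rightarrow> ('x \<Rightarrow> 'x \<Rightarrow> 'a \<Rightarrow> 'b) \<Rightarrow>
   ('x \<Rightarrow> 'y) \<Rightarrow> ('x \<Rightarrow> 'x \<Rightarrow> 'a \<Rightarrow> 'b) \<Rightarrow> ('x \<Rightarrow> 'b) \<Rightarrow> bool" where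
  "natural_iso D E Fo Fa Ho Ha \<eta> \<longleftrightarrow>
    (\<forall>u\<in>Ob D. \<eta> u \<in> Hom E (Fo u) (Ho u) \<and>
      (\<exists>\<theta>\<in>Hom E (Ho u) (Fo u). Cmp E \<theta> (\<eta> u) = Id E (Fo u) \<and> Cmp E (\<eta> u) \<theta> = Id E (Ho u))) \<and>
    (\<forall>u\<in>Ob D. \<forall>v\<in>Ob D. \<forall>f\<in>Hom D u v. Cmp E (\<eta> v) (Fa u v f) = Cmp E (Ha u v f) (\<eta> u))"

definition equivalence ::
  "('x, 'a) cat \<Rightarrow> ('y, 'b) cat \<Rightarrow> ('x \<Rightarrow> 'y) \<Rightarrow> ('x \<Rightarrow> 'x \<Rightarrow> 'a \<Rightarrow> 'b) \<Rightarrow> bool" where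
  "equivalence D E Fo Fa \<longleftrightarrow> is_functor D E Fo Fa \<and>
    (\<exists>Ho Ha \<eta> \<theta>. is_functor E D Ho Ha \<and>
      natural_iso D D (\<lambda>u. u) (\<lambda>u v f. f)
        (\<lambda>u. Ho (Fo u)) (\<lambda>u v f. Ha (Fo u) (Fo v) (Fa u v f)) \<eta> \<and>
      natural_iso E E (\<lambda>u. Fo (Ho u)) (\<lambda>u v f. Fa (Ho u) (Ho v) (Ha u v f))
        (\<lambda>u. u) (\<lambda>u v f. f) \<theta>)"


section \<open>Linear 2-categories\<close>

text \<open>
  2-categories are strict. \<open>F \<star> H\<close> is the composite 1-morphism ``first \<open>H\<close>, then \<open>F\<close>'',
  \<open>a \<cdot> b\<close> is vertical and \<open>a \<bullet> b\<close> horizontal composition. Of the record \<open>cell F H\<close> only the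
  module part is used; its \<open>mult\<close> and \<open>one\<close> are irrelevant.
\<close>

record ('o, 'm, 'c, 'k) two_cat =
  obj :: "'o set"
  mor :: "'o \<Rightarrow> 'o \<Rightarrow> 'm set"
  cell :: "'m \<Rightarrow> 'm \<Rightarrow> ('k, 'c) module"
  id1 :: "'o \<Rightarrow> 'm"
  comp1 :: "'m \<Rightarrow> 'm \<Rightarrow> 'm" (infixr \<open>\<star>\<index>\<close> 75)
  id2 :: "'m \<Rightarrow> 'c"
  vcomp :: "'c \<Rightarrow> 'c \<Rightarrow> 'c" (infixr \<open>\<cdot>\<index>\<close> 60)
  hcomp :: "'c \<Rightarrow> 'c \<Rightarrow> 'c" (infixr \<open>\<bullet>\<index>\<close> 70)

context
  fixes C :: "('o, 'm, 'c, 'k) two_cat" (structure)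
begin

definition hom2 :: "'m \<Rightarrow> 'm \<Rightarrow> 'c set" where
  "hom2 F H = carrier (cell C F H)"

definition hom_cat :: "'o \<Rightarrow> 'o \<Rightarrow> ('m, 'c) cat" where
  "hom_cat a b = \<lparr>Ob = mor C a b, Hom = hom2, Id = id2 C, Cmp = vcomp C\<rparr>"

definition whisker_left :: "'m \<Rightarrow> 'c \<Rightarrow> 'c" where
  "whisker_left F a = id2 C F \<bullet> a"

definition whisker_right :: "'c \<Rightarrow> 'm \<Rightarrow> 'c" where
  "whisker_right a F = a \<bullet> id2 C F"

definition iso2 :: "'m \<Rightarrow> 'm \<Rightarrow> 'c set" where
  "iso2 F H = {a \<in> hom2 F H. \<exists>b\<in>hom2 H F. b \<cdot> a = id2 C F \<and> a \<cdot> b = id2 C H}"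

text \<open>The inverse of a 2-isomorphism \<open>a : F \<Rightarrow> H\<close>.\<close>

definition inv2 :: "'m \<Rightarrow> 'm \<Rightarrow> 'c \<Rightarrow> 'c" where
  "inv2 F H a = (THE b. b \<in> hom2 H F \<and> b \<cdot> a = id2 C F \<and> a \<cdot> b = id2 C H)"

text \<open>\<open>Y\<close> is the direct sum of the \<open>P i\<close> with inclusions \<open>inc i\<close> and projections \<open>prj i\<close>.\<close>

definition direct_sum ::
  "'i set \<Rightarrow> ('i \<Rightarrow> 'm) \<Rightarrow> 'm \<Rightarrow> ('i \<Rightarrow> 'c) \<Rightarrow> ('i \<Rightarrow> 'c) \<Rightarrow> bool" where
  "direct_sum I P Y inc prj \<longleftrightarrow>
    (\<forall>i\<in>I. inc i \<in> hom2 (P i) Y \<and> prj i \<in> hom2 Y (P i)) \<and>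
    (\<forall>i\<in>I. \<forall>j\<in>I. prj i \<cdot> inc j = (if i = j then id2 C (P i) else \<zero>\<^bsub>cell C (P j) (P i)\<^esub>)) \<and>
    (\<Oplus>\<^bsub>cell C Y Y\<^esub>i\<in>I. inc i \<cdot> prj i) = id2 C Y"

end

notation whisker_left (infixr \<open>\<triangleright>\<index>\<close> 70)
notation whisker_right (infixl \<open>\<triangleleft>\<index>\<close> 72)

locale linear_two_category = field K
  for K :: "'k ring" and C :: "('o, 'm, 'c, 'k) two_cat" (structure) +
  assumes id1_closed: "a \<in> obj C \<Longrightarrow> id1 C a \<in> mor C a a"
    and comp1_closed:
      "\<lbrakk>a \<in> obj C; b \<in> obj C; c \<in> obj C; F \<in> mor C b c; H \<in> mor C a b\<rbrakk> \<Longrightarrow> F \<star> H \<in> mor C a c"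
    and comp1_id: "\<lbrakk>a \<in> obj C; b \<in> obj C; F \<in> mor C a b\<rbrakk> \<Longrightarrow> F \<star> id1 C a = F \<and> id1 C b \<star> F = F"
    and comp1_assoc:
      "\<lbrakk>a \<in> obj C; b \<in> obj C; c \<in> obj C; d \<in> obj C;
        F \<in> mor C c d; H \<in> mor C b c; L \<in> mor C a b\<rbrakk> \<Longrightarrow> (F \<star> H) \<star> L = F \<star> H \<star> L"
    and hom_category: "\<lbrakk>a \<in> obj C; b \<in> obj C\<rbrakk> \<Longrightarrow> category (hom_cat C a b)"
    and hcomp_closed:
      "\<lbrakk>a \<in> obj C; b \<in> obj C; c \<in> obj C; F \<in> mor C b c; F' \<in> mor C b c; H \<in> mor C a b; H' \<in> mor C a b;
        x \<in> hom2 C F F'; y \<in> hom2 C H H'\<rbrakk> \<Longrightarrow> x \<bullet> y \<in> hom2 C (F \<star> H) (F' \<star> H')"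
    and hcomp_id1:
      "\<lbrakk>a \<in> obj C; b \<in> obj C; F \<in> mor C a b; F' \<in> mor C a b; x \<in> hom2 C F F'\<rbrakk>
        \<Longrightarrow> x \<bullet> id2 C (id1 C a) = x \<and> id2 C (id1 C b) \<bullet> x = x"
    and hcomp_assoc:
      "\<lbrakk>a \<in> obj C; b \<in> obj C; c \<in> obj C; d \<in> obj C;
        F \<in> mor C c d; F' \<in> mor C c d; H \<in> mor C b c; H' \<in> mor C b c; L \<in> mor C a b; L' \<in> mor C a b;
        x \<in> hom2 C F F'; y \<in> hom2 C H H'; z \<in> hom2 C L L'\<rbrakk> \<Longrightarrow> (x \<bullet> y) \<bullet> z = x \<bullet> y \<bullet> z"
    and hcomp_id2:
      "\<lbrakk>a \<in> obj C; b \<in> obj C; c \<in> obj C; F \<in> mor C b c; H \<in> mor C a b\<rbrakk>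
        \<Longrightarrow> id2 C F \<bullet> id2 C H = id2 C (F \<star> H)"
    and interchange:
      "\<lbrakk>a \<in> obj C; b \<in> obj C; c \<in> obj C;
        F \<in> mor C b c; F' \<in> mor C b c; F'' \<in> mor C b c; H \<in> mor C a b; H' \<in> mor C a b; H'' \<in> mor C a b;
        x \<in> hom2 C F F'; x' \<in> hom2 C F' F''; y \<in> hom2 C H H'; y' \<in> hom2 C H' H''\<rbrakk>
        \<Longrightarrow> (x' \<cdot> x) \<bullet> (y' \<cdot> y) = (x' \<bullet> y') \<cdot> (x \<bullet> y)"
    and cell_module: "\<lbrakk>a \<in> obj C; b \<in> obj C; F \<in> mor C a b; H \<in> mor C a b\<rbrakk> \<Longrightarrow> module K (cell C F H)"
    and vcomp_bilinear:
      "\<lbrakk>a \<in> obj C; b \<in> obj C; F \<in> mor C a b; H \<in> mor C a b; L \<in> mor C a b;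
        x \<in> hom2 C H L; x' \<in> hom2 C H L; y \<in> hom2 C F H; y' \<in> hom2 C F H; k \<in> carrier K\<rbrakk>
        \<Longrightarrow> (x \<oplus>\<^bsub>cell C H L\<^esub> x') \<cdot> y = (x \<cdot> y) \<oplus>\<^bsub>cell C F L\<^esub> (x' \<cdot> y) \<and>
          x \<cdot> (y \<oplus>\<^bsub>cell C F H\<^esub> y') = (x \<cdot> y) \<oplus>\<^bsub>cell C F L\<^esub> (x \<cdot> y') \<and>
          (k \<odot>\<^bsub>cell C H L\<^esub> x) \<cdot> y = k \<odot>\<^bsub>cell C F L\<^esub> (x \<cdot> y) \<and>
          x \<cdot> (k \<odot>\<^bsub>cell C F H\<^esub> y) = k \<odot>\<^bsub>cell C F L\<^esub> (x \<cdot> y)"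
    and hcomp_bilinear:
      "\<lbrakk>a \<in> obj C; b \<in> obj C; c \<in> obj C; F \<in> mor C b c; F' \<in> mor C b c; H \<in> mor C a b; H' \<in> mor C a b;
        x \<in> hom2 C F F'; x' \<in> hom2 C F F'; y \<in> hom2 C H H'; y' \<in> hom2 C H H'; k \<in> carrier K\<rbrakk>
        \<Longrightarrow> (x \<oplus>\<^bsub>cell C F F'\<^esub> x') \<bullet> y = (x \<bullet> y) \<oplus>\<^bsub>cell C (F \<star> H) (F' \<star> H')\<^esub> (x' \<bullet> y) \<and>
          x \<bullet> (y \<oplus>\<^bsub>cell C H H'\<^esub> y') = (x \<bullet> y) \<oplus>\<^bsub>cell C (F \<star> H) (F' \<star> H')\<^esub> (x \<bullet> y') \<and>
          (k \<odot>\<^bsub>cell C F F'\<^esub> x) \<bullet> y = k \<odot>\<^bsub>cell C (F \<star> H) (F' \<star> H')\<^esub> (x \<bullet> y) \<and>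
          x \<bullet> (k \<odot>\<^bsub>cell C H H'\<^esub> y) = k \<odot>\<^bsub>cell C (F \<star> H) (F' \<star> H')\<^esub> (x \<bullet> y)"
    and additive:
      "\<lbrakk>a \<in> obj C; b \<in> obj C; P \<in> {..<(n::nat)} \<rightarrow> mor C a b\<rbrakk>
        \<Longrightarrow> \<exists>Y\<in>mor C a b. \<exists>inc prj. direct_sum C {..<n} P Y inc prj"


section \<open>2-representations and equivariant 1-morphisms\<close>

record ('g, 'm, 'c) two_rep =
  act :: "'g \<Rightarrow> 'm"
  phi :: "'g \<Rightarrow> 'g \<Rightarrow> 'c"
  phi1 :: "'c"

context
  fixes C :: "('o, 'm, 'c, 'k) two_cat" (structure)
    and G :: "'g monoid"
begin

definition is_two_rep :: "'o \<Rightarrow> ('g, 'm, 'c) two_rep \<Rightarrow> bool" where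
  "is_two_rep V R \<longleftrightarrow>
    V \<in> obj C \<and>
    (\<forall>g\<in>carrier G. act R g \<in> mor C V V) \<and>
    (\<forall>g\<in>carrier G. \<forall>h\<in>carrier G. phi R g h \<in> iso2 C (act R g \<star> act R h) (act R (g \<otimes>\<^bsub>G\<^esub> h))) \<and>
    phi1 R \<in> iso2 C (act R \<one>\<^bsub>G\<^esub>) (id1 C V) \<and>
    (\<forall>g\<in>carrier G. \<forall>h\<in>carrier G. \<forall>k\<in>carrier G.
      phi R (g \<otimes>\<^bsub>G\<^esub> h) k \<cdot> (phi R g h \<triangleleft> act R k) = phi R g (h \<otimes>\<^bsub>G\<^esub> k) \<cdot> (act R g \<triangleright> phi R h k)) \<and>
    (\<forall>g\<in>carrier G. phi R \<one>\<^bsub>G\<^esub> g = phi1 R \<triangleleft> act R g \<and> phi R g \<one>\<^bsub>G\<^esub> = act R g \<triangleright> phi1 R)"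

text \<open>
  Equivariant 1-morphisms \<open>(F, \<tau>)\<close> from \<open>W\<close> with \<open>S\<close> to \<open>V\<close> with \<open>R\<close>. Flips (and trivializations
  below) are extensional functions on \<open>carrier G\<close>.
\<close>

definition equivariant_cat ::
  "'o \<Rightarrow> ('g, 'm, 'c) two_rep \<Rightarrow> 'o \<Rightarrow> ('g, 'm, 'c) two_rep \<Rightarrow> ('m \<times> ('g \<Rightarrow> 'c), 'c) cat" where
  "equivariant_cat W S V R = \<lparr>
    Ob = {(F, \<tau>).
      F \<in> mor C W V \<and>
      \<tau> \<in> (\<Pi>\<^sub>E g\<in>carrier G. iso2 C (act R g \<star> F) (F \<star> act S g)) \<and>
      (\<forall>g\<in>carrier G. \<forall>h\<in>carrier G.
        \<tau> (g \<otimes>\<^bsub>G\<^esub> h) \<cdot> (phi R g h \<triangleleft> F) = (F \<triangleright> phi S g h) \<cdot> (\<tau> g \<triangleleft> act S h) \<cdot> (act R g \<triangleright> \<tau> h)) \<and>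
      \<tau> \<one>\<^bsub>G\<^esub> = inv2 C (F \<star> act S \<one>\<^bsub>G\<^esub>) F (F \<triangleright> phi1 S) \<cdot> (phi1 R \<triangleleft> F)},
    Hom = \<lambda>(F, \<tau>) (H, \<sigma>).
      {x \<in> hom2 C F H. \<forall>g\<in>carrier G. \<sigma> g \<cdot> (act R g \<triangleright> x) = (x \<triangleleft> act S g) \<cdot> \<tau> g},
    Id = \<lambda>(F, \<tau>). id2 C F,
    Cmp = vcomp C\<rparr>"

definition trivialized_cat ::
  "'o \<Rightarrow> ('g, 'm, 'c) two_rep \<Rightarrow> 'o \<Rightarrow> ('g, 'm, 'c) two_rep \<Rightarrow>
   ('m \<times> ('g \<Rightarrow> 'c) \<times> ('g \<Rightarrow> 'c), 'c) cat" where
  "trivialized_cat W S V R = \<lparr>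
    Ob = {(F, \<tau>, \<epsilon>).
      (F, \<tau>) \<in> Ob (equivariant_cat W S V R) \<and>
      \<epsilon> \<in> (\<Pi>\<^sub>E g\<in>carrier G. iso2 C F (act R g \<star> F)) \<and>
      (\<forall>g\<in>carrier G. \<forall>h\<in>carrier G.
        (phi R g h \<triangleleft> F) \<cdot> (act R g \<triangleright> \<epsilon> h) \<cdot> \<epsilon> g = \<epsilon> (g \<otimes>\<^bsub>G\<^esub> h)) \<and>
      (\<forall>s\<in>carrier G. \<forall>g\<in>carrier G.
        let t = s \<otimes>\<^bsub>G\<^esub> g \<otimes>\<^bsub>G\<^esub> inv\<^bsub>G\<^esub> s; \<tau>s' = inv2 C (act R s \<star> F) (F \<star> act S s) (\<tau> s) in
        (phi R s g \<triangleleft> F) \<cdot> (act R s \<triangleright> \<epsilon> g) \<cdot> \<tau>s' =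
        (phi R t s \<triangleleft> F) \<cdot> (act R t \<triangleright> \<tau>s') \<cdot> (\<epsilon> t \<triangleleft> act S s))},
    Hom = \<lambda>(F, \<tau>, \<epsilon>) (H, \<sigma>, \<delta>).
      {x \<in> Hom (equivariant_cat W S V R) (F, \<tau>) (H, \<sigma>).
        \<forall>g\<in>carrier G. \<delta> g \<cdot> x = (act R g \<triangleright> x) \<cdot> \<epsilon> g},
    Id = \<lambda>(F, \<tau>, \<epsilon>). id2 C F,
    Cmp = vcomp C\<rparr>"

text \<open>The flips of \<open>H \<star> F\<close>, where \<open>H\<close> has flips \<open>\<sigma>\<close> and \<open>F\<close> has flips \<open>\<tau>\<close>.\<close>

definition comp_flips :: "'m \<Rightarrow> ('g \<Rightarrow> 'c) \<Rightarrow> 'm \<Rightarrow> ('g \<Rightarrow> 'c) \<Rightarrow> 'g \<Rightarrow> 'c" where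
  "comp_flips H \<sigma> F \<tau> = (\<lambda>g\<in>carrier G. (H \<triangleright> \<tau> g) \<cdot> (\<sigma> g \<triangleleft> F))"

definition id_flips :: "('g, 'm, 'c) two_rep \<Rightarrow> 'g \<Rightarrow> 'c" where
  "id_flips R = (\<lambda>g\<in>carrier G. id2 C (act R g))"


section \<open>The fixed object\<close>

definition upsilon ::
  "('g, 'm, 'c) two_rep \<Rightarrow> ('g, 'm, 'c) two_rep \<Rightarrow> ('g \<Rightarrow> 'c) \<Rightarrow> 'm \<Rightarrow> ('g \<Rightarrow> 'c) \<Rightarrow> 'g \<Rightarrow> 'c" where
  "upsilon R S \<epsilon> U \<tau>U g = inv2 C (act R g \<star> U) (U \<star> act S g) (\<tau>U g) \<cdot> (U \<triangleright> \<epsilon> g)"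

text \<open>The object part of the functor \<open>F \<mapsto> U \<star> F\<close> into trivialized equivariant 1-morphisms.\<close>

definition post_U ::
  "('g, 'm, 'c) two_rep \<Rightarrow> ('g, 'm, 'c) two_rep \<Rightarrow> ('g \<Rightarrow> 'c) \<Rightarrow> 'm \<Rightarrow> ('g \<Rightarrow> 'c) \<Rightarrow>
   'm \<times> ('g \<Rightarrow> 'c) \<Rightarrow> 'm \<times> ('g \<Rightarrow> 'c) \<times> ('g \<Rightarrow> 'c)" where
  "post_U R S \<epsilon> U \<tau>U = (\<lambda>(F, \<tau>).
    (U \<star> F,
     comp_flips U \<tau>U F \<tau>,
     \<lambda>g\<in>carrier G.
       (inv2 C (act R g \<star> U) (U \<star> act S g) (\<tau>U g) \<triangleleft> F) \<cdot> (U \<triangleright> \<epsilon> g \<triangleleft> F)))"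

text \<open>\<open>(VG, U)\<close> with the 2-representation \<open>S\<close> and trivialization \<open>\<epsilon>\<close> is the pair \<open>(V\<^sup>G, U)\<close>.\<close>

definition is_fixed_object ::
  "'o \<Rightarrow> ('g, 'm, 'c) two_rep \<Rightarrow> 'o \<Rightarrow> ('g, 'm, 'c) two_rep \<Rightarrow> ('g \<Rightarrow> 'c) \<Rightarrow> 'm \<Rightarrow> ('g \<Rightarrow> 'c) \<Rightarrow> bool" where
  "is_fixed_object V R VG S \<epsilon> U \<tau>U \<longleftrightarrow>
    is_two_rep VG S \<and>
    (id1 C VG, id_flips S, \<epsilon>) \<in> Ob (trivialized_cat VG S VG S) \<and>
    (U, \<tau>U) \<in> Ob (equivariant_cat VG S V R) \<and>
    (\<forall>W T. is_two_rep W T \<longrightarrow>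
      equivalence (equivariant_cat W T VG S) (trivialized_cat W T V R)
        (post_U R S \<epsilon> U \<tau>U) (\<lambda>_ _ x. U \<triangleright> x))"


section \<open>The monoid \<open>A\<close> and the adjoint \<open>A'\<close>\<close>

text \<open>
  The pair \<open>(s, s)\<close> acts by \<open>\<phi>\<^bsub>s,h,s\<^sup>-\<^sup>1\<^esub> : s h s\<^sup>-\<^sup>1 \<cong> \<rho>(s h s\<^sup>-\<^sup>1)\<close>; composing with \<open>s\<close> on the right
  gives the flip of \<open>A = \<Oplus> \<rho>(h)\<close>, which on the summand \<open>h\<close> is
  \<open>s \<rho>(h) \<cong> \<rho>(s h) \<cong> \<rho>(s h s\<^sup>-\<^sup>1) s\<close>. The pair \<open>(g, 1)\<close> gives \<open>g A \<cong> A\<close>, whose inverse is the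
  trivialization.
\<close>

definition A_flips ::
  "('g, 'm, 'c) two_rep \<Rightarrow> 'm \<Rightarrow> ('g \<Rightarrow> 'c) \<Rightarrow> ('g \<Rightarrow> 'c) \<Rightarrow> 'g \<Rightarrow> 'c" where
  "A_flips R A inc prj = (\<lambda>s\<in>carrier G.
    \<Oplus>\<^bsub>cell C (act R s \<star> A) (A \<star> act R s)\<^esub>h\<in>carrier G.
      let t = s \<otimes>\<^bsub>G\<^esub> h \<otimes>\<^bsub>G\<^esub> inv\<^bsub>G\<^esub> s in
      (inc t \<triangleleft> act R s) \<cdot> inv2 C (act R t \<star> act R s) (act R (s \<otimes>\<^bsub>G\<^esub> h)) (phi R t s) \<cdot>
      phi R s h \<cdot> (act R s \<triangleright> prj h))"

definition A_triv ::
  "('g, 'm, 'c) two_rep \<Rightarrow> 'm \<Rightarrow> ('g \<Rightarrow> 'c) \<Rightarrow> ('g \<Rightarrow> 'c) \<Rightarrow> 'g \<Rightarrow> 'c" where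
  "A_triv R A inc prj = (\<lambda>g\<in>carrier G.
    \<Oplus>\<^bsub>cell C A (act R g \<star> A)\<^esub>h\<in>carrier G.
      let t = inv\<^bsub>G\<^esub> g \<otimes>\<^bsub>G\<^esub> h in
      (act R g \<triangleright> inc t) \<cdot> inv2 C (act R g \<star> act R t) (act R h) (phi R g t) \<cdot> prj h)"

definition alpha ::
  "('g, 'm, 'c) two_rep \<Rightarrow> ('g, 'm, 'c) two_rep \<Rightarrow> ('g \<Rightarrow> 'c) \<Rightarrow> 'm \<Rightarrow> ('g \<Rightarrow> 'c) \<Rightarrow>
   'm \<Rightarrow> ('g \<Rightarrow> 'c) \<Rightarrow> 'c" where
  "alpha R S \<epsilon> U \<tau>U A prj =
    (\<Oplus>\<^bsub>cell C (A \<star> U) U\<^esub>g\<in>carrier G.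
      inv2 C U (act R g \<star> U) (upsilon R S \<epsilon> U \<tau>U g) \<cdot> (prj g \<triangleleft> U))"

text \<open>
  \<open>A\<close> is the direct sum of the \<open>\<rho>(g)\<close>, \<open>(A', \<tau>A')\<close> is the equivariant 1-morphism whose image under
  \<open>F \<mapsto> U F\<close> is the trivialized equivariant 1-morphism \<open>A\<close>, and \<open>\<alpha>'\<close> is the counit. The equality
  \<open>U A' = A\<close> is no restriction: the universal property gives \<open>U A' \<cong> A\<close>, and transporting the
  inclusions and projections turns \<open>U A'\<close> itself into a direct sum of the \<open>\<rho>(g)\<close>. As \<open>U\<close> is
  faithful on 2-morphisms between endomorphisms of \<open>V\<^sup>G\<close>, \<open>\<alpha>'\<close> is determined by \<open>U \<alpha>' = \<alpha>\<close>.
\<close>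

definition is_adjoint_data ::
  "'o \<Rightarrow> ('g, 'm, 'c) two_rep \<Rightarrow> 'o \<Rightarrow> ('g, 'm, 'c) two_rep \<Rightarrow> ('g \<Rightarrow> 'c) \<Rightarrow> 'm \<Rightarrow> ('g \<Rightarrow> 'c) \<Rightarrow>
   'm \<Rightarrow> ('g \<Rightarrow> 'c) \<Rightarrow> ('g \<Rightarrow> 'c) \<Rightarrow> 'm \<Rightarrow> ('g \<Rightarrow> 'c) \<Rightarrow> 'c \<Rightarrow> bool" where
  "is_adjoint_data V R VG S \<epsilon> U \<tau>U A inc prj A' \<tau>A' \<alpha>' \<longleftrightarrow>
    A \<in> mor C V V \<and>
    direct_sum C (carrier G) (act R) A inc prj \<and>
    (A', \<tau>A') \<in> Ob (equivariant_cat V R VG S) \<and>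
    post_U R S \<epsilon> U \<tau>U (A', \<tau>A') = (A, A_flips R A inc prj, A_triv R A inc prj) \<and>
    \<alpha>' \<in> hom2 C (A' \<star> U) (id1 C VG) \<and>
    U \<triangleright> \<alpha>' = alpha R S \<epsilon> U \<tau>U A prj"


section \<open>Traces, the twisted group algebra and the group action\<close>

definition Tr :: "'o \<Rightarrow> 'm \<Rightarrow> ('k, 'c) module" where
  "Tr V F = cell C (id1 C V) F"

definition Dim :: "'o \<Rightarrow> ('k, 'c) module" where
  "Dim V = (Tr V (id1 C V))\<lparr>monoid.mult := vcomp C, one := id2 C (id1 C V)\<rparr>"

text \<open>
  \<open>\<Oplus>\<^sub>g \<T>r(\<rho>(g))\<close> as families of traces. The degree \<open>g\<close> part of a product is the sum of
  \<open>\<phi>\<^bsub>a,b\<^esub> \<circ> (x\<^sub>a y\<^sub>b)\<close> over \<open>a b = g\<close>.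
\<close>

definition twisted_group_algebra ::
  "'o \<Rightarrow> ('g, 'm, 'c) two_rep \<Rightarrow> ('k, 'g \<Rightarrow> 'c) module" where
  "twisted_group_algebra V R = \<lparr>
    carrier = (\<Pi>\<^sub>E g\<in>carrier G. carrier (Tr V (act R g))),
    monoid.mult = (\<lambda>x y. \<lambda>g\<in>carrier G.
      \<Oplus>\<^bsub>Tr V (act R g)\<^esub>a\<in>carrier G.
        let b = inv\<^bsub>G\<^esub> a \<otimes>\<^bsub>G\<^esub> g in phi R a b \<cdot> (x a \<bullet> y b)),
    one = (\<lambda>g\<in>carrier G.
      if g = \<one>\<^bsub>G\<^esub> then inv2 C (act R \<one>\<^bsub>G\<^esub>) (id1 C V) (phi1 R) else \<zero>\<^bsub>Tr V (act R g)\<^esub>),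
    ring.zero = (\<lambda>g\<in>carrier G. \<zero>\<^bsub>Tr V (act R g)\<^esub>),
    add = (\<lambda>x y. \<lambda>g\<in>carrier G. x g \<oplus>\<^bsub>Tr V (act R g)\<^esub> y g),
    smult = (\<lambda>k x. \<lambda>g\<in>carrier G. k \<odot>\<^bsub>Tr V (act R g)\<^esub> x g)\<rparr>"

text \<open>The canonical isomorphism \<open>s s\<^sup>-\<^sup>1 \<cong> id\<^sub>V\<close>.\<close>

definition cancel :: "('g, 'm, 'c) two_rep \<Rightarrow> 'g \<Rightarrow> 'c" where
  "cancel R s = phi1 R \<cdot> phi R s (inv\<^bsub>G\<^esub> s)"

text \<open>The composite of \<open>id\<^sub>V \<cong> s s\<^sup>-\<^sup>1\<close> and \<open>s \<mu> s\<^sup>-\<^sup>1\<close>.\<close>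

definition conjugate :: "'o \<Rightarrow> ('g, 'm, 'c) two_rep \<Rightarrow> 'g \<Rightarrow> 'c \<Rightarrow> 'c" where
  "conjugate V R s \<mu> =
    (act R s \<triangleright> \<mu> \<triangleleft> act R (inv\<^bsub>G\<^esub> s)) \<cdot>
    inv2 C (act R s \<star> act R (inv\<^bsub>G\<^esub> s)) (id1 C V) (cancel R s)"

definition trace_action ::
  "'o \<Rightarrow> ('g, 'm, 'c) two_rep \<Rightarrow> 'm \<Rightarrow> ('g \<Rightarrow> 'c) \<Rightarrow> 'g \<Rightarrow> 'c \<Rightarrow> 'c" where
  "trace_action V R M \<tau> s \<mu> =
    (M \<triangleright> cancel R s) \<cdot> (\<tau> s \<triangleleft> act R (inv\<^bsub>G\<^esub> s)) \<cdot> conjugate V R s \<mu>"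

text \<open>On the twisted group algebra \<open>s\<close> carries degree \<open>h = s\<^sup>-\<^sup>1 g s\<close> to degree \<open>g = s h s\<^sup>-\<^sup>1\<close>.\<close>

definition family_action ::
  "'o \<Rightarrow> ('g, 'm, 'c) two_rep \<Rightarrow> 'g \<Rightarrow> ('g \<Rightarrow> 'c) \<Rightarrow> 'g \<Rightarrow> 'c" where
  "family_action V R s x = (\<lambda>g\<in>carrier G.
    let h = inv\<^bsub>G\<^esub> s \<otimes>\<^bsub>G\<^esub> g \<otimes>\<^bsub>G\<^esub> s in
    phi R (s \<otimes>\<^bsub>G\<^esub> h) (inv\<^bsub>G\<^esub> s) \<cdot> (phi R s h \<triangleleft> act R (inv\<^bsub>G\<^esub> s)) \<cdot> conjugate V R s (x h))"

definition twisted_invariants ::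
  "'o \<Rightarrow> ('g, 'm, 'c) two_rep \<Rightarrow> ('k, 'g \<Rightarrow> 'c) module" where
  "twisted_invariants V R = (twisted_group_algebra V R)
    \<lparr>carrier := {x \<in> carrier (twisted_group_algebra V R). \<forall>s\<in>carrier G. family_action V R s x = x}\<rparr>"

definition trace_invariants ::
  "'o \<Rightarrow> ('g, 'm, 'c) two_rep \<Rightarrow> 'm \<Rightarrow> ('g \<Rightarrow> 'c) \<Rightarrow> ('k, 'c) module" where
  "trace_invariants V R M \<tau> = (Tr V M)
    \<lparr>carrier := {\<mu> \<in> carrier (Tr V M). \<forall>s\<in>carrier G. trace_action V R M \<tau> s \<mu> = \<mu>}\<rparr>"

text \<open>The flips of a 1-endomorphism \<open>F\<close> of \<open>V\<^sup>G\<close>.\<close>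

definition endo_flips :: "'o \<Rightarrow> ('g, 'm, 'c) two_rep \<Rightarrow> ('g \<Rightarrow> 'c) \<Rightarrow> 'm \<Rightarrow> 'g \<Rightarrow> 'c" where
  "endo_flips VG S \<epsilon> F = (\<lambda>g\<in>carrier G.
    (F \<triangleright> \<epsilon> g) \<cdot> (inv2 C (id1 C VG) (act S g) (\<epsilon> g) \<triangleleft> F))"

text \<open>The identification of \<open>\<Oplus>\<^sub>g \<T>r(\<rho>(g))\<close> with \<open>\<T>r(A)\<close>.\<close>

definition to_TrA :: "'o \<Rightarrow> 'm \<Rightarrow> ('g \<Rightarrow> 'c) \<Rightarrow> ('g \<Rightarrow> 'c) \<Rightarrow> 'c" where
  "to_TrA V A inc x = (\<Oplus>\<^bsub>Tr V A\<^esub>g\<in>carrier G. inc g \<cdot> x g)"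

text \<open>
  \<open>\<T>r(U F A')\<^sup>G\<close>, and the actions of the twisted group algebra on \<open>\<T>r(U F A')\<close> through
  \<open>\<alpha> F A' : A U F A' \<Rightarrow> U F A'\<close> and \<open>U F \<alpha>' A' : U F A' A \<Rightarrow> U F A'\<close>, where \<open>A = U A'\<close>.
\<close>

definition UFA_trace_invariants ::
  "'o \<Rightarrow> ('g, 'm, 'c) two_rep \<Rightarrow> 'o \<Rightarrow> ('g, 'm, 'c) two_rep \<Rightarrow> ('g \<Rightarrow> 'c) \<Rightarrow> 'm \<Rightarrow> ('g \<Rightarrow> 'c) \<Rightarrow>
   'm \<Rightarrow> ('g \<Rightarrow> 'c) \<Rightarrow> 'm \<Rightarrow> ('k, 'c) module" where
  "UFA_trace_invariants V R VG S \<epsilon> U \<tau>U A' \<tau>A' F =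
    trace_invariants V R (U \<star> F \<star> A')
      (comp_flips U \<tau>U (F \<star> A') (comp_flips F (endo_flips VG S \<epsilon> F) A' \<tau>A'))"

definition left_action ::
  "'o \<Rightarrow> 'm \<Rightarrow> ('g \<Rightarrow> 'c) \<Rightarrow> 'c \<Rightarrow> 'm \<Rightarrow> 'm \<Rightarrow> ('g \<Rightarrow> 'c) \<Rightarrow> 'c \<Rightarrow> 'c" where
  "left_action V A inc \<alpha> A' F x \<mu> = (\<alpha> \<triangleleft> (F \<star> A')) \<cdot> (to_TrA V A inc x \<bullet> \<mu>)"

definition right_action ::
  "'o \<Rightarrow> 'm \<Rightarrow> ('g \<Rightarrow> 'c) \<Rightarrow> 'm \<Rightarrow> 'c \<Rightarrow> 'm \<Rightarrow> 'm \<Rightarrow> 'c \<Rightarrow> ('g \<Rightarrow> 'c) \<Rightarrow> 'c" where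
  "right_action V A inc U \<alpha>' A' F \<mu> x = ((U \<star> F) \<triangleright> \<alpha>' \<triangleleft> A') \<cdot> (\<mu> \<bullet> to_TrA V A inc x)"

end


section \<open>Bimodules\<close>

text \<open>
  \<open>M\<close> is a \<open>B\<close>-bimodule, \<open>k\<close>-linearly, with left action \<open>l b m\<close> and right action \<open>r m b\<close>. HOL-Algebra
  has modules over commutative rings only, without a second action.
\<close>

definition bimodule ::
  "'k ring \<Rightarrow> ('k, 'b) module \<Rightarrow> ('k, 'm) module \<Rightarrow> ('b \<Rightarrow> 'm \<Rightarrow> 'm) \<Rightarrow> ('m \<Rightarrow> 'b \<Rightarrow> 'm) \<Rightarrow> bool" where
  "bimodule K B M l r \<longleftrightarrow>
    module K M \<and>
    (\<forall>b\<in>carrier B. \<forall>m\<in>carrier M. l b m \<in> carrier M \<and> r m b \<in> carrier M) \<and>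
    (\<forall>m\<in>carrier M. l \<one>\<^bsub>B\<^esub> m = m \<and> r m \<one>\<^bsub>B\<^esub> = m) \<and>
    (\<forall>b\<in>carrier B. \<forall>c\<in>carrier B. \<forall>m\<in>carrier M.
      l (b \<otimes>\<^bsub>B\<^esub> c) m = l b (l c m) \<and>
      r m (b \<otimes>\<^bsub>B\<^esub> c) = r (r m b) c \<and>
      r (l b m) c = l b (r m c) \<and>
      l (b \<oplus>\<^bsub>B\<^esub> c) m = l b m \<oplus>\<^bsub>M\<^esub> l c m \<and>
      r m (b \<oplus>\<^bsub>B\<^esub> c) = r m b \<oplus>\<^bsub>M\<^esub> r m c) \<and>
    (\<forall>b\<in>carrier B. \<forall>m\<in>carrier M. \<forall>n\<in>carrier M.
      l b (m \<oplus>\<^bsub>M\<^esub> n) = l b m \<oplus>\<^bsub>M\<^esub> l b n \<and>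
      r (m \<oplus>\<^bsub>M\<^esub> n) b = r m b \<oplus>\<^bsub>M\<^esub> r n b) \<and>
    (\<forall>k\<in>carrier K. \<forall>b\<in>carrier B. \<forall>m\<in>carrier M.
      l (k \<odot>\<^bsub>B\<^esub> b) m = k \<odot>\<^bsub>M\<^esub> l b m \<and> l b (k \<odot>\<^bsub>M\<^esub> m) = k \<odot>\<^bsub>M\<^esub> l b m \<and>
      r m (k \<odot>\<^bsub>B\<^esub> b) = k \<odot>\<^bsub>M\<^esub> r m b \<and> r (k \<odot>\<^bsub>M\<^esub> m) b = k \<odot>\<^bsub>M\<^esub> r m b)"

definition algebra_iso :: "'k ring \<Rightarrow> ('k, 'a) module \<Rightarrow> ('k, 'b) module \<Rightarrow> ('a \<Rightarrow> 'b) set" where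
  "algebra_iso K A B =
    {f \<in> ring_iso A B. \<forall>k\<in>carrier K. \<forall>x\<in>carrier A. f (k \<odot>\<^bsub>A\<^esub> x) = k \<odot>\<^bsub>B\<^esub> f x}"

text \<open>Isomorphisms from an \<open>A\<close>-bimodule \<open>M\<close> to a \<open>B\<close>-bimodule \<open>N\<close> over a map \<open>i\<close> from \<open>A\<close> to \<open>B\<close>.\<close>

definition bimodule_iso ::
  "'k ring \<Rightarrow> ('k, 'a) module \<Rightarrow> ('a \<Rightarrow> 'b) \<Rightarrow>
   ('k, 'm) module \<Rightarrow> ('a \<Rightarrow> 'm \<Rightarrow> 'm) \<Rightarrow> ('m \<Rightarrow> 'a \<Rightarrow> 'm) \<Rightarrow>
   ('k, 'n) module \<Rightarrow> ('b \<Rightarrow> 'n \<Rightarrow> 'n) \<Rightarrow> ('n \<Rightarrow> 'b \<Rightarrow> 'n) \<Rightarrow> ('m \<Rightarrow> 'n) set" where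
  "bimodule_iso K A i M l r N l' r' =
    {f. bij_betw f (carrier M) (carrier N) \<and>
      (\<forall>m\<in>carrier M. \<forall>n\<in>carrier M. f (m \<oplus>\<^bsub>M\<^esub> n) = f m \<oplus>\<^bsub>N\<^esub> f n) \<and>
      (\<forall>k\<in>carrier K. \<forall>m\<in>carrier M. f (k \<odot>\<^bsub>M\<^esub> m) = k \<odot>\<^bsub>N\<^esub> f m) \<and>
      (\<forall>a\<in>carrier A. \<forall>m\<in>carrier M. f (l a m) = l' (i a) (f m) \<and> f (r m a) = r' (f m) (i a))}"

end

theory Submission
  imports Defs
begin

text \<open>
  Let \<open>\<upsilon>\<^sub>g : U \<Rightarrow> g U\<close> be the trivialization of \<open>U\<close>. The universal property identifies 2-morphisms
  \<open>F \<Rightarrow> H\<close> between 1-endomorphisms of \<open>V\<^sup>G\<close> with the 2-morphisms \<open>U F \<Rightarrow> U H\<close> that commute with \<open>\<upsilon>\<close>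
  (\<open>U_faithful\<close>, \<open>U_full\<close>); compatibility with the flips need not be asked for, because \<open>F\<close> and \<open>H\<close>
  carry the flips that come from the trivialization of \<open>V\<^sup>G\<close>. In particular \<open>\<T>r(F)\<close> is the set of those
  \<open>x : U \<Rightarrow> U F\<close> that commute with \<open>\<upsilon>\<close>.

  On the other hand \<open>A'\<close> is left adjoint to \<open>U\<close>, so that \<open>x \<mapsto> (x A') \<circ> \<iota>\<close> is a bijection from all
  2-morphisms \<open>U \<Rightarrow> U F\<close> to \<open>\<T>r(U F A')\<close> (\<open>unmate_mate\<close>, \<open>mate_unmate\<close>). The point is that under this
  bijection the action of \<open>s \<in> G\<close> on traces becomes \<open>x \<mapsto> \<upsilon>\<^sub>s\<^sup>-\<^sup>1 \<circ> (s x) \<circ> \<upsilon>\<^sub>s\<close> (\<open>act_mate\<close>). Hence a trace is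
  invariant if and only if the corresponding \<open>x\<close> commutes with \<open>\<upsilon>\<close>, and \<open>\<xi> \<mapsto> (U \<xi> A') \<circ> \<iota>\<close> is a bijection
  from \<open>\<T>r(F)\<close> to \<open>\<T>r(U F A')\<^sup>G\<close> (\<open>trace_map_image\<close>, \<open>trace_map_injective\<close>). By the triangle identities it
  is compatible with the actions of \<open>\<D>im(V\<^sup>G)\<close> and of the twisted group algebra (\<open>mate_left\<close>,
  \<open>mate_right\<close>). For \<open>F = id\<close> the target is \<open>\<T>r(A)\<close>, that is, the twisted group algebra with its product and
  its action of \<open>G\<close> (\<open>total_mult\<close>, \<open>family_action_total\<close>), and this is the isomorphism of algebras. It
  sends \<open>a\<close> to the only family \<open>y\<close> with \<open>U a = \<Sum>\<^sub>g \<upsilon>\<^sub>g\<^sup>-\<^sup>1 \<circ> (y\<^sub>g U)\<close>, a description in which \<open>A\<close> does not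
  occur (\<open>trace_iso_characterization\<close>); therefore one map serves all choices of the adjoint.

  The algebra and bimodule axioms for the invariants are transported along these bijections from
  \<open>\<D>im(V\<^sup>G)\<close> and \<open>\<T>r(F)\<close>, where they are axioms of a linear 2-category, or, for commutativity, the
  Eckmann-Hilton argument. Two points need work. For the existence of \<open>A'\<close>, the sum \<open>A\<close> has to be a
  trivialized equivariant 1-morphism (\<open>regular_sum_trivialized\<close>), and \<open>\<alpha>\<close> has to commute with \<open>\<upsilon>\<close> in order to
  come from a counit (\<open>alpha_ups\<close>). And the second triangle identity (\<open>triangle_A'\<close>) is clear only after
  applying \<open>U\<close>, which is faithful on equivariant 2-morphisms; so the counit must be shown to be equivariant
  (\<open>counit_equivariant\<close>).
\<close>

section \<open>Equivalences of categories\<close>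

lemma equivalenceE:
  assumes "equivalence D E Fo Fa"
  obtains Ho Ha \<eta> \<theta> where "is_functor D E Fo Fa" "is_functor E D Ho Ha"
    "natural_iso D D (\<lambda>u. u) (\<lambda>u v f. f)
        (\<lambda>u. Ho (Fo u)) (\<lambda>u v f. Ha (Fo u) (Fo v) (Fa u v f)) \<eta>"
    "natural_iso E E (\<lambda>u. Fo (Ho u)) (\<lambda>u v f. Fa (Ho u) (Ho v) (Ha u v f))
        (\<lambda>u. u) (\<lambda>u v f. f) \<theta>"
  using assms unfolding equivalence_def by blast

lemma category_idI: "category D \<Longrightarrow> u \<in> Ob D \<Longrightarrow> Id D u \<in> Hom D u u"
  by (simp add: category_def)

lemma category_closed:
  "\<lbrakk>category D; u \<in> Ob D; v \<in> Ob D; w \<in> Ob D; f \<in> Hom D u v; g \<in> Hom D v w\<rbrakk>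
    \<Longrightarrow> Cmp D g f \<in> Hom D u w"
  unfolding category_def by blast

lemma category_id:
  "\<lbrakk>category D; u \<in> Ob D; v \<in> Ob D; f \<in> Hom D u v\<rbrakk> \<Longrightarrow> Cmp D f (Id D u) = f \<and> Cmp D (Id D v) f = f"
  unfolding category_def by blast

lemma category_assoc:
  "\<lbrakk>category D; u \<in> Ob D; v \<in> Ob D; w \<in> Ob D; z \<in> Ob D; f \<in> Hom D u v; g \<in> Hom D v w; h \<in> Hom D w z\<rbrakk>
    \<Longrightarrow> Cmp D h (Cmp D g f) = Cmp D (Cmp D h g) f"
  unfolding category_def by blast

text \<open>
  The objects of \<open>E\<close> carry additional structure on objects of \<open>D\<close>, and its morphisms are those that
  preserve it. Equivariant and trivialized 1-morphisms are of this kind.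
\<close>

lemma category_of_structured_objects:
  assumes D: "category D" and \<pi>: "\<And>u. u \<in> Ob E \<Longrightarrow> \<pi> u \<in> Ob D"
    and hom: "\<And>u v f. u \<in> Ob E \<Longrightarrow> v \<in> Ob E \<Longrightarrow> f \<in> Hom E u v \<Longrightarrow> f \<in> Hom D (\<pi> u) (\<pi> v)"
    and "\<And>u. u \<in> Ob E \<Longrightarrow> Id E u = Id D (\<pi> u)" "Cmp E = Cmp D"
    and "\<And>u. u \<in> Ob E \<Longrightarrow> Id D (\<pi> u) \<in> Hom E u u"
    and "\<And>u v w f g. \<lbrakk>u \<in> Ob E; v \<in> Ob E; w \<in> Ob E; f \<in> Hom E u v; g \<in> Hom E v w\<rbrakk> \<Longrightarrow> Cmp D g f \<in> Hom E u w"
  shows "category E"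
  unfolding category_def
proof (intro conjI ballI)
  fix u v f assume "u \<in> Ob E" "v \<in> Ob E" "f \<in> Hom E u v"
  then show "Cmp E f (Id E u) = f" "Cmp E (Id E v) f = f"
    using category_id[OF D \<pi> \<pi> hom, of u v f] assms(4,5) by simp_all
next
  fix u v w z f g h
  assume "u \<in> Ob E" "v \<in> Ob E" "w \<in> Ob E" "z \<in> Ob E" "f \<in> Hom E u v" "g \<in> Hom E v w" "h \<in> Hom E w z"
  then show "Cmp E h (Cmp E g f) = Cmp E (Cmp E h g) f"
    using category_assoc[OF D \<pi> \<pi> \<pi> \<pi> hom hom hom, of u v w z f g h] assms(5) by simp
qed (use assms in simp_all)

lemma natural_iso_natural:
  "\<lbrakk>natural_iso D E Fo Fa Ho Ha \<eta>; u \<in> Ob D; v \<in> Ob D; f \<in> Hom D u v\<rbrakk>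
    \<Longrightarrow> Cmp E (\<eta> v) (Fa u v f) = Cmp E (Ha u v f) (\<eta> u)"
  by (simp add: natural_iso_def)

lemma natural_iso_component:
  assumes "natural_iso D E Fo Fa Ho Ha \<eta>" "u \<in> Ob D"
  obtains \<theta> where "\<eta> u \<in> Hom E (Fo u) (Ho u)" "\<theta> \<in> Hom E (Ho u) (Fo u)"
    "Cmp E \<theta> (\<eta> u) = Id E (Fo u)" "Cmp E (\<eta> u) \<theta> = Id E (Ho u)"
  using assms by (auto simp: natural_iso_def)

lemma category_cancel_left:
  assumes "category D" "u \<in> Ob D" "v \<in> Ob D" "w \<in> Ob D" "f \<in> Hom D u v" "e \<in> Hom D v w" "e' \<in> Hom D w v"
    "Cmp D e' e = Id D v"
  shows "Cmp D e' (Cmp D e f) = f"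
  using assms category_assoc[of D u v w v f e e'] category_id[of D u v f] by simp

lemma category_cancel_right:
  assumes "category D" "u \<in> Ob D" "v \<in> Ob D" "w \<in> Ob D" "f \<in> Hom D v u" "e \<in> Hom D w v" "e' \<in> Hom D v w"
    "Cmp D e e' = Id D v"
  shows "Cmp D (Cmp D f e) e' = f"
  using assms category_assoc[of D v w v u e' e f] category_id[of D v u f] by simp

text \<open>
  Naturality expresses a morphism through its image and the components of the isomorphism. The two
  forms serve the two composites of an equivalence with its inverse.
\<close>

lemma natural_iso_id_faithful:
  assumes D: "category D"
    and n: "natural_iso D D (\<lambda>u. u) (\<lambda>u v f. f) Ho Ha \<eta>"
    and Ho: "\<And>u. u \<in> Ob D \<Longrightarrow> Ho u \<in> Ob D"
    and u: "u \<in> Ob D" "v \<in> Ob D" and f: "f \<in> Hom D u v" "g \<in> Hom D u v"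
    and eq: "Ha u v f = Ha u v g"
  shows "f = g"
proof -
  obtain \<eta>' where \<eta>: "\<eta> v \<in> Hom D v (Ho v)" "\<eta>' \<in> Hom D (Ho v) v" "Cmp D \<eta>' (\<eta> v) = Id D v"
    using natural_iso_component[OF n u(2)] by metis
  have "Cmp D (\<eta> v) h = Cmp D (Ha u v h) (\<eta> u)" if "h \<in> Hom D u v" for h
    using natural_iso_natural[OF n u that] .
  then have "Cmp D (\<eta> v) f = Cmp D (\<eta> v) g"
    using f eq by simp
  moreover have "Cmp D \<eta>' (Cmp D (\<eta> v) h) = h" if "h \<in> Hom D u v" for h
    using category_cancel_left[OF D u(1) u(2) Ho[OF u(2)] that \<eta>] .
  ultimately show ?thesis using f by metis
qed

lemma natural_iso_to_id_faithful:
  assumes D: "category D"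
    and n: "natural_iso D D Ho Ha (\<lambda>u. u) (\<lambda>u v f. f) \<theta>"
    and Ho: "\<And>u. u \<in> Ob D \<Longrightarrow> Ho u \<in> Ob D"
    and u: "u \<in> Ob D" "v \<in> Ob D" and f: "f \<in> Hom D u v" "g \<in> Hom D u v"
    and eq: "Ha u v f = Ha u v g"
  shows "f = g"
proof -
  obtain \<theta>' where \<theta>: "\<theta> u \<in> Hom D (Ho u) u" "\<theta>' \<in> Hom D u (Ho u)" "Cmp D (\<theta> u) \<theta>' = Id D u"
    using natural_iso_component[OF n u(1)] by metis
  have "Cmp D (\<theta> v) (Ha u v h) = Cmp D h (\<theta> u)" if "h \<in> Hom D u v" for h
    using natural_iso_natural[OF n u that] .
  then have "Cmp D f (\<theta> u) = Cmp D g (\<theta> u)"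
    using f eq by metis
  moreover have "Cmp D (Cmp D h (\<theta> u)) \<theta>' = h" if "h \<in> Hom D u v" for h
    using category_cancel_right[OF D u(2) u(1) Ho[OF u(1)] that \<theta>] .
  ultimately show ?thesis using f by metis
qed

lemma equivalence_faithful:
  assumes D: "category D" and eqv: "equivalence D E Fo Fa"
    and u: "u \<in> Ob D" "v \<in> Ob D" and f: "f \<in> Hom D u v" "g \<in> Hom D u v"
    and eq: "Fa u v f = Fa u v g"
  shows "f = g"
proof -
  obtain Ho Ha \<eta> \<theta> where h: "is_functor D E Fo Fa" "is_functor E D Ho Ha"
    and n: "natural_iso D D (\<lambda>u. u) (\<lambda>u v f. f)
        (\<lambda>u. Ho (Fo u)) (\<lambda>u v f. Ha (Fo u) (Fo v) (Fa u v f)) \<eta>"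
    by (rule equivalenceE[OF eqv])
  have "\<And>u. u \<in> Ob D \<Longrightarrow> Ho (Fo u) \<in> Ob D"
    using h by (simp add: is_functor_def)
  from natural_iso_id_faithful[OF D n this u f] eq show ?thesis by simp
qed

lemma equivalence_full:
  assumes D: "category D" and E: "category E" and eqv: "equivalence D E Fo Fa"
    and u: "u \<in> Ob D" "v \<in> Ob D" and y: "y \<in> Hom E (Fo u) (Fo v)"
  shows "\<exists>f\<in>Hom D u v. Fa u v f = y"
proof -
  obtain Ho Ha \<eta> \<theta> where F: "is_functor D E Fo Fa" and H: "is_functor E D Ho Ha"
    and n: "natural_iso D D (\<lambda>u. u) (\<lambda>u v f. f)
        (\<lambda>u. Ho (Fo u)) (\<lambda>u v f. Ha (Fo u) (Fo v) (Fa u v f)) \<eta>"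
    and m: "natural_iso E E (\<lambda>u. Fo (Ho u)) (\<lambda>u v f. Fa (Ho u) (Ho v) (Ha u v f))
        (\<lambda>u. u) (\<lambda>u v f. f) \<theta>"
    by (rule equivalenceE[OF eqv])
  have Fo: "Fo u \<in> Ob E" "Fo v \<in> Ob E" and Ho: "\<And>w. w \<in> Ob E \<Longrightarrow> Ho w \<in> Ob D"
    using F H u by (auto simp: is_functor_def)
  then have HFo: "Ho (Fo u) \<in> Ob D" "Ho (Fo v) \<in> Ob D" and FHo: "\<And>w. w \<in> Ob E \<Longrightarrow> Fo (Ho w) \<in> Ob E"
    using F by (auto simp: is_functor_def)
  define z where "z = Ha (Fo u) (Fo v) y"
  have z: "z \<in> Hom D (Ho (Fo u)) (Ho (Fo v))"
    using H Fo y by (simp add: is_functor_def z_def)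
  obtain e where e: "\<eta> v \<in> Hom D v (Ho (Fo v))" "e \<in> Hom D (Ho (Fo v)) v"
    "Cmp D e (\<eta> v) = Id D v" "Cmp D (\<eta> v) e = Id D (Ho (Fo v))"
    using natural_iso_component[OF n u(2)] by metis
  obtain d where d: "\<eta> u \<in> Hom D u (Ho (Fo u))" "d \<in> Hom D (Ho (Fo u)) u"
    "Cmp D d (\<eta> u) = Id D u" "Cmp D (\<eta> u) d = Id D (Ho (Fo u))"
    using natural_iso_component[OF n u(1)] by metis
  \<comment> \<open>The preimage is forced by naturality of \<open>\<eta>\<close>.\<close>
  define f where "f = Cmp D e (Cmp D z (\<eta> u))"
  have zu: "Cmp D z (\<eta> u) \<in> Hom D u (Ho (Fo v))"
    using category_closed[OF D u(1) HFo(1) HFo(2) d(1) z] .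
  have f: "f \<in> Hom D u v"
    unfolding f_def using category_closed[OF D u(1) HFo(2) u(2) zu e(2)] .
  have Ff: "Fa u v f \<in> Hom E (Fo u) (Fo v)"
    using F u f by (simp add: is_functor_def)
  have "Cmp D (\<eta> v) f = Cmp D z (\<eta> u)"
    unfolding f_def using category_cancel_left[OF D u(1) HFo(2) u(2) zu e(2) e(1) e(4)] .
  moreover have "Cmp D (\<eta> v) f = Cmp D (Ha (Fo u) (Fo v) (Fa u v f)) (\<eta> u)"
    using natural_iso_natural[OF n u f] .
  moreover have "Ha (Fo u) (Fo v) (Fa u v f) \<in> Hom D (Ho (Fo u)) (Ho (Fo v))"
    using H Fo Ff by (simp add: is_functor_def)
  ultimately have "Ha (Fo u) (Fo v) (Fa u v f) = z"
    using category_cancel_right[OF D HFo(2) HFo(1) u(1) _ d(1) d(2) d(4)] z by metis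
  then have "Ha (Fo u) (Fo v) (Fa u v f) = Ha (Fo u) (Fo v) y"
    by (simp add: z_def)
  from natural_iso_to_id_faithful[OF E m FHo Fo Ff y] this have "Fa u v f = y" by simp
  with f show ?thesis by blast
qed

lemma equivalence_essentially_surjective:
  assumes eqv: "equivalence D E Fo Fa" and w: "w \<in> Ob E"
  shows "\<exists>u\<in>Ob D. \<exists>\<theta>\<in>Hom E (Fo u) w. \<exists>\<theta>'\<in>Hom E w (Fo u).
    Cmp E \<theta>' \<theta> = Id E (Fo u) \<and> Cmp E \<theta> \<theta>' = Id E w"
proof -
  obtain Ho Ha \<eta> \<theta> where H: "is_functor E D Ho Ha"
    and m: "natural_iso E E (\<lambda>u. Fo (Ho u)) (\<lambda>u v f. Fa (Ho u) (Ho v) (Ha u v f))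
        (\<lambda>u. u) (\<lambda>u v f. f) \<theta>"
    by (rule equivalenceE[OF eqv])
  have "Ho w \<in> Ob D" using H w by (simp add: is_functor_def)
  with natural_iso_component[OF m w] show ?thesis by metis
qed


section \<open>Strict 2-categories: whiskering, inverses and direct sums\<close>

context linear_two_category
begin

lemma id2_closed: "\<lbrakk>a \<in> obj C; b \<in> obj C; F \<in> mor C a b\<rbrakk> \<Longrightarrow> id2 C F \<in> hom2 C F F"
  using category_idI[OF hom_category, of a b F] by (simp add: hom_cat_def)

lemma vcomp_closed:
  "\<lbrakk>a \<in> obj C; b \<in> obj C; F \<in> mor C a b; H \<in> mor C a b; L \<in> mor C a b;
    x \<in> hom2 C F H; y \<in> hom2 C H L\<rbrakk> \<Longrightarrow> y \<cdot> x \<in> hom2 C F L"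
  using category_closed[OF hom_category, of a b F H L x y] by (simp add: hom_cat_def)

lemma vcomp_id:
  "\<lbrakk>a \<in> obj C; b \<in> obj C; F \<in> mor C a b; H \<in> mor C a b; x \<in> hom2 C F H\<rbrakk>
    \<Longrightarrow> x \<cdot> id2 C F = x \<and> id2 C H \<cdot> x = x"
  using category_id[OF hom_category, of a b F H x] by (simp add: hom_cat_def)

lemma vcomp_assoc:
  "\<lbrakk>a \<in> obj C; b \<in> obj C; F \<in> mor C a b; H \<in> mor C a b; L \<in> mor C a b; M \<in> mor C a b;
    x \<in> hom2 C F H; y \<in> hom2 C H L; z \<in> hom2 C L M\<rbrakk> \<Longrightarrow> (z \<cdot> y) \<cdot> x = z \<cdot> y \<cdot> x"
  using category_assoc[OF hom_category, of a b F H L M x y z] by (simp add: hom_cat_def)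

lemma inv2_eqI:
  assumes "a \<in> obj C" "b \<in> obj C" "F \<in> mor C a b" "H \<in> mor C a b"
    and "x \<in> hom2 C F H" "y \<in> hom2 C H F" "y \<cdot> x = id2 C F" "x \<cdot> y = id2 C H"
  shows "inv2 C F H x = y"
  unfolding inv2_def
proof (rule the_equality)
  fix z assume z: "z \<in> hom2 C H F \<and> z \<cdot> x = id2 C F \<and> x \<cdot> z = id2 C H"
  have "z = z \<cdot> (x \<cdot> y)" using vcomp_id[of a b H F z] assms z by simp
  also have "\<dots> = (z \<cdot> x) \<cdot> y" using vcomp_assoc[of a b H F H F y x z] assms z by simp
  also have "\<dots> = y" using vcomp_id[of a b H F y] assms z by simp
  finally show "z = y" .
qed (use assms in simp)

lemma inv2:
  assumes "a \<in> obj C" "b \<in> obj C" "F \<in> mor C a b" "H \<in> mor C a b" "x \<in> iso2 C F H"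
  shows "inv2 C F H x \<in> hom2 C H F" "inv2 C F H x \<cdot> x = id2 C F" "x \<cdot> inv2 C F H x = id2 C H"
proof -
  obtain y where y: "x \<in> hom2 C F H" "y \<in> hom2 C H F" "y \<cdot> x = id2 C F" "x \<cdot> y = id2 C H"
    using assms(5) unfolding iso2_def by blast
  have "inv2 C F H x = y" using inv2_eqI[OF assms(1-4) y] .
  then show "inv2 C F H x \<in> hom2 C H F" "inv2 C F H x \<cdot> x = id2 C F" "x \<cdot> inv2 C F H x = id2 C H"
    using y by auto
qed


subsection \<open>Finite sums of 2-morphisms\<close>

lemma cell_abelian_group: "\<lbrakk>a \<in> obj C; b \<in> obj C; F \<in> mor C a b; H \<in> mor C a b\<rbrakk> \<Longrightarrow> abelian_group (cell C F H)"
  using cell_module module.axioms(2) by blast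

text \<open>
  Composition with a fixed 2-morphism is additive. As the zero of \<open>cell C F H\<close> depends on \<open>F\<close> and \<open>H\<close>,
  its behaviour under composition has to be derived.
\<close>

lemma additive_zero:
  assumes M: "abelian_group M" and N: "abelian_group N"
    and f: "\<And>x. x \<in> carrier M \<Longrightarrow> f x \<in> carrier N"
    and add: "\<And>x y. x \<in> carrier M \<Longrightarrow> y \<in> carrier M \<Longrightarrow> f (x \<oplus>\<^bsub>M\<^esub> y) = f x \<oplus>\<^bsub>N\<^esub> f y"
  shows "f \<zero>\<^bsub>M\<^esub> = \<zero>\<^bsub>N\<^esub>"
proof -
  interpret M: abelian_group M by (rule M)
  interpret N: abelian_group N by (rule N)
  have "f \<zero>\<^bsub>M\<^esub> \<oplus>\<^bsub>N\<^esub> f \<zero>\<^bsub>M\<^esub> = f \<zero>\<^bsub>M\<^esub> \<oplus>\<^bsub>N\<^esub> \<zero>\<^bsub>N\<^esub>"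
    using add[of "\<zero>\<^bsub>M\<^esub>" "\<zero>\<^bsub>M\<^esub>"] f by simp
  then show ?thesis using f by (simp only: N.add.l_cancel M.zero_closed N.zero_closed)
qed

lemma additive_finsum:
  assumes M: "abelian_group M" and N: "abelian_group N"
    and f: "\<And>x. x \<in> carrier M \<Longrightarrow> f x \<in> carrier N"
    and add: "\<And>x y. x \<in> carrier M \<Longrightarrow> y \<in> carrier M \<Longrightarrow> f (x \<oplus>\<^bsub>M\<^esub> y) = f x \<oplus>\<^bsub>N\<^esub> f y"
    and "finite I" and "\<And>i. i \<in> I \<Longrightarrow> z i \<in> carrier M"
  shows "f (finsum M z I) = finsum N (\<lambda>i. f (z i)) I"
proof -
  interpret M: abelian_group M by (rule M)
  interpret N: abelian_group N by (rule N)
  from \<open>finite I\<close> assms(6) show ?thesis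
  proof (induction I)
    case empty
    then show ?case using additive_zero[OF M N f add] by simp
  next
    case (insert i I)
    then have "z \<in> I \<rightarrow> carrier M" "(\<lambda>i. f (z i)) \<in> I \<rightarrow> carrier N" using f by auto
    then show ?case using insert f add by simp
  qed
qed

lemma finsum_single:
  assumes M: "abelian_group M" and "finite I" "i \<in> I" "y \<in> carrier M"
    and "\<And>j. j \<in> I \<Longrightarrow> z j = (if j = i then y else \<zero>\<^bsub>M\<^esub>)"
  shows "finsum M z I = y"
proof -
  interpret M: abelian_group M by (rule M)
  have "finsum M z I = finsum M (\<lambda>j. if i = j then (\<lambda>_. y) j else \<zero>\<^bsub>M\<^esub>) I"
    using assms by (intro M.finsum_cong') auto
  also have "\<dots> = y" using M.finsum_singleton[of i I "\<lambda>_. y"] assms by simp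
  finally show ?thesis .
qed

lemma vcomp_add_left:
  "\<lbrakk>a \<in> obj C; b \<in> obj C; F \<in> mor C a b; H \<in> mor C a b; L \<in> mor C a b;
    x \<in> hom2 C H L; x' \<in> hom2 C H L; y \<in> hom2 C F H\<rbrakk>
    \<Longrightarrow> (x \<oplus>\<^bsub>cell C H L\<^esub> x') \<cdot> y = (x \<cdot> y) \<oplus>\<^bsub>cell C F L\<^esub> (x' \<cdot> y)"
  using vcomp_bilinear[of a b F H L x x' y y] by auto

lemma vcomp_add_right:
  "\<lbrakk>a \<in> obj C; b \<in> obj C; F \<in> mor C a b; H \<in> mor C a b; L \<in> mor C a b;
    x \<in> hom2 C H L; y \<in> hom2 C F H; y' \<in> hom2 C F H\<rbrakk>
    \<Longrightarrow> x \<cdot> (y \<oplus>\<^bsub>cell C F H\<^esub> y') = (x \<cdot> y) \<oplus>\<^bsub>cell C F L\<^esub> (x \<cdot> y')"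
  using vcomp_bilinear[of a b F H L x x y y'] by auto

lemma hcomp_add_left:
  "\<lbrakk>a \<in> obj C; b \<in> obj C; c \<in> obj C; F \<in> mor C b c; F' \<in> mor C b c; H \<in> mor C a b; H' \<in> mor C a b;
    x \<in> hom2 C F F'; x' \<in> hom2 C F F'; y \<in> hom2 C H H'\<rbrakk>
    \<Longrightarrow> (x \<oplus>\<^bsub>cell C F F'\<^esub> x') \<bullet> y = (x \<bullet> y) \<oplus>\<^bsub>cell C (F \<star> H) (F' \<star> H')\<^esub> (x' \<bullet> y)"
  using hcomp_bilinear[of a b c F F' H H' x x' y y] by auto

lemma hcomp_add_right:
  "\<lbrakk>a \<in> obj C; b \<in> obj C; c \<in> obj C; F \<in> mor C b c; F' \<in> mor C b c; H \<in> mor C a b; H' \<in> mor C a b;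
    x \<in> hom2 C F F'; y \<in> hom2 C H H'; y' \<in> hom2 C H H'\<rbrakk>
    \<Longrightarrow> x \<bullet> (y \<oplus>\<^bsub>cell C H H'\<^esub> y') = (x \<bullet> y) \<oplus>\<^bsub>cell C (F \<star> H) (F' \<star> H')\<^esub> (x \<bullet> y')"
  using hcomp_bilinear[of a b c F F' H H' x x y y'] by auto

lemma vcomp_finsum_left:
  assumes "a \<in> obj C" "b \<in> obj C" "F \<in> mor C a b" "H \<in> mor C a b" "L \<in> mor C a b"
    and "finite I" "\<And>i. i \<in> I \<Longrightarrow> x i \<in> hom2 C H L" "y \<in> hom2 C F H"
  shows "(\<Oplus>\<^bsub>cell C H L\<^esub>i\<in>I. x i) \<cdot> y = (\<Oplus>\<^bsub>cell C F L\<^esub>i\<in>I. x i \<cdot> y)"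
  using assms additive_finsum[OF cell_abelian_group[of a b H L] cell_abelian_group[of a b F L], of "\<lambda>x. x \<cdot> y" I x]
    vcomp_add_left[of a b F H L] vcomp_closed[of a b F H L y]
  by (simp add: hom2_def)

lemma vcomp_finsum_right:
  assumes "a \<in> obj C" "b \<in> obj C" "F \<in> mor C a b" "H \<in> mor C a b" "L \<in> mor C a b"
    and "finite I" "x \<in> hom2 C H L" "\<And>i. i \<in> I \<Longrightarrow> y i \<in> hom2 C F H"
  shows "x \<cdot> (\<Oplus>\<^bsub>cell C F H\<^esub>i\<in>I. y i) = (\<Oplus>\<^bsub>cell C F L\<^esub>i\<in>I. x \<cdot> y i)"
  using assms additive_finsum[OF cell_abelian_group[of a b F H] cell_abelian_group[of a b F L], of "\<lambda>y. x \<cdot> y" I y]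
    vcomp_add_right[of a b F H L] vcomp_closed[of a b F H L _ x]
  by (simp add: hom2_def)

lemma hcomp_finsum_left:
  assumes "a \<in> obj C" "b \<in> obj C" "c \<in> obj C"
    "F \<in> mor C b c" "F' \<in> mor C b c" "H \<in> mor C a b" "H' \<in> mor C a b"
    and "finite I" "\<And>i. i \<in> I \<Longrightarrow> x i \<in> hom2 C F F'" "y \<in> hom2 C H H'"
  shows "(\<Oplus>\<^bsub>cell C F F'\<^esub>i\<in>I. x i) \<bullet> y = (\<Oplus>\<^bsub>cell C (F \<star> H) (F' \<star> H')\<^esub>i\<in>I. x i \<bullet> y)"
  using assms additive_finsum[OF cell_abelian_group[of b c F F']
      cell_abelian_group[of a c "F \<star> H" "F' \<star> H'"], of "\<lambda>x. x \<bullet> y" I x]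
    hcomp_add_left[of a b c F F' H H'] hcomp_closed[of a b c F F' H H' _ y] comp1_closed[of a b c]
  by (simp add: hom2_def)

lemma hcomp_finsum_right:
  assumes "a \<in> obj C" "b \<in> obj C" "c \<in> obj C"
    "F \<in> mor C b c" "F' \<in> mor C b c" "H \<in> mor C a b" "H' \<in> mor C a b"
    and "finite I" "x \<in> hom2 C F F'" "\<And>i. i \<in> I \<Longrightarrow> y i \<in> hom2 C H H'"
  shows "x \<bullet> (\<Oplus>\<^bsub>cell C H H'\<^esub>i\<in>I. y i) = (\<Oplus>\<^bsub>cell C (F \<star> H) (F' \<star> H')\<^esub>i\<in>I. x \<bullet> y i)"
  using assms additive_finsum[OF cell_abelian_group[of a b H H']
      cell_abelian_group[of a c "F \<star> H" "F' \<star> H'"], of "\<lambda>y. x \<bullet> y" I y]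
    hcomp_add_right[of a b c F F' H H'] hcomp_closed[of a b c F F' H H' x] comp1_closed[of a b c]
  by (simp add: hom2_def)

lemma vcomp_zero_left:
  assumes "a \<in> obj C" "b \<in> obj C" "F \<in> mor C a b" "H \<in> mor C a b" "L \<in> mor C a b" "y \<in> hom2 C F H"
  shows "\<zero>\<^bsub>cell C H L\<^esub> \<cdot> y = \<zero>\<^bsub>cell C F L\<^esub>"
  using assms additive_zero[OF cell_abelian_group[of a b H L] cell_abelian_group[of a b F L], of "\<lambda>x. x \<cdot> y"]
    vcomp_add_left[of a b F H L] vcomp_closed[of a b F H L y]
  by (simp add: hom2_def)

lemma vcomp_zero_right:
  assumes "a \<in> obj C" "b \<in> obj C" "F \<in> mor C a b" "H \<in> mor C a b" "L \<in> mor C a b" "x \<in> hom2 C H L"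
  shows "x \<cdot> \<zero>\<^bsub>cell C F H\<^esub> = \<zero>\<^bsub>cell C F L\<^esub>"
  using assms additive_zero[OF cell_abelian_group[of a b F H] cell_abelian_group[of a b F L], of "\<lambda>y. x \<cdot> y"]
    vcomp_add_right[of a b F H L] vcomp_closed[of a b F H L _ x]
  by (simp add: hom2_def)

lemma hcomp_zero_left:
  assumes "a \<in> obj C" "b \<in> obj C" "c \<in> obj C"
    "F \<in> mor C b c" "F' \<in> mor C b c" "H \<in> mor C a b" "H' \<in> mor C a b" "y \<in> hom2 C H H'"
  shows "\<zero>\<^bsub>cell C F F'\<^esub> \<bullet> y = \<zero>\<^bsub>cell C (F \<star> H) (F' \<star> H')\<^esub>"
  using assms additive_zero[OF cell_abelian_group[of b c F F']
      cell_abelian_group[of a c "F \<star> H" "F' \<star> H'"], of "\<lambda>x. x \<bullet> y"]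
    hcomp_add_left[of a b c F F' H H'] hcomp_closed[of a b c F F' H H' _ y] comp1_closed[of a b c]
  by (simp add: hom2_def)

lemma hcomp_zero_right:
  assumes "a \<in> obj C" "b \<in> obj C" "c \<in> obj C"
    "F \<in> mor C b c" "F' \<in> mor C b c" "H \<in> mor C a b" "H' \<in> mor C a b" "x \<in> hom2 C F F'"
  shows "x \<bullet> \<zero>\<^bsub>cell C H H'\<^esub> = \<zero>\<^bsub>cell C (F \<star> H) (F' \<star> H')\<^esub>"
  using assms additive_zero[OF cell_abelian_group[of a b H H']
      cell_abelian_group[of a c "F \<star> H" "F' \<star> H'"], of "\<lambda>y. x \<bullet> y"]
    hcomp_add_right[of a b c F F' H H'] hcomp_closed[of a b c F F' H H' x] comp1_closed[of a b c]
  by (simp add: hom2_def)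


subsection \<open>Direct sums\<close>

lemma direct_sum_inc: "direct_sum C I P Y inc prj \<Longrightarrow> i \<in> I \<Longrightarrow> inc i \<in> hom2 C (P i) Y"
  and direct_sum_prj: "direct_sum C I P Y inc prj \<Longrightarrow> i \<in> I \<Longrightarrow> prj i \<in> hom2 C Y (P i)"
  and direct_sum_prj_inc: "direct_sum C I P Y inc prj \<Longrightarrow> i \<in> I \<Longrightarrow> j \<in> I \<Longrightarrow>
    prj i \<cdot> inc j = (if i = j then id2 C (P i) else \<zero>\<^bsub>cell C (P j) (P i)\<^esub>)"
  and direct_sum_id: "direct_sum C I P Y inc prj \<Longrightarrow> (\<Oplus>\<^bsub>cell C Y Y\<^esub>i\<in>I. inc i \<cdot> prj i) = id2 C Y"
  unfolding direct_sum_def by auto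

lemma direct_sum_expand:
  assumes ab: "a \<in> obj C" "b \<in> obj C" and P: "\<And>i. i \<in> I \<Longrightarrow> P i \<in> mor C a b" "Y \<in> mor C a b"
    and ds: "direct_sum C I P Y inc prj" and I: "finite I"
    and x: "W \<in> mor C a b" "x \<in> hom2 C W Y"
  shows "x = (\<Oplus>\<^bsub>cell C W Y\<^esub>i\<in>I. inc i \<cdot> prj i \<cdot> x)"
proof -
  have c: "inc i \<cdot> prj i \<in> hom2 C Y Y" if "i \<in> I" for i
    using vcomp_closed[OF ab P(2) P(1)[OF that] P(2)] direct_sum_prj[OF ds that] direct_sum_inc[OF ds that] .
  have "x = (\<Oplus>\<^bsub>cell C Y Y\<^esub>i\<in>I. inc i \<cdot> prj i) \<cdot> x"
    using vcomp_id[OF ab x(1) P(2) x(2)] direct_sum_id[OF ds] by simp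
  also have "\<dots> = (\<Oplus>\<^bsub>cell C W Y\<^esub>i\<in>I. (inc i \<cdot> prj i) \<cdot> x)"
    using vcomp_finsum_left[OF ab x(1) P(2) P(2) I c x(2)] by simp
  also have "\<dots> = (\<Oplus>\<^bsub>cell C W Y\<^esub>i\<in>I. inc i \<cdot> prj i \<cdot> x)"
  proof -
    interpret sum: abelian_group "cell C W Y" using cell_abelian_group[OF ab x(1) P(2)] .
    show ?thesis
    proof (rule sum.finsum_cong')
      fix i assume i: "i \<in> I"
      show "(inc i \<cdot> prj i) \<cdot> x = inc i \<cdot> prj i \<cdot> x"
        using vcomp_assoc[OF ab x(1) P(2) P(1)[OF i] P(2) x(2) direct_sum_prj[OF ds i] direct_sum_inc[OF ds i]] .
    next
      show "(\<lambda>i. inc i \<cdot> prj i \<cdot> x) \<in> I \<rightarrow> carrier (cell C W Y)"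
        using vcomp_closed[OF ab x(1) P(1) P(2)] vcomp_closed[OF ab x(1) P(2) P(1)] x(2)
          direct_sum_prj[OF ds] direct_sum_inc[OF ds] by (auto simp: hom2_def)
    qed simp
  qed
  finally show ?thesis .
qed

text \<open>Inserting \<open>id = \<Sum> inc \<circ> prj\<close> reduces equations to components.\<close>

lemma direct_sum_eq_prj:
  assumes ab: "a \<in> obj C" "b \<in> obj C" and P: "\<And>i. i \<in> I \<Longrightarrow> P i \<in> mor C a b" "Y \<in> mor C a b"
    and ds: "direct_sum C I P Y inc prj" and I: "finite I"
    and W: "W \<in> mor C a b" and x: "x \<in> hom2 C W Y" and y: "y \<in> hom2 C W Y"
    and eq: "\<And>i. i \<in> I \<Longrightarrow> prj i \<cdot> x = prj i \<cdot> y"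
  shows "x = y"
proof -
  interpret sum: abelian_group "cell C W Y" using cell_abelian_group[OF ab W P(2)] .
  have "(\<lambda>i. inc i \<cdot> prj i \<cdot> y) \<in> I \<rightarrow> carrier (cell C W Y)"
    using vcomp_closed[OF ab W P(1) P(2)] vcomp_closed[OF ab W P(2) P(1)] y
      direct_sum_prj[OF ds] direct_sum_inc[OF ds] by (auto simp: hom2_def)
  then have "(\<Oplus>\<^bsub>cell C W Y\<^esub>i\<in>I. inc i \<cdot> prj i \<cdot> x) = (\<Oplus>\<^bsub>cell C W Y\<^esub>i\<in>I. inc i \<cdot> prj i \<cdot> y)"
    using eq by (intro sum.finsum_cong') auto
  then show ?thesis
    using direct_sum_expand[OF ab P ds I W x] direct_sum_expand[OF ab P ds I W y] by simp
qed

lemma direct_sum_eq_inc: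
  assumes ab: "a \<in> obj C" "b \<in> obj C" and P: "\<And>i. i \<in> I \<Longrightarrow> P i \<in> mor C a b" "Y \<in> mor C a b"
    and ds: "direct_sum C I P Y inc prj" and I: "finite I"
    and Z: "Z \<in> mor C a b" and x: "x \<in> hom2 C Y Z" and y: "y \<in> hom2 C Y Z"
    and eq: "\<And>i. i \<in> I \<Longrightarrow> x \<cdot> inc i = y \<cdot> inc i"
  shows "x = y"
proof -
  have c: "inc i \<cdot> prj i \<in> hom2 C Y Y" if "i \<in> I" for i
    using vcomp_closed[OF ab P(2) P(1)[OF that] P(2)] direct_sum_prj[OF ds that] direct_sum_inc[OF ds that] .
  have exp: "z = (\<Oplus>\<^bsub>cell C Y Z\<^esub>i\<in>I. (z \<cdot> inc i) \<cdot> prj i)" if z: "z \<in> hom2 C Y Z" for z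
  proof -
    interpret sum: abelian_group "cell C Y Z" using cell_abelian_group[OF ab P(2) Z] .
    have "z = z \<cdot> (\<Oplus>\<^bsub>cell C Y Y\<^esub>i\<in>I. inc i \<cdot> prj i)"
      using vcomp_id[OF ab P(2) Z z] direct_sum_id[OF ds] by simp
    also have "\<dots> = (\<Oplus>\<^bsub>cell C Y Z\<^esub>i\<in>I. z \<cdot> inc i \<cdot> prj i)"
      using vcomp_finsum_right[OF ab P(2) P(2) Z I z c] by simp
    also have "\<dots> = (\<Oplus>\<^bsub>cell C Y Z\<^esub>i\<in>I. (z \<cdot> inc i) \<cdot> prj i)"
    proof (rule sum.finsum_cong')
      fix i assume i: "i \<in> I"
      show "z \<cdot> inc i \<cdot> prj i = (z \<cdot> inc i) \<cdot> prj i"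
        using vcomp_assoc[OF ab P(2) P(1)[OF i] P(2) Z direct_sum_prj[OF ds i] direct_sum_inc[OF ds i] z] by simp
    next
      show "(\<lambda>i. (z \<cdot> inc i) \<cdot> prj i) \<in> I \<rightarrow> carrier (cell C Y Z)"
        using vcomp_closed[OF ab P(2) P(1) Z] vcomp_closed[OF ab P(1) P(2) Z] z
          direct_sum_prj[OF ds] direct_sum_inc[OF ds] by (auto simp: hom2_def)
    qed simp
    finally show ?thesis .
  qed
  interpret sum: abelian_group "cell C Y Z" using cell_abelian_group[OF ab P(2) Z] .
  have "(\<lambda>i. (y \<cdot> inc i) \<cdot> prj i) \<in> I \<rightarrow> carrier (cell C Y Z)"
    using vcomp_closed[OF ab P(2) P(1) Z] vcomp_closed[OF ab P(1) P(2) Z] y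
      direct_sum_prj[OF ds] direct_sum_inc[OF ds] by (auto simp: hom2_def)
  then have "(\<Oplus>\<^bsub>cell C Y Z\<^esub>i\<in>I. (x \<cdot> inc i) \<cdot> prj i) = (\<Oplus>\<^bsub>cell C Y Z\<^esub>i\<in>I. (y \<cdot> inc i) \<cdot> prj i)"
    using eq by (intro sum.finsum_cong') auto
  then show ?thesis
    using exp[OF x] exp[OF y] by simp
qed

text \<open>The sums that define \<open>alpha\<close>, \<open>A_flips\<close> and \<open>A_triv\<close> are evaluated on a summand by this lemma.\<close>

lemma direct_sum_cotuple:
  assumes ab: "a \<in> obj C" "b \<in> obj C" and P: "\<And>i. i \<in> I \<Longrightarrow> P i \<in> mor C a b" "Y \<in> mor C a b"
    and ds: "direct_sum C I P Y inc prj" and I: "finite I"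
    and Z: "Z \<in> mor C a b" and f: "\<And>i. i \<in> I \<Longrightarrow> f i \<in> hom2 C (P i) Z"
  shows "(\<Oplus>\<^bsub>cell C Y Z\<^esub>i\<in>I. f i \<cdot> prj i) \<in> hom2 C Y Z"
    and "j \<in> I \<Longrightarrow> (\<Oplus>\<^bsub>cell C Y Z\<^esub>i\<in>I. f i \<cdot> prj i) \<cdot> inc j = f j"
proof -
  interpret YZ: abelian_group "cell C Y Z" using cell_abelian_group[OF ab P(2) Z] .
  have c: "f i \<cdot> prj i \<in> hom2 C Y Z" if "i \<in> I" for i
    using vcomp_closed[OF ab P(2) P(1) Z] that direct_sum_prj[OF ds] f by blast
  show "(\<Oplus>\<^bsub>cell C Y Z\<^esub>i\<in>I. f i \<cdot> prj i) \<in> hom2 C Y Z"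
    using c YZ.finsum_closed[of "\<lambda>i. f i \<cdot> prj i" I] by (auto simp: hom2_def)
  assume j: "j \<in> I"
  have "(\<Oplus>\<^bsub>cell C Y Z\<^esub>i\<in>I. f i \<cdot> prj i) \<cdot> inc j = (\<Oplus>\<^bsub>cell C (P j) Z\<^esub>i\<in>I. (f i \<cdot> prj i) \<cdot> inc j)"
    using vcomp_finsum_left[OF ab P(1)[OF j] P(2) Z I c direct_sum_inc[OF ds j]] by simp
  also have "\<dots> = f j"
  proof (rule finsum_single[OF cell_abelian_group[OF ab P(1)[OF j] Z] I j])
    show "f j \<in> carrier (cell C (P j) Z)" using f[OF j] by (simp add: hom2_def)
  next
    fix i assume i: "i \<in> I"
    have "(f i \<cdot> prj i) \<cdot> inc j = f i \<cdot> prj i \<cdot> inc j"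
      using vcomp_assoc[OF ab P(1)[OF j] P(2) P(1)[OF i] Z direct_sum_inc[OF ds j] direct_sum_prj[OF ds i] f[OF i]] .
    also have "\<dots> = (if i = j then f j else \<zero>\<^bsub>cell C (P j) Z\<^esub>)"
      using direct_sum_prj_inc[OF ds i j] vcomp_id[OF ab P(1)[OF i] Z f[OF i]]
        vcomp_zero_right[OF ab P(1)[OF j] P(1)[OF i] Z f[OF i]] by auto
    finally show "(f i \<cdot> prj i) \<cdot> inc j = (if i = j then f j else \<zero>\<^bsub>cell C (P j) Z\<^esub>)" .
  qed
  finally show "(\<Oplus>\<^bsub>cell C Y Z\<^esub>i\<in>I. f i \<cdot> prj i) \<cdot> inc j = f j" .
qed

text \<open>
  This is the shape of \<open>A_flips\<close>, where \<open>\<pi>\<close> is a conjugation of \<open>G\<close>, and of \<open>A_triv\<close>, where it is a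
  translation.
\<close>

lemma direct_sum_permute:
  assumes ab: "a \<in> obj C" "b \<in> obj C"
    and P: "\<And>i. i \<in> I \<Longrightarrow> P i \<in> mor C a b" "Y \<in> mor C a b"
    and Q: "\<And>i. i \<in> I \<Longrightarrow> Q i \<in> mor C a b" "Z \<in> mor C a b"
    and ds: "direct_sum C I P Y inc prj" and ds': "direct_sum C I Q Z inc' prj'" and I: "finite I"
    and \<pi>: "bij_betw \<pi> I I"
    and f: "\<And>i. i \<in> I \<Longrightarrow> f i \<in> iso2 C (P i) (Q (\<pi> i))"
  defines "m \<equiv> (\<Oplus>\<^bsub>cell C Y Z\<^esub>i\<in>I. inc' (\<pi> i) \<cdot> f i \<cdot> prj i)"
  shows "m \<in> iso2 C Y Z"
    and "i \<in> I \<Longrightarrow> m \<cdot> inc i = inc' (\<pi> i) \<cdot> f i"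
    and "i \<in> I \<Longrightarrow> prj' (\<pi> i) \<cdot> m = f i \<cdot> prj i"
proof -
  have \<pi>I: "\<pi> i \<in> I" if "i \<in> I" for i using \<pi> that by (auto simp: bij_betw_def)
  have fh: "f i \<in> hom2 C (P i) (Q (\<pi> i))" if "i \<in> I" for i
    using f[OF that] by (simp add: iso2_def)
  have fi: "inc' (\<pi> i) \<cdot> f i \<in> hom2 C (P i) Z" if "i \<in> I" for i
    using vcomp_closed[OF ab P(1)[OF that] Q(1)[OF \<pi>I[OF that]] Q(2) fh[OF that]] direct_sum_inc[OF ds' \<pi>I[OF that]] .
  have m: "m = (\<Oplus>\<^bsub>cell C Y Z\<^esub>i\<in>I. (inc' (\<pi> i) \<cdot> f i) \<cdot> prj i)"
  proof -
    interpret sum: abelian_group "cell C Y Z" using cell_abelian_group[OF ab P(2) Q(2)] .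
    show ?thesis unfolding m_def
    proof (rule sum.finsum_cong')
      fix i assume i: "i \<in> I"
      show "inc' (\<pi> i) \<cdot> f i \<cdot> prj i = (inc' (\<pi> i) \<cdot> f i) \<cdot> prj i"
        using vcomp_assoc[OF ab P(2) P(1)[OF i] Q(1)[OF \<pi>I[OF i]] Q(2) direct_sum_prj[OF ds i] fh[OF i]
            direct_sum_inc[OF ds' \<pi>I[OF i]]] by simp
    next
      show "(\<lambda>i. (inc' (\<pi> i) \<cdot> f i) \<cdot> prj i) \<in> I \<rightarrow> carrier (cell C Y Z)"
        using vcomp_closed[OF ab P(2) P(1) Q(2)] fi direct_sum_prj[OF ds] by (auto simp: hom2_def)
    qed simp
  qed
  have mh: "m \<in> hom2 C Y Z" and mi: "\<And>i. i \<in> I \<Longrightarrow> m \<cdot> inc i = inc' (\<pi> i) \<cdot> f i"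
    unfolding m using direct_sum_cotuple[OF ab P ds I Q(2) fi] by auto
  show "i \<in> I \<Longrightarrow> m \<cdot> inc i = inc' (\<pi> i) \<cdot> f i" by (rule mi)
  show pm: "prj' (\<pi> i) \<cdot> m = f i \<cdot> prj i" if i: "i \<in> I" for i
  proof (rule direct_sum_eq_inc[OF ab P ds I Q(1)[OF \<pi>I[OF i]]])
    show "prj' (\<pi> i) \<cdot> m \<in> hom2 C Y (Q (\<pi> i))"
      using vcomp_closed[OF ab P(2) Q(2) Q(1)[OF \<pi>I[OF i]] mh direct_sum_prj[OF ds' \<pi>I[OF i]]] .
    show "f i \<cdot> prj i \<in> hom2 C Y (Q (\<pi> i))"
      using vcomp_closed[OF ab P(2) P(1)[OF i] Q(1)[OF \<pi>I[OF i]] direct_sum_prj[OF ds i] fh[OF i]] .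
    fix j assume j: "j \<in> I"
    have "(prj' (\<pi> i) \<cdot> m) \<cdot> inc j = (prj' (\<pi> i) \<cdot> inc' (\<pi> j)) \<cdot> f j"
      using vcomp_assoc[OF ab P(1)[OF j] P(2) Q(2) Q(1)[OF \<pi>I[OF i]] direct_sum_inc[OF ds j] mh
          direct_sum_prj[OF ds' \<pi>I[OF i]]]
        vcomp_assoc[OF ab P(1)[OF j] Q(1)[OF \<pi>I[OF j]] Q(2) Q(1)[OF \<pi>I[OF i]] fh[OF j] direct_sum_inc[OF ds' \<pi>I[OF j]]
            direct_sum_prj[OF ds' \<pi>I[OF i]]]
        mi[OF j] by simp
    also have "\<dots> = (if i = j then f i else \<zero>\<^bsub>cell C (P j) (Q (\<pi> i))\<^esub>)"
    proof -
      have "\<pi> i = \<pi> j \<longleftrightarrow> i = j" using \<pi> i j by (auto simp: bij_betw_def inj_on_def)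
      then show ?thesis
        using direct_sum_prj_inc[OF ds' \<pi>I[OF i] \<pi>I[OF j]] vcomp_id[OF ab P(1)[OF i] Q(1)[OF \<pi>I[OF i]] fh[OF i]]
          vcomp_zero_left[OF ab P(1)[OF j] Q(1)[OF \<pi>I[OF j]] Q(1)[OF \<pi>I[OF i]] fh[OF j]] by auto
    qed
    also have "\<dots> = f i \<cdot> prj i \<cdot> inc j"
      using direct_sum_prj_inc[OF ds i j] vcomp_id[OF ab P(1)[OF i] Q(1)[OF \<pi>I[OF i]] fh[OF i]]
        vcomp_zero_right[OF ab P(1)[OF j] P(1)[OF i] Q(1)[OF \<pi>I[OF i]] fh[OF i]] by auto
    also have "\<dots> = (f i \<cdot> prj i) \<cdot> inc j"
      using vcomp_assoc[OF ab P(1)[OF j] P(2) P(1)[OF i] Q(1)[OF \<pi>I[OF i]] direct_sum_inc[OF ds j]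
          direct_sum_prj[OF ds i] fh[OF i]] by simp
    finally show "(prj' (\<pi> i) \<cdot> m) \<cdot> inc j = (f i \<cdot> prj i) \<cdot> inc j" .
  qed
  \<comment> \<open>The inverse is assembled in the same way from the inverses of the \<open>f i\<close>.\<close>
  define \<sigma> where "\<sigma> = inv_into I \<pi>"
  have \<sigma>: "\<sigma> j \<in> I" "\<pi> (\<sigma> j) = j" if "j \<in> I" for j
    using bij_betw_inv_into_right[OF \<pi> that] bij_betw_inv_into[OF \<pi>] that
    by (auto simp: \<sigma>_def bij_betw_def)
  have \<sigma>\<pi>: "\<sigma> (\<pi> j) = j" if "j \<in> I" for j
    using bij_betw_inv_into_left[OF \<pi> that] by (simp add: \<sigma>_def)
  define g where "g = (\<lambda>j. inv2 C (P (\<sigma> j)) (Q j) (f (\<sigma> j)))"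
  have g: "g j \<in> hom2 C (Q j) (P (\<sigma> j))" "g j \<cdot> f (\<sigma> j) = id2 C (P (\<sigma> j))" "f (\<sigma> j) \<cdot> g j = id2 C (Q j)"
    if "j \<in> I" for j
    using inv2[OF ab P(1) Q(1), of "\<sigma> j" j "f (\<sigma> j)"] f[OF \<sigma>(1)[OF that]] \<sigma>[OF that] that by (auto simp: g_def)
  have gi: "inc (\<sigma> j) \<cdot> g j \<in> hom2 C (Q j) Y" if "j \<in> I" for j
    using vcomp_closed[OF ab Q(1)[OF that] P(1)[OF \<sigma>(1)[OF that]] P(2) g(1)[OF that]
        direct_sum_inc[OF ds \<sigma>(1)[OF that]]] .
  define n where "n = (\<Oplus>\<^bsub>cell C Z Y\<^esub>j\<in>I. (inc (\<sigma> j) \<cdot> g j) \<cdot> prj' j)"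
  have nh: "n \<in> hom2 C Z Y" and ni: "\<And>j. j \<in> I \<Longrightarrow> n \<cdot> inc' j = inc (\<sigma> j) \<cdot> g j"
    unfolding n_def using direct_sum_cotuple[OF ab Q ds' I P(2) gi] by auto
  have "n \<cdot> m = id2 C Y"
  proof (rule direct_sum_eq_inc[OF ab P ds I P(2)])
    show "n \<cdot> m \<in> hom2 C Y Y" using vcomp_closed[OF ab P(2) Q(2) P(2) mh nh] .
    show "id2 C Y \<in> hom2 C Y Y" using id2_closed[OF ab P(2)] .
    fix i assume i: "i \<in> I"
    note pi = \<pi>I[OF i]
    have gf: "g (\<pi> i) \<in> hom2 C (Q (\<pi> i)) (P i)" "g (\<pi> i) \<cdot> f i = id2 C (P i)"
      using g[OF pi] \<sigma>\<pi>[OF i] by auto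
    have "(n \<cdot> m) \<cdot> inc i = (n \<cdot> inc' (\<pi> i)) \<cdot> f i"
      using vcomp_assoc[OF ab P(1)[OF i] P(2) Q(2) P(2) direct_sum_inc[OF ds i] mh nh]
        vcomp_assoc[OF ab P(1)[OF i] Q(1)[OF pi] Q(2) P(2) fh[OF i] direct_sum_inc[OF ds' pi] nh] mi[OF i] by simp
    also have "\<dots> = inc i \<cdot> g (\<pi> i) \<cdot> f i"
      using ni[OF pi] \<sigma>\<pi>[OF i] vcomp_assoc[OF ab P(1)[OF i] Q(1)[OF pi] P(1)[OF i] P(2) fh[OF i] gf(1)
          direct_sum_inc[OF ds i]] by simp
    also have "\<dots> = id2 C Y \<cdot> inc i"
      using gf(2) vcomp_id[OF ab P(1)[OF i] P(2) direct_sum_inc[OF ds i]] by simp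
    finally show "(n \<cdot> m) \<cdot> inc i = id2 C Y \<cdot> inc i" .
  qed
  moreover have "m \<cdot> n = id2 C Z"
  proof (rule direct_sum_eq_inc[OF ab Q ds' I Q(2)])
    show "m \<cdot> n \<in> hom2 C Z Z" using vcomp_closed[OF ab Q(2) P(2) Q(2) nh mh] .
    show "id2 C Z \<in> hom2 C Z Z" using id2_closed[OF ab Q(2)] .
    fix j assume j: "j \<in> I"
    note sj = \<sigma>(1)[OF j]
    have fs: "f (\<sigma> j) \<in> hom2 C (P (\<sigma> j)) (Q j)" using fh[OF sj] \<sigma>(2)[OF j] by simp
    have "(m \<cdot> n) \<cdot> inc' j = (m \<cdot> inc (\<sigma> j)) \<cdot> g j"
      using vcomp_assoc[OF ab Q(1)[OF j] Q(2) P(2) Q(2) direct_sum_inc[OF ds' j] nh mh]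
        vcomp_assoc[OF ab Q(1)[OF j] P(1)[OF sj] P(2) Q(2) g(1)[OF j] direct_sum_inc[OF ds sj] mh] ni[OF j] by simp
    also have "\<dots> = inc' j \<cdot> f (\<sigma> j) \<cdot> g j"
      using mi[OF sj] \<sigma>(2)[OF j] vcomp_assoc[OF ab Q(1)[OF j] P(1)[OF sj] Q(1)[OF j] Q(2) g(1)[OF j] fs
          direct_sum_inc[OF ds' j]] by simp
    also have "\<dots> = id2 C Z \<cdot> inc' j"
      using g(3)[OF j] vcomp_id[OF ab Q(1)[OF j] Q(2) direct_sum_inc[OF ds' j]] by simp
    finally show "(m \<cdot> n) \<cdot> inc' j = id2 C Z \<cdot> inc' j" .
  qed
  ultimately show "m \<in> iso2 C Y Z" using mh nh by (auto simp: iso2_def)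
qed

text \<open>Direct sums are given by equations between sums and composites, hence preserved by linear functors.\<close>

lemma direct_sum_whisker_right:
  assumes ab: "a \<in> obj C" "b \<in> obj C" "c \<in> obj C" and L: "L \<in> mor C c a"
    and P: "\<And>i. i \<in> I \<Longrightarrow> P i \<in> mor C a b" "Y \<in> mor C a b"
    and ds: "direct_sum C I P Y inc prj" and I: "finite I"
  shows "direct_sum C I (\<lambda>i. P i \<star> L) (Y \<star> L) (\<lambda>i. inc i \<triangleleft> L) (\<lambda>i. prj i \<triangleleft> L)"
  unfolding direct_sum_def whisker_right_def
proof (intro conjI ballI)
  note o = ab(3) ab(1) ab(2)
  note idL = id2_closed[OF ab(3) ab(1) L]
  have LL: "id2 C L \<cdot> id2 C L = id2 C L" using vcomp_id[OF ab(3) ab(1) L L idL] by simp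
  fix i assume i: "i \<in> I"
  show "inc i \<bullet> id2 C L \<in> hom2 C (P i \<star> L) (Y \<star> L)"
    using hcomp_closed[OF o P(1)[OF i] P(2) L L direct_sum_inc[OF ds i] idL] .
  show "prj i \<bullet> id2 C L \<in> hom2 C (Y \<star> L) (P i \<star> L)"
    using hcomp_closed[OF o P(2) P(1)[OF i] L L direct_sum_prj[OF ds i] idL] .
  fix j assume j: "j \<in> I"
  have "(prj i \<bullet> id2 C L) \<cdot> (inc j \<bullet> id2 C L) = (prj i \<cdot> inc j) \<bullet> id2 C L"
    using interchange[OF o P(1)[OF j] P(2) P(1)[OF i] L L L direct_sum_inc[OF ds j] direct_sum_prj[OF ds i] idL idL]
        LL by simp
  also have "\<dots> = (if i = j then id2 C (P i \<star> L) else \<zero>\<^bsub>cell C (P j \<star> L) (P i \<star> L)\<^esub>)"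
    using direct_sum_prj_inc[OF ds i j] hcomp_id2[OF o P(1)[OF i] L]
      hcomp_zero_left[OF o P(1)[OF j] P(1)[OF i] L L idL] by auto
  finally show "(prj i \<bullet> id2 C L) \<cdot> (inc j \<bullet> id2 C L)
    = (if i = j then id2 C (P i \<star> L) else \<zero>\<^bsub>cell C (P j \<star> L) (P i \<star> L)\<^esub>)" .
next
  note o = ab(3) ab(1) ab(2)
  note idL = id2_closed[OF ab(3) ab(1) L]
  have LL: "id2 C L \<cdot> id2 C L = id2 C L" using vcomp_id[OF ab(3) ab(1) L L idL] by simp
  have YL: "Y \<star> L \<in> mor C c b" using comp1_closed[OF o P(2) L] .
  interpret sum: abelian_group "cell C (Y \<star> L) (Y \<star> L)" using cell_abelian_group[OF ab(3) ab(2) YL YL] .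
  have c: "inc i \<cdot> prj i \<in> hom2 C Y Y" if "i \<in> I" for i
    using vcomp_closed[OF ab(1-2) P(2) P(1)[OF that] P(2)] direct_sum_prj[OF ds that] direct_sum_inc[OF ds that] .
  have "(\<Oplus>\<^bsub>cell C (Y \<star> L) (Y \<star> L)\<^esub>i\<in>I. (inc i \<bullet> id2 C L) \<cdot> (prj i \<bullet> id2 C L)) =
    (\<Oplus>\<^bsub>cell C (Y \<star> L) (Y \<star> L)\<^esub>i\<in>I. (inc i \<cdot> prj i) \<bullet> id2 C L)"
  proof (rule sum.finsum_cong')
    fix i assume i: "i \<in> I"
    show "(inc i \<bullet> id2 C L) \<cdot> (prj i \<bullet> id2 C L) = (inc i \<cdot> prj i) \<bullet> id2 C L"
      using interchange[OF o P(2) P(1)[OF i] P(2) L L L direct_sum_prj[OF ds i] direct_sum_inc[OF ds i] idL idL] LL by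
          simp
  next
    show "(\<lambda>i. (inc i \<cdot> prj i) \<bullet> id2 C L) \<in> I \<rightarrow> carrier (cell C (Y \<star> L) (Y \<star> L))"
      using hcomp_closed[OF o P(2) P(2) L L c idL] by (auto simp: hom2_def)
  qed simp
  also have "\<dots> = (\<Oplus>\<^bsub>cell C Y Y\<^esub>i\<in>I. inc i \<cdot> prj i) \<bullet> id2 C L"
    using hcomp_finsum_left[OF o P(2) P(2) L L I c idL] by simp
  also have "\<dots> = id2 C (Y \<star> L)"
    using direct_sum_id[OF ds] hcomp_id2[OF o P(2) L] by simp
  finally show "(\<Oplus>\<^bsub>cell C (Y \<star> L) (Y \<star> L)\<^esub>i\<in>I. (inc i \<bullet> id2 C L) \<cdot> (prj i \<bullet> id2 C L)) = id2 C (Y \<star> L)" .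
qed

lemma direct_sum_whisker_left:
  assumes ab: "a \<in> obj C" "b \<in> obj C" "c \<in> obj C" and L: "L \<in> mor C b c"
    and P: "\<And>i. i \<in> I \<Longrightarrow> P i \<in> mor C a b" "Y \<in> mor C a b"
    and ds: "direct_sum C I P Y inc prj" and I: "finite I"
  shows "direct_sum C I (\<lambda>i. L \<star> P i) (L \<star> Y) (\<lambda>i. L \<triangleright> inc i) (\<lambda>i. L \<triangleright> prj i)"
  unfolding direct_sum_def whisker_left_def
proof (intro conjI ballI)
  note idL = id2_closed[OF ab(2) ab(3) L]
  have LL: "id2 C L \<cdot> id2 C L = id2 C L" using vcomp_id[OF ab(2) ab(3) L L idL] by simp
  fix i assume i: "i \<in> I"
  show "id2 C L \<bullet> inc i \<in> hom2 C (L \<star> P i) (L \<star> Y)"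
    using hcomp_closed[OF ab L L P(1)[OF i] P(2) idL direct_sum_inc[OF ds i]] .
  show "id2 C L \<bullet> prj i \<in> hom2 C (L \<star> Y) (L \<star> P i)"
    using hcomp_closed[OF ab L L P(2) P(1)[OF i] idL direct_sum_prj[OF ds i]] .
  fix j assume j: "j \<in> I"
  have "(id2 C L \<bullet> prj i) \<cdot> (id2 C L \<bullet> inc j) = id2 C L \<bullet> (prj i \<cdot> inc j)"
    using interchange[OF ab L L L P(1)[OF j] P(2) P(1)[OF i] idL idL direct_sum_inc[OF ds j] direct_sum_prj[OF ds i]]
        LL by simp
  also have "\<dots> = (if i = j then id2 C (L \<star> P i) else \<zero>\<^bsub>cell C (L \<star> P j) (L \<star> P i)\<^esub>)"
    using direct_sum_prj_inc[OF ds i j] hcomp_id2[OF ab L P(1)[OF i]]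
      hcomp_zero_right[OF ab L L P(1)[OF j] P(1)[OF i] idL] by auto
  finally show "(id2 C L \<bullet> prj i) \<cdot> (id2 C L \<bullet> inc j)
    = (if i = j then id2 C (L \<star> P i) else \<zero>\<^bsub>cell C (L \<star> P j) (L \<star> P i)\<^esub>)" .
next
  note idL = id2_closed[OF ab(2) ab(3) L]
  have LL: "id2 C L \<cdot> id2 C L = id2 C L" using vcomp_id[OF ab(2) ab(3) L L idL] by simp
  have YL: "L \<star> Y \<in> mor C a c" using comp1_closed[OF ab L P(2)] .
  interpret sum: abelian_group "cell C (L \<star> Y) (L \<star> Y)" using cell_abelian_group[OF ab(1) ab(3) YL YL] .
  have c: "inc i \<cdot> prj i \<in> hom2 C Y Y" if "i \<in> I" for i
    using vcomp_closed[OF ab(1-2) P(2) P(1)[OF that] P(2)] direct_sum_prj[OF ds that] direct_sum_inc[OF ds that] .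
  have "(\<Oplus>\<^bsub>cell C (L \<star> Y) (L \<star> Y)\<^esub>i\<in>I. (id2 C L \<bullet> inc i) \<cdot> (id2 C L \<bullet> prj i)) =
    (\<Oplus>\<^bsub>cell C (L \<star> Y) (L \<star> Y)\<^esub>i\<in>I. id2 C L \<bullet> (inc i \<cdot> prj i))"
  proof (rule sum.finsum_cong')
    fix i assume i: "i \<in> I"
    show "(id2 C L \<bullet> inc i) \<cdot> (id2 C L \<bullet> prj i) = id2 C L \<bullet> (inc i \<cdot> prj i)"
      using interchange[OF ab L L L P(2) P(1)[OF i] P(2) idL idL direct_sum_prj[OF ds i] direct_sum_inc[OF ds i]] LL
          by simp
  next
    show "(\<lambda>i. id2 C L \<bullet> (inc i \<cdot> prj i)) \<in> I \<rightarrow> carrier (cell C (L \<star> Y) (L \<star> Y))"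
      using hcomp_closed[OF ab L L P(2) P(2) idL c] by (auto simp: hom2_def)
  qed simp
  also have "\<dots> = id2 C L \<bullet> (\<Oplus>\<^bsub>cell C Y Y\<^esub>i\<in>I. inc i \<cdot> prj i)"
    using hcomp_finsum_right[OF ab L L P(2) P(2) I idL c] by simp
  also have "\<dots> = id2 C (L \<star> Y)"
    using direct_sum_id[OF ds] hcomp_id2[OF ab L P(2)] by simp
  finally show "(\<Oplus>\<^bsub>cell C (L \<star> Y) (L \<star> Y)\<^esub>i\<in>I. (id2 C L \<bullet> inc i) \<cdot> (id2 C L \<bullet> prj i)) = id2 C (L \<star> Y)" .
qed

text \<open>
  Families of traces of the \<open>\<rho>(g)\<close> become traces of their direct sum in this way.
\<close>

lemma direct_sum_tuple:
  assumes ab: "a \<in> obj C" "b \<in> obj C" and P: "\<And>i. i \<in> I \<Longrightarrow> P i \<in> mor C a b" "Y \<in> mor C a b"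
    and ds: "direct_sum C I P Y inc prj" and I: "finite I"
    and W: "W \<in> mor C a b" and f: "\<And>i. i \<in> I \<Longrightarrow> f i \<in> hom2 C W (P i)"
  shows "(\<Oplus>\<^bsub>cell C W Y\<^esub>i\<in>I. inc i \<cdot> f i) \<in> hom2 C W Y"
    and "j \<in> I \<Longrightarrow> prj j \<cdot> (\<Oplus>\<^bsub>cell C W Y\<^esub>i\<in>I. inc i \<cdot> f i) = f j"
proof -
  interpret sum: abelian_group "cell C W Y" using cell_abelian_group[OF ab W P(2)] .
  have c: "inc i \<cdot> f i \<in> hom2 C W Y" if "i \<in> I" for i
    using vcomp_closed[OF ab W P(1)[OF that] P(2) f[OF that] direct_sum_inc[OF ds that]] .
  show "(\<Oplus>\<^bsub>cell C W Y\<^esub>i\<in>I. inc i \<cdot> f i) \<in> hom2 C W Y"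
    using c sum.finsum_closed[of "\<lambda>i. inc i \<cdot> f i" I] by (auto simp: hom2_def)
  assume j: "j \<in> I"
  have "prj j \<cdot> (\<Oplus>\<^bsub>cell C W Y\<^esub>i\<in>I. inc i \<cdot> f i) = (\<Oplus>\<^bsub>cell C W (P j)\<^esub>i\<in>I. prj j \<cdot> inc i \<cdot> f i)"
    using vcomp_finsum_right[OF ab W P(2) P(1)[OF j] I direct_sum_prj[OF ds j] c] .
  also have "\<dots> = f j"
  proof (rule finsum_single[OF cell_abelian_group[OF ab W P(1)[OF j]] I j])
    show "f j \<in> carrier (cell C W (P j))" using f[OF j] by (simp add: hom2_def)
    fix i assume i: "i \<in> I"
    have "prj j \<cdot> inc i \<cdot> f i = (prj j \<cdot> inc i) \<cdot> f i"
      using vcomp_assoc[OF ab W P(1)[OF i] P(2) P(1)[OF j] f[OF i] direct_sum_inc[OF ds i] direct_sum_prj[OF ds j]] by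
          simp
    then show "prj j \<cdot> inc i \<cdot> f i = (if i = j then f j else \<zero>\<^bsub>cell C W (P j)\<^esub>)"
      using direct_sum_prj_inc[OF ds j i] vcomp_id[OF ab W P(1)[OF j] f[OF j]]
        vcomp_zero_left[OF ab W P(1)[OF i] P(1)[OF j] f[OF i]] by auto
  qed
  finally show "prj j \<cdot> (\<Oplus>\<^bsub>cell C W Y\<^esub>i\<in>I. inc i \<cdot> f i) = f j" .
qed


text \<open>
  Direct sums exist over sets \<open>{..<n}\<close> and are needed over \<open>G\<close>.
\<close>

lemma direct_sum_reindex:
  assumes ab: "a \<in> obj C" "b \<in> obj C" and Y: "Y \<in> mor C a b" and P: "\<And>j. j \<in> J \<Longrightarrow> P j \<in> mor C a b"
    and f: "bij_betw f I J" and ds: "direct_sum C I (\<lambda>i. P (f i)) Y inc prj"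
  shows "direct_sum C J P Y (\<lambda>j. inc (inv_into I f j)) (\<lambda>j. prj (inv_into I f j))"
proof -
  let ?g = "inv_into I f"
  have g: "?g j \<in> I" "f (?g j) = j" if "j \<in> J" for j
    using f that bij_betw_inv_into_right[OF f that] bij_betw_inv_into[OF f] by (auto simp: bij_betw_def)
  have gf: "?g (f i) = i" if "i \<in> I" for i using bij_betw_inv_into_left[OF f that] .
  have inj: "inj_on f I" and J: "J = f ` I" using f by (auto simp: bij_betw_def)
  have inc: "inc (?g j) \<in> hom2 C (P j) Y" and prj: "prj (?g j) \<in> hom2 C Y (P j)" if "j \<in> J" for j
    using direct_sum_inc[OF ds g(1)[OF that]] direct_sum_prj[OF ds g(1)[OF that]] g(2)[OF that] by simp_all
  interpret sum: abelian_group "cell C Y Y" using cell_abelian_group[OF ab Y Y] .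
  have c: "inc (?g j) \<cdot> prj (?g j) \<in> carrier (cell C Y Y)" if "j \<in> J" for j
    using vcomp_closed[OF ab Y P[OF that] Y prj[OF that] inc[OF that]] by (simp add: hom2_def)
  have "(\<Oplus>\<^bsub>cell C Y Y\<^esub>j\<in>J. inc (?g j) \<cdot> prj (?g j)) = (\<Oplus>\<^bsub>cell C Y Y\<^esub>i\<in>I. inc (?g (f i)) \<cdot> prj (?g (f i)))"
    unfolding J by (rule sum.finsum_reindex) (use inj c J in auto)
  also have "\<dots> = (\<Oplus>\<^bsub>cell C Y Y\<^esub>i\<in>I. inc i \<cdot> prj i)"
    using c[OF bij_betwE[OF f, rule_format]] by (intro sum.finsum_cong') (auto simp: gf)
  also have "\<dots> = id2 C Y" by (rule direct_sum_id[OF ds])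
  finally have sum: "(\<Oplus>\<^bsub>cell C Y Y\<^esub>j\<in>J. inc (?g j) \<cdot> prj (?g j)) = id2 C Y" .
  have "prj (?g i) \<cdot> inc (?g j) = (if i = j then id2 C (P i) else \<zero>\<^bsub>cell C (P j) (P i)\<^esub>)"
    if "i \<in> J" "j \<in> J" for i j
    using direct_sum_prj_inc[OF ds g(1)[OF that(1)] g(1)[OF that(2)]] g(2)[OF that(1)] g(2)[OF that(2)] by auto
  then show ?thesis unfolding direct_sum_def using inc prj sum by blast
qed

text \<open>
  The universal property provides \<open>A'\<close> with \<open>U A' \<cong> A\<close> only; with the transported inclusions and
  projections \<open>U A'\<close> itself is a direct sum.
\<close>

lemma direct_sum_transport:
  assumes ab: "a \<in> obj C" "b \<in> obj C" and Y: "Y \<in> mor C a b" and Z: "Z \<in> mor C a b"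
    and P: "\<And>i. i \<in> I \<Longrightarrow> P i \<in> mor C a b" and I: "finite I"
    and ds: "direct_sum C I P Y inc prj"
    and \<theta>: "\<theta> \<in> hom2 C Z Y" "\<theta>' \<in> hom2 C Y Z" "\<theta>' \<cdot> \<theta> = id2 C Z" "\<theta> \<cdot> \<theta>' = id2 C Y"
  shows "direct_sum C I P Z (\<lambda>i. \<theta>' \<cdot> inc i) (\<lambda>i. prj i \<cdot> \<theta>)"
proof -
  note di = direct_sum_inc[OF ds] and dp = direct_sum_prj[OF ds]
  have inc: "\<theta>' \<cdot> inc i \<in> hom2 C (P i) Z" and prj: "prj i \<cdot> \<theta> \<in> hom2 C Z (P i)" if "i \<in> I" for i
    using vcomp_closed[OF ab P[OF that] Y Z di[OF that] \<theta>(2)] vcomp_closed[OF ab Z Y P[OF that] \<theta>(1) dp[OF that]] .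
  have 1: "(prj i \<cdot> \<theta>) \<cdot> (\<theta>' \<cdot> inc j) = prj i \<cdot> inc j" if i: "i \<in> I" and j: "j \<in> I" for i j
  proof -
    have "(prj i \<cdot> \<theta>) \<cdot> (\<theta>' \<cdot> inc j) = prj i \<cdot> (\<theta> \<cdot> \<theta>') \<cdot> inc j"
      using vcomp_assoc[OF ab P[OF j] Z Y P[OF i] inc[OF j] \<theta>(1) dp[OF i]]
        vcomp_assoc[OF ab P[OF j] Y Z Y di[OF j] \<theta>(2) \<theta>(1)] by simp
    then show ?thesis using vcomp_id[OF ab P[OF j] Y di[OF j]] \<theta>(4) by simp
  qed
  have ip: "inc i \<cdot> prj i \<in> hom2 C Y Y" if "i \<in> I" for i
    using vcomp_closed[OF ab Y P[OF that] Y dp[OF that] di[OF that]] .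
  have 2: "(\<theta>' \<cdot> inc i) \<cdot> (prj i \<cdot> \<theta>) = (\<theta>' \<cdot> (inc i \<cdot> prj i)) \<cdot> \<theta>" if i: "i \<in> I" for i
    using vcomp_assoc[OF ab Z P[OF i] Y Z prj[OF i] di[OF i] \<theta>(2)]
      vcomp_assoc[OF ab Z Y P[OF i] Y \<theta>(1) dp[OF i] di[OF i]]
      vcomp_assoc[OF ab Z Y Y Z \<theta>(1) ip[OF i] \<theta>(2)] by simp
  have tip: "\<theta>' \<cdot> (inc i \<cdot> prj i) \<in> hom2 C Y Z" if "i \<in> I" for i
    using vcomp_closed[OF ab Y Y Z ip[OF that] \<theta>(2)] .
  interpret ZZ: abelian_group "cell C Z Z" using cell_abelian_group[OF ab Z Z] .
  have "(\<Oplus>\<^bsub>cell C Z Z\<^esub>i\<in>I. (\<theta>' \<cdot> inc i) \<cdot> (prj i \<cdot> \<theta>)) = (\<Oplus>\<^bsub>cell C Z Z\<^esub>i\<in>I. (\<theta>' \<cdot> (inc i \<cdot> prj i)) \<cdot> \<theta>)"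
    using vcomp_closed[OF ab Z Y Z \<theta>(1) tip] 2 by (intro ZZ.finsum_cong') (auto simp: hom2_def)
  also have "\<dots> = (\<theta>' \<cdot> (\<Oplus>\<^bsub>cell C Y Y\<^esub>i\<in>I. inc i \<cdot> prj i)) \<cdot> \<theta>"
    using vcomp_finsum_left[OF ab Z Y Z I tip \<theta>(1)] vcomp_finsum_right[OF ab Y Y Z I \<theta>(2) ip] by simp
  also have "\<dots> = id2 C Z"
    using direct_sum_id[OF ds] vcomp_id[OF ab Y Z \<theta>(2)] \<theta>(3) by simp
  finally show ?thesis
    unfolding direct_sum_def using inc prj 1 direct_sum_prj_inc[OF ds] by simp
qed

end


section \<open>A calculus of typed 2-cells\<close>

type_synonym ('o, 'm) arrow = "'o \<times> 'o \<times> 'm"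

text \<open>
  A 2-morphism together with its type: two objects and, as source and target, two paths of composable
  1-morphisms \<open>(domain, codomain, F)\<close>. Since paths are lists, composition of 1-morphisms becomes
  concatenation, strictly associative and cancellative, and the type of a composite can be computed
  from the types of its parts. The value of an ill-typed composite is \<open>None\<close>, so that associativity
  of vertical composition and the distribution of whiskering over it hold without side conditions and can
  be used as rewrite rules.
\<close>

datatype ('o, 'm, 'c) tcell =
  TCell (tdom: 'o) (tcod: 'o) (tsrc: "('o, 'm) arrow list") (ttgt: "('o, 'm) arrow list") (tval: "'c option")

lemma tcell_eq_iff:
  "x = y \<longleftrightarrow> tdom x = tdom y \<and> tcod x = tcod y \<and> tsrc x = tsrc y \<and> ttgt x = ttgt y \<and> tval x = tval y"
  by (auto intro: tcell.expand)

definition val :: "('o, 'm, 'c) tcell \<Rightarrow> 'c" where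
  "val x = the (tval x)"

lemma val_TCell [simp]: "val (TCell a b s t (Some x)) = x"
  by (simp add: val_def)

text \<open>
  The object at which a path ends, where the end of the empty path is the given object. With these
  functions the type of a whiskered cell is computed rather than assumed.
\<close>

fun left_end :: "('o, 'm) arrow list \<Rightarrow> 'o \<Rightarrow> 'o" where
  "left_end [] a = a"
| "left_end (f # l) a = fst (snd f)"

fun right_end :: "'o \<Rightarrow> ('o, 'm) arrow list \<Rightarrow> 'o" where
  "right_end b [] = b"
| "right_end b (f # l) = right_end (fst f) l"

lemma left_end_append [simp]: "left_end (l @ l') a = left_end l (left_end l' a)"
  by (cases l) auto

lemma right_end_append [simp]: "right_end b (l @ l') = right_end (right_end b l) l'"
  by (induction l arbitrary: b) auto

context linear_two_category
begin

text \<open>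
  \<open>path b l a\<close>: the 1-morphisms in \<open>l\<close> are composable and lead from \<open>a\<close> to \<open>b\<close>. A path is written in
  the order of composition, so its last entry starts at \<open>a\<close>.
\<close>

fun path :: "'o \<Rightarrow> ('o, 'm) arrow list \<Rightarrow> 'o \<Rightarrow> bool" where
  "path b [] a \<longleftrightarrow> a = b \<and> a \<in> obj C"
| "path b (f # l) a \<longleftrightarrow> fst (snd f) = b \<and> fst f \<in> obj C \<and> b \<in> obj C \<and>
    snd (snd f) \<in> mor C (fst f) b \<and> path (fst f) l a"

text \<open>
  The second clause keeps the composite of \<open>[F, H]\<close> literally equal to \<open>F \<star> H\<close>, without a trailing
  identity.
\<close>

fun composite :: "'o \<Rightarrow> ('o, 'm) arrow list \<Rightarrow> 'm" where
  "composite a [] = id1 C a"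
| "composite a [f] = snd (snd f)"
| "composite a (f # g # l) = snd (snd f) \<star> composite a (g # l)"

lemma path_append: "path c (l @ l') a \<longleftrightarrow> path c l (left_end l' a) \<and> path (left_end l' a) l' a"
proof (induction l arbitrary: c)
  case Nil
  then show ?case by (cases l') auto
qed auto

lemma path_obj: "path b l a \<Longrightarrow> a \<in> obj C \<and> b \<in> obj C"
  by (induction l arbitrary: b) auto

lemma path_ends: "path b l a \<Longrightarrow> left_end l a = b \<and> right_end b l = a"
  by (induction l arbitrary: b) auto

lemma composite_Cons:
  assumes "path b (f # l) a"
  shows "composite a (f # l) = snd (snd f) \<star> composite a l"
proof (cases l)
  case Nil
  then show ?thesis using assms comp1_id[of a b "snd (snd f)"] by auto
qed simp

lemma composite_closed: "path b l a \<Longrightarrow> composite a l \<in> mor C a b"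
proof (induction l arbitrary: b)
  case Nil
  then show ?case using id1_closed by auto
next
  case (Cons f l)
  show ?case
    using composite_Cons[OF Cons.prems] Cons.IH[of "fst f"] Cons.prems path_obj[OF Cons.prems]
      comp1_closed[of a "fst f" b "snd (snd f)" "composite a l"] by auto
qed

lemma composite_append:
  "path c l b \<Longrightarrow> path b l' a \<Longrightarrow> composite a (l @ l') = composite b l \<star> composite a l'"
proof (induction l arbitrary: c)
  case Nil
  then show ?case using comp1_id[of a b "composite a l'"] composite_closed[of b l' a] path_obj[of b l' a] by auto
next
  case (Cons f l)
  let ?F = "snd (snd f)"
  have p: "path c (f # (l @ l')) a"
    using Cons.prems path_append[of c "f # l" l' a] path_ends[OF Cons.prems(2)] by simp
  have "composite a (f # l @ l') = ?F \<star> composite b l \<star> composite a l'"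
    using composite_Cons[OF p] Cons.IH[of "fst f"] Cons.prems by simp
  also have "\<dots> = (?F \<star> composite b l) \<star> composite a l'"
    using comp1_assoc[of a b "fst f" c ?F "composite b l" "composite a l'"] Cons.prems
      composite_closed[of b l' a] composite_closed[of "fst f" l b] path_obj[of b l' a] by auto
  finally show ?case by (simp only: composite_Cons[OF Cons.prems(1)] append_Cons)
qed

definition ok :: "('o, 'm, 'c) tcell \<Rightarrow> bool" where
  "ok x \<longleftrightarrow> tval x \<noteq> None \<and> path (tcod x) (tsrc x) (tdom x) \<and> path (tcod x) (ttgt x) (tdom x) \<and>
    val x \<in> hom2 C (composite (tdom x) (tsrc x)) (composite (tdom x) (ttgt x))"

lemma ok_TCell:
  "ok (TCell a b s t (Some x)) \<longleftrightarrow> path b s a \<and> path b t a \<and> x \<in> hom2 C (composite a s) (composite a t)"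
  by (simp add: ok_def)

lemma okD:
  assumes "ok x"
  shows "tdom x \<in> obj C" "tcod x \<in> obj C"
    "path (tcod x) (tsrc x) (tdom x)" "path (tcod x) (ttgt x) (tdom x)"
    "composite (tdom x) (tsrc x) \<in> mor C (tdom x) (tcod x)"
    "composite (tdom x) (ttgt x) \<in> mor C (tdom x) (tcod x)"
    "val x \<in> hom2 C (composite (tdom x) (tsrc x)) (composite (tdom x) (ttgt x))"
    "tval x = Some (val x)"
    "left_end (tsrc x) (tdom x) = tcod x" "left_end (ttgt x) (tdom x) = tcod x"
    "right_end (tcod x) (tsrc x) = tdom x" "right_end (tcod x) (ttgt x) = tdom x"
proof -
  have *: "path (tcod x) (tsrc x) (tdom x)" "path (tcod x) (ttgt x) (tdom x)"
    using assms by (auto simp: ok_def)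
  then show "path (tcod x) (tsrc x) (tdom x)" "path (tcod x) (ttgt x) (tdom x)"
    "tdom x \<in> obj C" "tcod x \<in> obj C"
    "left_end (tsrc x) (tdom x) = tcod x" "left_end (ttgt x) (tdom x) = tcod x"
    "right_end (tcod x) (tsrc x) = tdom x" "right_end (tcod x) (ttgt x) = tdom x"
    using path_obj path_ends by blast+
  show "composite (tdom x) (tsrc x) \<in> mor C (tdom x) (tcod x)"
    "composite (tdom x) (ttgt x) \<in> mor C (tdom x) (tcod x)"
    using * composite_closed by blast+
  show "val x \<in> hom2 C (composite (tdom x) (tsrc x)) (composite (tdom x) (ttgt x))"
    using assms by (auto simp: ok_def)
  show "tval x = Some (val x)" using assms by (auto simp: ok_def val_def)
qed

lemma tcell_eqI:
  assumes "ok x" "ok y" "tdom x = tdom y" "tcod x = tcod y" "tsrc x = tsrc y" "ttgt x = ttgt y" "val x = val y"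
  shows "x = y"
  using assms okD(8)[of x] okD(8)[of y] by (simp add: tcell_eq_iff)


subsection \<open>Vertical composition and whiskering\<close>

definition vc :: "('o, 'm, 'c) tcell \<Rightarrow> ('o, 'm, 'c) tcell \<Rightarrow> ('o, 'm, 'c) tcell" where
  "vc y x = TCell (tdom x) (tcod x) (tsrc x) (ttgt y)
    (if ok y \<and> ok x \<and> tdom y = tdom x \<and> tcod y = tcod x \<and> tsrc y = ttgt x
     then Some (val y \<cdot> val x) else None)"

text \<open>
  Whiskering with the path \<open>l\<close> on the left and the path \<open>r\<close> on the right.
\<close>

definition wh :: "('o, 'm) arrow list \<Rightarrow> ('o, 'm, 'c) tcell \<Rightarrow> ('o, 'm) arrow list \<Rightarrow> ('o, 'm, 'c) tcell" where
  "wh l x r = TCell (right_end (tdom x) r) (left_end l (tcod x)) (l @ tsrc x @ r) (l @ ttgt x @ r)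
    (if ok x \<and> path (left_end l (tcod x)) l (tcod x) \<and> path (tdom x) r (right_end (tdom x) r)
     then Some (id2 C (composite (tcod x) l) \<bullet> val x \<bullet> id2 C (composite (right_end (tdom x) r) r)) else None)"

definition idc :: "'o \<Rightarrow> ('o, 'm) arrow list \<Rightarrow> 'o \<Rightarrow> ('o, 'm, 'c) tcell" where
  "idc b l a = TCell a b l l (Some (id2 C (composite a l)))"

lemma vc_sel [simp]: "tdom (vc y x) = tdom x" "tcod (vc y x) = tcod x" "tsrc (vc y x) = tsrc x"
    "ttgt (vc y x) = ttgt y"
  by (simp_all add: vc_def)

lemma wh_sel [simp]: "tdom (wh l x r) = right_end (tdom x) r" "tcod (wh l x r) = left_end l (tcod x)"
  "tsrc (wh l x r) = l @ tsrc x @ r" "ttgt (wh l x r) = l @ ttgt x @ r"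
  by (simp_all add: wh_def)

lemma idc_sel [simp]: "tdom (idc b l a) = a" "tcod (idc b l a) = b" "tsrc (idc b l a) = l" "ttgt (idc b l a) = l"
  by (simp_all add: idc_def)

lemma ok_idc [simp]: "ok (idc b l a) \<longleftrightarrow> path b l a"
  using id2_closed[OF _ _ composite_closed] path_obj[of b l a] by (auto simp: ok_TCell idc_def)

lemma val_idc [simp]: "val (idc b l a) = id2 C (composite a l)"
  by (simp add: idc_def)

lemma ok_vc [simp]:
  "ok (vc y x) \<longleftrightarrow> ok y \<and> ok x \<and> tdom y = tdom x \<and> tcod y = tcod x \<and> tsrc y = ttgt x"
proof (cases "ok y \<and> ok x \<and> tdom y = tdom x \<and> tcod y = tcod x \<and> tsrc y = ttgt x")
  case True
  then have "val y \<cdot> val x \<in> hom2 C (composite (tdom x) (tsrc x)) (composite (tdom x) (ttgt y))"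
    using vcomp_closed[OF okD(1,2,5,6)[of x] _ okD(7)[of x], of "composite (tdom x) (ttgt y)" "val y"]
      okD(6,7)[of y] by auto
  with True show ?thesis using okD(3)[of x] okD(4)[of y] by (auto simp: ok_TCell vc_def)
next
  case False
  then show ?thesis by (auto simp: ok_def vc_def)
qed

lemma val_vc: "ok (vc y x) \<Longrightarrow> val (vc y x) = val y \<cdot> val x"
  unfolding ok_vc by (simp add: vc_def)

lemma whisker_value:
  assumes x: "ok x" and l: "path c l (tcod x)" and r: "path (tdom x) r d"
  shows "val x \<bullet> id2 C (composite d r) \<in> hom2 C (composite d (tsrc x @ r)) (composite d (ttgt x @ r))"
    and "id2 C (composite (tcod x) l) \<bullet> val x \<bullet> id2 C (composite d r)
      \<in> hom2 C (composite d (l @ tsrc x @ r)) (composite d (l @ ttgt x @ r))"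
proof -
  note X = okD[OF x] and lo = path_obj[OF l] and ro = path_obj[OF r]
    and lm = composite_closed[OF l] and rm = composite_closed[OF r]
  have p: "path (tcod x) (tsrc x @ r) d" "path (tcod x) (ttgt x @ r) d"
    using X r path_ends[OF r] by (simp_all add: path_append)
  have e: "composite d (tsrc x @ r) = composite (tdom x) (tsrc x) \<star> composite d r"
    "composite d (ttgt x @ r) = composite (tdom x) (ttgt x) \<star> composite d r"
    using composite_append[OF X(3) r] composite_append[OF X(4) r] by simp_all
  show 1: "val x \<bullet> id2 C (composite d r) \<in> hom2 C (composite d (tsrc x @ r)) (composite d (ttgt x @ r))"
    unfolding e using hcomp_closed[OF _ _ _ X(5,6) rm rm X(7) id2_closed[OF _ _ rm]] X(1,2) ro by simp
  show "id2 C (composite (tcod x) l) \<bullet> val x \<bullet> id2 C (composite d r)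
      \<in> hom2 C (composite d (l @ tsrc x @ r)) (composite d (l @ ttgt x @ r))"
    using hcomp_closed[OF _ _ _ lm lm composite_closed[OF p(1)] composite_closed[OF p(2)] id2_closed[OF _ _ lm] 1]
      ro lo composite_append[OF l p(1)] composite_append[OF l p(2)] by simp
qed

lemma ok_wh [simp]:
  "ok (wh l x r) \<longleftrightarrow> ok x \<and> path (left_end l (tcod x)) l (tcod x) \<and> path (tdom x) r (right_end (tdom x) r)"
proof (cases "ok x \<and> path (left_end l (tcod x)) l (tcod x) \<and> path (tdom x) r (right_end (tdom x) r)")
  case True
  then have x: "ok x" and l: "path (left_end l (tcod x)) l (tcod x)" and r: "path (tdom x) r (right_end (tdom x) r)"
    by auto
  have "path (left_end l (tcod x)) (l @ p @ r) (right_end (tdom x) r)" if "path (tcod x) p (tdom x)" for p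
    using l r that path_ends[OF r] path_ends[OF that] by (simp add: path_append)
  then show ?thesis using True okD(3,4)[OF x] whisker_value(2)[OF x l r] by (simp add: ok_TCell wh_def)
next
  case False
  then show ?thesis by (auto simp: ok_def wh_def)
qed

lemma val_wh:
  "ok (wh l x r) \<Longrightarrow> val (wh l x r) =
    id2 C (composite (tcod x) l) \<bullet> val x \<bullet> id2 C (composite (right_end (tdom x) r) r)"
  unfolding ok_wh by (simp add: wh_def)

lemma val_wh_left: "ok (wh l x []) \<Longrightarrow> val (wh l x []) = id2 C (composite (tcod x) l) \<bullet> val x"
  using hcomp_id1[OF okD(1,2,5,6,7)[of x]] by (simp add: val_wh)

lemma val_wh_right:
  assumes "ok (wh [] x r)"
  shows "val (wh [] x r) = val x \<bullet> id2 C (composite (right_end (tdom x) r) r)"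
proof -
  have x: "ok x" and r: "path (tdom x) r (right_end (tdom x) r)"
    and c: "path (tcod x) [] (tcod x)" using assms okD(2) by auto
  have p: "path (tcod x) (tsrc x @ r) (right_end (tdom x) r)" "path (tcod x) (ttgt x @ r) (right_end (tdom x) r)"
    using okD(3,4)[OF x] okD(9,10)[OF x] r path_ends[OF r] by (simp_all add: path_append)
  show ?thesis
    using hcomp_id1[OF _ _ composite_closed[OF p(1)] composite_closed[OF p(2)] whisker_value(1)[OF x c r]]
      path_obj[OF p(1)] by (simp add: val_wh[OF assms])
qed

lemma tval_not_ok: "\<not> ok (wh l x r) \<Longrightarrow> tval (wh l x r) = None" "\<not> ok (vc y x) \<Longrightarrow> tval (vc y x) = None"
  unfolding ok_wh ok_vc by (auto simp: wh_def vc_def)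

lemma wh_Nil [simp]: "ok x \<Longrightarrow> wh [] x [] = x"
  using hcomp_id1[OF okD(1,2,5,6,7)[of x]] okD(1,2)[of x]
  by (intro tcell_eqI) (simp_all add: val_wh_left)

lemma vc_assoc [simp]: "vc (vc z y) x = vc z (vc y x)"
proof (cases "ok (vc (vc z y) x)")
  case True
  then have x: "ok x" and y: "ok y" and z: "ok z"
    and m: "tdom y = tdom x" "tcod y = tcod x" "tsrc y = ttgt x" "tdom z = tdom x" "tcod z = tcod x" "tsrc z = ttgt y"
    by auto
  have Y: "composite (tdom x) (ttgt y) \<in> mor C (tdom x) (tcod x)"
      "val y \<in> hom2 C (composite (tdom x) (ttgt x)) (composite (tdom x) (ttgt y))"
    and Z: "composite (tdom x) (ttgt z) \<in> mor C (tdom x) (tcod x)"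
      "val z \<in> hom2 C (composite (tdom x) (ttgt y)) (composite (tdom x) (ttgt z))"
    using okD(6,7)[OF y] okD(6,7)[OF z] m by simp_all
  have "(val z \<cdot> val y) \<cdot> val x = val z \<cdot> val y \<cdot> val x"
    using vcomp_assoc[OF okD(1,2,5,6)[OF x] Y(1) Z(1) okD(7)[OF x] Y(2) Z(2)] .
  then show ?thesis
    using x y z m by (intro tcell_eqI) (simp_all add: val_vc)
next
  case False
  then have "\<not> ok (vc z (vc y x))" by auto
  then show ?thesis using False by (simp add: tcell_eq_iff tval_not_ok del: ok_vc)
qed

lemma vc_idc [simp]:
  assumes "ok x" "tdom x = a" "tcod x = b"
  shows "ttgt x = l \<Longrightarrow> vc (idc b l a) x = x" and "tsrc x = l \<Longrightarrow> vc x (idc b l a) = x"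
proof -
  note v = vcomp_id[OF okD(1,2,5,6,7)[OF assms(1)]]
  show "ttgt x = l \<Longrightarrow> vc (idc b l a) x = x"
    using assms okD(4)[OF assms(1)] v by (intro tcell_eqI) (auto simp: val_vc)
  show "tsrc x = l \<Longrightarrow> vc x (idc b l a) = x"
    using assms okD(3)[OF assms(1)] v by (intro tcell_eqI) (auto simp: val_vc)
qed

lemma wh_vc [simp]: "wh l (vc y x) r = vc (wh l y r) (wh l x r)"
proof (cases "ok (wh l (vc y x) r)")
  case True
  then have y: "ok y" and x: "ok x" and m: "tdom y = tdom x" "tcod y = tcod x" "tsrc y = ttgt x"
    and l: "path (left_end l (tcod x)) l (tcod x)" and r: "path (tdom x) r (right_end (tdom x) r)" by auto
  define d where "d = right_end (tdom x) r"
  define c where "c = left_end l (tcod x)"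
  have l': "path c l (tcod x)" and r': "path (tdom x) r d" using l r by (simp_all add: c_def d_def)
  note X = okD[OF x] and Y = okD[OF y] and lo = path_obj[OF l'] and ro = path_obj[OF r']
    and lm = composite_closed[OF l'] and rm = composite_closed[OF r']
  have p: "path (tcod x) (tsrc x @ r) d" "path (tcod x) (ttgt x @ r) d" "path (tcod x) (ttgt y @ r) d"
    using X Y m r' path_ends[OF r'] by (simp_all add: path_append)
  note pm = p[THEN composite_closed]
  have idl: "id2 C (composite (tcod x) l) \<in> hom2 C (composite (tcod x) l) (composite (tcod x) l)"
    and idr: "id2 C (composite d r) \<in> hom2 C (composite d r) (composite d r)"
    using id2_closed[OF _ _ lm] id2_closed[OF _ _ rm] lo ro by auto
  have "(val y \<cdot> val x) \<bullet> id2 C (composite d r) = (val y \<bullet> id2 C (composite d r)) \<cdot> (val x \<bullet> id2 C (composite d r))"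
    using interchange[OF _ X(1,2,5,6) _ rm rm rm X(7) _ idr idr, of "composite (tdom y) (ttgt y)" "val y"]
      vcomp_id[OF _ _ rm rm idr] X Y m ro by auto
  then have "id2 C (composite (tcod x) l) \<bullet> (val y \<cdot> val x) \<bullet> id2 C (composite d r) =
    (id2 C (composite (tcod x) l) \<bullet> val y \<bullet> id2 C (composite d r)) \<cdot>
    (id2 C (composite (tcod x) l) \<bullet> val x \<bullet> id2 C (composite d r))"
    using interchange[OF _ _ _ lm lm lm pm idl idl whisker_value(1)[OF x l' r'], of "val y \<bullet> id2 C (composite d r)"]
      whisker_value(1)[OF y, of c l r d] vcomp_id[OF _ _ lm lm idl] l' r' m lo ro by auto
  then show ?thesis using True x y m l r
    by (intro tcell_eqI) (auto simp: val_vc val_wh c_def d_def)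
next
  case False
  have "tdom x = tdom y" if "path (tdom x) r d" "path (tdom y) r d" "right_end (tdom x) r = right_end (tdom y) r" for
      d
    using that by (cases r) auto
  moreover have "tcod x = tcod y" if "path c l (tcod x)" "path c l (tcod y)" for c
    using path_ends[OF that(1)] path_ends[OF that(2)] by simp
  ultimately have n: "\<not> ok (vc (wh l y r) (wh l x r))"
    using False by (auto simp del: path.simps) metis
  have "tval (wh l (vc y x) r) = None" "tval (vc (wh l y r) (wh l x r)) = None"
    using False n by (simp_all only: tval_not_ok not_False_eq_True)
  then show ?thesis by (simp add: tcell_eq_iff)
qed

lemma wh_wh [simp]: "wh l (wh l' x r') r = wh (l @ l') x (r' @ r)"
proof (cases "ok (wh l (wh l' x r') r)")
  case True
  then have x: "ok x" and l': "path (left_end l' (tcod x)) l' (tcod x)"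
    and r': "path (tdom x) r' (right_end (tdom x) r')"
    and l: "path (left_end (l @ l') (tcod x)) l (left_end l' (tcod x))"
    and r: "path (right_end (tdom x) r') r (right_end (tdom x) (r' @ r))" by auto
  define d d' where "d = right_end (tdom x) (r' @ r)" and "d' = right_end (tdom x) r'"
  define c c' where "c = left_end (l @ l') (tcod x)" and "c' = left_end l' (tcod x)"
  have pl': "path c' l' (tcod x)" and pl: "path c l c'" and pr': "path (tdom x) r' d'" and pr: "path d' r d"
    using l l' r r' by (simp_all add: c_def d_def c'_def d'_def)
  note X = okD[OF x]
  have obj: "c \<in> obj C" "c' \<in> obj C" "d \<in> obj C" "d' \<in> obj C" using path_obj pl pr by auto
  note lm = composite_closed[OF pl] and rm = composite_closed[OF pr]
    and lm' = composite_closed[OF pl'] and rm' = composite_closed[OF pr']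
  have p: "path (tcod x) (tsrc x @ r') d'" "path (tcod x) (ttgt x @ r') d'"
    using X pr' path_ends[OF pr'] by (simp_all add: path_append)
  note pm = p[THEN composite_closed]
  let ?L = "id2 C (composite c' l)" and ?L' = "id2 C (composite (tcod x) l')"
    and ?R = "id2 C (composite d r)" and ?R' = "id2 C (composite d' r')"
  have R: "?R' \<bullet> ?R = id2 C (composite d (r' @ r))" and L: "?L \<bullet> ?L' = id2 C (composite (tcod x) (l @ l'))"
    using hcomp_id2 obj X lm lm' rm rm' composite_append[OF pl pl'] composite_append[OF pr' pr] by simp_all
  note id = id2_closed[OF _ _ lm] id2_closed[OF _ _ lm'] id2_closed[OF _ _ rm] id2_closed[OF _ _ rm']
  have prr: "path (tdom x) (r' @ r) d" using pr pr' path_ends[OF pr] by (simp add: path_append)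
  have q: "path (tcod x) (tsrc x @ r' @ r) d" "path (tcod x) (ttgt x @ r' @ r) d"
    using X prr path_ends[OF prr] path_ends[OF pr] path_ends[OF pr'] by (simp_all add: path_append)
  note qm = q[THEN composite_closed]
  have "?L \<bullet> (?L' \<bullet> val x \<bullet> ?R') \<bullet> ?R = ?L \<bullet> ?L' \<bullet> (val x \<bullet> ?R') \<bullet> ?R"
    using hcomp_assoc[OF _ _ _ _ lm' lm' pm rm rm id(2) whisker_value(1)[OF x pl' pr'] id(3)] obj X by simp
  also have "(val x \<bullet> ?R') \<bullet> ?R = val x \<bullet> id2 C (composite d (r' @ r))"
    using hcomp_assoc[OF _ _ _ _ X(5,6) rm' rm' rm rm X(7) id(4) id(3)] obj X R by simp
  also have "?L \<bullet> ?L' \<bullet> val x \<bullet> id2 C (composite d (r' @ r)) =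
    id2 C (composite (tcod x) (l @ l')) \<bullet> val x \<bullet> id2 C (composite d (r' @ r))"
    using hcomp_assoc[OF _ _ _ _ lm lm lm' lm' qm id(1) id(2)  whisker_value(1)[OF x pl' prr]] obj X L by simp
  finally show ?thesis using True x l l' r r'
    path_append[of c l l' "tcod x"] path_append[of "tdom x" r' r d] path_ends[OF pr]
    by (intro tcell_eqI) (auto simp: val_wh c_def d_def c'_def d'_def)
next
  case False
  have "path (tdom x) (r' @ r) (right_end (tdom x) (r' @ r)) \<longleftrightarrow>
      path (tdom x) r' (right_end (tdom x) r') \<and> path (right_end (tdom x) r') r (right_end (tdom x) (r' @ r))"
  proof -
    have "path b r' (left_end r d) \<and> path (left_end r d) r d \<longleftrightarrow>
      path b r' (right_end b r') \<and> path (right_end b r') r d" for b d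
      using path_ends by metis
    then show ?thesis by (simp add: path_append)
  qed
  with False have n: "\<not> ok (wh (l @ l') x (r' @ r))"
    by (auto simp: path_append)
  have "tval (wh l (wh l' x r') r) = None" "tval (wh (l @ l') x (r' @ r)) = None"
    using False n by (simp_all only: tval_not_ok not_False_eq_True)
  then show ?thesis by (simp add: tcell_eq_iff)
qed

lemma wh_idc [simp]:
  assumes "path b p a" "path (left_end l b) l b" "path a r (right_end a r)"
  shows "wh l (idc b p a) r = idc (left_end l b) (l @ p @ r) (right_end a r)"
proof -
  have *: "path (left_end l b) (l @ p @ r) (right_end a r)" "path b (p @ r) (right_end a r)"
    using assms path_ends[OF assms(3)] path_ends[OF assms(1)] by (simp_all add: path_append)
  have "id2 C (composite b l) \<bullet> id2 C (composite a p) \<bullet> id2 C (composite (right_end a r) r) =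
    id2 C (composite (right_end a r) (l @ p @ r))"
    using path_obj[OF assms(1)] path_obj[OF assms(2)] path_obj[OF assms(3)]
      hcomp_id2[OF _ _ _ composite_closed[OF assms(1)] composite_closed[OF assms(3)]]
      hcomp_id2[OF _ _ _ composite_closed[OF assms(2)] composite_closed[OF *(2)]]
      composite_append[OF assms(1,3)] composite_append[OF assms(2) *(2)] by simp
  then show ?thesis using assms * by (intro tcell_eqI) (auto simp: val_wh)
qed


subsection \<open>The exchange law\<close>

lemma val_hcomp:
  assumes "ok x" "ok y" "tdom x = tcod y"
  shows "val x \<bullet> val y = val (vc (wh [] x (ttgt y)) (wh (tsrc x) y []))"
    and "val x \<bullet> val y = val (vc (wh (ttgt x) y []) (wh [] x (tsrc y)))"
proof -
  note X = okD[OF assms(1)] and Y = okD[OF assms(2)]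
  note i = id2_closed[OF X(1,2,5)] id2_closed[OF X(1,2,6)] id2_closed[OF Y(1,2,5)] id2_closed[OF Y(1,2,6)]
  note v = vcomp_id[OF X(1,2,5,6,7)] vcomp_id[OF Y(1,2,5,6,7)]
  have "(val x \<cdot> id2 C (composite (tdom x) (tsrc x))) \<bullet> (id2 C (composite (tdom y) (ttgt y)) \<cdot> val y) =
    (val x \<bullet> id2 C (composite (tdom y) (ttgt y))) \<cdot> (id2 C (composite (tdom x) (tsrc x)) \<bullet> val y)"
    using interchange[OF Y(1,2) X(2) _ _ _ Y(5,6,6) _ _ Y(7) i(4)] X i assms(3) by simp
  then show "val x \<bullet> val y = val (vc (wh [] x (ttgt y)) (wh (tsrc x) y []))"
    using X Y v assms by (simp add: val_vc val_wh_left val_wh_right)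
  have "(id2 C (composite (tdom x) (ttgt x)) \<cdot> val x) \<bullet> (val y \<cdot> id2 C (composite (tdom y) (tsrc y))) =
    (id2 C (composite (tdom x) (ttgt x)) \<bullet> val y) \<cdot> (val x \<bullet> id2 C (composite (tdom y) (tsrc y)))"
    using interchange[OF Y(1,2) X(2) _ _ _ Y(5,5,6) _ _ i(3) Y(7)] X i assms(3) by simp
  then show "val x \<bullet> val y = val (vc (wh (ttgt x) y []) (wh [] x (tsrc y)))"
    using X Y v assms by (simp add: val_vc val_wh_left val_wh_right)
qed

text \<open>Two cells that act on disjoint parts \<open>l\<close>-\<open>x\<close>-\<open>m\<close>-\<open>y\<close>-\<open>r\<close> of a path can be applied in either order.\<close>

lemma exchange:
  assumes "ok x" "ok y" "path (tdom x) m (tcod y)"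
  shows "vc (wh l x (m @ ttgt y @ r)) (wh (l @ tsrc x @ m) y r) =
    vc (wh (l @ ttgt x @ m) y r) (wh l x (m @ tsrc y @ r))"
proof -
  have e: "left_end m (tcod y) = tdom x" using path_ends[OF assms(3)] by simp
  define z where "z = wh m y []"
  have z: "ok z" "tcod z = tdom x" "ttgt z = m @ ttgt y" "tsrc z = m @ tsrc y" "tdom z = tdom y"
    using assms e okD(1)[OF assms(2)] by (simp_all add: z_def)
  have p: "path (tdom x) (m @ tsrc y) (tdom y)" "path (tdom x) (m @ ttgt y) (tdom y)"
    using okD(3)[OF z(1)] okD(4)[OF z(1)] z by simp_all
  note q = path_ends[OF p(1)] path_ends[OF p(2)]
  have "vc (wh [] x (ttgt z)) (wh (tsrc x) z []) = vc (wh (ttgt x) z []) (wh [] x (tsrc z))"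
  proof (rule tcell_eqI)
    show "val (vc (wh [] x (ttgt z)) (wh (tsrc x) z [])) = val (vc (wh (ttgt x) z []) (wh [] x (tsrc z)))"
      using val_hcomp[of x z] assms z by simp
  qed (use assms z okD[OF assms(1)] okD(1)[OF assms(2)] p q in simp_all)
  then have "wh l (vc (wh [] x (ttgt z)) (wh (tsrc x) z [])) r = wh l (vc (wh (ttgt x) z []) (wh [] x (tsrc z))) r"
    by simp
  then show ?thesis by (simp add: z z_def)
qed


subsection \<open>Invertible cells\<close>

definition invertible :: "('o, 'm, 'c) tcell \<Rightarrow> bool" where
  "invertible x \<longleftrightarrow> ok x \<and> val x \<in> iso2 C (composite (tdom x) (tsrc x)) (composite (tdom x) (ttgt x))"

definition invc :: "('o, 'm, 'c) tcell \<Rightarrow> ('o, 'm, 'c) tcell" where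
  "invc x = TCell (tdom x) (tcod x) (ttgt x) (tsrc x)
    (Some (inv2 C (composite (tdom x) (tsrc x)) (composite (tdom x) (ttgt x)) (val x)))"

lemma invc_sel [simp]: "tdom (invc x) = tdom x" "tcod (invc x) = tcod x" "tsrc (invc x) = ttgt x"
    "ttgt (invc x) = tsrc x"
  by (simp_all add: invc_def)

lemma val_invc: "val (invc x) = inv2 C (composite (tdom x) (tsrc x)) (composite (tdom x) (ttgt x)) (val x)"
  by (simp add: invc_def)

lemma invertible_ok [simp]: "invertible x \<Longrightarrow> ok x"
  by (simp add: invertible_def)

lemma ok_invc [simp]: "invertible x \<Longrightarrow> ok (invc x)"
  using inv2(1)[OF okD(1,2,5,6)[of x], of "val x"] okD(3,4)[of x] by (simp add: invertible_def invc_def ok_TCell)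

lemma vc_invc [simp]: "invertible x \<Longrightarrow> vc (invc x) x = idc (tcod x) (tsrc x) (tdom x)"
  and vc_invc_right [simp]: "invertible x \<Longrightarrow> vc x (invc x) = idc (tcod x) (ttgt x) (tdom x)"
  using inv2[OF okD(1,2,5,6)[of x], of "val x"] okD(3,4)[of x]
  by (auto intro!: tcell_eqI simp: val_vc val_invc invertible_def)

lemma invertibleI:
  assumes "ok x" "ok y" "tsrc y = ttgt x" "ttgt y = tsrc x" "tdom y = tdom x" "tcod y = tcod x"
    and "vc y x = idc (tcod x) (tsrc x) (tdom x)" "vc x y = idc (tcod x) (ttgt x) (tdom x)"
  shows "invertible x" "invc x = y"
proof -
  have v: "val y \<cdot> val x = id2 C (composite (tdom x) (tsrc x))" "val x \<cdot> val y = id2 C (composite (tdom x) (ttgt x))"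
    using val_vc[of y x] val_vc[of x y] unfolding assms(7,8)
    by (simp_all add: assms(1-6) okD(3,4)[OF assms(1)])
  show x: "invertible x" using v assms okD(7)[OF assms(2)] okD(7)[OF assms(1)]
    by (auto simp: invertible_def iso2_def)
  show "invc x = y"
    using inv2_eqI[OF okD(1,2,5,6,7)[OF assms(1)] _ v] okD(7)[OF assms(2)] assms x
    by (intro tcell_eqI) (auto simp: val_invc)
qed

lemma invertible_invc [simp]: "invertible x \<Longrightarrow> invertible (invc x)"
  using invertibleI(1)[of "invc x" x] by simp

lemma invc_invc [simp]: "invertible x \<Longrightarrow> invc (invc x) = x"
  using invertibleI(2)[of "invc x" x] by simp

lemma vc_invc_cancel [simp]: "invertible x \<Longrightarrow> ok (vc x z) \<Longrightarrow> vc (invc x) (vc x z) = z"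
  and vc_invc_cancel' [simp]: "invertible x \<Longrightarrow> ok (vc (invc x) z) \<Longrightarrow> vc x (vc (invc x) z) = z"
  by (simp_all add: vc_assoc[symmetric] del: vc_assoc)

lemma wh_invc [simp]:
  assumes "invertible x" "ok (wh l x r)"
  shows "vc (wh l (invc x) r) (wh l x r) = idc (left_end l (tcod x)) (l @ tsrc x @ r) (right_end (tdom x) r)"
    and "vc (wh l x r) (wh l (invc x) r) = idc (left_end l (tcod x)) (l @ ttgt x @ r) (right_end (tdom x) r)"
  using assms okD(3,4)[of x] by (simp_all add: wh_vc[symmetric] del: wh_vc)

lemma invertible_wh [simp]:
  assumes "invertible x" "path (left_end l (tcod x)) l (tcod x)" "path (tdom x) r (right_end (tdom x) r)"
  shows "invertible (wh l x r)" "invc (wh l x r) = wh l (invc x) r"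
  using assms wh_invc[of x l r] invertibleI[of "wh l x r" "wh l (invc x) r"] by simp_all

lemma wh_invc_cancel [simp]:
  assumes "invertible x"
  shows "ok (vc (wh l x r) z) \<Longrightarrow> vc (wh l (invc x) r) (vc (wh l x r) z) = z"
    and "ok (vc (wh l (invc x) r) z) \<Longrightarrow> vc (wh l x r) (vc (wh l (invc x) r) z) = z"
proof -
  show "vc (wh l (invc x) r) (vc (wh l x r) z) = z" if z: "ok (vc (wh l x r) z)"
  proof -
    have w: "ok (wh l x r)" using z unfolding ok_vc by blast
    have "vc (wh l (invc x) r) (vc (wh l x r) z) = vc (vc (wh l (invc x) r) (wh l x r)) z"
      by (simp only: vc_assoc)
    also have "\<dots> = z" unfolding wh_invc(1)[OF assms w] using z by simp
    finally show ?thesis .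
  qed
  show "vc (wh l x r) (vc (wh l (invc x) r) z) = z" if z: "ok (vc (wh l (invc x) r) z)"
  proof -
    have "ok (wh l (invc x) r)" using z unfolding ok_vc by blast
    then have w: "ok (wh l x r)" using assms by simp
    have "vc (wh l x r) (vc (wh l (invc x) r) z) = vc (vc (wh l x r) (wh l (invc x) r)) z"
      by (simp only: vc_assoc)
    also have "\<dots> = z" unfolding wh_invc(2)[OF assms w] using z by simp
    finally show ?thesis .
  qed
qed

lemma invertible_vc [simp]:
  assumes "invertible y" "invertible x" "tdom y = tdom x" "tcod y = tcod x" "tsrc y = ttgt x"
  shows "invertible (vc y x)" "invc (vc y x) = vc (invc x) (invc y)"
  using assms invertibleI[of "vc y x" "vc (invc x) (invc y)"] by simp_all

lemma invertible_TCell [simp]: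
  "invertible (TCell a b s t (Some x)) \<longleftrightarrow> path b s a \<and> path b t a \<and> x \<in> iso2 C (composite a s) (composite a t)"
  by (auto simp: invertible_def ok_TCell iso2_def)

lemma vc_left_cancel:
  assumes "invertible m" "ok (vc m x)" "ok (vc m y)" "vc m x = vc m y"
  shows "x = y"
proof -
  have "vc (invc m) (vc m x) = vc (invc m) (vc m y)" by (simp only: assms(4))
  then show ?thesis by (simp only: vc_invc_cancel[OF assms(1,2)] vc_invc_cancel[OF assms(1,3)])
qed

lemma vc_right_cancel:
  assumes "invertible m" "ok (vc x m)" "ok (vc y m)" "vc x m = vc y m"
  shows "x = y"
proof -
  have "vc (vc x m) (invc m) = vc (vc y m) (invc m)" by (simp only: assms(4))
  then show ?thesis using assms(1-3) by simp
qed


subsection \<open>Testing equality on a direct sum\<close>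

text \<open>
  Whiskering preserves direct sums, so that a cell out of a whiskered sum can be tested on the summands.
\<close>

lemma eq_on_summands:
  assumes ds: "direct_sum C I (\<lambda>i. composite a (q i)) (composite a p) inc prj" and I: "finite I"
    and p: "path b p a" and q: "\<And>i. i \<in> I \<Longrightarrow> path b (q i) a"
    and r: "path a r (tdom x)"
    and x: "ok x" "tsrc x = l @ p @ r" and y: "ok y" "tsrc y = l @ p @ r"
    and xy: "tdom x = tdom y" "tcod x = tcod y" "ttgt x = ttgt y"
    and eq: "\<And>i. i \<in> I \<Longrightarrow> vc x (wh l (TCell a b (q i) p (Some (inc i))) r) = vc y
        (wh l (TCell a b (q i) p (Some (inc i))) r)"
  shows "x = y"
proof (rule tcell_eqI[OF x(1) y(1) xy(1,2) _ xy(3)])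
  show "tsrc x = tsrc y" using x y by simp
  note X = okD[OF x(1)]
  have lr: "path (tcod x) l b" "path a r (tdom x)"
    using okD(3)[OF x(1)] path_ends[OF p] path_ends[OF r] r unfolding x(2) path_append by simp_all
  have obj: "a \<in> obj C" "b \<in> obj C" using path_obj[OF p] by auto
  note L = composite_closed[OF lr(1)] and R = composite_closed[OF lr(2)]
  have pr: "path b (s @ r) (tdom x)" if "path b s a" for s
    using that lr(2) path_ends[OF lr(2)] by (simp add: path_append)
  have e: "composite (tdom x) (l @ s @ r) = composite b l \<star> composite a s \<star> composite (tdom x) r" if "path b s a" for
      s
    using composite_append[OF lr(1) pr[OF that]] composite_append[OF that lr(2)] by simp
  have c: "composite a s \<star> composite (tdom x) r \<in> mor C (tdom x) b" if "path b s a" for s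
    using composite_closed[OF pr[OF that]] composite_append[OF that lr(2)] by simp
  have D: "direct_sum C I (\<lambda>i. composite b l \<star> composite a (q i) \<star> composite (tdom x) r)
    (composite b l \<star> composite a p \<star> composite (tdom x) r)
    (\<lambda>i. composite b l \<triangleright> (inc i \<triangleleft> composite (tdom x) r)) (\<lambda>i. composite b l \<triangleright> (prj i \<triangleleft> composite (tdom x) r))"
    using direct_sum_whisker_right[OF obj X(1) R composite_closed[OF q] composite_closed[OF p] ds I]
      c[OF q] c[OF p]
    by (intro direct_sum_whisker_left[OF X(1) obj(2) X(2) L _ _ _ I]) auto
  show "val x = val y"
  proof (rule direct_sum_eq_inc[OF X(1,2) _ _ D I])
    show "composite b l \<star> composite a p \<star> composite (tdom x) r \<in> mor C (tdom x) (tcod x)"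
      using X(5) x(2) e[OF p] by simp
    show "composite (tdom x) (ttgt x) \<in> mor C (tdom x) (tcod x)" by (rule X)
    show "val x \<in> hom2 C (composite b l \<star> composite a p \<star> composite (tdom x) r) (composite (tdom x) (ttgt x))"
      using X(7) x(2) e[OF p] by simp
    show "val y \<in> hom2 C (composite b l \<star> composite a p \<star> composite (tdom x) r) (composite (tdom x) (ttgt x))"
      using okD(7)[OF y(1)] y(2) xy e[OF p] by simp
    fix i assume i: "i \<in> I"
    show "composite b l \<star> composite a (q i) \<star> composite (tdom x) r \<in> mor C (tdom x) (tcod x)"
      using comp1_closed[OF X(1) obj(2) X(2) L c[OF q[OF i]]] .
    have "ok (TCell a b (q i) p (Some (inc i)))"
      using direct_sum_inc[OF ds i] p q[OF i] by (simp add: ok_TCell)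
    then have w: "ok (wh l (TCell a b (q i) p (Some (inc i))) r)"
      "val (wh l (TCell a b (q i) p (Some (inc i))) r) = composite b l \<triangleright> (inc i \<triangleleft> composite (tdom x) r)"
      using lr path_ends[OF lr(1)] path_ends[OF lr(2)] by (simp_all add: val_wh whisker_left_def whisker_right_def)
    show "val x \<cdot> composite b l \<triangleright> inc i \<triangleleft> composite (tdom x) r = val y \<cdot> composite b l \<triangleright> inc i \<triangleleft> composite (tdom x) r"
      using arg_cong[OF eq[OF i], of val] w x y xy lr path_ends[OF lr(1)] path_ends[OF lr(2)]
      by (simp add: val_vc)
  qed
qed

text \<open>
  Composites are normalized to be nested on the right. In this form an equation between composites of two
  cells rewrites the head of a longer composite.
\<close>

lemma vc_head: "vc a b = w \<Longrightarrow> vc a (vc b z) = vc w z"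
  by (simp only: vc_assoc[symmetric])

lemma vc_head3: "vc a (vc b c) = w \<Longrightarrow> vc a (vc b (vc c z)) = vc w z"
  by (simp only: vc_assoc[symmetric])

text \<open>
  The whiskerings \<open>F \<triangleright> x\<close>, \<open>x \<triangleleft> H\<close> and \<open>F \<triangleright> x \<triangleleft> H\<close> correspond to \<open>val_wh_left\<close>, \<open>val_wh_right\<close> and this lemma.
\<close>

lemma val_wh_both:
  "ok (wh (f # l) x (h # r)) \<Longrightarrow> val (wh (f # l) x (h # r)) =
    id2 C (composite (tcod x) (f # l)) \<bullet> val x \<bullet> id2 C (composite (right_end (fst h) r) (h # r))"
  using val_wh[of "f # l" x "h # r"] by simp

lemmas val_simps = val_vc val_wh_left val_wh_right val_wh_both val_invc

lemma tcell_eq_val: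
  assumes "ok x" "ok y" "tdom x = tdom y" "tcod x = tcod y" "tsrc x = tsrc y" "ttgt x = ttgt y"
  shows "x = y \<longleftrightarrow> val x = val y"
  using tcell_eqI[OF assms] by auto

lemma composite_Cons_path: "path b p a \<Longrightarrow> b \<in> obj C \<Longrightarrow> c \<in> obj C \<Longrightarrow> F \<in> mor C b c \<Longrightarrow>
    composite a ((b, c, F) # p) = F \<star> composite a p"
  using composite_Cons[of c "(b, c, F)" p a] by simp

lemma composite_snoc_path: "path c p b \<Longrightarrow> a \<in> obj C \<Longrightarrow> b \<in> obj C \<Longrightarrow> F \<in> mor C a b \<Longrightarrow>
    composite a (p @ [(a, b, F)]) = composite b p \<star> F"
  using composite_append[of c p b "[(a, b, F)]" a] by simp

end


section \<open>2-representations\<close>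

locale finite_group_setting = linear_two_category K C + G: group G
  for K :: "'k ring" and C :: "('o, 'm, 'c, 'k) two_cat" (structure) and G :: "'g monoid" +
  assumes finite_G: "finite (carrier G)"
begin

abbreviation gmult :: "'g \<Rightarrow> 'g \<Rightarrow> 'g" (infixl \<open>\<diamondop>\<close> 70) where "g \<diamondop> h \<equiv> g \<otimes>\<^bsub>G\<^esub> h"
abbreviation ginv :: "'g \<Rightarrow> 'g" where "ginv g \<equiv> inv\<^bsub>G\<^esub> g"

text \<open>
  Together with associativity these rules bring products in \<open>G\<close> to a normal form, which is needed for
  comparing the types of cells.
\<close>

lemma group_cancel [simp]:
  "\<lbrakk>g \<in> carrier G; h \<in> carrier G\<rbrakk> \<Longrightarrow> ginv g \<diamondop> (g \<diamondop> h) = h"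
  "\<lbrakk>g \<in> carrier G; h \<in> carrier G\<rbrakk> \<Longrightarrow> g \<diamondop> (ginv g \<diamondop> h) = h"
  by (simp_all add: G.m_assoc[symmetric])

lemmas group_simps [simp] = G.m_assoc G.inv_mult_group

end

locale two_representation = finite_group_setting K C G
  for K :: "'k ring" and C :: "('o, 'm, 'c, 'k) two_cat" (structure) and G :: "'g monoid" +
  fixes V :: 'o and R :: "('g, 'm, 'c) two_rep"
  assumes rep: "is_two_rep C G V R"
begin

abbreviation rho :: "'g \<Rightarrow> ('o, 'm) arrow" where "rho g \<equiv> (V, V, act R g)"

definition phi_cell :: "'g \<Rightarrow> 'g \<Rightarrow> ('o, 'm, 'c) tcell" where
  "phi_cell g h = TCell V V [rho g, rho h] [rho (g \<diamondop> h)] (Some (phi R g h))"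

definition phi1_cell :: "('o, 'm, 'c) tcell" where
  "phi1_cell = TCell V V [rho \<one>\<^bsub>G\<^esub>] [] (Some (phi1 R))"

lemma V_obj [simp]: "V \<in> obj C"
  using rep by (simp add: is_two_rep_def)

lemma act_mor [simp]: "g \<in> carrier G \<Longrightarrow> act R g \<in> mor C V V"
  using rep by (simp add: is_two_rep_def)

lemma id1_mor [simp]: "id1 C V \<in> mor C V V"
  using id1_closed by simp

lemma phi_cell_sel [simp]:
  "tdom (phi_cell g h) = V" "tcod (phi_cell g h) = V" "tsrc (phi_cell g h) = [rho g, rho h]"
  "ttgt (phi_cell g h) = [rho (g \<diamondop> h)]" "val (phi_cell g h) = phi R g h"
  by (simp_all add: phi_cell_def)

lemma phi1_cell_sel [simp]:
  "tdom phi1_cell = V" "tcod phi1_cell = V" "tsrc phi1_cell = [rho \<one>\<^bsub>G\<^esub>]"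
  "ttgt phi1_cell = []" "val phi1_cell = phi1 R"
  by (simp_all add: phi1_cell_def)

lemma invertible_phi [simp]: "g \<in> carrier G \<Longrightarrow> h \<in> carrier G \<Longrightarrow> invertible (phi_cell g h)"
  using rep by (simp add: phi_cell_def is_two_rep_def)

lemma invertible_phi1 [simp]: "invertible phi1_cell"
  using rep by (simp add: phi1_cell_def is_two_rep_def)

text \<open>
  The axioms of a 2-representation as equations between typed cells.
\<close>

lemma phi_assoc:
  assumes "g \<in> carrier G" "h \<in> carrier G" "k \<in> carrier G"
  shows "vc (phi_cell (g \<diamondop> h) k) (wh [] (phi_cell g h) [rho k]) =
    vc (phi_cell g (h \<diamondop> k)) (wh [rho g] (phi_cell h k) [])"
proof (subst tcell_eq_val)
  show "val (vc (phi_cell (g \<diamondop> h) k) (wh [] (phi_cell g h) [rho k])) =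
    val (vc (phi_cell g (h \<diamondop> k)) (wh [rho g] (phi_cell h k) []))"
    using rep assms by (simp add: val_simps is_two_rep_def whisker_left_def whisker_right_def)
qed (use assms in simp_all)

lemma phi_one:
  assumes "g \<in> carrier G"
  shows "phi_cell \<one>\<^bsub>G\<^esub> g = wh [] phi1_cell [rho g]" "phi_cell g \<one>\<^bsub>G\<^esub> = wh [rho g] phi1_cell []"
  using rep assms by (auto intro!: tcell_eqI simp: val_simps is_two_rep_def whisker_left_def whisker_right_def)

text \<open>The canonical isomorphism \<open>s s\<^sup>-\<^sup>1 \<cong> id\<close>.\<close>

definition cancel_cell :: "'g \<Rightarrow> ('o, 'm, 'c) tcell" where
  "cancel_cell s = vc phi1_cell (phi_cell s (ginv s))"

lemma cancel_cell_sel [simp]: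
  "tdom (cancel_cell s) = V" "tcod (cancel_cell s) = V" "tsrc (cancel_cell s) = [rho s, rho (ginv s)]"
  "ttgt (cancel_cell s) = []"
  by (simp_all add: cancel_cell_def)

lemma invertible_cancel [simp]: "s \<in> carrier G \<Longrightarrow> invertible (cancel_cell s)"
  by (simp add: cancel_cell_def)

lemma val_cancel [simp]: "s \<in> carrier G \<Longrightarrow> val (cancel_cell s) = cancel C G R s"
  by (simp add: cancel_cell_def val_simps cancel_def)

lemma cancel_right:
  assumes "g \<in> carrier G" "s \<in> carrier G"
  shows "wh [rho g] (cancel_cell s) [] =
    vc (phi_cell (g \<diamondop> s) (ginv s)) (wh [] (phi_cell g s) [rho (ginv s)])"
  using phi_assoc[of g s "ginv s"] phi_one(2)[of g] assms by (simp add: cancel_cell_def)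

text \<open>
  The isomorphisms \<open>s s\<^sup>-\<^sup>1 \<cong> id\<close> and \<open>s\<^sup>-\<^sup>1 s \<cong> id\<close> exhibit \<open>s\<close> and \<open>s\<^sup>-\<^sup>1\<close> as mutually adjoint; both
  sides are \<open>\<phi>\<close> on \<open>s\<^sup>-\<^sup>1 s s\<^sup>-\<^sup>1\<close>, bracketed in two ways.
\<close>

lemma cancel_zigzag:
  assumes "s \<in> carrier G"
  shows "wh [rho (ginv s)] (cancel_cell s) [] = wh [] (cancel_cell (ginv s)) [rho (ginv s)]"
  using cancel_right[of "ginv s" s] phi_one(1)[of "ginv s"] assms by (simp add: cancel_cell_def)

end


section \<open>The sum of all \<open>\<rho>(g)\<close>\<close>

text \<open>
  The sum is given as a path, so that it can be a single 1-morphism as well as the composite \<open>U A'\<close>.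
\<close>

locale regular_sum = two_representation K C G V R
  for K :: "'k ring" and C :: "('o, 'm, 'c, 'k) two_cat" (structure) and G :: "'g monoid" and V R +
  fixes A :: "('o, 'm) arrow list" and inc prj :: "'g \<Rightarrow> 'c"
  assumes path_A [simp]: "path V A V"
    and sum_A: "direct_sum C (carrier G) (act R) (composite V A) inc prj"
begin

lemma A_ends [simp]: "left_end A V = V" "right_end V A = V"
  using path_ends[OF path_A] by auto

lemma A_mor [simp]: "composite V A \<in> mor C V V"
  using composite_closed[OF path_A] .

abbreviation "flips_A \<equiv> A_flips C G R (composite V A) inc prj"
abbreviation "triv_A \<equiv> A_triv C G R (composite V A) inc prj"

definition inc_cell where "inc_cell g = TCell V V [rho g] A (Some (inc g))"
definition prj_cell where "prj_cell g = TCell V V A [rho g] (Some (prj g))"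
definition flip_cell where
  "flip_cell s = TCell V V (rho s # A) (A @ [rho s]) (Some (flips_A s))"
definition triv_cell where
  "triv_cell g = TCell V V A (rho g # A) (Some (triv_A g))"

lemma sum_cell_sel [simp]:
  "tdom (inc_cell g) = V" "tcod (inc_cell g) = V" "tsrc (inc_cell g) = [rho g]" "ttgt (inc_cell g) = A"
  "tdom (prj_cell g) = V" "tcod (prj_cell g) = V" "tsrc (prj_cell g) = A" "ttgt (prj_cell g) = [rho g]"
  "tdom (flip_cell g) = V" "tcod (flip_cell g) = V" "tsrc (flip_cell g) = rho g # A"
      "ttgt (flip_cell g) = A @ [rho g]"
  "tdom (triv_cell g) = V" "tcod (triv_cell g) = V" "tsrc (triv_cell g) = A" "ttgt (triv_cell g) = rho g # A"
  "val (inc_cell g) = inc g" "val (prj_cell g) = prj g"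
  "val (flip_cell g) = flips_A g"
  "val (triv_cell g) = triv_A g"
  by (simp_all add: inc_cell_def prj_cell_def flip_cell_def triv_cell_def)

lemma ok_inc [simp]: "g \<in> carrier G \<Longrightarrow> ok (inc_cell g)"
  and ok_prj [simp]: "g \<in> carrier G \<Longrightarrow> ok (prj_cell g)"
  using direct_sum_inc[OF sum_A] direct_sum_prj[OF sum_A] by (simp_all add: ok_TCell inc_cell_def prj_cell_def)

lemma composite_A [simp]:
  "g \<in> carrier G \<Longrightarrow> composite V (rho g # A) = act R g \<star> composite V A"
  "g \<in> carrier G \<Longrightarrow> composite V (A @ [rho g]) = composite V A \<star> act R g"
  using composite_Cons_path[OF path_A] composite_snoc_path[OF path_A] by auto

text \<open>
  On the summands \<open>A_flips\<close> and \<open>A_triv\<close> are composites of the isomorphisms \<open>\<phi>\<close> and their inverses.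
  In this form all identities between them follow from the associativity of \<open>\<phi>\<close>.
\<close>

lemma A_flips_sum:
  assumes s: "s \<in> carrier G"
  shows "flips_A s \<in> iso2 C (act R s \<star> composite V A) (composite V A \<star> act R s)"
    and "h \<in> carrier G \<Longrightarrow> flips_A s \<cdot> (act R s \<triangleright> inc h) =
      (inc (s \<diamondop> h \<diamondop> ginv s) \<triangleleft> act R s) \<cdot> val (vc (invc (phi_cell (s \<diamondop> h \<diamondop> ginv s) s)) (phi_cell s h))"
    and "h \<in> carrier G \<Longrightarrow> (prj (s \<diamondop> h \<diamondop> ginv s) \<triangleleft> act R s) \<cdot> flips_A s =
      val (vc (invc (phi_cell (s \<diamondop> h \<diamondop> ginv s) s)) (phi_cell s h)) \<cdot> (act R s \<triangleright> prj h)"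
proof -
  define \<pi> where "\<pi> h = s \<diamondop> h \<diamondop> ginv s" for h
  have \<pi>: "\<pi> h \<in> carrier G" if "h \<in> carrier G" for h using that s by (simp add: \<pi>_def)
  have bij: "bij_betw \<pi> (carrier G) (carrier G)"
    by (rule bij_betwI[where g = "\<lambda>h. ginv s \<diamondop> h \<diamondop> s"]) (use s in \<open>auto simp: \<pi>_def\<close>)
  define f where "f h = val (vc (invc (phi_cell (\<pi> h) s)) (phi_cell s h))" for h
  have F: "invertible (vc (invc (phi_cell (\<pi> h) s)) (phi_cell s h))" if "h \<in> carrier G" for h
    using that s by (intro invertible_vc) (simp_all add: \<pi>_def)
  have f: "f h \<in> iso2 C (act R s \<star> act R h) (act R (\<pi> h) \<star> act R s)" if "h \<in> carrier G" for h
    using F[OF that] unfolding invertible_def f_def by simp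
  have fe: "f h = inv2 C (act R (\<pi> h) \<star> act R s) (act R (s \<diamondop> h)) (phi R (\<pi> h) s) \<cdot> phi R s h" if "h \<in> carrier G" for h
    using F[OF that] s that unfolding f_def invertible_def by (simp add: val_simps \<pi>_def)
  have mor: "act R s \<star> act R h \<in> mor C V V" "act R h \<star> act R s \<in> mor C V V" if "h \<in> carrier G" for h
    using that s comp1_closed[of V V V] by simp_all
  have morA: "act R s \<star> composite V A \<in> mor C V V" "composite V A \<star> act R s \<in> mor C V V"
    using s comp1_closed[of V V V] by simp_all
  have ds: "direct_sum C (carrier G) (\<lambda>h. act R s \<star> act R h) (act R s \<star> composite V A) (\<lambda>h. act R s \<triangleright> inc h)
      (\<lambda>h. act R s \<triangleright> prj h)"
    using direct_sum_whisker_left[OF V_obj V_obj V_obj act_mor[OF s] act_mor A_mor sum_A finite_G] .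
  have ds': "direct_sum C (carrier G) (\<lambda>h. act R h \<star> act R s) (composite V A \<star> act R s) (\<lambda>h. inc h \<triangleleft> act R s)
      (\<lambda>h. prj h \<triangleleft> act R s)"
    using direct_sum_whisker_right[OF V_obj V_obj V_obj act_mor[OF s] act_mor A_mor sum_A finite_G] .
  note perm = direct_sum_permute[OF V_obj V_obj mor(1) morA(1) mor(2) morA(2) ds ds' finite_G bij f]
  have e: "flips_A s =
    (\<Oplus>\<^bsub>cell C (act R s \<star> composite V A) (composite V A \<star> act R s)\<^esub>h\<in>carrier G. (inc (\<pi> h) \<triangleleft> act R s) \<cdot> f h \<cdot>
        (act R s \<triangleright> prj h))"
  proof -
    interpret sum: abelian_group "cell C (act R s \<star> composite V A) (composite V A \<star> act R s)"
      using cell_abelian_group[OF V_obj V_obj morA] .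
    have fh: "f h \<in> hom2 C (act R s \<star> act R h) (act R (\<pi> h) \<star> act R s)" if "h \<in> carrier G" for h
      using f[OF that] by (simp add: iso2_def)
    have "(inc (\<pi> h) \<triangleleft> act R s) \<cdot> f h \<cdot> (act R s \<triangleright> prj h) \<in> carrier
        (cell C (act R s \<star> composite V A) (composite V A \<star> act R s))"
      if h: "h \<in> carrier G" for h
      using vcomp_closed[OF V_obj V_obj morA(1) mor(2)[OF \<pi>[OF h]] morA(2)
          vcomp_closed[OF V_obj V_obj morA(1) mor(1)[OF h] mor(2)[OF \<pi>[OF h]]]]
        direct_sum_prj[OF ds h] direct_sum_inc[OF ds' \<pi>[OF h]] fh[OF h] by (simp add: hom2_def)
    moreover have "inv2 C (act R (\<pi> h) \<star> act R s) (act R (s \<diamondop> h)) (phi R (\<pi> h) s) \<cdot> phi R s h \<cdot> (act R s \<triangleright> prj h)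
      = f h \<cdot> (act R s \<triangleright> prj h)" if h: "h \<in> carrier G" for h
    proof -
      have "ok (invc (phi_cell (\<pi> h) s))" "ok (phi_cell s h)" using h s \<pi> by simp_all
      from okD(7)[OF this(1)] okD(7)[OF this(2)] show ?thesis
        unfolding fe[OF h]
        using vcomp_assoc[OF V_obj V_obj morA(1) mor(1)[OF h] act_mor mor(2)[OF \<pi>[OF h]] direct_sum_prj[OF ds h],
            of "s \<diamondop> h" "phi R s h" "inv2 C (act R (\<pi> h) \<star> act R s) (act R (s \<diamondop> h)) (phi R (\<pi> h) s)"] h s
        by (simp add: val_invc \<pi>_def)
    qed
    ultimately show ?thesis using s by (auto simp: A_flips_def Let_def \<pi>_def intro!: sum.finsum_cong')
  qed
  show "flips_A s \<in> iso2 C (act R s \<star> composite V A) (composite V A \<star> act R s)"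
    unfolding e by (rule perm(1))
  show "h \<in> carrier G \<Longrightarrow> flips_A s \<cdot> (act R s \<triangleright> inc h) =
      (inc (s \<diamondop> h \<diamondop> ginv s) \<triangleleft> act R s) \<cdot> val (vc (invc (phi_cell (s \<diamondop> h \<diamondop> ginv s) s)) (phi_cell s h))"
    unfolding e using perm(2) by (simp add: \<pi>_def f_def)
  show "h \<in> carrier G \<Longrightarrow> (prj (s \<diamondop> h \<diamondop> ginv s) \<triangleleft> act R s) \<cdot> flips_A s =
      val (vc (invc (phi_cell (s \<diamondop> h \<diamondop> ginv s) s)) (phi_cell s h)) \<cdot> (act R s \<triangleright> prj h)"
    unfolding e using perm(3) by (simp add: \<pi>_def f_def)
qed

lemma A_triv_sum:
  assumes s: "s \<in> carrier G"
  shows "triv_A s \<in> iso2 C (composite V A) (act R s \<star> composite V A)"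
    and "h \<in> carrier G \<Longrightarrow> triv_A s \<cdot> inc h =
      (act R s \<triangleright> inc (ginv s \<diamondop> h)) \<cdot> val (invc (phi_cell s (ginv s \<diamondop> h)))"
    and "h \<in> carrier G \<Longrightarrow> (act R s \<triangleright> prj (ginv s \<diamondop> h)) \<cdot> triv_A s =
      val (invc (phi_cell s (ginv s \<diamondop> h))) \<cdot> prj h"
proof -
  define \<pi> where "\<pi> h = ginv s \<diamondop> h" for h
  have \<pi>: "\<pi> h \<in> carrier G" if "h \<in> carrier G" for h using that s by (simp add: \<pi>_def)
  have bij: "bij_betw \<pi> (carrier G) (carrier G)"
    by (rule bij_betwI[where g = "\<lambda>h. s \<diamondop> h"]) (use s in \<open>auto simp: \<pi>_def\<close>)
  define f where "f h = val (invc (phi_cell s (\<pi> h)))" for h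
  have F: "invertible (invc (phi_cell s (\<pi> h)))" if "h \<in> carrier G" for h
    using that s by (simp add: \<pi>_def)
  have f: "f h \<in> iso2 C (act R h) (act R s \<star> act R (\<pi> h))" if "h \<in> carrier G" for h
    using F[OF that] s that unfolding invertible_def f_def by (simp add: \<pi>_def)
  have mor: "act R s \<star> act R h \<in> mor C V V" if "h \<in> carrier G" for h
    using that s comp1_closed[of V V V] by simp_all
  have morA: "act R s \<star> composite V A \<in> mor C V V"
    using s comp1_closed[of V V V] by simp_all
  have ds: "direct_sum C (carrier G) (\<lambda>h. act R s \<star> act R h) (act R s \<star> composite V A) (\<lambda>h. act R s \<triangleright> inc h)
      (\<lambda>h. act R s \<triangleright> prj h)"
    using direct_sum_whisker_left[OF V_obj V_obj V_obj act_mor[OF s] act_mor A_mor sum_A finite_G] .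
  note perm = direct_sum_permute[OF V_obj V_obj act_mor A_mor mor morA sum_A ds finite_G bij f]
  have e: "triv_A s =
    (\<Oplus>\<^bsub>cell C (composite V A) (act R s \<star> composite V A)\<^esub>h\<in>carrier G. (act R s \<triangleright> inc (\<pi> h)) \<cdot> f h \<cdot> prj h)"
  proof -
    interpret sum: abelian_group "cell C (composite V A) (act R s \<star> composite V A)"
      using cell_abelian_group[OF V_obj V_obj A_mor morA] .
    have fh: "f h \<in> hom2 C (act R h) (act R s \<star> act R (\<pi> h))" if "h \<in> carrier G" for h
      using f[OF that] by (simp add: iso2_def)
    have "(act R s \<triangleright> inc (\<pi> h)) \<cdot> f h \<cdot> prj h \<in> carrier (cell C (composite V A) (act R s \<star> composite V A))"
      if h: "h \<in> carrier G" for h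
      using vcomp_closed[OF V_obj V_obj A_mor mor[OF \<pi>[OF h]] morA
          vcomp_closed[OF V_obj V_obj A_mor act_mor[OF h] mor[OF \<pi>[OF h]]]]
        direct_sum_prj[OF sum_A h] direct_sum_inc[OF ds \<pi>[OF h]] fh[OF h] by (simp add: hom2_def)
    moreover have "f h = inv2 C (act R s \<star> act R (\<pi> h)) (act R h) (phi R s (\<pi> h))" if h: "h \<in> carrier G" for h
      using h s by (simp add: f_def val_invc \<pi>_def)
    ultimately show ?thesis using s by (auto simp: A_triv_def Let_def \<pi>_def intro!: sum.finsum_cong')
  qed
  show "triv_A s \<in> iso2 C (composite V A) (act R s \<star> composite V A)"
    unfolding e by (rule perm(1))
  show "h \<in> carrier G \<Longrightarrow> triv_A s \<cdot> inc h =
      (act R s \<triangleright> inc (ginv s \<diamondop> h)) \<cdot> val (invc (phi_cell s (ginv s \<diamondop> h)))"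
    unfolding e using perm(2) by (simp add: \<pi>_def f_def)
  show "h \<in> carrier G \<Longrightarrow> (act R s \<triangleright> prj (ginv s \<diamondop> h)) \<cdot> triv_A s =
      val (invc (phi_cell s (ginv s \<diamondop> h))) \<cdot> prj h"
    unfolding e using perm(3) by (simp add: \<pi>_def f_def)
qed

lemma invertible_flip [simp]: "s \<in> carrier G \<Longrightarrow> invertible (flip_cell s)"
  and invertible_triv [simp]: "s \<in> carrier G \<Longrightarrow> invertible (triv_cell s)"
  using A_flips_sum(1) A_triv_sum(1) by (simp_all add: flip_cell_def triv_cell_def path_append)

lemma flip_inc:
  assumes "s \<in> carrier G" "h \<in> carrier G"
  shows "vc (flip_cell s) (wh [rho s] (inc_cell h) []) =
    vc (wh [] (inc_cell (s \<diamondop> h \<diamondop> ginv s)) [rho s]) (vc (invc (phi_cell (s \<diamondop> h \<diamondop> ginv s) s)) (phi_cell s h))"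
proof (subst tcell_eq_val)
  show "val (vc (flip_cell s) (wh [rho s] (inc_cell h) [])) =
    val (vc (wh [] (inc_cell (s \<diamondop> h \<diamondop> ginv s)) [rho s]) (vc (invc (phi_cell (s \<diamondop> h \<diamondop> ginv s) s)) (phi_cell s h)))"
    using assms A_flips_sum(2)[OF assms] by (simp add: val_simps whisker_left_def whisker_right_def)
qed (use assms in simp_all)

lemma flip_prj:
  assumes "s \<in> carrier G" "h \<in> carrier G"
  shows "vc (wh [] (prj_cell (s \<diamondop> h \<diamondop> ginv s)) [rho s]) (flip_cell s) =
    vc (invc (phi_cell (s \<diamondop> h \<diamondop> ginv s) s)) (vc (phi_cell s h) (wh [rho s] (prj_cell h) []))"
proof -
  have "vc (wh [] (prj_cell (s \<diamondop> h \<diamondop> ginv s)) [rho s]) (flip_cell s) =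
    vc (vc (invc (phi_cell (s \<diamondop> h \<diamondop> ginv s) s)) (phi_cell s h)) (wh [rho s] (prj_cell h) [])"
  proof (subst tcell_eq_val)
    show "val (vc (wh [] (prj_cell (s \<diamondop> h \<diamondop> ginv s)) [rho s]) (flip_cell s)) =
      val (vc (vc (invc (phi_cell (s \<diamondop> h \<diamondop> ginv s) s)) (phi_cell s h)) (wh [rho s] (prj_cell h) []))"
      using assms A_flips_sum(3)[OF assms]
      by (subst (2) val_vc) (simp_all add: val_simps whisker_left_def whisker_right_def del: vc_assoc)
  qed (use assms in simp_all)
  then show ?thesis by simp
qed

lemma triv_inc:
  assumes "g \<in> carrier G" "h \<in> carrier G"
  shows "vc (triv_cell g) (inc_cell h) =
    vc (wh [rho g] (inc_cell (ginv g \<diamondop> h)) []) (invc (phi_cell g (ginv g \<diamondop> h)))"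
proof (subst tcell_eq_val)
  show "val (vc (triv_cell g) (inc_cell h)) =
    val (vc (wh [rho g] (inc_cell (ginv g \<diamondop> h)) []) (invc (phi_cell g (ginv g \<diamondop> h))))"
    using assms A_triv_sum(2)[OF assms] by (simp add: val_simps whisker_left_def whisker_right_def)
qed (use assms in simp_all)

lemma triv_prj:
  assumes "g \<in> carrier G" "h \<in> carrier G"
  shows "vc (wh [rho g] (prj_cell (ginv g \<diamondop> h)) []) (triv_cell g) =
    vc (invc (phi_cell g (ginv g \<diamondop> h))) (prj_cell h)"
proof (subst tcell_eq_val)
  show "val (vc (wh [rho g] (prj_cell (ginv g \<diamondop> h)) []) (triv_cell g)) =
    val (vc (invc (phi_cell g (ginv g \<diamondop> h))) (prj_cell h))"
    using assms A_triv_sum(3)[OF assms] by (simp add: val_simps whisker_left_def whisker_right_def)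
qed (use assms in simp_all)

lemma eq_on_inc:
  assumes "ok x" "tsrc x = l @ A @ r" "ok y" "tsrc y = l @ A @ r" "path V r (tdom x)"
    and "tdom x = tdom y" "tcod x = tcod y" "ttgt x = ttgt y"
    and "\<And>g. g \<in> carrier G \<Longrightarrow> vc x (wh l (inc_cell g) r) = vc y (wh l (inc_cell g) r)"
  shows "x = y"
  by (rule eq_on_summands[of "carrier G" V "\<lambda>g. [rho g]" A inc prj V r x l y])
    (use assms sum_A finite_G in \<open>simp_all add: inc_cell_def\<close>)

end


section \<open>Equivariant and trivialized 1-morphisms\<close>

locale representation_pair = two_representation K C G V R + S: two_representation K C G W T
  for K :: "'k ring" and C :: "('o, 'm, 'c, 'k) two_cat" (structure) and G :: "'g monoid" and V R W T
begin

definition flipc :: "('o, 'm) arrow list \<Rightarrow> ('g \<Rightarrow> 'c) \<Rightarrow> 'g \<Rightarrow> ('o, 'm, 'c) tcell" where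
  "flipc p \<tau> g = TCell W V (rho g # p) (p @ [S.rho g]) (Some (\<tau> g))"

definition trivc :: "('o, 'm) arrow list \<Rightarrow> ('g \<Rightarrow> 'c) \<Rightarrow> 'g \<Rightarrow> ('o, 'm, 'c) tcell" where
  "trivc p \<epsilon> g = TCell W V p (rho g # p) (Some (\<epsilon> g))"

lemma flipc_sel [simp]:
  "tdom (flipc p \<tau> g) = W" "tcod (flipc p \<tau> g) = V" "tsrc (flipc p \<tau> g) = rho g # p"
  "ttgt (flipc p \<tau> g) = p @ [S.rho g]" "val (flipc p \<tau> g) = \<tau> g"
  "tdom (trivc p \<tau> g) = W" "tcod (trivc p \<tau> g) = V" "tsrc (trivc p \<tau> g) = p"
  "ttgt (trivc p \<tau> g) = rho g # p" "val (trivc p \<tau> g) = \<tau> g"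
  by (simp_all add: flipc_def trivc_def)

text \<open>
  The conditions on flips, with all composites written as typed cells. The 1-morphism is given by a path,
  because it will often be a composite.
\<close>

lemma equivariant_iff:
  assumes p: "path V p W"
  shows "(composite W p, \<tau>) \<in> Ob (equivariant_cat C G W T V R) \<longleftrightarrow>
    \<tau> \<in> extensional (carrier G) \<and> (\<forall>g\<in>carrier G. invertible (flipc p \<tau> g)) \<and>
    (\<forall>g\<in>carrier G. \<forall>h\<in>carrier G. vc (flipc p \<tau> (g \<diamondop> h)) (wh [] (phi_cell g h) p) =
      vc (wh p (S.phi_cell g h) []) (vc (wh [] (flipc p \<tau> g) [S.rho h]) (wh [rho g] (flipc p \<tau> h) []))) \<and>
    flipc p \<tau> \<one>\<^bsub>G\<^esub> = vc (invc (wh p S.phi1_cell [])) (wh [] phi1_cell p)"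
proof -
  note e = path_ends[OF p]
  have [simp]: "left_end p W = V" "right_end V p = W" "path V p W" using e p by auto
  have m: "composite W p \<in> mor C W V" using composite_closed[OF p] .
  have c [simp]: "composite W (rho g # p) = act R g \<star> composite W p"
    "composite W (p @ [S.rho g]) = composite W p \<star> act T g" if "g \<in> carrier G" for g
    using that composite_Cons_path[OF p] composite_snoc_path[OF p] by auto
  have inv: "invertible (flipc p \<tau> g) \<longleftrightarrow> \<tau> g \<in> iso2 C (act R g \<star> composite W p) (composite W p \<star> act T g)"
    if "g \<in> carrier G" for g
    using that by (simp add: flipc_def path_append)
  have mult: "vc (flipc p \<tau> (g \<diamondop> h)) (wh [] (phi_cell g h) p) =
      vc (wh p (S.phi_cell g h) []) (vc (wh [] (flipc p \<tau> g) [S.rho h]) (wh [rho g] (flipc p \<tau> h) [])) \<longleftrightarrow>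
     \<tau> (g \<diamondop> h) \<cdot> (phi R g h \<triangleleft> composite W p) =
      (composite W p \<triangleright> phi T g h) \<cdot> (\<tau> g \<triangleleft> act T h) \<cdot> (act R g \<triangleright> \<tau> h)"
    if all: "\<forall>g\<in>carrier G. invertible (flipc p \<tau> g)" and gh: "g \<in> carrier G" "h \<in> carrier G" for g h
  proof -
    have [simp]: "invertible (flipc p \<tau> g)" "invertible (flipc p \<tau> h)" "invertible (flipc p \<tau> (g \<diamondop> h))"
      using all gh by simp_all
    show ?thesis
      by (subst tcell_eq_val) (use gh in \<open>simp_all add: val_simps whisker_left_def whisker_right_def\<close>)
  qed
  have unit: "flipc p \<tau> \<one>\<^bsub>G\<^esub> = vc (invc (wh p S.phi1_cell [])) (wh [] phi1_cell p) \<longleftrightarrow>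
    \<tau> \<one>\<^bsub>G\<^esub> = inv2 C (composite W p \<star> act T \<one>\<^bsub>G\<^esub>) (composite W p) (composite W p \<triangleright> phi1 T) \<cdot> (phi1 R \<triangleleft> composite W p)"
    if all: "\<forall>g\<in>carrier G. invertible (flipc p \<tau> g)"
  proof -
    have [simp]: "invertible (flipc p \<tau> \<one>\<^bsub>G\<^esub>)" using all by simp
    have [simp]: "invertible (wh p S.phi1_cell [])" "ok (wh p S.phi1_cell [])" by simp_all
    show ?thesis
      by (subst tcell_eq_val) (simp_all add: val_simps whisker_left_def whisker_right_def del: invertible_wh)
  qed
  show ?thesis
    using m mult unit inv by (auto simp: equivariant_cat_def PiE_iff)
qed

lemma trivialized_iff:
  assumes p: "path V p W"
  shows "(composite W p, \<tau>, \<epsilon>) \<in> Ob (trivialized_cat C G W T V R) \<longleftrightarrow>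
    (composite W p, \<tau>) \<in> Ob (equivariant_cat C G W T V R) \<and>
    \<epsilon> \<in> extensional (carrier G) \<and> (\<forall>g\<in>carrier G. invertible (trivc p \<epsilon> g)) \<and>
    (\<forall>g\<in>carrier G. \<forall>h\<in>carrier G. vc (wh [] (phi_cell g h) p) (vc (wh [rho g] (trivc p \<epsilon> h) []) (trivc p \<epsilon> g)) =
      trivc p \<epsilon> (g \<diamondop> h)) \<and>
    (\<forall>s\<in>carrier G. \<forall>g\<in>carrier G. let t = s \<diamondop> g \<diamondop> ginv s in
      vc (wh [] (phi_cell s g) p) (vc (wh [rho s] (trivc p \<epsilon> g) []) (invc (flipc p \<tau> s))) =
      vc (wh [] (phi_cell t s) p) (vc (wh [rho t] (invc (flipc p \<tau> s)) []) (wh [] (trivc p \<epsilon> t) [S.rho s])))"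
    (is "_ \<longleftrightarrow> ?E \<and> _ \<and> ?inv \<and> ?mult \<and> ?compat")
proof (cases ?E)
  case True
  note e = path_ends[OF p]
  have [simp]: "left_end p W = V" "right_end V p = W" "path V p W" using e p by auto
  have m: "composite W p \<in> mor C W V" using composite_closed[OF p] .
  have c [simp]: "composite W (rho g # p) = act R g \<star> composite W p"
    "composite W (p @ [S.rho g]) = composite W p \<star> act T g" if "g \<in> carrier G" for g
    using that composite_Cons_path[OF p] composite_snoc_path[OF p] by auto
  have [simp]: "invertible (flipc p \<tau> g)" if "g \<in> carrier G" for g
    using True that by (simp add: equivariant_iff[OF p])
  have inv: "invertible (trivc p \<epsilon> g) \<longleftrightarrow> \<epsilon> g \<in> iso2 C (composite W p) (act R g \<star> composite W p)"
    if "g \<in> carrier G" for g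
    using that by (simp add: trivc_def path_append)
  have mult: "vc (wh [] (phi_cell g h) p) (vc (wh [rho g] (trivc p \<epsilon> h) []) (trivc p \<epsilon> g)) = trivc p \<epsilon> (g \<diamondop> h) \<longleftrightarrow>
     (phi R g h \<triangleleft> composite W p) \<cdot> (act R g \<triangleright> \<epsilon> h) \<cdot> \<epsilon> g = \<epsilon> (g \<diamondop> h)"
    if all: ?inv and gh: "g \<in> carrier G" "h \<in> carrier G" for g h
  proof -
    have [simp]: "invertible (trivc p \<epsilon> g)" "invertible (trivc p \<epsilon> h)" "invertible (trivc p \<epsilon> (g \<diamondop> h))"
      using all gh by simp_all
    show ?thesis
      by (subst tcell_eq_val) (use gh in \<open>simp_all add: val_simps whisker_left_def whisker_right_def\<close>)
  qed
  have compat: "(let t = s \<diamondop> g \<diamondop> ginv s in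
      vc (wh [] (phi_cell s g) p) (vc (wh [rho s] (trivc p \<epsilon> g) []) (invc (flipc p \<tau> s))) =
      vc (wh [] (phi_cell t s) p) (vc (wh [rho t] (invc (flipc p \<tau> s)) []) (wh [] (trivc p \<epsilon> t) [S.rho s]))) \<longleftrightarrow>
    (let t = s \<diamondop> g \<diamondop> ginv s; \<tau>s' = inv2 C (act R s \<star> composite W p) (composite W p \<star> act T s) (\<tau> s) in
        (phi R s g \<triangleleft> composite W p) \<cdot> (act R s \<triangleright> \<epsilon> g) \<cdot> \<tau>s' =
        (phi R t s \<triangleleft> composite W p) \<cdot> (act R t \<triangleright> \<tau>s') \<cdot> (\<epsilon> t \<triangleleft> act T s))"
    if all: ?inv and gh: "s \<in> carrier G" "g \<in> carrier G" for s g
  proof -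
    have [simp]: "invertible (trivc p \<epsilon> g)" if "g \<in> carrier G" for g
      using all that by simp
    show ?thesis unfolding Let_def
      by (subst tcell_eq_val) (use gh in \<open>simp_all add: val_simps whisker_left_def whisker_right_def\<close>)
  qed
  have "(composite W p, \<tau>, \<epsilon>) \<in> Ob (trivialized_cat C G W T V R) \<longleftrightarrow>
    \<epsilon> \<in> extensional (carrier G) \<and> (\<forall>g\<in>carrier G. \<epsilon> g \<in> iso2 C (composite W p) (act R g \<star> composite W p)) \<and>
    (\<forall>g\<in>carrier G. \<forall>h\<in>carrier G. (phi R g h \<triangleleft> composite W p) \<cdot> (act R g \<triangleright> \<epsilon> h) \<cdot> \<epsilon> g = \<epsilon> (g \<diamondop> h)) \<and>
    (\<forall>s\<in>carrier G. \<forall>g\<in>carrier G.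
      let t = s \<diamondop> g \<diamondop> ginv s; \<tau>s' = inv2 C (act R s \<star> composite W p) (composite W p \<star> act T s) (\<tau> s) in
        (phi R s g \<triangleleft> composite W p) \<cdot> (act R s \<triangleright> \<epsilon> g) \<cdot> \<tau>s' =
        (phi R t s \<triangleleft> composite W p) \<cdot> (act R t \<triangleright> \<tau>s') \<cdot> (\<epsilon> t \<triangleleft> act T s))"
    using True by (simp add: trivialized_cat_def PiE_iff conj_ac)
  also have "\<dots> \<longleftrightarrow> \<epsilon> \<in> extensional (carrier G) \<and> ?inv \<and> ?mult \<and> ?compat"
  proof (cases ?inv)
    case True
    have i: "\<forall>g\<in>carrier G. \<epsilon> g \<in> iso2 C (composite W p) (act R g \<star> composite W p)"
      using inv True by blast
    show ?thesis
      using i True mult[OF True] compat[OF True] by (simp only: simp_thms cong: ball_cong)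
  next
    case False
    then show ?thesis using inv by blast
  qed
  finally show ?thesis using True by simp
next
  case False
  then show ?thesis by (auto simp: trivialized_cat_def)
qed

lemma equivariant_mor: "(F, \<tau>) \<in> Ob (equivariant_cat C G W T V R) \<Longrightarrow> F \<in> mor C W V"
  by (simp add: equivariant_cat_def)

lemma trivialized_equivariant:
  "(F, \<tau>, \<epsilon>) \<in> Ob (trivialized_cat C G W T V R) \<Longrightarrow> (F, \<tau>) \<in> Ob (equivariant_cat C G W T V R)"
  by (simp add: trivialized_cat_def)

abbreviation single :: "'m \<Rightarrow> ('o, 'm) arrow list" where "single F \<equiv> [(W, V, F)]"

lemma equivariant_hom_iff:
  assumes p: "path V p W" and q: "path V q W"
    and F: "(composite W p, \<tau>) \<in> Ob (equivariant_cat C G W T V R)"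
    and H: "(composite W q, \<tau>') \<in> Ob (equivariant_cat C G W T V R)"
  shows "x \<in> Hom (equivariant_cat C G W T V R) (composite W p, \<tau>) (composite W q, \<tau>') \<longleftrightarrow>
    ok (TCell W V p q (Some x)) \<and>
    (\<forall>g\<in>carrier G. vc (flipc q \<tau>' g) (wh [rho g] (TCell W V p q (Some x)) []) =
      vc (wh [] (TCell W V p q (Some x)) [S.rho g]) (flipc p \<tau> g))"
proof (cases "ok (TCell W V p q (Some x))")
  case True
  then have x: "x \<in> hom2 C (composite W p) (composite W q)" by (simp add: ok_TCell)
  have [simp]: "left_end p W = V" "right_end V p = W" "path V p W"
    "left_end q W = V" "right_end V q = W" "path V q W" using path_ends[OF p] path_ends[OF q] p q by auto
  have "vc (flipc q \<tau>' g) (wh [rho g] (TCell W V p q (Some x)) []) =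
      vc (wh [] (TCell W V p q (Some x)) [S.rho g]) (flipc p \<tau> g) \<longleftrightarrow>
    \<tau>' g \<cdot> (act R g \<triangleright> x) = (x \<triangleleft> act T g) \<cdot> \<tau> g" if g: "g \<in> carrier G" for g
  proof -
    have [simp]: "invertible (flipc p \<tau> g)" "invertible (flipc q \<tau>' g)"
      using F H g by (simp_all add: equivariant_iff p q)
    show ?thesis using True g
      by (subst tcell_eq_val) (simp_all add: val_simps whisker_left_def whisker_right_def)
  qed
  then show ?thesis using x True by (simp add: equivariant_cat_def)
next
  case False
  then show ?thesis using p q by (simp add: equivariant_cat_def ok_TCell)
qed

lemma trivialized_hom_iff:
  assumes p: "path V p W" and q: "path V q W"
    and F: "(composite W p, \<tau>, \<epsilon>) \<in> Ob (trivialized_cat C G W T V R)"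
    and H: "(composite W q, \<tau>', \<delta>) \<in> Ob (trivialized_cat C G W T V R)"
  shows "x \<in> Hom (trivialized_cat C G W T V R) (composite W p, \<tau>, \<epsilon>) (composite W q, \<tau>', \<delta>) \<longleftrightarrow>
    x \<in> Hom (equivariant_cat C G W T V R) (composite W p, \<tau>) (composite W q, \<tau>') \<and>
    (\<forall>g\<in>carrier G. vc (trivc q \<delta> g) (TCell W V p q (Some x)) =
      vc (wh [rho g] (TCell W V p q (Some x)) []) (trivc p \<epsilon> g))"
proof (cases "ok (TCell W V p q (Some x))")
  case True
  have [simp]: "left_end p W = V" "right_end V p = W" "path V p W"
    "left_end q W = V" "right_end V q = W" "path V q W" using path_ends[OF p] path_ends[OF q] p q by auto
  have "vc (trivc q \<delta> g) (TCell W V p q (Some x)) =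
      vc (wh [rho g] (TCell W V p q (Some x)) []) (trivc p \<epsilon> g) \<longleftrightarrow>
    \<delta> g \<cdot> x = (act R g \<triangleright> x) \<cdot> \<epsilon> g" if g: "g \<in> carrier G" for g
  proof -
    have [simp]: "invertible (trivc p \<epsilon> g)" "invertible (trivc q \<delta> g)"
      using F H g by (simp_all add: trivialized_iff p q)
    show ?thesis using True g
      by (subst tcell_eq_val) (simp_all add: val_simps whisker_left_def whisker_right_def)
  qed
  then show ?thesis by (simp add: trivialized_cat_def)
next
  case False
  then have "x \<notin> Hom (equivariant_cat C G W T V R) (composite W p, \<tau>) (composite W q, \<tau>')"
    using equivariant_hom_iff[OF p q trivialized_equivariant[OF F] trivialized_equivariant[OF H]] by simp
  then show ?thesis by (simp add: trivialized_cat_def)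
qed


lemma single_path: "F \<in> mor C W V \<Longrightarrow> path V (single F) W \<and> composite W (single F) = F"
  by simp

lemma equivariant_category: "category (equivariant_cat C G W T V R)"
proof (rule category_of_structured_objects[where D = "hom_cat C W V" and \<pi> = fst])
  let ?D = "equivariant_cat C G W T V R"
  show "category (hom_cat C W V)" by (rule hom_category) simp_all
  have m: "F \<in> mor C W V" if "(F, \<tau>) \<in> Ob ?D" for F \<tau> using that by (rule equivariant_mor)
  have hom: "x \<in> Hom ?D (F, \<tau>) (H, \<tau>') \<longleftrightarrow>
    ok (TCell W V (single F) (single H) (Some x)) \<and>
    (\<forall>g\<in>carrier G. vc (flipc (single H) \<tau>' g) (wh [rho g] (TCell W V (single F) (single H) (Some x)) []) =
      vc (wh [] (TCell W V (single F) (single H) (Some x)) [S.rho g]) (flipc (single F) \<tau> g))"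
    if "(F, \<tau>) \<in> Ob ?D" "(H, \<tau>') \<in> Ob ?D" for F \<tau> H \<tau>' x
    using equivariant_hom_iff[of "single F" "single H" \<tau> \<tau>' x] that m by simp
  fix u v w x y
  assume u: "u \<in> Ob ?D"
  obtain F \<tau> where F: "u = (F, \<tau>)" "(F, \<tau>) \<in> Ob ?D" using u by (cases u) auto
  show "fst u \<in> Ob (hom_cat C W V)" using m[OF F(2)] F(1) by (simp add: hom_cat_def)
  show "Id ?D u = Id (hom_cat C W V) (fst u)" using F(1) by (simp add: equivariant_cat_def hom_cat_def)
  show "Id (hom_cat C W V) (fst u) \<in> Hom ?D u u"
  proof -
    have "TCell W V (single F) (single F) (Some (id2 C F)) = idc V (single F) W" by (simp add: idc_def)
    moreover have "ok (flipc (single F) \<tau> g)" if "g \<in> carrier G" for g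
      using equivariant_iff[of "single F" \<tau>] F(2) m[OF F(2)] that by simp
    ultimately show ?thesis using F m[OF F(2)] by (simp add: hom hom_cat_def)
  qed
  assume v: "v \<in> Ob ?D" and x: "x \<in> Hom ?D u v"
  obtain H \<tau>' where H: "v = (H, \<tau>')" "(H, \<tau>') \<in> Ob ?D" using v by (cases v) auto
  show "x \<in> Hom (hom_cat C W V) (fst u) (fst v)"
    using x F(1) H(1) by (simp add: equivariant_cat_def hom_cat_def)
  assume w: "w \<in> Ob ?D" and y: "y \<in> Hom ?D v w"
  obtain L \<tau>'' where L: "w = (L, \<tau>'')" "(L, \<tau>'') \<in> Ob ?D" using w by (cases w) auto
  define cx cy where "cx = TCell W V (single F) (single H) (Some x)"
    and "cy = TCell W V (single H) (single L) (Some y)"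
  have c: "ok cx" "ok cy" "tdom cx = W" "tcod cx = V" "tsrc cx = single F" "ttgt cx = single H"
    "tdom cy = W" "tcod cy = V" "tsrc cy = single H" "ttgt cy = single L"
    using x y hom F H L by (simp_all add: cx_def cy_def)
  have xy: "TCell W V (single F) (single L) (Some (y \<cdot> x)) = vc cy cx"
    using c by (simp add: vc_def) (simp add: cx_def cy_def)
  show "Cmp (hom_cat C W V) y x \<in> Hom ?D u w"
    unfolding F(1) L(1) hom[OF F(2) L(2)] hom_cat_def cat.simps xy
  proof (intro conjI ballI)
    show "ok (vc cy cx)" using c by simp
    fix g assume g: "g \<in> carrier G"
    have ex: "vc (flipc (single H) \<tau>' g) (wh [rho g] cx []) = vc (wh [] cx [S.rho g]) (flipc (single F) \<tau> g)"
      and ey: "vc (flipc (single L) \<tau>'' g) (wh [rho g] cy []) = vc (wh [] cy [S.rho g]) (flipc (single H) \<tau>' g)"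
      using x y g F H L by (simp_all add: hom cx_def cy_def)
    show "vc (flipc (single L) \<tau>'' g) (wh [rho g] (vc cy cx) []) =
      vc (wh [] (vc cy cx) [S.rho g]) (flipc (single F) \<tau> g)"
      by (simp add: vc_head[OF ey] ex)
  qed
qed (simp add: equivariant_cat_def hom_cat_def)

lemma trivialized_category: "category (trivialized_cat C G W T V R)"
proof (rule category_of_structured_objects[where D = "equivariant_cat C G W T V R" and \<pi> = "\<lambda>(F, \<tau>, \<epsilon>). (F, \<tau>)"])
  let ?D = "equivariant_cat C G W T V R" and ?E = "trivialized_cat C G W T V R"
  show D: "category ?D" by (rule equivariant_category)
  have m: "F \<in> mor C W V" if "(F, \<tau>, \<epsilon>) \<in> Ob ?E" for F \<tau> \<epsilon>
    using that trivialized_equivariant equivariant_mor by blast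
  have hom: "x \<in> Hom ?E (F, \<tau>, \<epsilon>) (H, \<tau>', \<delta>) \<longleftrightarrow> x \<in> Hom ?D (F, \<tau>) (H, \<tau>') \<and>
    (\<forall>g\<in>carrier G. vc (trivc (single H) \<delta> g) (TCell W V (single F) (single H) (Some x)) =
      vc (wh [rho g] (TCell W V (single F) (single H) (Some x)) []) (trivc (single F) \<epsilon> g))"
    if "(F, \<tau>, \<epsilon>) \<in> Ob ?E" "(H, \<tau>', \<delta>) \<in> Ob ?E" for F \<tau> \<epsilon> H \<tau>' \<delta> x
    using trivialized_hom_iff[of "single F" "single H" \<tau> \<epsilon> \<tau>' \<delta> x] that m by simp
  fix u v w x y
  assume u: "u \<in> Ob ?E"
  obtain F \<tau> \<epsilon> where F: "u = (F, \<tau>, \<epsilon>)" "(F, \<tau>, \<epsilon>) \<in> Ob ?E" using u by (cases u) auto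
  have F': "(F, \<tau>) \<in> Ob ?D" using trivialized_equivariant[OF F(2)] .
  show "(case u of (F, \<tau>, \<epsilon>) \<Rightarrow> (F, \<tau>)) \<in> Ob ?D" using F' F(1) by simp
  have Id: "Id ?D (F, \<tau>) = id2 C F" by (simp add: equivariant_cat_def)
  show "Id ?E u = Id ?D (case u of (F, \<tau>, \<epsilon>) \<Rightarrow> (F, \<tau>))" using F(1) Id by (simp add: trivialized_cat_def)
  show "Id ?D (case u of (F, \<tau>, \<epsilon>) \<Rightarrow> (F, \<tau>)) \<in> Hom ?E u u"
  proof -
    have "TCell W V (single F) (single F) (Some (id2 C F)) = idc V (single F) W" by (simp add: idc_def)
    moreover have "ok (trivc (single F) \<epsilon> g)" if "g \<in> carrier G" for g
      using trivialized_iff[of "single F" \<tau> \<epsilon>] F(2) m[OF F(2)] that by simp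
    ultimately show ?thesis
      using F m[OF F(2)] category_idI[OF D F'] Id by (simp add: hom)
  qed
  assume v: "v \<in> Ob ?E" and x: "x \<in> Hom ?E u v"
  obtain H \<tau>' \<delta> where H: "v = (H, \<tau>', \<delta>)" "(H, \<tau>', \<delta>) \<in> Ob ?E" using v by (cases v) auto
  have H': "(H, \<tau>') \<in> Ob ?D" using trivialized_equivariant[OF H(2)] .
  have x': "x \<in> Hom ?D (F, \<tau>) (H, \<tau>')" using x F H by (simp add: hom)
  show "x \<in> Hom ?D (case u of (F, \<tau>, \<epsilon>) \<Rightarrow> (F, \<tau>)) (case v of (F, \<tau>, \<epsilon>) \<Rightarrow> (F, \<tau>))"
    using x' F(1) H(1) by simp
  assume w: "w \<in> Ob ?E" and y: "y \<in> Hom ?E v w"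
  obtain L \<tau>'' \<delta>' where L: "w = (L, \<tau>'', \<delta>')" "(L, \<tau>'', \<delta>') \<in> Ob ?E" using w by (cases w) auto
  have L': "(L, \<tau>'') \<in> Ob ?D" using trivialized_equivariant[OF L(2)] .
  have y': "y \<in> Hom ?D (H, \<tau>') (L, \<tau>'')" using y H L by (simp add: hom)
  have Cmp: "Cmp ?D y x = y \<cdot> x" by (simp add: equivariant_cat_def)
  have yx: "y \<cdot> x \<in> Hom ?D (F, \<tau>) (L, \<tau>'')"
    using category_closed[OF D F' H' L' x' y'] Cmp by simp
  define cx cy where "cx = TCell W V (single F) (single H) (Some x)"
    and "cy = TCell W V (single H) (single L) (Some y)"
  have c: "ok cx" "ok cy"
    using x' y' equivariant_hom_iff[of "single F" "single H" \<tau> \<tau>' x]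
        equivariant_hom_iff[of "single H" "single L" \<tau>' \<tau>'' y]
      F' H' L' m[OF F(2)] m[OF H(2)] m[OF L(2)] by (simp_all add: cx_def cy_def)
  have xy: "TCell W V (single F) (single L) (Some (y \<cdot> x)) = vc cy cx"
    using c by (simp add: vc_def) (simp add: cx_def cy_def)
  show "Cmp ?D y x \<in> Hom ?E u w"
    unfolding Cmp F(1) L(1) hom[OF F(2) L(2)] xy
  proof (intro conjI ballI)
    show "y \<cdot> x \<in> Hom ?D (F, \<tau>) (L, \<tau>'')" by (rule yx)
    fix g assume g: "g \<in> carrier G"
    have ex: "vc (trivc (single H) \<delta> g) cx = vc (wh [rho g] cx []) (trivc (single F) \<epsilon> g)"
      and ey: "vc (trivc (single L) \<delta>' g) cy = vc (wh [rho g] cy []) (trivc (single H) \<delta> g)"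
      using x y g F H L by (simp_all add: hom cx_def cy_def)
    show "vc (trivc (single L) \<delta>' g) (vc cy cx) = vc (wh [rho g] (vc cy cx) []) (trivc (single F) \<epsilon> g)"
      by (simp add: vc_head[OF ey] ex)
  qed
qed (simp add: equivariant_cat_def trivialized_cat_def)

end


context regular_sum
begin

text \<open>
  The summand \<open>t\<close> in which \<open>s \<rho>(h)\<close> arrives is described by an equation instead of the formula
  \<open>t = s h s\<^sup>-\<^sup>1\<close>; this avoids computations with inverses in the calculations below.
\<close>

lemma flip_on_summand:
  assumes "s \<in> carrier G" "h \<in> carrier G" "t \<in> carrier G" "t \<diamondop> s = s \<diamondop> h"
  shows "vc (flip_cell s) (wh [rho s] (inc_cell h) []) =
    vc (wh [] (inc_cell t) [rho s]) (vc (invc (phi_cell t s)) (phi_cell s h))"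
proof -
  have "t = s \<diamondop> h \<diamondop> ginv s" using assms G.inv_solve_right[of t "s \<diamondop> h" s] by simp
  then show ?thesis using flip_inc[OF assms(1,2)] by simp
qed

lemma triv_on_summand:
  assumes "g \<in> carrier G" "m \<in> carrier G"
  shows "vc (triv_cell g) (inc_cell (g \<diamondop> m)) = vc (wh [rho g] (inc_cell m) []) (invc (phi_cell g m))"
  using triv_inc[of g "g \<diamondop> m"] assms by simp

text \<open>
  Both sides are composites of \<open>\<phi>\<close> and its inverse from \<open>\<rho>(g) \<rho>(h) \<rho>(k)\<close> to \<open>\<rho>(t) \<rho>(g h)\<close>. Followed
  by \<open>\<phi>\<close>, each becomes the canonical map to \<open>\<rho>(g h k)\<close>.
\<close>

lemma flip_mult_core:
  assumes c: "g \<in> carrier G" "h \<in> carrier G" "k \<in> carrier G" "t \<in> carrier G" "t' \<in> carrier G"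
    and tg: "t \<diamondop> g = g \<diamondop> t'" and th: "t' \<diamondop> h = h \<diamondop> k"
  shows "vc (wh [rho t] (phi_cell g h) []) (vc (wh [] (invc (phi_cell t g)) [rho h])
      (vc (wh [] (phi_cell g t') [rho h]) (vc (wh [rho g] (invc (phi_cell t' h)) []) (wh [rho g] (phi_cell h k) []))))
          =
    vc (invc (phi_cell t (g \<diamondop> h))) (vc (phi_cell (g \<diamondop> h) k) (wh [] (phi_cell g h) [rho k]))"
    (is "?x = ?y")
proof (rule vc_left_cancel[of "phi_cell t (g \<diamondop> h)"])
  have tgh: "t \<diamondop> (g \<diamondop> h) = g \<diamondop> (h \<diamondop> k)"
    using c G.m_assoc[of t g h] G.m_assoc[of g t' h] tg th by (simp del: group_simps)
  have a1: "vc (phi_cell t (g \<diamondop> h)) (wh [rho t] (phi_cell g h) []) = vc (phi_cell (g \<diamondop> t') h)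
      (wh [] (phi_cell t g) [rho h])"
    using phi_assoc[of t g h] c tg by simp
  have a2: "vc (phi_cell (g \<diamondop> t') h) (wh [] (phi_cell g t') [rho h]) = vc (phi_cell g (h \<diamondop> k))
      (wh [rho g] (phi_cell t' h) [])"
    using phi_assoc[of g t' h] c th by simp
  have a3: "vc (phi_cell g (h \<diamondop> k)) (wh [rho g] (phi_cell h k) []) = vc (phi_cell (g \<diamondop> h) k)
      (wh [] (phi_cell g h) [rho k])"
    using phi_assoc[of g h k] c by simp
  show "vc (phi_cell t (g \<diamondop> h)) ?x = vc (phi_cell t (g \<diamondop> h)) ?y"
    using c by (simp add: tgh tg th a1 a2 a3 vc_head[OF a1] vc_head[OF a2])
  show "ok (vc (phi_cell t (g \<diamondop> h)) ?x)" "ok (vc (phi_cell t (g \<diamondop> h)) ?y)"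
    using c by (simp_all add: tgh tg th)
  show "invertible (phi_cell t (g \<diamondop> h))" using c by simp
qed

lemma flip_mult:
  assumes g: "g \<in> carrier G" and h: "h \<in> carrier G"
  shows "vc (flip_cell (g \<diamondop> h)) (wh [] (phi_cell g h) A) =
    vc (wh A (phi_cell g h) []) (vc (wh [] (flip_cell g) [rho h]) (wh [rho g] (flip_cell h) []))"
proof (rule eq_on_inc[where l = "[rho g, rho h]" and r = "[]"])
  fix k assume k: "k \<in> carrier G"
  define t' where "t' = h \<diamondop> k \<diamondop> ginv h"
  define t where "t = g \<diamondop> t' \<diamondop> ginv g"
  have t: "t \<in> carrier G" "t' \<in> carrier G" and th: "t' \<diamondop> h = h \<diamondop> k" and tg: "t \<diamondop> g = g \<diamondop> t'"
    using g h k by (simp_all add: t_def t'_def)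
  have tgh: "t \<diamondop> (g \<diamondop> h) = (g \<diamondop> h) \<diamondop> k"
    using g h k t G.m_assoc[of t g h] G.m_assoc[of g t' h] G.m_assoc[of g h k] tg th by (simp del: group_simps)
  note c = g h k t
  have e1: "vc (wh [] (phi_cell g h) A) (wh [rho g, rho h] (inc_cell k) []) =
    vc (wh [rho (g \<diamondop> h)] (inc_cell k) []) (wh [] (phi_cell g h) [rho k])"
    using exchange[of "phi_cell g h" "inc_cell k" "[]" "[]" "[]"] c by simp
  have e3: "vc (wh [rho g] (flip_cell h) []) (wh [rho g, rho h] (inc_cell k) []) =
    vc (wh [rho g] (inc_cell t') [rho h]) (vc (wh [rho g] (invc (phi_cell t' h)) []) (wh [rho g] (phi_cell h k) []))"
    using arg_cong[OF flip_on_summand[OF h k t(2) th], of "\<lambda>x. wh [rho g] x []"] by simp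
  have e4: "vc (wh [] (flip_cell g) [rho h]) (wh [rho g] (inc_cell t') [rho h]) =
    vc (wh [] (inc_cell t) [rho g, rho h]) (vc (wh [] (invc (phi_cell t g)) [rho h]) (wh [] (phi_cell g t') [rho h]))"
    using arg_cong[OF flip_on_summand[OF g t(2) t(1) tg], of "\<lambda>x. wh [] x [rho h]"] by simp
  have e5: "vc (wh A (phi_cell g h) []) (wh [] (inc_cell t) [rho g, rho h]) =
    vc (wh [] (inc_cell t) [rho (g \<diamondop> h)]) (wh [rho t] (phi_cell g h) [])"
    using exchange[of "inc_cell t" "phi_cell g h" "[]" "[]" "[]"] c by simp
  show "vc (vc (flip_cell (g \<diamondop> h)) (wh [] (phi_cell g h) A)) (wh [rho g, rho h] (inc_cell k) []) =
    vc (vc (wh A (phi_cell g h) []) (vc (wh [] (flip_cell g) [rho h]) (wh [rho g] (flip_cell h) [])))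
      (wh [rho g, rho h] (inc_cell k) [])"
    using flip_mult_core[OF c tg th]
    by (simp add: e1 vc_head[OF flip_on_summand[OF G.m_closed[OF g h] k t(1) tgh]] e3 vc_head[OF e4] vc_head[OF e5])
qed (use g h in \<open>simp_all add: path_append\<close>)

lemma flip_one: "flip_cell \<one>\<^bsub>G\<^esub> = vc (invc (wh A phi1_cell [])) (wh [] phi1_cell A)"
proof (rule eq_on_inc[where l = "[rho \<one>\<^bsub>G\<^esub>]" and r = "[]"])
  fix h assume h: "h \<in> carrier G"
  have e1: "vc (wh [] phi1_cell A) (wh [rho \<one>\<^bsub>G\<^esub>] (inc_cell h) []) = vc (inc_cell h) (wh [] phi1_cell [rho h])"
    using exchange[of phi1_cell "inc_cell h" "[]" "[]" "[]"] h by simp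
  have e2: "vc (wh A (invc phi1_cell) []) (inc_cell h) = vc (wh [] (inc_cell h) [rho \<one>\<^bsub>G\<^esub>])
      (wh [rho h] (invc phi1_cell) [])"
    using exchange[of "inc_cell h" "invc phi1_cell" "[]" "[]" "[]"] h by simp
  show "vc (flip_cell \<one>\<^bsub>G\<^esub>) (wh [rho \<one>\<^bsub>G\<^esub>] (inc_cell h) []) =
    vc (vc (invc (wh A phi1_cell [])) (wh [] phi1_cell A)) (wh [rho \<one>\<^bsub>G\<^esub>] (inc_cell h) [])"
    using flip_on_summand[of "\<one>\<^bsub>G\<^esub>" h h] h phi_one[OF h] by (simp add: e1 vc_head[OF e2])
qed simp_all

lemma triv_mult:
  assumes g: "g \<in> carrier G" and h: "h \<in> carrier G"
  shows "vc (wh [] (phi_cell g h) A) (vc (wh [rho g] (triv_cell h) []) (triv_cell g)) = triv_cell (g \<diamondop> h)"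
proof (rule eq_on_inc[where l = "[]" and r = "[]"])
  fix k assume k: "k \<in> carrier G"
  define m where "m = ginv (g \<diamondop> h) \<diamondop> k"
  have m: "m \<in> carrier G" and km: "k = g \<diamondop> (h \<diamondop> m)" using g h k by (simp_all add: m_def)
  note c = g h m
  have e1: "vc (wh [rho g] (triv_cell h) []) (wh [rho g] (inc_cell (h \<diamondop> m)) []) =
    vc (wh [rho g, rho h] (inc_cell m) []) (wh [rho g] (invc (phi_cell h m)) [])"
    using arg_cong[OF triv_on_summand[OF h m], of "\<lambda>x. wh [rho g] x []"] by simp
  have e2: "vc (wh [] (phi_cell g h) A) (wh [rho g, rho h] (inc_cell m) []) =
    vc (wh [rho (g \<diamondop> h)] (inc_cell m) []) (wh [] (phi_cell g h) [rho m])"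
    using exchange[of "phi_cell g h" "inc_cell m" "[]" "[]" "[]"] c by simp
  have e3: "vc (wh [] (phi_cell g h) [rho m]) (vc (wh [rho g] (invc (phi_cell h m)) []) (invc (phi_cell g (h \<diamondop> m)))) =
    invc (phi_cell (g \<diamondop> h) m)"
    by (rule vc_left_cancel[of "phi_cell (g \<diamondop> h) m"]) (use c phi_assoc[OF c] in \<open>simp_all add: vc_head[OF phi_assoc]\<close>)
  show "vc (vc (wh [] (phi_cell g h) A) (vc (wh [rho g] (triv_cell h) []) (triv_cell g))) (wh [] (inc_cell k) []) =
    vc (triv_cell (g \<diamondop> h)) (wh [] (inc_cell k) [])"
    using triv_on_summand[of g "h \<diamondop> m"] triv_on_summand[of "g \<diamondop> h" m] c
    by (simp add: km vc_head[OF e1] vc_head[OF e2] e3)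
qed (use g h in simp_all)

text \<open>
  Again, followed by \<open>\<phi>\<close> both sides become canonical maps, this time from \<open>\<rho>(s) \<rho>(g m)\<close> to
  \<open>\<rho>(s g m)\<close>.
\<close>

lemma compat_core:
  assumes c: "s \<in> carrier G" "g \<in> carrier G" "t \<in> carrier G" "m \<in> carrier G" "n \<in> carrier G"
    and ts: "t \<diamondop> s = s \<diamondop> g" and ns: "n \<diamondop> s = s \<diamondop> m"
  shows "vc (wh [] (phi_cell t s) [rho m]) (vc (wh [rho t] (invc (phi_cell s m)) [])
      (vc (wh [rho t] (phi_cell n s) [])
      (vc (wh [] (invc (phi_cell t n)) [rho s]) (vc (invc (phi_cell (t \<diamondop> n) s)) (phi_cell s (g \<diamondop> m)))))) =
    vc (wh [] (phi_cell s g) [rho m]) (wh [rho s] (invc (phi_cell g m)) [])"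
    (is "?x = ?y")
proof (rule vc_left_cancel[of "phi_cell (s \<diamondop> g) m"])
  have tns: "t \<diamondop> (s \<diamondop> m) = s \<diamondop> (g \<diamondop> m)"
    using c G.m_assoc[of t s m] G.m_assoc[of s g m] ts by (simp del: group_simps)
  have a1: "vc (phi_cell (s \<diamondop> g) m) (wh [] (phi_cell t s) [rho m]) = vc (phi_cell t (s \<diamondop> m))
      (wh [rho t] (phi_cell s m) [])"
    using phi_assoc[of t s m] c ts by simp
  have a2: "vc (phi_cell t (s \<diamondop> m)) (wh [rho t] (phi_cell n s) []) = vc (phi_cell (t \<diamondop> n) s)
      (wh [] (phi_cell t n) [rho s])"
    using phi_assoc[of t n s] c ns by simp
  have a3: "vc (phi_cell (s \<diamondop> g) m) (wh [] (phi_cell s g) [rho m]) = vc (phi_cell s (g \<diamondop> m))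
      (wh [rho s] (phi_cell g m) [])"
    using phi_assoc[of s g m] c by simp
  show "vc (phi_cell (s \<diamondop> g) m) ?x = vc (phi_cell (s \<diamondop> g) m) ?y"
    using c by (simp add: ts ns tns vc_head[OF a1] vc_head[OF a2] vc_head[OF a3])
  show "ok (vc (phi_cell (s \<diamondop> g) m) ?x)" "ok (vc (phi_cell (s \<diamondop> g) m) ?y)"
    using c by (simp_all add: ts ns tns)
  show "invertible (phi_cell (s \<diamondop> g) m)" using c by simp
qed

lemma flip_triv_compat:
  assumes s: "s \<in> carrier G" and g: "g \<in> carrier G" and t: "t \<in> carrier G" and ts: "t \<diamondop> s = s \<diamondop> g"
  shows "vc (wh [] (phi_cell s g) A) (vc (wh [rho s] (triv_cell g) []) (invc (flip_cell s))) =
    vc (wh [] (phi_cell t s) A) (vc (wh [rho t] (invc (flip_cell s)) []) (wh [] (triv_cell t) [rho s]))"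
    (is "?x = ?y")
proof (rule vc_right_cancel[of "flip_cell s"])
  show "vc ?x (flip_cell s) = vc ?y (flip_cell s)"
  proof (rule eq_on_inc[where l = "[rho s]" and r = "[]"])
    fix h assume h: "h \<in> carrier G"
    define m where "m = ginv g \<diamondop> h"
    define n where "n = s \<diamondop> m \<diamondop> ginv s"
    have m: "m \<in> carrier G" and hm: "h = g \<diamondop> m" using g h by (simp_all add: m_def)
    have n: "n \<in> carrier G" and ns: "n \<diamondop> s = s \<diamondop> m" using s m by (simp_all add: n_def)
    have tns: "t \<diamondop> (s \<diamondop> m) = s \<diamondop> (g \<diamondop> m)"
      using s g m t G.m_assoc[of t s m] G.m_assoc[of s g m] ts by (simp del: group_simps)
    then have tns': "(t \<diamondop> n) \<diamondop> s = s \<diamondop> (g \<diamondop> m)" using s g m n t ns by simp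
    note c = s g t m n
    have e1: "vc (flip_cell s) (wh [rho s] (inc_cell h) []) =
      vc (wh [] (inc_cell (t \<diamondop> n)) [rho s]) (vc (invc (phi_cell (t \<diamondop> n) s)) (phi_cell s (g \<diamondop> m)))"
      using flip_on_summand[OF s h G.m_closed[OF t n]] tns' hm by simp
    have e2: "vc (wh [] (triv_cell t) [rho s]) (wh [] (inc_cell (t \<diamondop> n)) [rho s]) =
      vc (wh [rho t] (inc_cell n) [rho s]) (wh [] (invc (phi_cell t n)) [rho s])"
      using arg_cong[OF triv_on_summand[OF t n], of "\<lambda>x. wh [] x [rho s]"] by simp
    have "vc (invc (flip_cell s)) (wh [] (inc_cell n) [rho s]) =
      vc (wh [rho s] (inc_cell m) []) (vc (invc (phi_cell s m)) (phi_cell n s))"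
    proof (rule vc_left_cancel[of "flip_cell s"])
      show "vc (flip_cell s) (vc (invc (flip_cell s)) (wh [] (inc_cell n) [rho s])) =
        vc (flip_cell s) (vc (wh [rho s] (inc_cell m) []) (vc (invc (phi_cell s m)) (phi_cell n s)))"
        using c ns by (simp add: vc_head[OF flip_on_summand[OF s m n ns]])
    qed (use c ns in simp_all)
    then have e3: "vc (wh [rho t] (invc (flip_cell s)) []) (wh [rho t] (inc_cell n) [rho s]) =
      vc (wh [rho t, rho s] (inc_cell m) []) (vc (wh [rho t] (invc (phi_cell s m)) [])
          (wh [rho t] (phi_cell n s) []))"
      by (auto dest: arg_cong[of _ _ "\<lambda>x. wh [rho t] x []"])
    have e4: "vc (wh [] (phi_cell t s) A) (wh [rho t, rho s] (inc_cell m) []) =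
      vc (wh [rho (s \<diamondop> g)] (inc_cell m) []) (wh [] (phi_cell t s) [rho m])"
      using exchange[of "phi_cell t s" "inc_cell m" "[]" "[]" "[]"] c ts by simp
    have e5: "vc (wh [rho s] (triv_cell g) []) (wh [rho s] (inc_cell h) []) =
      vc (wh [rho s, rho g] (inc_cell m) []) (wh [rho s] (invc (phi_cell g m)) [])"
      using arg_cong[OF triv_on_summand[OF g m], of "\<lambda>x. wh [rho s] x []"] hm by simp
    have e6: "vc (wh [] (phi_cell s g) A) (wh [rho s, rho g] (inc_cell m) []) =
      vc (wh [rho (s \<diamondop> g)] (inc_cell m) []) (wh [] (phi_cell s g) [rho m])"
      using exchange[of "phi_cell s g" "inc_cell m" "[]" "[]" "[]"] c by simp
    show "vc (vc ?x (flip_cell s)) (wh [rho s] (inc_cell h) []) = vc (vc ?y (flip_cell s))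
        (wh [rho s] (inc_cell h) [])"
      using c h compat_core[OF s g t m n ts ns]
      by (simp add: e5 vc_head[OF e6] e1 vc_head[OF e2] vc_head[OF e3] vc_head[OF e4])
  qed (use s g t ts in \<open>simp_all add: path_append\<close>)
qed (use s g t ts in \<open>simp_all add: path_append\<close>)

text \<open>
  The flips of \<open>A\<close> and its trivialization are characterized by their restrictions to the summands, so
  that they can be recognized after transport along an isomorphism.
\<close>

lemma flip_cell_unique:
  assumes s: "s \<in> carrier G" and x: "ok x" "tdom x = V" "tcod x = V" "tsrc x = rho s # A" "ttgt x = A @ [rho s]"
    and eq: "\<And>h t. h \<in> carrier G \<Longrightarrow> t \<in> carrier G \<Longrightarrow> t \<diamondop> s = s \<diamondop> h \<Longrightarrow>
      vc x (wh [rho s] (inc_cell h) []) = vc (wh [] (inc_cell t) [rho s]) (vc (invc (phi_cell t s)) (phi_cell s h))"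
  shows "x = flip_cell s"
proof (rule eq_on_inc[where l = "[rho s]" and r = "[]"])
  fix h assume h: "h \<in> carrier G"
  define t where "t = s \<diamondop> h \<diamondop> ginv s"
  have "t \<in> carrier G" "t \<diamondop> s = s \<diamondop> h" using s h by (simp_all add: t_def)
  then show "vc x (wh [rho s] (inc_cell h) []) = vc (flip_cell s) (wh [rho s] (inc_cell h) [])"
    using eq[OF h] flip_on_summand[OF s h] by simp
qed (use s x in simp_all)

lemma triv_cell_unique:
  assumes g: "g \<in> carrier G" and x: "ok x" "tdom x = V" "tcod x = V" "tsrc x = A" "ttgt x = rho g # A"
    and eq: "\<And>m. m \<in> carrier G \<Longrightarrow>
      vc x (inc_cell (g \<diamondop> m)) = vc (wh [rho g] (inc_cell m) []) (invc (phi_cell g m))"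
  shows "x = triv_cell g"
proof (rule eq_on_inc[where l = "[]" and r = "[]"])
  fix k assume k: "k \<in> carrier G"
  have "k = g \<diamondop> (ginv g \<diamondop> k)" "ginv g \<diamondop> k \<in> carrier G" using g k by simp_all
  then show "vc x (wh [] (inc_cell k) []) = vc (triv_cell g) (wh [] (inc_cell k) [])"
    using eq[of "ginv g \<diamondop> k"] triv_on_summand[OF g, of "ginv g \<diamondop> k"] k by simp
qed (use g x in simp_all)

sublocale pair: representation_pair K C G V R V R ..

lemma regular_sum_trivialized:
  "(composite V A, flips_A, triv_A)
    \<in> Ob (trivialized_cat C G V R V R)"
proof -
  have f: "pair.flipc A (flips_A) = flip_cell"
    "pair.trivc A (triv_A) = triv_cell"
    by (auto simp: pair.flipc_def pair.trivc_def flip_cell_def triv_cell_def)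
  have "(composite V A, flips_A) \<in> Ob (equivariant_cat C G V R V R)"
    unfolding pair.equivariant_iff[OF path_A] f
    using flip_mult flip_one by (auto simp: A_flips_def)
  moreover have "triv_A \<in> extensional (carrier G)"
    by (simp add: A_triv_def)
  moreover have "let t = s \<diamondop> g \<diamondop> ginv s in
      vc (wh [] (phi_cell s g) A) (vc (wh [rho s] (triv_cell g) []) (invc (flip_cell s))) =
      vc (wh [] (phi_cell t s) A) (vc (wh [rho t] (invc (flip_cell s)) []) (wh [] (triv_cell t) [rho s]))"
    if "s \<in> carrier G" "g \<in> carrier G" for s g
    using flip_triv_compat[of s g "s \<diamondop> g \<diamondop> ginv s"] that by (simp add: Let_def)
  ultimately show ?thesis
    unfolding pair.trivialized_iff[OF path_A] f using triv_mult by auto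
qed

end


section \<open>The fixed object\<close>

text \<open>
  The qualifiers \<open>to_V\<close>, \<open>from_V\<close> and \<open>endo\<close> mark the facts about equivariant 1-morphisms from \<open>V\<^sup>G\<close> to \<open>V\<close>,
  from \<open>V\<close> to \<open>V\<^sup>G\<close> and from \<open>V\<^sup>G\<close> to itself.
\<close>

locale fixed_object = two_representation K C G V R + S: two_representation K C G VG S
  for K :: "'k ring" and C :: "('o, 'm, 'c, 'k) two_cat" (structure) and G :: "'g monoid" and V R VG S +
  fixes \<epsilon> :: "'g \<Rightarrow> 'c" and U :: 'm and \<tau>U :: "'g \<Rightarrow> 'c"
  assumes fixed: "is_fixed_object C G V R VG S \<epsilon> U \<tau>U"
begin

sublocale to_V: representation_pair K C G V R VG S ..
sublocale endo: representation_pair K C G VG S VG S ..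

abbreviation "postU \<equiv> post_U C G R S \<epsilon> U \<tau>U"
abbreviation "endo_fl F \<equiv> endo_flips C G VG S \<epsilon> F"
abbreviation u :: "('o, 'm) arrow" where "u \<equiv> (VG, V, U)"

definition eps_cell :: "'g \<Rightarrow> ('o, 'm, 'c) tcell" where
  "eps_cell g = TCell VG VG [] [S.rho g] (Some (\<epsilon> g))"

definition tau_cell :: "'g \<Rightarrow> ('o, 'm, 'c) tcell" where
  "tau_cell g = TCell VG V [rho g, u] [u, S.rho g] (Some (\<tau>U g))"

lemma eps_tau_sel [simp]:
  "tdom (eps_cell g) = VG" "tcod (eps_cell g) = VG" "tsrc (eps_cell g) = []" "ttgt (eps_cell g) = [S.rho g]"
  "tdom (tau_cell g) = VG" "tcod (tau_cell g) = V" "tsrc (tau_cell g) = [rho g, u]" "ttgt (tau_cell g) = [u, S.rho g]"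
  "val (eps_cell g) = \<epsilon> g" "val (tau_cell g) = \<tau>U g"
  by (simp_all add: eps_cell_def tau_cell_def)

lemma id_trivialized: "(id1 C VG, id_flips C G S, \<epsilon>) \<in> Ob (trivialized_cat C G VG S VG S)"
  and U_equivariant: "(U, \<tau>U) \<in> Ob (equivariant_cat C G VG S V R)"
  and post_U_equivalence: "is_two_rep C G W T \<Longrightarrow>
    equivalence (equivariant_cat C G W T VG S) (trivialized_cat C G W T V R)
        (postU) (\<lambda>_ _ x. U \<triangleright> x)"
  using fixed by (simp_all add: is_fixed_object_def)

lemma U_mor [simp]: "U \<in> mor C VG V"
  using to_V.equivariant_mor[OF U_equivariant] .

lemma eps_facts:
  shows invertible_eps [simp]: "g \<in> carrier G \<Longrightarrow> invertible (eps_cell g)"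
    and eps_mult: "g \<in> carrier G \<Longrightarrow> h \<in> carrier G \<Longrightarrow>
      vc (S.phi_cell g h) (vc (wh [S.rho g] (eps_cell h) []) (eps_cell g)) = eps_cell (g \<diamondop> h)"
proof -
  have e: "endo.trivc [] \<epsilon> = eps_cell" by (auto simp: endo.trivc_def eps_cell_def)
  have "(composite VG [], id_flips C G S, \<epsilon>) \<in> Ob (trivialized_cat C G VG S VG S)"
    using id_trivialized by simp
  then have *: "\<forall>g\<in>carrier G. invertible (eps_cell g)"
    "\<forall>g\<in>carrier G. \<forall>h\<in>carrier G. vc (wh [] (S.phi_cell g h) []) (vc (wh [S.rho g] (eps_cell h) []) (eps_cell g)) =
        eps_cell (g \<diamondop> h)"
    by (subst (asm) endo.trivialized_iff; simp add: e)+
  show "g \<in> carrier G \<Longrightarrow> invertible (eps_cell g)" using * by blast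
  show "g \<in> carrier G \<Longrightarrow> h \<in> carrier G \<Longrightarrow>
      vc (S.phi_cell g h) (vc (wh [S.rho g] (eps_cell h) []) (eps_cell g)) = eps_cell (g \<diamondop> h)"
    using * by simp
qed

lemma tau_facts:
  shows invertible_tau [simp]: "g \<in> carrier G \<Longrightarrow> invertible (tau_cell g)"
    and tau_mult: "g \<in> carrier G \<Longrightarrow> h \<in> carrier G \<Longrightarrow> vc (tau_cell (g \<diamondop> h)) (wh [] (phi_cell g h) [u]) =
      vc (wh [u] (S.phi_cell g h) []) (vc (wh [] (tau_cell g) [S.rho h]) (wh [rho g] (tau_cell h) []))"
    and tau_one: "tau_cell \<one>\<^bsub>G\<^esub> = vc (wh [u] (invc S.phi1_cell) []) (wh [] phi1_cell [u])"
proof -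
  have e: "to_V.flipc [u] \<tau>U = tau_cell" by (auto simp: to_V.flipc_def tau_cell_def)
  have "(composite VG [u], \<tau>U) \<in> Ob (equivariant_cat C G VG S V R)"
    using U_equivariant by simp
  then have *: "\<forall>g\<in>carrier G. invertible (tau_cell g)"
    "\<forall>g\<in>carrier G. \<forall>h\<in>carrier G. vc (tau_cell (g \<diamondop> h)) (wh [] (phi_cell g h) [u]) =
      vc (wh [u] (S.phi_cell g h) []) (vc (wh [] (tau_cell g) [S.rho h]) (wh [rho g] (tau_cell h) []))"
    "tau_cell \<one>\<^bsub>G\<^esub> = vc (wh [u] (invc S.phi1_cell) []) (wh [] phi1_cell [u])"
    by (subst (asm) to_V.equivariant_iff; simp add: e)+
  show "g \<in> carrier G \<Longrightarrow> invertible (tau_cell g)" using * by blast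
  show "g \<in> carrier G \<Longrightarrow> h \<in> carrier G \<Longrightarrow> vc (tau_cell (g \<diamondop> h)) (wh [] (phi_cell g h) [u]) =
      vc (wh [u] (S.phi_cell g h) []) (vc (wh [] (tau_cell g) [S.rho h]) (wh [rho g] (tau_cell h) []))"
    using * by blast
  show "tau_cell \<one>\<^bsub>G\<^esub> = vc (wh [u] (invc S.phi1_cell) []) (wh [] phi1_cell [u])"
    using * by blast
qed

text \<open>
  Multiplicativity of \<open>\<epsilon>\<close> at \<open>(1, 1)\<close> gives \<open>\<epsilon>\<^sub>1 \<circ> (\<phi>\<^sub>1 \<circ> \<epsilon>\<^sub>1) = \<epsilon>\<^sub>1\<close>, after an exchange, and \<open>\<epsilon>\<^sub>1\<close>
  is invertible.
\<close>

lemma eps_one: "eps_cell \<one>\<^bsub>G\<^esub> = invc S.phi1_cell"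
proof -
  let ?e = "eps_cell \<one>\<^bsub>G\<^esub>"
  define x where "x = vc S.phi1_cell ?e"
  have x: "ok x" "tdom x = VG" "tcod x = VG" "tsrc x = []" "ttgt x = []" by (simp_all add: x_def)
  have "vc ?e x = vc (wh [S.rho \<one>\<^bsub>G\<^esub>] x []) ?e"
    using exchange[of ?e x "[]" "[]" "[]"] x by simp
  also have "\<dots> = ?e"
    using eps_mult[of "\<one>\<^bsub>G\<^esub>" "\<one>\<^bsub>G\<^esub>"] S.phi_one(2)[of "\<one>\<^bsub>G\<^esub>"] by (simp add: x_def)
  finally have "vc ?e x = vc ?e (idc VG [] VG)" using x by simp
  moreover have "ok (vc ?e x)" "ok (vc ?e (idc VG [] VG))" using x by simp_all
  ultimately have "x = idc VG [] VG" using vc_left_cancel[of ?e] by simp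
  then have "vc (invc S.phi1_cell) x = invc S.phi1_cell" by simp
  then show ?thesis by (simp add: x_def)
qed

text \<open>
  The trivialization \<open>\<upsilon>\<^sub>g\<close> of \<open>U\<close>.
\<close>

definition ups :: "'g \<Rightarrow> ('o, 'm, 'c) tcell" where
  "ups g = vc (invc (tau_cell g)) (wh [u] (eps_cell g) [])"

lemma ups_sel [simp]: "tdom (ups g) = VG" "tcod (ups g) = V" "tsrc (ups g) = [u]" "ttgt (ups g) = [rho g, u]"
  by (simp_all add: ups_def)

lemma invertible_ups [simp]: "g \<in> carrier G \<Longrightarrow> invertible (ups g)"
  by (simp add: ups_def)

lemma val_ups: "g \<in> carrier G \<Longrightarrow> val (ups g) = upsilon C R S \<epsilon> U \<tau>U g"
  by (simp add: ups_def val_simps upsilon_def whisker_left_def)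

lemma tau_ups: "g \<in> carrier G \<Longrightarrow> vc (tau_cell g) (ups g) = wh [u] (eps_cell g) []"
  by (simp add: ups_def)

lemma tau_eq: "g \<in> carrier G \<Longrightarrow> tau_cell g = vc (wh [u] (eps_cell g) []) (invc (ups g))"
  by (rule vc_right_cancel[of "ups g"]) (simp_all add: tau_ups)

text \<open>
  \<open>\<upsilon>\<close> inherits multiplicativity from \<open>\<epsilon>\<close> and the flips of \<open>U\<close>.
\<close>

lemma ups_mult:
  assumes g: "g \<in> carrier G" and h: "h \<in> carrier G"
  shows "vc (wh [] (phi_cell g h) [u]) (vc (wh [rho g] (ups h) []) (ups g)) = ups (g \<diamondop> h)"
proof (rule vc_left_cancel[of "tau_cell (g \<diamondop> h)"])
  have e: "vc (wh [] (tau_cell g) [S.rho h]) (wh [rho g, u] (eps_cell h) []) =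
    vc (wh [u, S.rho g] (eps_cell h) []) (tau_cell g)"
    using exchange[of "tau_cell g" "eps_cell h" "[]" "[]" "[]"] g h by simp
  have t: "vc (tau_cell (g \<diamondop> h)) (ups (g \<diamondop> h)) =
    vc (wh [u] (S.phi_cell g h) []) (vc (wh [u, S.rho g] (eps_cell h) []) (wh [u] (eps_cell g) []))"
    using g h tau_ups[of "g \<diamondop> h"] arg_cong[OF eps_mult[OF g h], of "\<lambda>x. wh [u] x []"] by simp
  show "vc (tau_cell (g \<diamondop> h)) (vc (wh [] (phi_cell g h) [u]) (vc (wh [rho g] (ups h) []) (ups g))) =
    vc (tau_cell (g \<diamondop> h)) (ups (g \<diamondop> h))"
    unfolding t using g h by (simp add: vc_head[OF tau_mult] ups_def vc_head[OF e])
qed (use g h in simp_all)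

lemma ups_one: "ups \<one>\<^bsub>G\<^esub> = wh [] (invc phi1_cell) [u]"
  by (rule vc_left_cancel[of "tau_cell \<one>\<^bsub>G\<^esub>"])
    (simp_all add: tau_ups, simp add: tau_one eps_one)


subsection \<open>1-endomorphisms of the fixed object\<close>

context
  fixes p :: "('o, 'm) arrow list"
  assumes p: "path VG p VG"
begin

lemma p_simps: "path VG p VG" "left_end p VG = VG" "right_end VG p = VG" "composite VG p \<in> mor C VG VG"
  "composite VG (u # p) = U \<star> composite VG p"
  using p path_ends[OF p] composite_closed[OF p] composite_Cons_path[OF p] by auto

lemma endo_flip_cell:
  assumes g: "g \<in> carrier G"
  shows "endo.flipc p (endo_fl (composite VG p)) g =
    vc (wh p (eps_cell g) []) (wh [] (invc (eps_cell g)) p)" (is "?l = ?r")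
proof -
  have r: "ok ?r" using g p_simps by simp
  have v: "endo_fl (composite VG p) g = val ?r"
    using r g p_simps by (simp add: val_simps endo_flips_def whisker_left_def whisker_right_def)
  have "tval ?r = Some (val ?r)" using okD(8)[OF r] .
  then show ?thesis using v g by (simp add: tcell_eq_iff p_simps) (simp add: endo.flipc_def)
qed

text \<open>
  The flips \<open>(F \<epsilon>\<^sub>g) \<circ> (\<epsilon>\<^sub>g\<^sup>-\<^sup>1 F)\<close> satisfy the axioms because \<open>\<epsilon>\<^sub>g\<^sub>h\<close> can be written with \<open>\<epsilon>\<^sub>g\<close> and \<open>\<epsilon>\<^sub>h\<close> in
  either order.
\<close>

lemma endo_equivariant:
  "(composite VG p, endo_fl (composite VG p)) \<in> Ob (equivariant_cat C G VG S VG S)"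
proof -
  note [simp] = p_simps
  let ?f = "\<lambda>g. vc (wh p (eps_cell g) []) (wh [] (invc (eps_cell g)) p)"
  have inv: "invertible (?f g)" if "g \<in> carrier G" for g
    using that by simp
  have mult: "vc (?f (g \<diamondop> h)) (wh [] (S.phi_cell g h) p) =
      vc (wh p (S.phi_cell g h) []) (vc (wh [] (?f g) [S.rho h]) (wh [S.rho g] (?f h) []))"
    if g: "g \<in> carrier G" and h: "h \<in> carrier G" for g h
  proof -
    have e1: "eps_cell (g \<diamondop> h) = vc (S.phi_cell g h) (vc (wh [] (eps_cell g) [S.rho h]) (eps_cell h))"
      using eps_mult[OF g h] exchange[of "eps_cell g" "eps_cell h" "[]" "[]" "[]"] g h by simp
    have e2: "vc (invc (eps_cell (g \<diamondop> h))) (S.phi_cell g h) = vc (invc (eps_cell g))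
        (wh [S.rho g] (invc (eps_cell h)) [])"
      unfolding eps_mult[OF g h, symmetric] using g h by simp
    have e3: "vc (wh [] (invc (eps_cell (g \<diamondop> h))) p) (wh [] (S.phi_cell g h) p) =
      vc (wh [] (invc (eps_cell g)) p) (wh [S.rho g] (invc (eps_cell h)) p)"
      using arg_cong[OF e2, of "\<lambda>x. wh [] x p"] by simp
    have e4: "vc (wh [] (invc (eps_cell g)) (p @ [S.rho h])) (wh (S.rho g # p) (eps_cell h) []) =
      vc (wh p (eps_cell h) []) (wh [] (invc (eps_cell g)) p)"
      using exchange[of "invc (eps_cell g)" "eps_cell h" p "[]" "[]"] g h by simp
    show ?thesis using g h by (simp add: e3 vc_head[OF e4]) (simp add: e1)
  qed
  have one: "?f \<one>\<^bsub>G\<^esub> = vc (invc (wh p S.phi1_cell [])) (wh [] S.phi1_cell p)"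
    by (simp add: eps_one)
  have ext: "endo_fl (composite VG p) \<in> extensional (carrier G)"
    by (simp add: endo_flips_def)
  show ?thesis
    unfolding endo.equivariant_iff[OF p]
    using inv mult one ext by (simp add: endo_flip_cell)
qed

lemma U_endo_trivialized:
  shows "postU (composite VG p, endo_fl (composite VG p)) \<in> Ob (trivialized_cat C G VG S V R)"
  using post_U_equivalence[OF S.rep] endo_equivariant unfolding equivalence_def is_functor_def by blast

definition U_flips where "U_flips = fst (snd (postU (composite VG p, endo_fl (composite VG p))))"
definition U_triv where "U_triv = snd (snd (postU (composite VG p, endo_fl (composite VG p))))"

lemma post_U_endo: "postU (composite VG p, endo_fl (composite VG p)) =
    (composite VG (u # p), U_flips, U_triv)"
  by (simp add: post_U_def U_flips_def U_triv_def p_simps)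

text \<open>
  The flips of \<open>U F\<close> are determined by \<open>\<upsilon>\<close>, which is why commuting with \<open>\<upsilon>\<close> implies commuting with the
  flips.
\<close>

lemma U_endo_flip_cell:
  assumes g: "g \<in> carrier G"
  shows "to_V.flipc (u # p) U_flips g = vc (wh (u # p) (eps_cell g) []) (wh [] (invc (ups g)) p)"
proof -
  note [simp] = p_simps
  let ?f = "endo.flipc p (endo_fl (composite VG p)) g"
  let ?r = "vc (wh [u] ?f []) (wh [] (tau_cell g) p)"
  have f: "ok ?f" unfolding endo_flip_cell[OF g] using g by simp
  have r: "ok ?r" using g f by simp
  have v: "U_flips g = val ?r"
    using r g f by (simp add: val_simps U_flips_def post_U_def comp_flips_def whisker_left_def whisker_right_def)
  have "tval ?r = Some (val ?r)" using okD(8)[OF r] .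
  then have "to_V.flipc (u # p) U_flips g = ?r" using v g by (simp add: tcell_eq_iff) (simp add: to_V.flipc_def)
  also have "\<dots> = vc (wh (u # p) (eps_cell g) []) (wh [] (invc (ups g)) p)"
    using g by (simp add: endo_flip_cell) (simp add: tau_eq)
  finally show ?thesis .
qed

lemma U_endo_triv_cell:
  assumes g: "g \<in> carrier G"
  shows "to_V.trivc (u # p) U_triv g = wh [] (ups g) p"
proof -
  note [simp] = p_simps
  let ?r = "vc (wh [] (invc (tau_cell g)) p) (wh [u] (eps_cell g) p)"
  have r: "ok ?r" using g by simp
  have v: "U_triv g = val ?r"
    using r g by (simp add: val_vc val_invc val_wh_right val_wh[of "[u]"] U_triv_def post_U_def whisker_left_def
        whisker_right_def)
  have "tval ?r = Some (val ?r)" using okD(8)[OF r] .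
  then have "to_V.trivc (u # p) U_triv g = ?r" using v g by (simp add: tcell_eq_iff) (simp add: to_V.trivc_def)
  then show ?thesis by (simp add: ups_def)
qed

end

text \<open>
  Every 2-morphism between endomorphisms of \<open>V\<^sup>G\<close> is equivariant, and a 2-morphism \<open>U F \<Rightarrow> U H\<close>
  compatible with \<open>\<upsilon>\<close> is automatically compatible with the flips. The universal property
  therefore describes 2-morphisms \<open>F \<Rightarrow> H\<close> as the 2-morphisms \<open>U F \<Rightarrow> U H\<close> that commute with \<open>\<upsilon>\<close>.
\<close>

lemma endo_hom:
  assumes p: "path VG p VG" and q: "path VG q VG" and x: "ok (TCell VG VG p q (Some x))"
  shows "x \<in> Hom (equivariant_cat C G VG S VG S)
    (composite VG p, endo_fl (composite VG p))
    (composite VG q, endo_fl (composite VG q))"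
proof -
  note [simp] = p_simps[OF p] p_simps[OF q]
  let ?x = "TCell VG VG p q (Some x)"
  show ?thesis
    unfolding endo.equivariant_hom_iff[OF p q endo_equivariant[OF p] endo_equivariant[OF q]]
  proof (intro conjI ballI)
    show "ok ?x" by (rule x)
    fix g assume g: "g \<in> carrier G"
    have e1: "vc (wh [] (invc (eps_cell g)) q) (wh [S.rho g] ?x []) = vc ?x (wh [] (invc (eps_cell g)) p)"
      using exchange[of "invc (eps_cell g)" ?x "[]" "[]" "[]"] g x by simp
    have e2: "vc (wh q (eps_cell g) []) ?x = vc (wh [] ?x [S.rho g]) (wh p (eps_cell g) [])"
      using exchange[of ?x "eps_cell g" "[]" "[]" "[]"] g x by simp
    show "vc (endo.flipc q (endo_fl (composite VG q)) g) (wh [S.rho g] ?x []) =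
      vc (wh [] ?x [S.rho g]) (endo.flipc p (endo_fl (composite VG p)) g)"
      by (simp add: endo_flip_cell g p q e1 vc_head[OF e2])
  qed
qed

lemma U_faithful:
  assumes p: "path VG p VG" and q: "path VG q VG"
    and x: "ok x" "tdom x = VG" "tcod x = VG" "tsrc x = p" "ttgt x = q"
    and y: "ok y" "tdom y = VG" "tcod y = VG" "tsrc y = p" "ttgt y = q"
    and eq: "wh [u] x [] = wh [u] y []"
  shows "x = y"
proof -
  note [simp] = p_simps[OF p] p_simps[OF q]
  have t: "x = TCell VG VG p q (Some (val x))" "y = TCell VG VG p q (Some (val y))"
    using x y okD(8)[OF x(1)] okD(8)[OF y(1)] by (simp_all add: tcell_eq_iff)
  have o: "ok (TCell VG VG p q (Some (val x)))" "ok (TCell VG VG p q (Some (val y)))"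
    using x(1) y(1) t by simp_all
  have "ok (wh [u] x [])" "ok (wh [u] y [])" using x y by simp_all
  then have "U \<triangleright> val x = U \<triangleright> val y"
    using arg_cong[OF eq, of val] x y by (simp add: val_simps whisker_left_def)
  then have "val x = val y"
    using equivalence_faithful[OF endo.equivariant_category post_U_equivalence[OF S.rep]
        endo_equivariant[OF p] endo_equivariant[OF q] endo_hom[OF p q o(1)] endo_hom[OF p q o(2)]] by simp
  then show ?thesis using t by simp
qed

lemma U_full:
  assumes p: "path VG p VG" and q: "path VG q VG"
    and z: "ok z" "tdom z = VG" "tcod z = V" "tsrc z = u # p" "ttgt z = u # q"
    and comm: "\<And>g. g \<in> carrier G \<Longrightarrow> vc (wh [] (ups g) q) z = vc (wh [rho g] z []) (wh [] (ups g) p)"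
  obtains x where "ok (TCell VG VG p q (Some x))" "wh [u] (TCell VG VG p q (Some x)) [] = z"
proof -
  note [simp] = p_simps[OF p] p_simps[OF q]
  let ?D = "equivariant_cat C G VG S VG S" and ?E = "trivialized_cat C G VG S V R"
  let ?P = "postU"
  have t: "TCell VG V (u # p) (u # q) (Some (val z)) = z"
    using z okD(8)[OF z(1)] by (simp add: tcell_eq_iff)
  have up: "path V (u # p) VG" and uq: "path V (u # q) VG" by simp_all
  note obp = U_endo_trivialized[OF p, unfolded post_U_endo[OF p]]
    and obq = U_endo_trivialized[OF q, unfolded post_U_endo[OF q]]
  have comm': "vc (wh [] (invc (ups g)) q) (wh [rho g] z []) = vc z (wh [] (invc (ups g)) p)" if g: "g \<in> carrier G"
      for g
  proof (rule vc_left_cancel[of "wh [] (ups g) q"])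
    have "vc (wh [] (ups g) q) (vc z (wh [] (invc (ups g)) p)) = wh [rho g] z []"
      using g z by (simp add: vc_head[OF comm])
    then show "vc (wh [] (ups g) q) (vc (wh [] (invc (ups g)) q) (wh [rho g] z [])) =
      vc (wh [] (ups g) q) (vc z (wh [] (invc (ups g)) p))" using g z by simp
  qed (use g z in simp_all)
  have "val z \<in> Hom ?E (composite VG (u # p), U_flips p, U_triv p) (composite VG (u # q), U_flips q, U_triv q)"
    unfolding to_V.trivialized_hom_iff[OF up uq obp obq] t
      to_V.equivariant_hom_iff[OF up uq to_V.trivialized_equivariant[OF obp] to_V.trivialized_equivariant[OF obq]]
  proof (intro conjI ballI)
    show "ok z" by (rule z)
    fix g assume g: "g \<in> carrier G"
    show "vc (to_V.trivc (u # q) (U_triv q) g) z = vc (wh [rho g] z []) (to_V.trivc (u # p) (U_triv p) g)"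
      using comm[OF g] g by (simp add: U_endo_triv_cell p q)
    have e: "vc (wh (u # q) (eps_cell g) []) z = vc (wh [] z [S.rho g]) (wh (u # p) (eps_cell g) [])"
      using exchange[of z "eps_cell g" "[]" "[]" "[]"] g z by simp
    show "vc (to_V.flipc (u # q) (U_flips q) g) (wh [rho g] z []) = vc (wh [] z [S.rho g])
        (to_V.flipc (u # p) (U_flips p) g)"
      by (simp add: U_endo_flip_cell p q g comm' vc_head[OF e])
  qed
  then have "val z \<in> Hom ?E (?P (composite VG p, endo_fl (composite VG p)))
      (?P (composite VG q, endo_fl (composite VG q)))"
    by (simp only: post_U_endo p q)
  from equivalence_full[OF endo.equivariant_category to_V.trivialized_category post_U_equivalence[OF S.rep]
      endo_equivariant[OF p] endo_equivariant[OF q] this]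
  obtain x where x: "x \<in> Hom ?D (composite VG p, endo_fl (composite VG p))
      (composite VG q, endo_fl (composite VG q))" and Ux: "U \<triangleright> x = val z" by blast
  have o: "ok (TCell VG VG p q (Some x))"
    using x unfolding endo.equivariant_hom_iff[OF p q endo_equivariant[OF p] endo_equivariant[OF q]] by blast
  moreover have "wh [u] (TCell VG VG p q (Some x)) [] = z"
    using o Ux z by (intro tcell_eqI) (simp_all add: val_simps whisker_left_def)
  ultimately show ?thesis by (rule that)
qed

end


section \<open>The adjoint of \<open>U\<close>\<close>

locale adjoint_sum = fixed_object K C G V R VG S \<epsilon> U \<tau>U
  for K :: "'k ring" and C :: "('o, 'm, 'c, 'k) two_cat" (structure) and G :: "'g monoid"
    and V R VG S and \<epsilon> :: "'g \<Rightarrow> 'c" and U :: 'm and \<tau>U :: "'g \<Rightarrow> 'c" +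
  fixes inc prj :: "'g \<Rightarrow> 'c" and A' :: 'm and \<tau>A' :: "'g \<Rightarrow> 'c"
  assumes sum_UA: "direct_sum C (carrier G) (act R) (U \<star> A') inc prj"
    and A'_equivariant: "(A', \<tau>A') \<in> Ob (equivariant_cat C G V R VG S)"
    and post_U_A': "post_U C G R S \<epsilon> U \<tau>U (A', \<tau>A') =
      (U \<star> A', A_flips C G R (U \<star> A') inc prj, A_triv C G R (U \<star> A') inc prj)"
begin

sublocale from_V: representation_pair K C G VG S V R ..

abbreviation a :: "('o, 'm) arrow" where "a \<equiv> (V, VG, A')"

lemma A'_mor [simp]: "A' \<in> mor C V VG"
  using from_V.equivariant_mor[OF A'_equivariant] .

sublocale regular_sum K C G V R "[u, a]" inc prj
  by unfold_locales (use sum_UA in simp_all)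

definition tauA_cell :: "'g \<Rightarrow> ('o, 'm, 'c) tcell" where
  "tauA_cell g = TCell V VG [S.rho g, a] [a, rho g] (Some (\<tau>A' g))"

lemma tauA_sel [simp]:
  "tdom (tauA_cell g) = V" "tcod (tauA_cell g) = VG" "tsrc (tauA_cell g) = [S.rho g, a]"
  "ttgt (tauA_cell g) = [a, rho g]" "val (tauA_cell g) = \<tau>A' g"
  by (simp_all add: tauA_cell_def)

lemma invertible_tauA [simp]: "g \<in> carrier G \<Longrightarrow> invertible (tauA_cell g)"
proof -
  have e: "from_V.flipc [a] \<tau>A' = tauA_cell" by (auto simp: from_V.flipc_def tauA_cell_def)
  have "(composite V [a], \<tau>A') \<in> Ob (equivariant_cat C G V R VG S)"
    using A'_equivariant by simp
  then have "\<forall>g\<in>carrier G. invertible (tauA_cell g)"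
    by (subst (asm) from_V.equivariant_iff; simp add: e)
  then show "g \<in> carrier G \<Longrightarrow> invertible (tauA_cell g)" by blast
qed

text \<open>This is what \<open>U A' = A\<close> means for the flips and the trivialization.\<close>

lemma ups_A: "g \<in> carrier G \<Longrightarrow> wh [] (ups g) [a] = triv_cell g"
proof (rule tcell_eqI)
  assume g: "g \<in> carrier G"
  have "val (triv_cell g) = snd (snd (postU (A', \<tau>A'))) g"
    by (simp add: post_U_A')
  also have "\<dots> = val (wh [] (ups g) [a])"
    using g by (simp add: post_U_def ups_def val_simps whisker_left_def whisker_right_def)
  finally show "val (wh [] (ups g) [a]) = val (triv_cell g)" by simp
qed simp_all

lemma tau_A: "g \<in> carrier G \<Longrightarrow> vc (wh [u] (tauA_cell g) []) (wh [] (tau_cell g) [a]) = flip_cell g"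
proof (rule tcell_eqI)
  assume g: "g \<in> carrier G"
  have "val (flip_cell g) = fst (snd (postU (A', \<tau>A'))) g"
    by (simp add: post_U_A')
  also have "\<dots> = val (vc (wh [u] (tauA_cell g) []) (wh [] (tau_cell g) [a]))"
    using g by (simp add: post_U_def comp_flips_def val_simps whisker_left_def whisker_right_def)
  finally show "val (vc (wh [u] (tauA_cell g) []) (wh [] (tau_cell g) [a])) = val (flip_cell g)" by simp
qed simp_all


subsection \<open>The counit\<close>

abbreviation "alpha_A \<equiv> alpha C G R S \<epsilon> U \<tau>U (U \<star> A') prj"

definition alpha_cell :: "('o, 'm, 'c) tcell" where
  "alpha_cell = TCell VG V [u, a, u] [u] (Some (alpha_A))"

lemma alpha_sel [simp]:
  "tdom alpha_cell = VG" "tcod alpha_cell = V" "tsrc alpha_cell = [u, a, u]" "ttgt alpha_cell = [u]"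
  "val alpha_cell = alpha_A"
  by (simp_all add: alpha_cell_def)

lemma alpha_facts:
  shows ok_alpha [simp]: "ok alpha_cell"
    and alpha_inc: "g \<in> carrier G \<Longrightarrow> vc alpha_cell (wh [] (inc_cell g) [u]) = invc (ups g)"
proof -
  have o: "VG \<in> obj C" "V \<in> obj C" by simp_all
  have UA: "U \<star> A' \<in> mor C V V" using A_mor by simp
  have ds: "direct_sum C (carrier G) (\<lambda>g. act R g \<star> U) ((U \<star> A') \<star> U) (\<lambda>g. inc g \<triangleleft> U) (\<lambda>g. prj g \<triangleleft> U)"
    using direct_sum_whisker_right[OF o(2,2,1) U_mor act_mor UA sum_UA finite_G] .
  have f: "inv2 C U (act R g \<star> U) (upsilon C R S \<epsilon> U \<tau>U g) \<in> hom2 C (act R g \<star> U) U" if "g \<in> carrier G" for g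
    using okD(7)[OF ok_invc[OF invertible_ups[OF that]]] that by (simp add: val_invc val_ups)
  have m: "act R g \<star> U \<in> mor C VG V" if "g \<in> carrier G" for g
    using comp1_closed[OF o(1) o(2) o(2)] that by simp
  have mA: "(U \<star> A') \<star> U \<in> mor C VG V" using comp1_closed[OF o(1) o(2) o(2) UA U_mor] .
  note cot = direct_sum_cotuple[OF o m mA ds finite_G U_mor f, simplified]
  have assoc: "(U \<star> A') \<star> U = U \<star> A' \<star> U"
    using comp1_assoc[OF o(1) o(2) o(1) o(2) U_mor A'_mor U_mor] .
  show ok: "ok alpha_cell" using cot(1) by (simp add: ok_TCell alpha_cell_def alpha_def assoc)
  show "vc alpha_cell (wh [] (inc_cell g) [u]) = invc (ups g)" if g: "g \<in> carrier G"
  proof (rule tcell_eqI)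
    show "val (vc alpha_cell (wh [] (inc_cell g) [u])) = val (invc (ups g))"
      using cot(2)[OF g] ok g
      by (simp add: val_simps alpha_def val_ups whisker_right_def)
  qed (use ok g in simp_all)
qed

text \<open>
  Compared on the summands \<open>\<rho>(g m) U\<close> of \<open>A U\<close>, this is the multiplicativity of \<open>\<upsilon>\<close>.
\<close>

lemma alpha_ups:
  assumes g: "g \<in> carrier G"
  shows "vc (ups g) alpha_cell = vc (wh [rho g] alpha_cell []) (wh [] (ups g) [a, u])"
proof (rule eq_on_inc[where l = "[]" and r = "[u]"])
  fix k assume k: "k \<in> carrier G"
  define m where "m = ginv g \<diamondop> k"
  have m: "m \<in> carrier G" and km: "k = g \<diamondop> m" using g k by (simp_all add: m_def)
  have e1: "vc (wh [] (ups g) [a, u]) (wh [] (inc_cell (g \<diamondop> m)) [u]) =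
    vc (wh [rho g] (inc_cell m) [u]) (wh [] (invc (phi_cell g m)) [u])"
    using arg_cong[OF triv_on_summand[OF g m], of "\<lambda>x. wh [] x [u]"] g by (simp add: ups_A[symmetric])
  have e2: "vc (wh [rho g] alpha_cell []) (wh [rho g] (inc_cell m) [u]) = wh [rho g] (invc (ups m)) []"
    using arg_cong[OF alpha_inc[OF m], of "\<lambda>x. wh [rho g] x []"] by simp
  have e3: "vc (wh [rho g] (invc (ups m)) []) (wh [] (invc (phi_cell g m)) [u]) = vc (ups g) (invc (ups (g \<diamondop> m)))"
    unfolding ups_mult[OF g m, symmetric] using g m by simp
  show "vc (vc (ups g) alpha_cell) (wh [] (inc_cell k) [u]) =
    vc (vc (wh [rho g] alpha_cell []) (wh [] (ups g) [a, u])) (wh [] (inc_cell k) [u])"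
    using alpha_inc[OF k] by (simp add: km e1 vc_head[OF e2] e3)
qed (use g in simp_all)

lemma counit_exists:
  "\<exists>\<alpha>'. \<alpha>' \<in> hom2 C (A' \<star> U) (id1 C VG) \<and> U \<triangleright> \<alpha>' = alpha_A"
proof -
  obtain x where x: "ok (TCell VG VG [a, u] [] (Some x))" "wh [u] (TCell VG VG [a, u] [] (Some x)) [] = alpha_cell"
    by (rule U_full[of "[a, u]" "[]" alpha_cell]) (simp_all add: alpha_ups)
  have "U \<triangleright> x = val alpha_cell"
    unfolding x(2)[symmetric] using x(1) by (simp add: val_simps whisker_left_def)
  then show ?thesis using x(1) by (auto simp: ok_TCell)
qed

end

context fixed_object
begin

text \<open>
  By essential surjectivity the trivialized 1-morphism \<open>A\<close> is isomorphic to some \<open>U A'\<close>. An isomorphism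
  of trivialized 1-morphisms respects flips and trivializations, so those of \<open>U A'\<close> are the ones that belong
  to the transported inclusions and projections.
\<close>

lemma adjoint_sum_exists:
  "\<exists>inc prj A' \<tau>A'. adjoint_sum K C G V R VG S \<epsilon> U \<tau>U inc prj A' \<tau>A'"
proof -
  obtain f where f: "bij_betw f {0..<card (carrier G)} (carrier G)"
    using ex_bij_betw_nat_finite[OF finite_G] by blast
  define n where "n = card (carrier G)"
  have f: "bij_betw f {..<n} (carrier G)" using f by (simp add: n_def atLeast0LessThan)
  have "(\<lambda>i. act R (f i)) \<in> {..<n} \<rightarrow> mor C V V"
    using f act_mor by (auto dest: bij_betwE)
  from additive[OF V_obj V_obj this] obtain Y inc0 prj0 where Y [simp]: "Y \<in> mor C V V"
    and ds0: "direct_sum C {..<n} (\<lambda>i. act R (f i)) Y inc0 prj0" by blast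
  define inc prj where "inc j = inc0 (inv_into {..<n} f j)" and "prj j = prj0 (inv_into {..<n} f j)" for j
  have ds: "direct_sum C (carrier G) (act R) Y inc prj"
    unfolding inc_def prj_def using direct_sum_reindex[OF V_obj V_obj Y act_mor f ds0] .
  interpret Y: regular_sum K C G V R "[(V, V, Y)]" inc prj
    by unfold_locales (use ds in simp_all)
  let ?D = "equivariant_cat C G V R VG S" and ?E = "trivialized_cat C G V R V R"
  interpret from_V: representation_pair K C G VG S V R ..
  let ?w = "(Y, A_flips C G R Y inc prj, A_triv C G R Y inc prj)"
  have w: "?w \<in> Ob ?E" using Y.regular_sum_trivialized by simp
  from equivalence_essentially_surjective[OF post_U_equivalence[OF rep] w]
  obtain B where B: "B \<in> Ob ?D" and "\<exists>\<theta>\<in>Hom ?E (postU B) ?w. \<exists>\<theta>'\<in>Hom ?E ?w (postU B).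
    Cmp ?E \<theta>' \<theta> = Id ?E (postU B) \<and> Cmp ?E \<theta> \<theta>' = Id ?E ?w"
    by blast
  then obtain A' \<tau>A' \<theta> \<theta>' where A': "(A', \<tau>A') \<in> Ob ?D"
    and \<theta>: "\<theta> \<in> Hom ?E (postU (A', \<tau>A')) ?w" "\<theta>' \<in> Hom ?E ?w (postU (A', \<tau>A'))"
      "Cmp ?E \<theta>' \<theta> = Id ?E (postU (A', \<tau>A'))" "Cmp ?E \<theta> \<theta>' = Id ?E ?w"
    by (cases B) auto
  have A'_mor [simp]: "A' \<in> mor C V VG" using from_V.equivariant_mor[OF A'] .
  define F E where "F = fst (snd (postU (A', \<tau>A')))" and "E = snd (snd (postU (A', \<tau>A')))"
  have P: "postU (A', \<tau>A') = (U \<star> A', F, E)"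
    by (simp add: F_def E_def post_U_def)
  have ext: "F \<in> extensional (carrier G)" "E \<in> extensional (carrier G)"
    by (simp_all add: F_def E_def post_U_def comp_flips_def)
  have obP: "(U \<star> A', F, E) \<in> Ob ?E"
    using post_U_equivalence[OF rep] A' P unfolding equivalence_def is_functor_def by metis
  let ?p = "[u, (V, VG, A')]" and ?q = "[(V, V, Y)]"
  have p: "path V ?p V" "composite V ?p = U \<star> A'" and q: "path V ?q V" "composite V ?q = Y" by simp_all
  have obp: "(composite V ?p, F, E) \<in> Ob ?E" and obq: "(composite V ?q, A_flips C G R Y inc prj, A_triv C G R Y inc
      prj) \<in> Ob ?E"
    using obP w p q by simp_all
  define th' where "th' = TCell V V ?q ?p (Some \<theta>')"
  have hom': "ok th'" "\<And>g. g \<in> carrier G \<Longrightarrow>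
      vc (Y.pair.flipc ?p F g) (wh [rho g] th' []) = vc (wh [] th' [rho g])
          (Y.pair.flipc ?q (A_flips C G R Y inc prj) g)"
    "\<And>g. g \<in> carrier G \<Longrightarrow>
      vc (Y.pair.trivc ?p E g) th' = vc (wh [rho g] th' []) (Y.pair.trivc ?q (A_triv C G R Y inc prj) g)"
    using \<theta>(2) unfolding P
    using Y.pair.trivialized_hom_iff[OF q(1) p(1) obq obp, of \<theta>']
      Y.pair.equivariant_hom_iff[OF q(1) p(1) Y.pair.trivialized_equivariant[OF obq]
          Y.pair.trivialized_equivariant[OF obp], of \<theta>']
    by (simp_all add: th'_def)
  have th: "\<theta> \<in> hom2 C (U \<star> A') Y" "\<theta>' \<in> hom2 C Y (U \<star> A')" "\<theta>' \<cdot> \<theta> = id2 C (U \<star> A')" "\<theta> \<cdot> \<theta>' = id2 C Y"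
    using \<theta> unfolding P by (simp_all add: trivialized_cat_def equivariant_cat_def)
  have UA: "U \<star> A' \<in> mor C V V" using composite_closed[OF p(1)] p(2) by simp
  define inc' prj' where "inc' g = \<theta>' \<cdot> inc g" and "prj' g = prj g \<cdot> \<theta>" for g
  have ds': "direct_sum C (carrier G) (act R) (U \<star> A') inc' prj'"
    unfolding inc'_def prj'_def
    using direct_sum_transport[OF V_obj V_obj Y UA act_mor finite_G ds th] .
  interpret B: regular_sum K C G V R ?p inc' prj'
    by unfold_locales (use ds' in simp_all)
  have th'_sel [simp]: "tdom th' = V" "tcod th' = V" "tsrc th' = ?q" "ttgt th' = ?p" "val th' = \<theta>'"
    by (simp_all add: th'_def)
  have i: "B.inc_cell g = vc th' (Y.inc_cell g)" if "g \<in> carrier G" for g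
    using that hom'(1) by (intro tcell_eqI) (simp_all add: val_simps inc'_def)
  have fl: "Y.pair.flipc ?q (A_flips C G R Y inc prj) = Y.flip_cell"
      "Y.pair.trivc ?q (A_triv C G R Y inc prj) = Y.triv_cell"
    by (auto simp: Y.pair.flipc_def Y.flip_cell_def Y.pair.trivc_def Y.triv_cell_def)
  have okF: "ok (Y.pair.flipc ?p F g)" "ok (Y.pair.trivc ?p E g)" if "g \<in> carrier G" for g
    using obp that Y.pair.trivialized_equivariant[OF obp]
    by (simp_all add: Y.pair.trivialized_iff[OF p(1)] Y.pair.equivariant_iff[OF p(1)] del: composite.simps)
  have F: "Y.pair.flipc ?p F s = B.flip_cell s" if s: "s \<in> carrier G" for s
  proof (rule B.flip_cell_unique[OF s okF(1)[OF s]])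
    fix h t assume h: "h \<in> carrier G" and t: "t \<in> carrier G" and ts: "t \<diamondop> s = s \<diamondop> h"
    note e1 = hom'(2)[OF s, unfolded fl] and e2 = Y.flip_on_summand[OF s h t ts]
    show "vc (Y.pair.flipc ?p F s) (wh [rho s] (B.inc_cell h) []) =
      vc (wh [] (B.inc_cell t) [rho s]) (vc (invc (phi_cell t s)) (phi_cell s h))"
      by (simp add: i h t vc_head[OF e1] e2)
  qed simp_all
  have E: "Y.pair.trivc ?p E g = B.triv_cell g" if g: "g \<in> carrier G" for g
  proof (rule B.triv_cell_unique[OF g okF(2)[OF g]])
    fix m assume m: "m \<in> carrier G"
    note e1 = hom'(3)[OF g, unfolded fl] and e2 = Y.triv_on_summand[OF g m]
    show "vc (Y.pair.trivc ?p E g) (B.inc_cell (g \<diamondop> m)) = vc (wh [rho g] (B.inc_cell m) []) (invc (phi_cell g m))"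
      by (simp add: i g m vc_head[OF e1] e2)
  qed simp_all
  have "F = A_flips C G R (U \<star> A') inc' prj'"
  proof (rule extensionalityI[OF ext(1)])
    show "A_flips C G R (U \<star> A') inc' prj' \<in> extensional (carrier G)" by (simp add: A_flips_def)
    show "F x = A_flips C G R (U \<star> A') inc' prj' x" if "x \<in> carrier G" for x
      using arg_cong[OF F[OF that], of val] by simp
  qed
  moreover have "E = A_triv C G R (U \<star> A') inc' prj'"
  proof (rule extensionalityI[OF ext(2)])
    show "A_triv C G R (U \<star> A') inc' prj' \<in> extensional (carrier G)" by (simp add: A_triv_def)
    show "E x = A_triv C G R (U \<star> A') inc' prj' x" if "x \<in> carrier G" for x
      using arg_cong[OF E[OF that], of val] by simp
  qed
  ultimately have "adjoint_sum K C G V R VG S \<epsilon> U \<tau>U inc' prj' A' \<tau>A'"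
    using ds' A' P by unfold_locales simp_all
  then show ?thesis by blast
qed

end


locale adjunction = adjoint_sum K C G V R VG S \<epsilon> U \<tau>U inc prj A' \<tau>A'
  for K :: "'k ring" and C :: "('o, 'm, 'c, 'k) two_cat" (structure) and G :: "'g monoid"
    and V R VG S and \<epsilon> :: "'g \<Rightarrow> 'c" and U :: 'm and \<tau>U :: "'g \<Rightarrow> 'c"
    and inc prj :: "'g \<Rightarrow> 'c" and A' :: 'm and \<tau>A' :: "'g \<Rightarrow> 'c" +
  fixes \<alpha>' :: 'c
  assumes counit_hom: "\<alpha>' \<in> hom2 C (A' \<star> U) (id1 C VG)"
    and U_counit: "U \<triangleright> \<alpha>' = alpha C G R S \<epsilon> U \<tau>U (U \<star> A') prj"
begin

definition counit :: "('o, 'm, 'c) tcell" where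
  "counit = TCell VG VG [a, u] [] (Some \<alpha>')"

definition iota :: "('o, 'm, 'c) tcell" where
  "iota = vc (inc_cell \<one>\<^bsub>G\<^esub>) (invc phi1_cell)"

lemma unit_counit_sel [simp]:
  "tdom counit = VG" "tcod counit = VG" "tsrc counit = [a, u]" "ttgt counit = []" "val counit = \<alpha>'"
  "tdom iota = V" "tcod iota = V" "tsrc iota = []" "ttgt iota = [u, a]"
  by (simp_all add: counit_def iota_def)

lemma ok_counit [simp]: "ok counit"
  using counit_hom by (simp add: counit_def ok_TCell)

lemma ok_iota [simp]: "ok iota"
  by (simp add: iota_def)

lemma U_counit_cell: "wh [u] counit [] = alpha_cell"
  by (rule tcell_eqI) (use U_counit in \<open>simp_all add: val_simps whisker_left_def\<close>)

text \<open>The first triangle identity: \<open>\<alpha>\<close> restricted to the summand \<open>\<rho>(1) U\<close> is \<open>\<upsilon>\<^sub>1\<^sup>-\<^sup>1 = \<phi>\<^sub>1 U\<close>.\<close>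

lemma triangle_U: "vc (wh [u] counit []) (wh [] iota [u]) = idc V [u] VG"
  using vc_head[OF alpha_inc[of "\<one>\<^bsub>G\<^esub>"], of "wh [] (invc phi1_cell) [u]"]
  by (simp add: U_counit_cell iota_def ups_one)

text \<open>
  The flips of \<open>A'\<close>, combined with the trivialization of \<open>V\<^sup>G\<close>, let \<open>G\<close> act on \<open>A'\<close> from the right.
  Under \<open>U\<close> this becomes right multiplication on the summands of \<open>A\<close>.
\<close>

definition beta :: "'g \<Rightarrow> ('o, 'm, 'c) tcell" where
  "beta g = vc (tauA_cell g) (wh [] (eps_cell g) [a])"

lemma beta_sel [simp]: "tdom (beta g) = V" "tcod (beta g) = VG" "tsrc (beta g) = [a]" "ttgt (beta g) = [a, rho g]"
  by (simp_all add: beta_def)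

lemma invertible_beta [simp]: "g \<in> carrier G \<Longrightarrow> invertible (beta g)"
  by (simp add: beta_def)

lemma tauA_eq: "g \<in> carrier G \<Longrightarrow> tauA_cell g = vc (beta g) (wh [] (invc (eps_cell g)) [a])"
  by (simp add: beta_def)

lemma U_beta: "g \<in> carrier G \<Longrightarrow> wh [u] (beta g) [] = vc (flip_cell g) (triv_cell g)"
  using arg_cong[OF tau_ups[of g], of "\<lambda>x. wh [] x [a]"]
  by (simp add: beta_def tau_A[symmetric] ups_A[symmetric])

lemma U_beta_inc:
  assumes t: "t \<in> carrier G" and g: "g \<in> carrier G"
  shows "vc (wh [u] (beta g) []) (inc_cell (t \<diamondop> g)) = vc (wh [] (inc_cell t) [rho g]) (invc (phi_cell t g))"
proof -
  define m where "m = ginv g \<diamondop> (t \<diamondop> g)"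
  have m: "m \<in> carrier G" and tg: "t \<diamondop> g = g \<diamondop> m" using t g by (simp_all add: m_def)
  have "vc (wh [u] (beta g) []) (inc_cell (t \<diamondop> g)) =
    vc (vc (flip_cell g) (wh [rho g] (inc_cell m) [])) (invc (phi_cell g m))"
    using triv_on_summand[OF g m] by (simp add: U_beta g tg)
  also have "\<dots> = vc (wh [] (inc_cell t) [rho g]) (invc (phi_cell t g))"
    unfolding flip_on_summand[OF g m t tg] using t g m tg by simp
  finally show ?thesis .
qed

text \<open>
  The counit is equivariant for the flips of \<open>A' U\<close>. Both sides are 2-morphisms between
  endomorphisms of \<open>V\<^sup>G\<close>, where \<open>U\<close> is faithful, and under \<open>U\<close> they can be compared on the summands
  of \<open>A U\<close>.
\<close>

lemma counit_equivariant:
  assumes g: "g \<in> carrier G"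
  shows "vc (wh [] counit [S.rho g]) (vc (wh [a] (tau_cell g) []) (wh [] (beta g) [u])) = vc (eps_cell g) counit"
proof (rule U_faithful[where p = "[a, u]" and q = "[S.rho g]"])
  show "wh [u] (vc (wh [] counit [S.rho g]) (vc (wh [a] (tau_cell g) []) (wh [] (beta g) [u]))) [] =
    wh [u] (vc (eps_cell g) counit) []"
  proof (rule eq_on_inc[where l = "[]" and r = "[u]"])
    fix k assume k: "k \<in> carrier G"
    define t where "t = k \<diamondop> ginv g"
    have t: "t \<in> carrier G" and kt: "k = t \<diamondop> g" using g k by (simp_all add: t_def)
    have al: "wh [u] counit [S.rho g] = wh [] alpha_cell [S.rho g]" by (simp add: U_counit_cell[symmetric])
    have e1: "vc (wh [u] (beta g) [u]) (wh [] (inc_cell (t \<diamondop> g)) [u]) =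
      vc (wh [] (inc_cell t) [rho g, u]) (wh [] (invc (phi_cell t g)) [u])"
      using arg_cong[OF U_beta_inc[OF t g], of "\<lambda>x. wh [] x [u]"] by simp
    have e2: "vc (wh [u, a] (tau_cell g) []) (wh [] (inc_cell t) [rho g, u]) =
      vc (wh [] (inc_cell t) [u, S.rho g]) (wh [rho t] (tau_cell g) [])"
      using exchange[of "inc_cell t" "tau_cell g" "[]" "[]" "[]"] g t by simp
    have e3: "vc (wh [] alpha_cell [S.rho g]) (wh [] (inc_cell t) [u, S.rho g]) = wh [] (invc (ups t)) [S.rho g]"
      using arg_cong[OF alpha_inc[OF t], of "\<lambda>x. wh [] x [S.rho g]"] by simp
    have e4: "vc (wh [u] (eps_cell g) []) (invc (ups t)) = vc (wh [] (invc (ups t)) [S.rho g])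
        (wh [rho t, u] (eps_cell g) [])"
      using exchange[of "invc (ups t)" "eps_cell g" "[]" "[]" "[]"] g t by simp
    have e6: "vc (wh [rho t, u] (eps_cell g) []) (wh [rho t] (invc (ups g)) []) = wh [rho t] (tau_cell g) []"
      using arg_cong[OF tau_eq[OF g], of "\<lambda>x. wh [rho t] x []"] by simp
    have e5: "invc (ups (t \<diamondop> g)) = vc (invc (ups t)) (vc (wh [rho t] (invc (ups g)) [])
        (wh [] (invc (phi_cell t g)) [u]))"
      unfolding ups_mult[OF t g, symmetric] using g t by simp
    show "vc (wh [u] (vc (wh [] counit [S.rho g]) (vc (wh [a] (tau_cell g) []) (wh [] (beta g) [u]))) [])
        (wh [] (inc_cell k) [u]) =
      vc (wh [u] (vc (eps_cell g) counit) []) (wh [] (inc_cell k) [u])"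
      using alpha_inc[OF k] g t
      by (simp add: kt e1 vc_head[OF e2] al vc_head[OF e3] U_counit_cell e5 vc_head[OF e4] vc_head[OF e6])
  qed (use g in simp_all)
qed (use g in simp_all)

lemma iota_equivariant:
  assumes g: "g \<in> carrier G"
  shows "vc (flip_cell g) (wh [rho g] iota []) = wh [] iota [rho g]"
  using vc_head[OF flip_on_summand[of g "\<one>\<^bsub>G\<^esub>" "\<one>\<^bsub>G\<^esub>"], of "wh [rho g] (invc phi1_cell) []"] g phi_one[OF g]
  by (simp add: iota_def)

lemma triangle_A'_under_U: "vc (wh [u] counit [a]) (wh [u, a] iota []) = idc V [u, a] V"
proof (rule eq_on_inc[where l = "[]" and r = "[]"])
  fix k assume k: "k \<in> carrier G"
  have e1: "vc (wh [u, a] iota []) (inc_cell k) = vc (wh [] (inc_cell k) [u, a]) (wh [rho k] iota [])"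
    using exchange[of "inc_cell k" iota "[]" "[]" "[]"] k by simp
  have al: "wh [u] counit [a] = wh [] alpha_cell [a]" by (simp add: U_counit_cell[symmetric])
  have e2: "vc (wh [] alpha_cell [a]) (wh [] (inc_cell k) [u, a]) = invc (triv_cell k)"
    using arg_cong[OF alpha_inc[OF k], of "\<lambda>x. wh [] x [a]"] k by (simp add: ups_A[symmetric])
  have e3: "vc (invc (triv_cell k)) (wh [rho k] iota []) = inc_cell k"
  proof (rule vc_left_cancel[of "triv_cell k"])
    show "vc (triv_cell k) (vc (invc (triv_cell k)) (wh [rho k] iota [])) = vc (triv_cell k) (inc_cell k)"
      using k triv_on_summand[OF k, of "\<one>\<^bsub>G\<^esub>"] phi_one(2)[OF k] by (simp add: iota_def)
  qed (use k in simp_all)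
  show "vc (vc (wh [u] counit [a]) (wh [u, a] iota [])) (wh [] (inc_cell k) []) = vc (idc V [u, a] V)
      (wh [] (inc_cell k) [])"
    using k by (simp add: e1 al vc_head[OF e2] e3)
qed simp_all

text \<open>
  The second triangle identity. It holds after applying \<open>U\<close>; since \<open>U\<close> is faithful on equivariant
  2-morphisms only, the composite has to be shown to be equivariant.
\<close>

lemma triangle_A': "vc (wh [] counit [a]) (wh [a] iota []) = idc VG [a] V"
proof -
  let ?e = "vc (wh [] counit [a]) (wh [a] iota [])"
  have beta: "vc (beta g) ?e = vc (wh [] ?e [rho g]) (beta g)" if g: "g \<in> carrier G" for g
  proof -
    have e1: "vc (wh [a] iota [rho g]) (beta g) = vc (wh [a] (flip_cell g) [])
        (vc (wh [] (beta g) [u, a]) (wh [a] iota []))"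
    proof -
      have "vc (wh [a, rho g] iota []) (beta g) = vc (wh [] (beta g) [u, a]) (wh [a] iota [])"
        using exchange[of "beta g" iota "[]" "[]" "[]"] g by simp
      moreover have "wh [a] iota [rho g] = vc (wh [a] (flip_cell g) []) (wh [a, rho g] iota [])"
        using arg_cong[OF iota_equivariant[OF g], of "\<lambda>x. wh [a] x []"] by simp
      ultimately show ?thesis by simp
    qed
    have e2: "vc (wh [] counit [a, rho g]) (wh [a, u] (tauA_cell g) []) = vc (tauA_cell g)
        (wh [] counit [S.rho g, a])"
      using exchange[of counit "tauA_cell g" "[]" "[]" "[]"] g by simp
    have e3: "vc (wh [] counit [S.rho g, a]) (vc (wh [a] (tau_cell g) [a]) (wh [] (beta g) [u, a])) =
      vc (wh [] (eps_cell g) [a]) (wh [] counit [a])"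
      using arg_cong[OF counit_equivariant[OF g], of "\<lambda>x. wh [] x [a]"] by simp
    have "vc (wh [] ?e [rho g]) (beta g) =
      vc (wh [] counit [a, rho g]) (vc (wh [a] (flip_cell g) []) (vc (wh [] (beta g) [u, a]) (wh [a] iota [])))"
      using e1 by simp
    also have "\<dots> = vc (tauA_cell g) (vc (wh [] (eps_cell g) [a]) ?e)"
      using g by (simp add: tau_A[symmetric] vc_head[OF e2] vc_head3[OF e3])
    also have "\<dots> = vc (beta g) ?e" by (simp add: beta_def)
    finally show ?thesis by simp
  qed
  have e: "ok ?e" by simp
  define e where "e = val ?e"
  have t: "TCell V VG [a] [a] (Some e) = ?e"
    using okD(8)[OF e] by (simp add: tcell_eq_iff e_def)
  have t': "TCell V VG [a] [a] (Some (id2 C A')) = idc VG [a] V" by (simp add: idc_def)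
  have pa: "path VG [a] V" by simp
  have ob: "(composite V [a], \<tau>A') \<in> Ob (equivariant_cat C G V R VG S)" using A'_equivariant by simp
  have fl: "from_V.flipc [a] \<tau>A' = tauA_cell" by (auto simp: from_V.flipc_def tauA_cell_def)
  let ?H = "Hom (equivariant_cat C G V R VG S) (composite V [a], \<tau>A') (composite V [a], \<tau>A')"
  have "e \<in> ?H"
    unfolding from_V.equivariant_hom_iff[OF pa pa ob ob] t fl
  proof (intro conjI ballI)
    show "ok ?e" by (rule e)
    fix g assume g: "g \<in> carrier G"
    define c where "c = ?e"
    have c: "ok c" "tdom c = V" "tcod c = VG" "tsrc c = [a]" "ttgt c = [a]"
      using e by (simp_all add: c_def)
    have x: "vc (wh [] (invc (eps_cell g)) [a]) (wh [S.rho g] c []) = vc c (wh [] (invc (eps_cell g)) [a])"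
      using exchange[of "invc (eps_cell g)" c "[]" "[]" "[]"] g c by simp
    show "vc (tauA_cell g) (wh [S.rho g] ?e []) = vc (wh [] ?e [rho g]) (tauA_cell g)"
      using vc_head[OF beta[OF g], unfolded c_def[symmetric]] unfolding c_def[symmetric]
      by (simp add: tauA_eq[OF g] x)
  qed
  moreover have "id2 C A' \<in> ?H"
    unfolding from_V.equivariant_hom_iff[OF pa pa ob ob] t' fl by simp
  moreover have "U \<triangleright> e = U \<triangleright> id2 C A'"
  proof -
    have "U \<triangleright> e = val (wh [u] ?e [])" using val_wh_left[of "[u]" ?e] by (simp add: e_def whisker_left_def)
    also have "\<dots> = id2 C (U \<star> A')" using triangle_A'_under_U by simp
    also have "\<dots> = U \<triangleright> id2 C A'" using hcomp_id2[of V VG V U A'] by (simp add: whisker_left_def)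
    finally show ?thesis .
  qed
  ultimately have "e = id2 C A'"
    using equivalence_faithful[OF from_V.equivariant_category post_U_equivalence[OF rep] ob ob] by simp
  then show ?thesis using t t' by simp
qed


section \<open>Traces of \<open>F\<close> and of \<open>U F A'\<close>\<close>

text \<open>
  Since \<open>A'\<close> is left adjoint to \<open>U\<close>, 2-morphisms \<open>U \<Rightarrow> U F\<close> correspond to traces of \<open>U F A'\<close>.
\<close>

text \<open>
  For \<open>x : U \<Rightarrow> U F\<close> and a trace \<open>m\<close> of \<open>U F A'\<close>, where \<open>F\<close> is the composite of the path \<open>p\<close>.
\<close>

definition mate :: "('o, 'm, 'c) tcell \<Rightarrow> ('o, 'm, 'c) tcell" where
  "mate x = vc (wh [] x [a]) iota"

definition unmate :: "('o, 'm) arrow list \<Rightarrow> ('o, 'm, 'c) tcell \<Rightarrow> ('o, 'm, 'c) tcell" where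
  "unmate p m = vc (wh (u # p) counit []) (wh [] m [u])"

text \<open>
  The flips of \<open>U F A'\<close>, rewritten with the help of \<open>\<upsilon>\<close> and \<open>beta\<close> so that the left and the right part
  of the 1-morphism are separated, and the action of \<open>s\<close> on traces of \<open>U F A'\<close>.
\<close>

definition UFA_flip :: "('o, 'm) arrow list \<Rightarrow> 'g \<Rightarrow> ('o, 'm, 'c) tcell" where
  "UFA_flip p s = vc (wh (u # p) (beta s) []) (wh [] (invc (ups s)) (p @ [a]))"

definition act_cell :: "('o, 'm) arrow list \<Rightarrow> 'g \<Rightarrow> ('o, 'm, 'c) tcell \<Rightarrow> ('o, 'm, 'c) tcell" where
  "act_cell p s m = vc (wh (u # p @ [a]) (cancel_cell s) []) (vc (wh [] (UFA_flip p s) [rho (ginv s)])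
    (vc (wh [rho s] m [rho (ginv s)]) (invc (cancel_cell s))))"

definition conj_ups :: "('o, 'm) arrow list \<Rightarrow> 'g \<Rightarrow> ('o, 'm, 'c) tcell \<Rightarrow> ('o, 'm, 'c) tcell" where
  "conj_ups p s x = vc (wh [] (invc (ups s)) p) (vc (wh [rho s] x []) (ups s))"

context
  fixes p :: "('o, 'm) arrow list"
  assumes p: "path VG p VG"
begin

lemma p_ends: "path VG p VG" "left_end p VG = VG" "right_end VG p = VG"
  using p path_ends[OF p] by auto

lemma unmate_mate:
  assumes x: "ok x" "tdom x = VG" "tcod x = V" "tsrc x = [u]" "ttgt x = u # p"
  shows "unmate p (mate x) = x"
proof -
  have e: "vc (wh (u # p) counit []) (wh [] x [a, u]) = vc x (wh [u] counit [])"
    using exchange[of x counit "[]" "[]" "[]"] x by simp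
  show ?thesis using x by (simp add: unmate_def mate_def vc_head[OF e] triangle_U)
qed

lemma mate_unmate:
  assumes m: "ok m" "tdom m = V" "tcod m = V" "tsrc m = []" "ttgt m = u # p @ [a]"
  shows "mate (unmate p m) = m"
proof -
  note [simp] = p_ends
  have e: "vc (wh [] m [u, a]) iota = vc (wh (u # p @ [a]) iota []) m"
    using exchange[of m iota "[]" "[]" "[]"] m by simp
  have e2: "vc (wh (u # p) counit [a]) (wh (u # p @ [a]) iota []) = idc V (u # p @ [a]) V"
    using arg_cong[OF triangle_A', of "\<lambda>x. wh (u # p) x []"] by (simp add: wh_idc[of VG "[a]" V "u # p" "[]"])
  show ?thesis using m by (simp add: unmate_def mate_def e vc_head[OF e2])
qed

text \<open>
  The conjugate of \<open>\<iota>\<close> by \<open>s\<close>, moved back by right multiplication with \<open>s\<close>, is the inclusion of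
  \<open>s \<rho>(s\<^sup>-\<^sup>1) \<cong> id\<close> into \<open>s A\<close>, and so is \<open>\<upsilon>\<^sub>s A' \<circ> \<iota>\<close>.
\<close>

lemma act_mate_core:
  assumes s: "s \<in> carrier G"
  shows "vc (wh [rho s, u, a] (cancel_cell s) []) (vc (wh [rho s, u] (beta s) [rho (ginv s)])
      (vc (wh [rho s] iota [rho (ginv s)]) (invc (cancel_cell s)))) = vc (triv_cell s) iota"
proof -
  let ?t = "ginv s"
  have t: "?t \<in> carrier G" using s by simp
  have "vc (wh [u] (beta s) []) iota = vc (wh [] (inc_cell ?t) [rho s]) (invc (cancel_cell ?t))"
    using vc_head[OF U_beta_inc[OF t s], of "invc phi1_cell"] s by (simp add: iota_def cancel_cell_def)
  then have e1: "vc (wh [rho s, u] (beta s) [rho ?t]) (wh [rho s] iota [rho ?t]) =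
    vc (wh [rho s] (inc_cell ?t) [rho s, rho ?t]) (wh [rho s] (invc (cancel_cell ?t)) [rho ?t])"
    by (auto dest: arg_cong[of _ _ "\<lambda>x. wh [rho s] x [rho ?t]"])
  have e2: "vc (wh [rho s, u, a] (cancel_cell s) []) (wh [rho s] (inc_cell ?t) [rho s, rho ?t]) =
    vc (wh [rho s] (inc_cell ?t) []) (wh [rho s, rho ?t] (cancel_cell s) [])"
    using exchange[of "inc_cell ?t" "cancel_cell s" "[]" "[rho s]" "[]"] s by simp
  have e3: "wh [rho s, rho ?t] (cancel_cell s) [] = wh [rho s] (cancel_cell ?t) [rho ?t]"
    using arg_cong[OF cancel_zigzag[OF s], of "\<lambda>x. wh [rho s] x []"] by simp
  have e4: "vc (triv_cell s) iota = vc (wh [rho s] (inc_cell ?t) []) (invc (cancel_cell s))"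
    using vc_head[OF triv_on_summand[OF s t], of "invc phi1_cell"] s by (simp add: iota_def cancel_cell_def)
  show ?thesis using s by (simp add: vc_head[OF e1] vc_head[OF e2] e3 e4)
qed

text \<open>Under this correspondence the action of \<open>s\<close> on traces is conjugation by \<open>\<upsilon>\<^sub>s\<close>.\<close>

lemma act_mate:
  assumes s: "s \<in> carrier G" and x: "ok x" "tdom x = VG" "tcod x = V" "tsrc x = [u]" "ttgt x = u # p"
  shows "act_cell p s (mate x) = mate (conj_ups p s x)"
proof -
  note [simp] = p_ends
  let ?t = "ginv s"
  define y where "y = vc (wh [] (invc (ups s)) p) (wh [rho s] x [])"
  have y: "ok y" "tdom y = VG" "tcod y = V" "tsrc y = [rho s, u]" "ttgt y = u # p"
    using s x by (simp_all add: y_def)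
  have e1: "vc (wh (u # p) (beta s) [rho ?t]) (wh [] y [a, rho ?t]) =
    vc (wh [] y [a, rho s, rho ?t]) (wh [rho s, u] (beta s) [rho ?t])"
    using exchange[of y "beta s" "[]" "[]" "[rho ?t]"] s y by simp
  have e2: "vc (wh (u # p @ [a]) (cancel_cell s) []) (wh [] y [a, rho s, rho ?t]) =
    vc (wh [] y [a]) (wh [rho s, u, a] (cancel_cell s) [])"
    using exchange[of y "cancel_cell s" "[a]" "[]" "[]"] s y by simp
  have "act_cell p s (mate x) = vc (wh (u # p @ [a]) (cancel_cell s) []) (vc (wh (u # p) (beta s) [rho ?t])
    (vc (wh [] y [a, rho ?t]) (vc (wh [rho s] iota [rho ?t]) (invc (cancel_cell s)))))"
    using s x by (simp add: act_cell_def mate_def UFA_flip_def y_def)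
  also have "\<dots> = vc (wh [] y [a]) (vc (triv_cell s) iota)"
    using act_mate_core[OF s] by (simp add: vc_head[OF e1] vc_head[OF e2])
  also have "\<dots> = mate (conj_ups p s x)"
    using s by (simp add: mate_def conj_ups_def y_def ups_A[symmetric])
  finally show ?thesis .
qed

text \<open>
  An invariant trace is the mate of some \<open>x\<close> that is fixed under conjugation with all \<open>\<upsilon>\<^sub>s\<close>, and such \<open>x\<close> comes
  from \<open>V\<^sup>G\<close> by the universal property.
\<close>

lemma act_invariant_iff:
  assumes m: "ok m" "tdom m = V" "tcod m = V" "tsrc m = []" "ttgt m = u # p @ [a]"
  shows "(\<forall>s\<in>carrier G. act_cell p s m = m) \<longleftrightarrow>
    (\<exists>x. ok x \<and> tdom x = VG \<and> tcod x = VG \<and> tsrc x = [] \<and> ttgt x = p \<and> m = mate (wh [u] x []))"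
proof
  note [simp] = p_ends
  assume inv: "\<forall>s\<in>carrier G. act_cell p s m = m"
  define z where "z = unmate p m"
  have z: "ok z" "tdom z = VG" "tcod z = V" "tsrc z = [u]" "ttgt z = u # p" and mz: "m = mate z"
    using m mate_unmate[OF m] by (simp_all add: z_def unmate_def)
  have "vc (wh [] (ups s) p) z = vc (wh [rho s] z []) (wh [] (ups s) [])" if s: "s \<in> carrier G" for s
  proof -
    have c: "ok (conj_ups p s z)" "tdom (conj_ups p s z) = VG" "tcod (conj_ups p s z) = V"
      "tsrc (conj_ups p s z) = [u]" "ttgt (conj_ups p s z) = u # p"
      using s z by (simp_all add: conj_ups_def)
    have "mate (conj_ups p s z) = mate z" using inv s act_mate[OF s z] mz by simp
    then have "conj_ups p s z = z" using unmate_mate[OF c] unmate_mate[OF z] by simp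
    then have "vc (wh [] (ups s) p) z = vc (wh [] (ups s) p) (conj_ups p s z)" by simp
    also have "\<dots> = vc (wh [rho s] z []) (ups s)" using s z by (simp add: conj_ups_def)
    finally show ?thesis using s by simp
  qed
  then obtain x where x: "ok (TCell VG VG [] p (Some x))" "wh [u] (TCell VG VG [] p (Some x)) [] = z"
    using U_full[of "[]" p z] z by auto
  show "\<exists>x. ok x \<and> tdom x = VG \<and> tcod x = VG \<and> tsrc x = [] \<and> ttgt x = p \<and> m = mate (wh [u] x [])"
    by (rule exI[of _ "TCell VG VG [] p (Some x)"]) (use x mz in simp)
next
  note [simp] = p_ends
  assume "\<exists>x. ok x \<and> tdom x = VG \<and> tcod x = VG \<and> tsrc x = [] \<and> ttgt x = p \<and> m = mate (wh [u] x [])"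
  then obtain x where x: "ok x" "tdom x = VG" "tcod x = VG" "tsrc x = []" "ttgt x = p" and m: "m = mate (wh [u] x [])"
    by blast
  show "\<forall>s\<in>carrier G. act_cell p s m = m"
  proof
    fix s assume s: "s \<in> carrier G"
    have "vc (wh [] (ups s) p) (wh [u] x []) = vc (wh [rho s, u] x []) (ups s)"
      using exchange[of "ups s" x "[]" "[]" "[]"] s x by simp
    then have "conj_ups p s (wh [u] x []) = vc (wh [] (invc (ups s)) p) (vc (wh [] (ups s) p) (wh [u] x []))"
      by (simp add: conj_ups_def)
    also have "\<dots> = wh [u] x []" using s x by simp
    finally show "act_cell p s m = m" using act_mate[OF s, of "wh [u] x []"] x by (simp add: m)
  qed
qed

lemma mate_injective:
  assumes x: "ok x" "tdom x = VG" "tcod x = VG" "tsrc x = []" "ttgt x = p"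
    and y: "ok y" "tdom y = VG" "tcod y = VG" "tsrc y = []" "ttgt y = p"
    and eq: "mate (wh [u] x []) = mate (wh [u] y [])"
  shows "x = y"
proof -
  have "wh [u] x [] = unmate p (mate (wh [u] x []))"
    using x by (simp add: unmate_mate)
  also have "\<dots> = unmate p (mate (wh [u] y []))" by (simp only: eq)
  also have "\<dots> = wh [u] y []" using y by (simp add: unmate_mate)
  finally have "wh [u] x [] = wh [u] y []" .
  then show ?thesis using U_faithful[of "[]" p x y] x y p by simp
qed

lemma unmate_x:
  assumes x: "ok x" "tdom x = VG" "tcod x = VG" "tsrc x = []" "ttgt x = []"
  shows "vc (wh [u] counit []) (wh [] (mate (wh [u] x [])) [u]) = wh [u] x []"
proof -
  have e: "vc (wh [u] counit []) (wh [u] x [a, u]) = vc (wh [u] x []) (wh [u] counit [])"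
    using arg_cong[OF exchange[of x counit "[]" "[]" "[]"], of "\<lambda>x. wh [u] x []"] x by simp
  show ?thesis using x by (simp add: mate_def vc_head[OF e] triangle_U)
qed

text \<open>
  The left-hand sides are the actions of the mate of a 2-endomorphism \<open>x\<close> of \<open>id\<close>. For the left action
  the first triangle identity removes \<open>\<alpha>\<close>, for the right action the second one removes \<open>\<alpha>'\<close>.
\<close>

lemma mate_left:
  assumes x: "ok x" "tdom x = VG" "tcod x = VG" "tsrc x = []" "ttgt x = []"
    and y: "ok y" "tdom y = VG" "tcod y = VG" "tsrc y = []" "ttgt y = p"
  shows "vc (wh [] alpha_cell (p @ [a])) (vc (wh [] (mate (wh [u] x [])) (u # p @ [a])) (mate (wh [u] y []))) =
    mate (wh [u] (vc (wh [] x p) y) [])"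
proof -
  note [simp] = p_ends
  define m where "m = mate (wh [u] y [])"
  have m: "ok m" "tdom m = V" "tcod m = V" "tsrc m = []" "ttgt m = u # p @ [a]"
    using y by (simp_all add: m_def mate_def)
  have "vc alpha_cell (wh [] (mate (wh [u] x [])) [u]) = wh [u] x []"
    using unmate_x[OF x] by (simp add: U_counit_cell)
  then have e: "vc (wh [] alpha_cell (p @ [a])) (wh [] (mate (wh [u] x [])) (u # p @ [a])) = wh [u] x (p @ [a])"
    by (auto dest: arg_cong[of _ _ "\<lambda>x. wh [] x (p @ [a])"])
  show ?thesis unfolding m_def[symmetric] by (simp add: vc_head[OF e]) (simp add: m_def mate_def)
qed

lemma mate_right:
  assumes x: "ok x" "tdom x = VG" "tcod x = VG" "tsrc x = []" "ttgt x = []"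
    and y: "ok y" "tdom y = VG" "tcod y = VG" "tsrc y = []" "ttgt y = p"
  shows "vc (wh (u # p) counit [a]) (vc (wh (u # p @ [a]) (mate (wh [u] x [])) []) (mate (wh [u] y []))) =
    mate (wh [u] (vc (wh p x []) y) [])"
proof -
  note [simp] = p_ends
  have e1: "vc (wh [] counit [a]) (wh [a, u] x [a]) = vc (wh [] x [a]) (wh [] counit [a])"
    using exchange[of counit x "[]" "[]" "[a]"] x by simp
  have "vc (wh [] counit [a]) (wh [a] (mate (wh [u] x [])) []) = vc (wh [] x [a])
      (vc (wh [] counit [a]) (wh [a] iota []))"
    by (simp add: mate_def vc_head[OF e1])
  also have "\<dots> = wh [] x [a]" unfolding triangle_A' using x by simp
  finally have e: "vc (wh (u # p) counit [a]) (wh (u # p @ [a]) (mate (wh [u] x [])) []) = wh (u # p) x [a]"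
    by (auto dest: arg_cong[of _ _ "\<lambda>x. wh (u # p) x []"])
  show ?thesis by (simp add: vc_head[OF e]) (simp add: mate_def)
qed

end

end


section \<open>Transport of structure\<close>

text \<open>
  Surjective maps that respect the operations carry the equational axioms to their target. This is how
  the invariants acquire their structure.
\<close>

lemma module_transport:
  fixes M :: "('k, 'a) module" and N :: "('k, 'b) module"
  assumes M: "module K M" and surj: "f ` carrier M = carrier N"
    and zero: "f \<zero>\<^bsub>M\<^esub> = \<zero>\<^bsub>N\<^esub>"
    and add: "\<And>m n. m \<in> carrier M \<Longrightarrow> n \<in> carrier M \<Longrightarrow> f (m \<oplus>\<^bsub>M\<^esub> n) = f m \<oplus>\<^bsub>N\<^esub> f n"
    and smult: "\<And>k m. k \<in> carrier K \<Longrightarrow> m \<in> carrier M \<Longrightarrow> f (k \<odot>\<^bsub>M\<^esub> m) = k \<odot>\<^bsub>N\<^esub> f m"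
  shows "module K N"
proof -
  interpret M: module K M by (rule M)
  have N: "f m \<in> carrier N" if "m \<in> carrier M" for m using surj that by blast
  have ex: "\<exists>m\<in>carrier M. x = f m" if "x \<in> carrier N" for x using surj that by blast
  have ab: "abelian_group N"
  proof (rule abelian_groupI)
    show "\<zero>\<^bsub>N\<^esub> \<in> carrier N" using N[OF M.zero_closed] zero by simp
    fix x y assume "x \<in> carrier N" "y \<in> carrier N"
    then obtain m n where m: "m \<in> carrier M" "x = f m" and n: "n \<in> carrier M" "y = f n" using ex by metis
    show "x \<oplus>\<^bsub>N\<^esub> y \<in> carrier N" using N[of "m \<oplus>\<^bsub>M\<^esub> n"] m n by (simp add: add)
    show "x \<oplus>\<^bsub>N\<^esub> y = y \<oplus>\<^bsub>N\<^esub> x" using m n by (simp add: add[symmetric] M.a_comm)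
    show "\<zero>\<^bsub>N\<^esub> \<oplus>\<^bsub>N\<^esub> x = x" using m by (simp add: add[symmetric] zero[symmetric])
    show "\<exists>y\<in>carrier N. y \<oplus>\<^bsub>N\<^esub> x = \<zero>\<^bsub>N\<^esub>"
      using m N[of "\<ominus>\<^bsub>M\<^esub> m"] by (intro bexI[of _ "f (\<ominus>\<^bsub>M\<^esub> m)"]) (simp_all add: add[symmetric] zero[symmetric] M.l_neg)
    fix z assume "z \<in> carrier N"
    then obtain l where l: "l \<in> carrier M" "z = f l" using ex by metis
    show "x \<oplus>\<^bsub>N\<^esub> y \<oplus>\<^bsub>N\<^esub> z = x \<oplus>\<^bsub>N\<^esub> (y \<oplus>\<^bsub>N\<^esub> z)" using m n l by (simp add: add[symmetric] M.a_assoc)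
  qed
  show ?thesis
  proof (rule moduleI[OF M.R.is_cring ab])
    fix x assume "x \<in> carrier N"
    then obtain m where m: "m \<in> carrier M" "x = f m" using ex by metis
    show "\<one>\<^bsub>K\<^esub> \<odot>\<^bsub>N\<^esub> x = x" using m by (simp add: smult[symmetric])
  next
    fix k j x assume k: "k \<in> carrier K" and j: "j \<in> carrier K" and "x \<in> carrier N"
    then obtain m where m: "m \<in> carrier M" "x = f m" using ex by metis
    show "(k \<oplus>\<^bsub>K\<^esub> j) \<odot>\<^bsub>N\<^esub> x = k \<odot>\<^bsub>N\<^esub> x \<oplus>\<^bsub>N\<^esub> j \<odot>\<^bsub>N\<^esub> x"
      using k j m by (simp add: smult[symmetric] add[symmetric] M.smult_l_distr)
    show "(k \<otimes>\<^bsub>K\<^esub> j) \<odot>\<^bsub>N\<^esub> x = k \<odot>\<^bsub>N\<^esub> (j \<odot>\<^bsub>N\<^esub> x)"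
      using k j m by (simp add: smult[symmetric] M.smult_assoc1)
  next
    fix k x y assume k: "k \<in> carrier K" and "x \<in> carrier N" "y \<in> carrier N"
    then obtain m n where m: "m \<in> carrier M" "x = f m" and n: "n \<in> carrier M" "y = f n" using ex by metis
    show "k \<odot>\<^bsub>N\<^esub> (x \<oplus>\<^bsub>N\<^esub> y) = k \<odot>\<^bsub>N\<^esub> x \<oplus>\<^bsub>N\<^esub> k \<odot>\<^bsub>N\<^esub> y"
      using k m n by (simp add: smult[symmetric] add[symmetric] M.smult_r_distr)
  next
    fix k x assume "k \<in> carrier K" "x \<in> carrier N"
    then show "k \<odot>\<^bsub>N\<^esub> x \<in> carrier N" using ex N smult M.smult_closed by metis
  qed
qed

lemma algebra_transport:
  fixes A :: "('k, 'a) module" and B :: "('k, 'b) module"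
  assumes A: "algebra K A" and surj: "f ` carrier A = carrier B"
    and zero: "f \<zero>\<^bsub>A\<^esub> = \<zero>\<^bsub>B\<^esub>" and one: "f \<one>\<^bsub>A\<^esub> = \<one>\<^bsub>B\<^esub>"
    and add: "\<And>a b. a \<in> carrier A \<Longrightarrow> b \<in> carrier A \<Longrightarrow> f (a \<oplus>\<^bsub>A\<^esub> b) = f a \<oplus>\<^bsub>B\<^esub> f b"
    and mult: "\<And>a b. a \<in> carrier A \<Longrightarrow> b \<in> carrier A \<Longrightarrow> f (a \<otimes>\<^bsub>A\<^esub> b) = f a \<otimes>\<^bsub>B\<^esub> f b"
    and smult: "\<And>k a. k \<in> carrier K \<Longrightarrow> a \<in> carrier A \<Longrightarrow> f (k \<odot>\<^bsub>A\<^esub> a) = k \<odot>\<^bsub>B\<^esub> f a"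
  shows "algebra K B"
proof -
  interpret A: algebra K A by (rule A)
  have "module K A" using A.module .
  from module_transport[OF this surj zero add smult] interpret B: module K B .
  have B: "f m \<in> carrier B" if "m \<in> carrier A" for m using surj that by blast
  have ex: "\<exists>m\<in>carrier A. x = f m" if "x \<in> carrier B" for x using surj that by blast
  have cr: "cring B"
  proof (rule cringI)
    show "abelian_group B" by (rule B.abelian_group_axioms)
    show "comm_monoid B"
    proof (rule comm_monoidI)
      show "\<one>\<^bsub>B\<^esub> \<in> carrier B" using B[of "\<one>\<^bsub>A\<^esub>"] one by simp
      fix x y assume "x \<in> carrier B" "y \<in> carrier B"
      then obtain m n where m: "m \<in> carrier A" "x = f m" and n: "n \<in> carrier A" "y = f n" using ex by metis
      show "x \<otimes>\<^bsub>B\<^esub> y \<in> carrier B" using B[of "m \<otimes>\<^bsub>A\<^esub> n"] m n by (simp add: mult)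
      show "x \<otimes>\<^bsub>B\<^esub> y = y \<otimes>\<^bsub>B\<^esub> x" using m n by (simp add: mult[symmetric] A.m_comm)
      show "\<one>\<^bsub>B\<^esub> \<otimes>\<^bsub>B\<^esub> x = x" using m by (simp add: mult[symmetric] one[symmetric])
      fix z assume "z \<in> carrier B"
      then obtain l where l: "l \<in> carrier A" "z = f l" using ex by metis
      show "x \<otimes>\<^bsub>B\<^esub> y \<otimes>\<^bsub>B\<^esub> z = x \<otimes>\<^bsub>B\<^esub> (y \<otimes>\<^bsub>B\<^esub> z)" using m n l by (simp add: mult[symmetric] A.m_assoc)
    qed
    fix x y z assume "x \<in> carrier B" "y \<in> carrier B" "z \<in> carrier B"
    then obtain m n l where "m \<in> carrier A" "x = f m" "n \<in> carrier A" "y = f n" "l \<in> carrier A" "z = f l" using ex by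
        metis
    then show "(x \<oplus>\<^bsub>B\<^esub> y) \<otimes>\<^bsub>B\<^esub> z = x \<otimes>\<^bsub>B\<^esub> z \<oplus>\<^bsub>B\<^esub> y \<otimes>\<^bsub>B\<^esub> z"
      by (simp add: mult[symmetric] add[symmetric] A.l_distr)
  qed
  show ?thesis
  proof (rule algebraI[OF A.R_cring cr B.smult_closed B.smult_l_distr B.smult_r_distr B.smult_assoc1 B.smult_one])
    fix k x y assume k: "k \<in> carrier K" and "x \<in> carrier B" "y \<in> carrier B"
    then obtain m n where "m \<in> carrier A" "x = f m" "n \<in> carrier A" "y = f n" using ex by metis
    then show "(k \<odot>\<^bsub>B\<^esub> x) \<otimes>\<^bsub>B\<^esub> y = k \<odot>\<^bsub>B\<^esub> (x \<otimes>\<^bsub>B\<^esub> y)"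
      using k by (simp add: mult[symmetric] smult[symmetric] A.smult_assoc2)
  qed
qed

lemma bimodule_transport:
  assumes M: "bimodule K A M l r" and A: "algebra K A"
    and i: "i ` carrier A = carrier B" "i \<one>\<^bsub>A\<^esub> = \<one>\<^bsub>B\<^esub>"
      "\<And>a b. a \<in> carrier A \<Longrightarrow> b \<in> carrier A \<Longrightarrow> i (a \<oplus>\<^bsub>A\<^esub> b) = i a \<oplus>\<^bsub>B\<^esub> i b"
      "\<And>a b. a \<in> carrier A \<Longrightarrow> b \<in> carrier A \<Longrightarrow> i (a \<otimes>\<^bsub>A\<^esub> b) = i a \<otimes>\<^bsub>B\<^esub> i b"
      "\<And>k a. k \<in> carrier K \<Longrightarrow> a \<in> carrier A \<Longrightarrow> i (k \<odot>\<^bsub>A\<^esub> a) = k \<odot>\<^bsub>B\<^esub> i a"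
    and f: "f ` carrier M = carrier N" "f \<zero>\<^bsub>M\<^esub> = \<zero>\<^bsub>N\<^esub>"
      "\<And>m n. m \<in> carrier M \<Longrightarrow> n \<in> carrier M \<Longrightarrow> f (m \<oplus>\<^bsub>M\<^esub> n) = f m \<oplus>\<^bsub>N\<^esub> f n"
      "\<And>k m. k \<in> carrier K \<Longrightarrow> m \<in> carrier M \<Longrightarrow> f (k \<odot>\<^bsub>M\<^esub> m) = k \<odot>\<^bsub>N\<^esub> f m"
      "\<And>a m. a \<in> carrier A \<Longrightarrow> m \<in> carrier M \<Longrightarrow> f (l a m) = l' (i a) (f m)"
      "\<And>a m. a \<in> carrier A \<Longrightarrow> m \<in> carrier M \<Longrightarrow> f (r m a) = r' (f m) (i a)"
  shows "bimodule K B N l' r'"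
proof -
  interpret A: algebra K A by (rule A)
  have mod: "module K M" using M by (simp add: bimodule_def)
  interpret M: module K M by (rule mod)
  have closed: "l a m \<in> carrier M" "r m a \<in> carrier M" if "a \<in> carrier A" "m \<in> carrier M" for a m
    using M that by (simp_all add: bimodule_def)
  have one: "l \<one>\<^bsub>A\<^esub> m = m" "r m \<one>\<^bsub>A\<^esub> = m" if "m \<in> carrier M" for m
    using M that by (simp_all add: bimodule_def)
  have ax: "l (a \<otimes>\<^bsub>A\<^esub> b) m = l a (l b m)" "r m (a \<otimes>\<^bsub>A\<^esub> b) = r (r m a) b" "r (l a m) b = l a (r m b)"
    "l (a \<oplus>\<^bsub>A\<^esub> b) m = l a m \<oplus>\<^bsub>M\<^esub> l b m" "r m (a \<oplus>\<^bsub>A\<^esub> b) = r m a \<oplus>\<^bsub>M\<^esub> r m b"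
    if "a \<in> carrier A" "b \<in> carrier A" "m \<in> carrier M" for a b m
    using M that by (simp_all add: bimodule_def)
  have ax2: "l a (m \<oplus>\<^bsub>M\<^esub> n) = l a m \<oplus>\<^bsub>M\<^esub> l a n" "r (m \<oplus>\<^bsub>M\<^esub> n) a = r m a \<oplus>\<^bsub>M\<^esub> r n a"
    if "a \<in> carrier A" "m \<in> carrier M" "n \<in> carrier M" for a m n
    using M that by (simp_all add: bimodule_def)
  have ax3: "l (k \<odot>\<^bsub>A\<^esub> a) m = k \<odot>\<^bsub>M\<^esub> l a m" "l a (k \<odot>\<^bsub>M\<^esub> m) = k \<odot>\<^bsub>M\<^esub> l a m"
    "r m (k \<odot>\<^bsub>A\<^esub> a) = k \<odot>\<^bsub>M\<^esub> r m a" "r (k \<odot>\<^bsub>M\<^esub> m) a = k \<odot>\<^bsub>M\<^esub> r m a"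
    if "k \<in> carrier K" "a \<in> carrier A" "m \<in> carrier M" for k a m
    using M that by (simp_all add: bimodule_def)
  have N: "f m \<in> carrier N" if "m \<in> carrier M" for m using f(1) that by blast
  note sym = f(5,6)[symmetric] f(3,4)[symmetric] i(2-5)[symmetric]
  note cl = closed A.m_closed A.a_closed A.smult_closed M.a_closed M.smult_closed
  have BA: "\<And>P. (\<forall>b\<in>carrier B. P b) = (\<forall>a\<in>carrier A. P (i a))" unfolding i(1)[symmetric] by blast
  have NM: "\<And>P. (\<forall>n\<in>carrier N. P n) = (\<forall>m\<in>carrier M. P (f m))" unfolding f(1)[symmetric] by blast
  show ?thesis unfolding bimodule_def BA NM
  proof (intro conjI ballI)
    show "module K N" by (rule module_transport[OF mod f(1-4)])
  qed (use N in \<open>simp_all add: sym cl one ax ax2 ax3\<close>)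
qed


section \<open>Traces as bimodules\<close>

context linear_two_category
begin

lemma hom2_id_cases:
  assumes "a \<in> obj C" "x \<in> hom2 C (id1 C a) (id1 C a)" "y \<in> hom2 C (id1 C a) (id1 C a)"
  shows "x \<bullet> y = x \<cdot> y" "x \<bullet> y = y \<cdot> x"
proof -
  note o = assms(1) assms(1)
  note m = id1_closed[OF assms(1)]
  note e = id2_closed[OF o m]
  note v = vcomp_id[OF o m m assms(2)] vcomp_id[OF o m m assms(3)]
  note h = hcomp_id1[OF o m m assms(2)] hcomp_id1[OF o m m assms(3)]
  show "x \<bullet> y = x \<cdot> y"
    using interchange[OF o(1) o m m m m m m e assms(2) assms(3) e] v h by simp
  show "x \<bullet> y = y \<cdot> x"
    using interchange[OF o(1) o m m m m m m assms(2) e e assms(3)] v h by simp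
qed

lemma Dim_sel [simp]:
  "carrier (Dim C a) = hom2 C (id1 C a) (id1 C a)" "monoid.mult (Dim C a) = vcomp C"
      "monoid.one (Dim C a) = id2 C (id1 C a)"
  "ring.add (Dim C a) = ring.add (cell C (id1 C a) (id1 C a))"
      "ring.zero (Dim C a) = ring.zero (cell C (id1 C a) (id1 C a))"
  "module.smult (Dim C a) = module.smult (cell C (id1 C a) (id1 C a))"
  by (simp_all add: Dim_def Tr_def hom2_def)

text \<open>The algebra of 2-endomorphisms of an identity is commutative by the Eckmann-Hilton argument.\<close>

lemma Dim_algebra:
  assumes a: "a \<in> obj C"
  shows "algebra K (Dim C a)"
proof -
  note o = a a and m = id1_closed[OF a]
  interpret M: module K "cell C (id1 C a) (id1 C a)" using cell_module[OF o m m] .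
  have c: "carrier (cell C (id1 C a) (id1 C a)) = hom2 C (id1 C a) (id1 C a)" by (simp add: hom2_def)
  note [simp] = M.smult_closed[unfolded c] M.a_closed[unfolded c] M.zero_closed[unfolded c]
  have vc: "y \<cdot> x \<in> hom2 C (id1 C a) (id1 C a)" if "x \<in> hom2 C (id1 C a) (id1 C a)" "y \<in> hom2 C (id1 C a) (id1 C a)"
      for x y
    using vcomp_closed[OF o m m m that] .
  have cr: "cring (Dim C a)"
  proof (rule cringI)
    show "abelian_group (Dim C a)"
    proof (rule abelian_groupI)
      show "\<exists>y\<in>carrier (Dim C a). y \<oplus>\<^bsub>Dim C a\<^esub> x = \<zero>\<^bsub>Dim C a\<^esub>" if "x \<in> carrier (Dim C a)" for x
        using that M.l_neg[unfolded c] M.a_inv_closed[unfolded c] by auto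
    qed (use M.a_assoc[unfolded c] M.a_comm[unfolded c] M.l_zero[unfolded c] in simp_all)
    show "comm_monoid (Dim C a)"
    proof (rule comm_monoidI)
      show "\<one>\<^bsub>Dim C a\<^esub> \<in> carrier (Dim C a)" using id2_closed[OF o m] by simp
    next
      fix x y assume xy: "x \<in> carrier (Dim C a)" "y \<in> carrier (Dim C a)"
      show "x \<otimes>\<^bsub>Dim C a\<^esub> y \<in> carrier (Dim C a)" using xy vc by simp
      show "\<one>\<^bsub>Dim C a\<^esub> \<otimes>\<^bsub>Dim C a\<^esub> x = x" using xy vcomp_id[OF o m m, of x] by simp
      show "x \<otimes>\<^bsub>Dim C a\<^esub> y = y \<otimes>\<^bsub>Dim C a\<^esub> x" using xy hom2_id_cases[OF a, of x y] by simp
      fix z assume "z \<in> carrier (Dim C a)"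
      then show "x \<otimes>\<^bsub>Dim C a\<^esub> y \<otimes>\<^bsub>Dim C a\<^esub> z = x \<otimes>\<^bsub>Dim C a\<^esub> (y \<otimes>\<^bsub>Dim C a\<^esub> z)"
        using xy vcomp_assoc[OF o m m m m, of z y x] by simp
    qed
    show "(x \<oplus>\<^bsub>Dim C a\<^esub> y) \<otimes>\<^bsub>Dim C a\<^esub> z = x \<otimes>\<^bsub>Dim C a\<^esub> z \<oplus>\<^bsub>Dim C a\<^esub> y \<otimes>\<^bsub>Dim C a\<^esub> z"
      if "x \<in> carrier (Dim C a)" "y \<in> carrier (Dim C a)" "z \<in> carrier (Dim C a)" for x y z
      using that vcomp_add_left[OF o m m m] by simp
  qed
  show ?thesis
  proof (rule algebraI[OF is_cring cr])
    show "k \<odot>\<^bsub>Dim C a\<^esub> x \<otimes>\<^bsub>Dim C a\<^esub> y = k \<odot>\<^bsub>Dim C a\<^esub> (x \<otimes>\<^bsub>Dim C a\<^esub> y)"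
      if "k \<in> carrier K" "x \<in> carrier (Dim C a)" "y \<in> carrier (Dim C a)" for k x y
      using that vcomp_bilinear[OF o m m m, of x x y y k] by simp
  qed (use M.smult_l_distr[unfolded c] M.smult_r_distr[unfolded c] M.smult_assoc1[unfolded c] M.smult_one[unfolded c]
      in simp_all)
qed

lemma trace_bimodule:
  assumes a: "a \<in> obj C" and F: "F \<in> mor C a a"
  shows "bimodule K (Dim C a) (Tr C a F) (\<lambda>x y. x \<bullet> y) (\<lambda>y x. y \<bullet> x)"
proof -
  note o = a a and m = id1_closed[OF a]
  note c1 = comp1_id[OF o F] comp1_id[OF o m]
  note ba = hcomp_bilinear[OF a o m m m F, unfolded conjunct1[OF c1(1)] conjunct2[OF c1(1)] conjunct1[OF c1(2)]]
    and bb = hcomp_bilinear[OF a o m F m m, unfolded conjunct1[OF c1(1)] conjunct2[OF c1(1)] conjunct1[OF c1(2)]]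
  note ca = hcomp_closed[OF a o m m m F, unfolded conjunct1[OF c1(1)] conjunct2[OF c1(1)] conjunct1[OF c1(2)]]
    and cb = hcomp_closed[OF a o m F m m, unfolded conjunct1[OF c1(1)] conjunct2[OF c1(1)] conjunct1[OF c1(2)]]
  have TrF: "Tr C a F = cell C (id1 C a) F" "carrier (cell C (id1 C a) F) = hom2 C (id1 C a) F"
    by (simp_all add: Tr_def hom2_def)
  show ?thesis
    unfolding bimodule_def TrF Dim_sel
  proof (intro conjI ballI)
    show "module K (cell C (id1 C a) F)" using cell_module[OF o m F] .
  next
    fix b x assume b: "b \<in> hom2 C (id1 C a) (id1 C a)" and x: "x \<in> hom2 C (id1 C a) F"
    show "b \<bullet> x \<in> hom2 C (id1 C a) F" "x \<bullet> b \<in> hom2 C (id1 C a) F" using ca[OF b x] cb[OF x b] .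
  next
    fix x assume x: "x \<in> hom2 C (id1 C a) F"
    show "id2 C (id1 C a) \<bullet> x = x" "x \<bullet> id2 C (id1 C a) = x" using hcomp_id1[OF o m F x] by auto
  next
    fix b c x assume b: "b \<in> hom2 C (id1 C a) (id1 C a)" and c: "c \<in> hom2 C (id1 C a) (id1 C a)" and x:
        "x \<in> hom2 C (id1 C a) F"
    show "(b \<cdot> c) \<bullet> x = b \<bullet> c \<bullet> x"
      using hcomp_assoc[OF o o m m m m m F b c x] hom2_id_cases(1)[OF a b c] by simp
    show "x \<bullet> (b \<cdot> c) = (x \<bullet> b) \<bullet> c"
      using hcomp_assoc[OF o o m F m m m m x b c] hom2_id_cases(1)[OF a b c] by simp
    show "(b \<bullet> x) \<bullet> c = b \<bullet> x \<bullet> c"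
      using hcomp_assoc[OF o o m m m F m m b x c] .
    show "(b \<oplus>\<^bsub>cell C (id1 C a) (id1 C a)\<^esub> c) \<bullet> x = b \<bullet> x \<oplus>\<^bsub>cell C (id1 C a) F\<^esub> c \<bullet> x"
      using ba[OF b c x x zero_closed] by blast
    show "x \<bullet> (b \<oplus>\<^bsub>cell C (id1 C a) (id1 C a)\<^esub> c) = x \<bullet> b \<oplus>\<^bsub>cell C (id1 C a) F\<^esub> x \<bullet> c"
      using bb[OF x x b c zero_closed] by blast
  next
    fix b x y assume b: "b \<in> hom2 C (id1 C a) (id1 C a)" and x: "x \<in> hom2 C (id1 C a) F" and y:
        "y \<in> hom2 C (id1 C a) F"
    show "b \<bullet> (x \<oplus>\<^bsub>cell C (id1 C a) F\<^esub> y) = b \<bullet> x \<oplus>\<^bsub>cell C (id1 C a) F\<^esub> b \<bullet> y"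
      using ba[OF b b x y zero_closed] by blast
    show "(x \<oplus>\<^bsub>cell C (id1 C a) F\<^esub> y) \<bullet> b = x \<bullet> b \<oplus>\<^bsub>cell C (id1 C a) F\<^esub> y \<bullet> b"
      using bb[OF x y b b zero_closed] by blast
  next
    fix k b x assume k: "k \<in> carrier K" and b: "b \<in> hom2 C (id1 C a) (id1 C a)" and x: "x \<in> hom2 C (id1 C a) F"
    show "(k \<odot>\<^bsub>cell C (id1 C a) (id1 C a)\<^esub> b) \<bullet> x = k \<odot>\<^bsub>cell C (id1 C a) F\<^esub> (b \<bullet> x)"
      "b \<bullet> (k \<odot>\<^bsub>cell C (id1 C a) F\<^esub> x) = k \<odot>\<^bsub>cell C (id1 C a) F\<^esub> (b \<bullet> x)"
      using ba[OF b b x x k] by auto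
    show "x \<bullet> (k \<odot>\<^bsub>cell C (id1 C a) (id1 C a)\<^esub> b) = k \<odot>\<^bsub>cell C (id1 C a) F\<^esub> (x \<bullet> b)"
      "(k \<odot>\<^bsub>cell C (id1 C a) F\<^esub> x) \<bullet> b = k \<odot>\<^bsub>cell C (id1 C a) F\<^esub> (x \<bullet> b)"
      using bb[OF x x b b k] by auto
  qed
qed

end


context fixed_object
begin

text \<open>
  The 2-endomorphism \<open>\<Sum>\<^sub>g \<upsilon>\<^sub>g\<^sup>-\<^sup>1 \<circ> (x\<^sub>g U)\<close> of \<open>U\<close>. The isomorphism of algebras is defined as the inverse of
  \<open>y \<mapsto> ups_sum y\<close>, which involves no choice of \<open>A\<close>.
\<close>

definition ups_sum :: "('g \<Rightarrow> 'c) \<Rightarrow> 'c" where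
  "ups_sum x = (\<Oplus>\<^bsub>cell C U U\<^esub>g\<in>carrier G. inv2 C U (act R g \<star> U) (upsilon C R S \<epsilon> U \<tau>U g) \<cdot> (x g \<triangleleft> U))"

definition trace_iso :: "'c \<Rightarrow> 'g \<Rightarrow> 'c" where
  "trace_iso x = (THE y. y \<in> carrier (twisted_group_algebra C G V R) \<and> U \<triangleright> x = ups_sum y)"

end

context two_representation
begin

lemma twisted_carrier:
  "x \<in> carrier (twisted_group_algebra C G V R) \<longleftrightarrow>
    x \<in> extensional (carrier G) \<and> (\<forall>g\<in>carrier G. x g \<in> hom2 C (id1 C V) (act R g))"
  by (simp add: twisted_group_algebra_def Tr_def hom2_def PiE_iff conj_commute)

end

context adjunction
begin

section \<open>The twisted group algebra as traces of \<open>A\<close>\<close>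

abbreviation twisted :: "('k, 'g \<Rightarrow> 'c) module" where "twisted \<equiv> twisted_group_algebra C G V R"
abbreviation total :: "('g \<Rightarrow> 'c) \<Rightarrow> 'c" where "total x \<equiv> to_TrA C G V (U \<star> A') inc x"

definition comps :: "'c \<Rightarrow> 'g \<Rightarrow> 'c" where
  "comps m = (\<lambda>g\<in>carrier G. prj g \<cdot> m)"

definition total_cell :: "('g \<Rightarrow> 'c) \<Rightarrow> ('o, 'm, 'c) tcell" where
  "total_cell x = TCell V V [] [u, a] (Some (total x))"

definition comp_cell :: "('g \<Rightarrow> 'c) \<Rightarrow> 'g \<Rightarrow> ('o, 'm, 'c) tcell" where
  "comp_cell x g = TCell V V [] [rho g] (Some (x g))"

lemma total_cell_sel [simp]:
  "tdom (total_cell x) = V" "tcod (total_cell x) = V" "tsrc (total_cell x) = []" "ttgt (total_cell x) = [u, a]"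
  "val (total_cell x) = total x"
  "tdom (comp_cell x g) = V" "tcod (comp_cell x g) = V" "tsrc (comp_cell x g) = []" "ttgt (comp_cell x g) = [rho g]"
  "val (comp_cell x g) = x g"
  by (simp_all add: total_cell_def comp_cell_def)

lemma UA_mor [simp]: "U \<star> A' \<in> mor C V V"
  using A_mor by simp

lemma total_facts:
  assumes x: "x \<in> carrier twisted"
  shows total_closed: "total x \<in> hom2 C (id1 C V) (U \<star> A')"
    and prj_total: "g \<in> carrier G \<Longrightarrow> prj g \<cdot> total x = x g"
  using direct_sum_tuple[OF V_obj V_obj act_mor UA_mor sum_UA finite_G id1_mor, of x] x
  by (simp_all add: twisted_carrier to_TrA_def Tr_def)

lemma ok_total [simp]: "x \<in> carrier twisted \<Longrightarrow> ok (total_cell x)"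
  by (simp add: total_cell_def ok_TCell total_closed)

lemma ok_comp [simp]: "x \<in> carrier twisted \<Longrightarrow> g \<in> carrier G \<Longrightarrow> ok (comp_cell x g)"
  by (simp add: comp_cell_def ok_TCell twisted_carrier)

lemma prj_total_cell:
  assumes "x \<in> carrier twisted" "g \<in> carrier G"
  shows "vc (prj_cell g) (total_cell x) = comp_cell x g"
  using assms by (intro tcell_eqI) (simp_all add: val_simps prj_total)

lemma comps_closed: "m \<in> hom2 C (id1 C V) (U \<star> A') \<Longrightarrow> comps m \<in> carrier twisted"
  using vcomp_closed[OF V_obj V_obj id1_mor UA_mor act_mor _ direct_sum_prj[OF sum_UA]]
  by (simp add: twisted_carrier comps_def)

lemma comps_total: "x \<in> carrier twisted \<Longrightarrow> comps (total x) = x"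
  by (rule extensionalityI[of _ "carrier G"]) (simp_all add: comps_def prj_total twisted_carrier)

lemma comps_injective:
  assumes m: "m \<in> hom2 C (id1 C V) (U \<star> A')" and n: "n \<in> hom2 C (id1 C V) (U \<star> A')" and eq: "comps m = comps n"
  shows "m = n"
proof (rule direct_sum_eq_prj[OF V_obj V_obj act_mor UA_mor sum_UA finite_G id1_mor m n])
  show "prj g \<cdot> m = prj g \<cdot> n" if "g \<in> carrier G" for g
    using fun_cong[OF eq, of g] that by (simp add: comps_def)
qed

lemma total_comps: "m \<in> hom2 C (id1 C V) (U \<star> A') \<Longrightarrow> total (comps m) = m"
  by (rule comps_injective) (simp_all add: total_closed comps_closed comps_total)

lemma inv_ups_A: "g \<in> carrier G \<Longrightarrow> vc (wh [] alpha_cell [a]) (wh [] (inc_cell g) [u, a]) = invc (triv_cell g)"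
  using arg_cong[OF alpha_inc[of g], of "\<lambda>x. wh [] x [a]"] by (simp add: ups_A[symmetric])

lemma alpha_A'_hom: "alpha_A \<triangleleft> A' \<in> hom2 C ((U \<star> A') \<star> (U \<star> A')) (U \<star> A')"
proof -
  have "val (wh [] alpha_cell [a]) \<in> hom2 C (U \<star> A' \<star> U \<star> A') (U \<star> A')"
    using okD(7)[of "wh [] alpha_cell [a]"] by simp
  moreover have "(U \<star> A') \<star> (U \<star> A') = U \<star> A' \<star> U \<star> A'"
    using comp1_assoc[of V V VG V U A' "U \<star> A'"] by simp
  ultimately show ?thesis by (simp add: val_simps whisker_right_def)
qed

text \<open>
  The product of the twisted group algebra is the product of \<open>\<T>r(A)\<close>; this reduces to
  \<open>\<alpha> A'\<close> being \<open>\<phi>\<^sub>g\<^sub>,\<^sub>h\<close> on the summand \<open>\<rho>(g) \<rho>(h)\<close> of \<open>A A\<close>.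
\<close>

lemma alpha_A'_summand:
  assumes g: "g \<in> carrier G" and b: "b \<in> carrier G"
  shows "vc (prj_cell (g \<diamondop> b)) (invc (triv_cell g)) = vc (phi_cell g b) (wh [rho g] (prj_cell b) [])"
proof (rule vc_right_cancel[of "triv_cell g"])
  show "vc (vc (prj_cell (g \<diamondop> b)) (invc (triv_cell g))) (triv_cell g) =
    vc (vc (phi_cell g b) (wh [rho g] (prj_cell b) [])) (triv_cell g)"
    using triv_prj[OF g, of "g \<diamondop> b"] g b by simp
qed (use g b in simp_all)

lemma total_mult:
  assumes x: "x \<in> carrier twisted" and y: "y \<in> carrier twisted"
  shows "x \<otimes>\<^bsub>twisted\<^esub> y = comps (val (vc (wh [] alpha_cell [a]) (vc (wh [] (total_cell x) [u, a]) (total_cell y))))"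
proof (rule extensionalityI[of _ "carrier G"])
  show "x \<otimes>\<^bsub>twisted\<^esub> y \<in> extensional (carrier G)" by (simp add: twisted_group_algebra_def)
  show "comps m \<in> extensional (carrier G)" for m by (simp add: comps_def)
  fix g assume g: "g \<in> carrier G"
  have xh: "x h \<in> hom2 C (id1 C V) (act R h)" if "h \<in> carrier G" for h
    using x that by (simp add: twisted_carrier)
  define z where "z h = inc h \<cdot> x h" for h
  have z: "z h \<in> hom2 C (id1 C V) (U \<star> A')" if "h \<in> carrier G" for h
    unfolding z_def using vcomp_closed[OF V_obj V_obj id1_mor act_mor[OF that] UA_mor xh[OF that]
        direct_sum_inc[OF sum_UA that]] .
  let ?y = "total y" and ?al = "alpha_A \<triangleleft> A'"
  have AA: "(U \<star> A') \<star> (U \<star> A') \<in> mor C V V" using comp1_closed[OF V_obj V_obj V_obj UA_mor UA_mor] .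
  have ii: "id1 C V \<star> id1 C V = id1 C V" using comp1_id[OF V_obj V_obj id1_mor] by simp
  have zy: "z h \<bullet> ?y \<in> hom2 C (id1 C V) ((U \<star> A') \<star> (U \<star> A'))" if "h \<in> carrier G" for h
    using hcomp_closed[OF V_obj V_obj V_obj id1_mor UA_mor id1_mor UA_mor z[OF that] total_closed[OF y]] ii by simp
  have azy: "?al \<cdot> (z h \<bullet> ?y) \<in> hom2 C (id1 C V) (U \<star> A')" if "h \<in> carrier G" for h
    using vcomp_closed[OF V_obj V_obj id1_mor AA UA_mor zy[OF that] alpha_A'_hom] .
  have summand: "prj g \<cdot> ?al \<cdot> (z h \<bullet> ?y) = phi R h (ginv h \<diamondop> g) \<cdot> (x h \<bullet> y (ginv h \<diamondop> g))"
    if h: "h \<in> carrier G" for h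
  proof -
    define b where "b = ginv h \<diamondop> g"
    have b: "b \<in> carrier G" and gb: "g = h \<diamondop> b" using g h by (simp_all add: b_def)
    have "z h \<bullet> ?y = val (vc (inc_cell h) (comp_cell x h)) \<bullet> val (total_cell y)"
      using h x by (simp add: val_simps z_def)
    also have "\<dots> = val (vc (wh [] (vc (inc_cell h) (comp_cell x h)) [u, a]) (total_cell y))"
      using val_hcomp(1)[of "vc (inc_cell h) (comp_cell x h)" "total_cell y"] h x y by simp
    finally have "prj g \<cdot> ?al \<cdot> (z h \<bullet> ?y) = val (vc (prj_cell g) (vc (wh [] alpha_cell [a])
      (vc (wh [] (vc (inc_cell h) (comp_cell x h)) [u, a]) (total_cell y))))"
      using g h x y by (simp add: val_vc[of "prj_cell g"] val_vc[of "wh [] alpha_cell [a]"]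
          val_wh_right[of alpha_cell] whisker_right_def)
    also have "vc (prj_cell g) (vc (wh [] alpha_cell [a])
        (vc (wh [] (vc (inc_cell h) (comp_cell x h)) [u, a]) (total_cell y)))
      = vc (phi_cell h b) (vc (wh [rho h] (comp_cell y b) []) (comp_cell x h))"
    proof -
      have e1: "vc (wh [] (comp_cell x h) [u, a]) (total_cell y) = vc (wh [rho h] (total_cell y) []) (comp_cell x h)"
        using exchange[of "comp_cell x h" "total_cell y" "[]" "[]" "[]"] x y h by simp
      have e2: "vc (wh [rho h] (prj_cell b) []) (wh [rho h] (total_cell y) []) = wh [rho h] (comp_cell y b) []"
        using arg_cong[OF prj_total_cell[OF y b], of "\<lambda>x. wh [rho h] x []"] by simp
      show ?thesis
        by (simp add: vc_head[OF inv_ups_A[OF h]] gb vc_head[OF alpha_A'_summand[OF h b]] e1 vc_head[OF e2])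
    qed
    also have "val \<dots> = phi R h b \<cdot> val (vc (wh [rho h] (comp_cell y b) []) (comp_cell x h))"
      using h b x y by (simp add: val_vc[of "phi_cell h b"])
    also have "val (vc (wh [rho h] (comp_cell y b) []) (comp_cell x h)) = x h \<bullet> y b"
      using val_hcomp(2)[of "comp_cell x h" "comp_cell y b"] x y h b by simp
    finally show ?thesis by (simp add: b_def)
  qed
  have r1: "val (vc (wh [] alpha_cell [a]) (vc (wh [] (total_cell x) [u, a]) (total_cell y))) = ?al \<cdot> (total x \<bullet> ?y)"
    using val_hcomp(1)[of "total_cell x" "total_cell y"] x y
    by (simp add: val_vc[of "wh [] alpha_cell [a]"] val_wh_right[of alpha_cell] whisker_right_def)
  have r2: "total x \<bullet> ?y = (\<Oplus>\<^bsub>cell C (id1 C V) ((U \<star> A') \<star> (U \<star> A'))\<^esub>h\<in>carrier G. z h \<bullet> ?y)"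
    using hcomp_finsum_left[OF V_obj V_obj V_obj id1_mor UA_mor id1_mor UA_mor finite_G z total_closed[OF y]] ii
    by (simp add: to_TrA_def Tr_def z_def)
  have r3: "?al \<cdot> (\<Oplus>\<^bsub>cell C (id1 C V) ((U \<star> A') \<star> (U \<star> A'))\<^esub>h\<in>carrier G. z h \<bullet> ?y) =
      (\<Oplus>\<^bsub>cell C (id1 C V) (U \<star> A')\<^esub>h\<in>carrier G. ?al \<cdot> (z h \<bullet> ?y))"
    using vcomp_finsum_right[OF V_obj V_obj id1_mor AA UA_mor finite_G alpha_A'_hom zy] .
  have r4: "prj g \<cdot> (\<Oplus>\<^bsub>cell C (id1 C V) (U \<star> A')\<^esub>h\<in>carrier G. ?al \<cdot> (z h \<bullet> ?y)) =
      (\<Oplus>\<^bsub>cell C (id1 C V) (act R g)\<^esub>h\<in>carrier G. prj g \<cdot> ?al \<cdot> (z h \<bullet> ?y))"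
    using vcomp_finsum_right[OF V_obj V_obj id1_mor UA_mor act_mor[OF g] finite_G direct_sum_prj[OF sum_UA g] azy] .
  have r5: "(\<Oplus>\<^bsub>cell C (id1 C V) (act R g)\<^esub>h\<in>carrier G. prj g \<cdot> ?al \<cdot> (z h \<bullet> ?y)) =
      (\<Oplus>\<^bsub>cell C (id1 C V) (act R g)\<^esub>h\<in>carrier G. phi R h (ginv h \<diamondop> g) \<cdot> (x h \<bullet> y (ginv h \<diamondop> g)))"
  proof -
    interpret sum: abelian_group "cell C (id1 C V) (act R g)"
      using cell_abelian_group[OF V_obj V_obj id1_mor act_mor[OF g]] .
    show ?thesis
    proof (rule sum.finsum_cong')
      show "(\<lambda>h. phi R h (ginv h \<diamondop> g) \<cdot> (x h \<bullet> y (ginv h \<diamondop> g))) \<in> carrier G \<rightarrow> carrier (cell C (id1 C V) (act R g))"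
        using vcomp_closed[OF V_obj V_obj id1_mor UA_mor act_mor[OF g] azy direct_sum_prj[OF sum_UA g]] summand
        by (auto simp: hom2_def)
    qed (use summand in simp_all)
  qed
  show "(x \<otimes>\<^bsub>twisted\<^esub> y) g = comps (val (vc (wh [] alpha_cell [a]) (vc (wh [] (total_cell x) [u, a]) (total_cell y))))
      g"
    unfolding r1 r2 r3 using g r4 r5 by (simp add: comps_def twisted_group_algebra_def Tr_def Let_def)
qed

lemma UFA_flip_Nil: "s \<in> carrier G \<Longrightarrow> UFA_flip [] s = flip_cell s"
  using U_beta[of s] by (simp add: UFA_flip_def ups_A[symmetric])

text \<open>
  On the component in degree \<open>g\<close>, the flip of \<open>A\<close> is \<open>\<phi>\<close> followed by an inverse of \<open>\<phi>\<close>; the latter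
  cancels against the isomorphism \<open>g s s\<^sup>-\<^sup>1 \<cong> g\<close>.
\<close>

lemma family_action_total:
  assumes x: "x \<in> carrier twisted" and s: "s \<in> carrier G"
  shows "family_action C G V R s x = comps (val (act_cell [] s (total_cell x)))"
proof (rule extensionalityI[of _ "carrier G"])
  show "family_action C G V R s x \<in> extensional (carrier G)" by (simp add: family_action_def)
  show "comps m \<in> extensional (carrier G)" for m by (simp add: comps_def)
  fix g assume g: "g \<in> carrier G"
  let ?t = "ginv s"
  define h where "h = ?t \<diamondop> g \<diamondop> s"
  have h: "h \<in> carrier G" and gs: "g \<diamondop> s = s \<diamondop> h" and hg: "s \<diamondop> h \<diamondop> ?t = g"
    using s g by (simp_all add: h_def)
  have act: "ok (act_cell [] s (total_cell x))"
    using s x by (simp add: act_cell_def UFA_flip_Nil)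
  have e1: "vc (prj_cell g) (wh [u, a] (cancel_cell s) []) = vc (wh [rho g] (cancel_cell s) [])
      (wh [] (prj_cell g) [rho s, rho ?t])"
    using exchange[of "prj_cell g" "cancel_cell s" "[]" "[]" "[]"] s g by simp
  have e2: "vc (wh [] (prj_cell g) [rho s, rho ?t]) (wh [] (flip_cell s) [rho ?t]) =
    vc (wh [] (invc (phi_cell g s)) [rho ?t]) (vc (wh [] (phi_cell s h) [rho ?t]) (wh [rho s] (prj_cell h) [rho ?t]))"
    using arg_cong[OF flip_prj[OF s h], of "\<lambda>x. wh [] x [rho ?t]"] unfolding hg by simp
  have e3: "vc (wh [rho s] (prj_cell h) [rho ?t]) (wh [rho s] (total_cell x) [rho ?t]) = wh [rho s] (comp_cell x h)
      [rho ?t]"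
    using arg_cong[OF prj_total_cell[OF x h], of "\<lambda>x. wh [rho s] x [rho ?t]"] by simp
  have "vc (prj_cell g) (act_cell [] s (total_cell x)) =
    vc (phi_cell (s \<diamondop> h) ?t) (vc (wh [] (phi_cell s h) [rho ?t])
        (vc (wh [rho s] (comp_cell x h) [rho ?t]) (invc (cancel_cell s))))"
    using s g h x
    by (simp add: act_cell_def UFA_flip_Nil vc_head[OF e1] vc_head[OF e2] vc_head[OF e3] cancel_right gs)
  moreover have "ok (vc (prj_cell g) (act_cell [] s (total_cell x)))"
    using act g s by (simp add: act_cell_def UFA_flip_Nil)
  ultimately have "prj g \<cdot> val (act_cell [] s (total_cell x)) =
    val (vc (phi_cell (s \<diamondop> h) ?t) (vc (wh [] (phi_cell s h) [rho ?t])
        (vc (wh [rho s] (comp_cell x h) [rho ?t]) (invc (cancel_cell s)))))"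
    using val_vc[of "prj_cell g" "act_cell [] s (total_cell x)"] by simp
  also have "\<dots> = family_action C G V R s x g"
    using s g h x by (simp add: val_simps family_action_def conjugate_def h_def[symmetric] Let_def whisker_left_def
        whisker_right_def)
  finally show "family_action C G V R s x g = comps (val (act_cell [] s (total_cell x))) g"
    using g by (simp add: comps_def)
qed


section \<open>The isomorphisms\<close>

text \<open>
  The map \<open>\<xi> \<mapsto> (U \<xi> A') \<circ> \<iota>\<close> on traces of the composite of \<open>p\<close>.
\<close>

definition trace_map :: "('o, 'm) arrow list \<Rightarrow> 'c \<Rightarrow> 'c" where
  "trace_map p x = val (mate (wh [u] (TCell VG VG [] p (Some x)) []))"

context
  fixes p :: "('o, 'm) arrow list"
  assumes p: "path VG p VG"
begin

lemma trace_cell: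
  assumes x: "x \<in> hom2 C (id1 C VG) (composite VG p)"
  shows "ok (TCell VG VG [] p (Some x))"
    and "ok (mate (wh [u] (TCell VG VG [] p (Some x)) []))"
    and "TCell V V [] (u # p @ [a]) (Some (trace_map p x)) = mate (wh [u] (TCell VG VG [] p (Some x)) [])"
proof -
  show 1: "ok (TCell VG VG [] p (Some x))" using x p by (simp add: ok_TCell)
  show 2: "ok (mate (wh [u] (TCell VG VG [] p (Some x)) []))" using 1 by (simp add: mate_def)
  show "TCell V V [] (u # p @ [a]) (Some (trace_map p x)) = mate (wh [u] (TCell VG VG [] p (Some x)) [])"
    using okD(8)[OF 2] by (simp add: tcell_eq_iff trace_map_def) (simp add: mate_def)
qed

lemma UFA_composite: "composite V (u # p @ [a]) = U \<star> composite VG p \<star> A'"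
  "path V (u # p @ [a]) V" "path VG (p @ [a]) V" "composite V (p @ [a]) = composite VG p \<star> A'"
proof -
  note e = path_ends[OF p]
  show 1: "path VG (p @ [a]) V" using p e by (simp add: path_append)
  show "path V (u # p @ [a]) V" using 1 by simp
  show 2: "composite V (p @ [a]) = composite VG p \<star> A'"
    using composite_append[OF p, of "[a]" V] by simp
  show "composite V (u # p @ [a]) = U \<star> composite VG p \<star> A'"
    using composite_Cons_path[OF 1] 2 by simp
qed

lemma trace_map_closed:
  assumes "x \<in> hom2 C (id1 C VG) (composite VG p)"
  shows "trace_map p x \<in> hom2 C (id1 C V) (U \<star> composite VG p \<star> A')"
  using okD(7)[OF trace_cell(2)[OF assms]] UFA_composite by (simp add: trace_map_def mate_def)

lemma trace_map_linear:
  assumes x: "x \<in> hom2 C (id1 C VG) (composite VG p)" and y: "y \<in> hom2 C (id1 C VG) (composite VG p)"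
    and k: "k \<in> carrier K"
  shows "trace_map p (x \<oplus>\<^bsub>cell C (id1 C VG) (composite VG p)\<^esub> y) =
      trace_map p x \<oplus>\<^bsub>cell C (id1 C V) (U \<star> composite VG p \<star> A')\<^esub> trace_map p y"
    and "trace_map p (k \<odot>\<^bsub>cell C (id1 C VG) (composite VG p)\<^esub> x) =
      k \<odot>\<^bsub>cell C (id1 C V) (U \<star> composite VG p \<star> A')\<^esub> trace_map p x"
proof -
  let ?F = "composite VG p"
  have o: "V \<in> obj C" "VG \<in> obj C" by simp_all
  have F: "?F \<in> mor C VG VG" using composite_closed[OF p] .
  have FA: "?F \<star> A' \<in> mor C V VG" using comp1_closed[OF o(1) o(2) o(2) F A'_mor] .
  have UFA: "U \<star> ?F \<star> A' \<in> mor C V V" using comp1_closed[OF o(1) o(2) o(1) U_mor FA] .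
  have i: "id1 C VG \<star> A' = A'" using comp1_id[OF o A'_mor] by simp
  note idU = id2_closed[OF o(2) o(1) U_mor] and idA = id2_closed[OF o(1) o(2) A'_mor]
  have v: "trace_map p z = (id2 C U \<bullet> (z \<bullet> id2 C A')) \<cdot> val iota" if "z \<in> hom2 C (id1 C VG) ?F" for z
    using trace_cell(1,2)[OF that] by (simp add: trace_map_def mate_def val_vc val_wh[of "[u]"])
  have io: "val iota \<in> hom2 C (id1 C V) (U \<star> A')" using okD(7)[OF ok_iota] by simp
  interpret M: module K "cell C (id1 C VG) ?F" using cell_module[OF o(2) o(2) S.id1_mor F] .
  have xy: "x \<oplus>\<^bsub>cell C (id1 C VG) ?F\<^esub> y \<in> hom2 C (id1 C VG) ?F" "k \<odot>\<^bsub>cell C (id1 C VG) ?F\<^esub> x \<in> hom2 C (id1 C VG) ?F"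
    using x y k by (simp_all add: hom2_def)
  note h1 = hcomp_closed[OF o(1) o(2) o(2) S.id1_mor F A'_mor A'_mor x idA, unfolded i]
    hcomp_closed[OF o(1) o(2) o(2) S.id1_mor F A'_mor A'_mor y idA, unfolded i]
  note h2 = hcomp_closed[OF o(1) o(2) o(1) U_mor U_mor A'_mor FA idU h1(1)]
    hcomp_closed[OF o(1) o(2) o(1) U_mor U_mor A'_mor FA idU h1(2)]
  note b1 = hcomp_bilinear[OF o(1) o(2) o(2) S.id1_mor F A'_mor A'_mor x y idA idA k, unfolded i]
  note b2 = hcomp_bilinear[OF o(1) o(2) o(1) U_mor U_mor A'_mor FA idU idU h1 k]
  note b3 = vcomp_bilinear[OF o(1) o(1) id1_mor UA_mor UFA h2 io io k]
  show "trace_map p (x \<oplus>\<^bsub>cell C (id1 C VG) ?F\<^esub> y) =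
      trace_map p x \<oplus>\<^bsub>cell C (id1 C V) (U \<star> ?F \<star> A')\<^esub> trace_map p y"
    using b1 b2 b3 by (simp add: v x y xy)
  show "trace_map p (k \<odot>\<^bsub>cell C (id1 C VG) ?F\<^esub> x) = k \<odot>\<^bsub>cell C (id1 C V) (U \<star> ?F \<star> A')\<^esub> trace_map p x"
    using b1 b2 b3 by (simp add: v x y xy)
qed

lemma trace_map_zero: "trace_map p \<zero>\<^bsub>cell C (id1 C VG) (composite VG p)\<^esub> = \<zero>\<^bsub>cell C (id1 C V) (U \<star> composite VG p \<star> A')\<^esub>"
proof (rule additive_zero)
  have o: "V \<in> obj C" "VG \<in> obj C" by simp_all
  have F: "composite VG p \<in> mor C VG VG" using composite_closed[OF p] .
  show "abelian_group (cell C (id1 C VG) (composite VG p))"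
    using cell_abelian_group[OF o(2) o(2) S.id1_mor F] .
  show "abelian_group (cell C (id1 C V) (U \<star> composite VG p \<star> A'))"
    using cell_abelian_group[OF o(1) o(1) id1_mor] composite_closed[OF UFA_composite(2)] by (simp add: UFA_composite)
qed (use trace_map_closed trace_map_linear(1)[OF _ _ zero_closed] in \<open>simp_all add: hom2_def\<close>)

lemma trace_map_image:
  "trace_map p ` hom2 C (id1 C VG) (composite VG p) =
    {m \<in> hom2 C (id1 C V) (U \<star> composite VG p \<star> A'). \<forall>s\<in>carrier G.
      act_cell p s (TCell V V [] (u # p @ [a]) (Some m)) = TCell V V [] (u # p @ [a]) (Some m)}"
    (is "?L = ?R")
proof (intro equalityI subsetI)
  fix m assume "m \<in> ?L"
  then obtain x where x: "x \<in> hom2 C (id1 C VG) (composite VG p)" and m: "m = trace_map p x" by blast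
  have "\<forall>s\<in>carrier G. act_cell p s (mate (wh [u] (TCell VG VG [] p (Some x)) [])) = mate
      (wh [u] (TCell VG VG [] p (Some x)) [])"
    by (subst act_invariant_iff[OF p])
      (use trace_cell(1,2)[OF x] in \<open>auto simp: mate_def intro!: exI[of _ "TCell VG VG [] p (Some x)"]\<close>)
  then show "m \<in> ?R" using trace_map_closed[OF x] trace_cell(3)[OF x] by (simp add: m)
next
  fix m assume m: "m \<in> ?R"
  let ?m = "TCell V V [] (u # p @ [a]) (Some m)"
  have mh: "m \<in> hom2 C (id1 C V) (U \<star> composite VG p \<star> A')" and inv: "\<forall>s\<in>carrier G. act_cell p s ?m = ?m"
    using m by auto
  have ok: "ok ?m" using mh unfolding ok_TCell UFA_composite(1) using UFA_composite(2) by simp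
  obtain x where x: "ok x" "tdom x = VG" "tcod x = VG" "tsrc x = []" "ttgt x = p" and mx: "?m = mate (wh [u] x [])"
    using act_invariant_iff[OF p ok] inv by auto
  have "x = TCell VG VG [] p (Some (val x))" using x okD(8)[OF x(1)] by (simp add: tcell_eq_iff)
  then have "m = trace_map p (val x)" using arg_cong[OF mx, of val] by (simp add: trace_map_def)
  moreover have "val x \<in> hom2 C (id1 C VG) (composite VG p)" using okD(7)[OF x(1)] x by simp
  ultimately show "m \<in> ?L" by blast
qed

lemma trace_map_injective: "inj_on (trace_map p) (hom2 C (id1 C VG) (composite VG p))"
proof (rule inj_onI)
  fix x y assume x: "x \<in> hom2 C (id1 C VG) (composite VG p)" and y: "y \<in> hom2 C (id1 C VG) (composite VG p)"
    and eq: "trace_map p x = trace_map p y"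
  have "TCell VG VG [] p (Some x) = TCell VG VG [] p (Some y)"
    by (rule mate_injective[OF p])
      (use trace_cell(1)[OF x] trace_cell(1)[OF y] trace_cell(3)[OF x] trace_cell(3)[OF y] eq in simp_all)
  then show "x = y" by simp
qed

end

text \<open>
  \<open>ups_sum y\<close> is \<open>\<alpha> \<circ> (y U)\<close> for the trace \<open>y\<close> of \<open>A\<close>, hence the 2-morphism whose mate is \<open>y\<close>.
\<close>

lemma trace_iso_characterization:
  assumes x: "x \<in> hom2 C (id1 C VG) (id1 C VG)" and y: "y \<in> carrier twisted"
  shows "U \<triangleright> x = ups_sum y \<longleftrightarrow> y = comps (trace_map [] x)"
proof -
  have pN: "path VG [] VG" by simp
  let ?x = "TCell VG VG [] [] (Some x)"
  have okx: "ok ?x" using x by (simp add: ok_TCell)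
  have tc: "TCell V V [] [u, a] (Some (trace_map [] x)) = mate (wh [u] ?x [])"
    using trace_cell(3)[OF pN, of x] x by simp
  have tm: "trace_map [] x \<in> hom2 C (id1 C V) (U \<star> A')"
    using trace_map_closed[OF pN, of x] x comp1_id[of V VG A'] by simp
  have Ux: "U \<triangleright> x = val (wh [u] ?x [])" using okx by (simp add: val_simps whisker_left_def)
  have sum: "ups_sum z = val (vc alpha_cell (wh [] (total_cell z) [u]))" if z: "z \<in> carrier twisted" for z
  proof -
    have o: "VG \<in> obj C" "V \<in> obj C" by simp_all
    have zg: "z g \<in> hom2 C (id1 C V) (act R g)" if "g \<in> carrier G" for g
      using z that by (simp add: twisted_carrier)
    have iz: "inc g \<cdot> z g \<in> hom2 C (id1 C V) (U \<star> A')" if "g \<in> carrier G" for g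
      using vcomp_closed[OF o(2) o(2) id1_mor act_mor[OF that] UA_mor zg[OF that] direct_sum_inc[OF sum_UA that]] .
    note idU = id2_closed[OF o U_mor]
    have iU: "id1 C V \<star> U = U" using comp1_id[OF o U_mor] by simp
    have AU: "(U \<star> A') \<star> U \<in> mor C VG V" using comp1_closed[OF o(1) o(2) o(2) UA_mor U_mor] .
    have izU: "(inc g \<cdot> z g) \<bullet> id2 C U \<in> hom2 C U ((U \<star> A') \<star> U)" if "g \<in> carrier G" for g
      using hcomp_closed[OF o(1) o(2) o(2) id1_mor UA_mor U_mor U_mor iz[OF that] idU] iU by simp
    have assoc: "(U \<star> A') \<star> U = U \<star> A' \<star> U"
      using comp1_assoc[OF o(1) o(2) o(1) o(2) U_mor A'_mor U_mor] .
    have al: "val alpha_cell \<in> hom2 C ((U \<star> A') \<star> U) U"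
      using okD(7)[OF ok_alpha] assoc by simp
    have "val (vc alpha_cell (wh [] (total_cell z) [u])) = val alpha_cell \<cdot> (total z \<bullet> id2 C U)"
      using z by (simp add: val_simps)
    also have "total z \<bullet> id2 C U = (\<Oplus>\<^bsub>cell C U ((U \<star> A') \<star> U)\<^esub>g\<in>carrier G. (inc g \<cdot> z g) \<bullet> id2 C U)"
      using hcomp_finsum_left[OF o(1) o(2) o(2) id1_mor UA_mor U_mor U_mor finite_G iz idU] iU
      by (simp add: to_TrA_def Tr_def)
    also have "val alpha_cell \<cdot> \<dots> = (\<Oplus>\<^bsub>cell C U U\<^esub>g\<in>carrier G. val alpha_cell \<cdot> ((inc g \<cdot> z g) \<bullet> id2 C U))"
      using vcomp_finsum_right[OF o U_mor AU U_mor finite_G al izU] .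
    also have "\<dots> = ups_sum z"
    proof -
      interpret sum: abelian_group "cell C U U" using cell_abelian_group[OF o U_mor U_mor] .
      have e: "val alpha_cell \<cdot> ((inc g \<cdot> z g) \<bullet> id2 C U) =
        inv2 C U (act R g \<star> U) (upsilon C R S \<epsilon> U \<tau>U g) \<cdot> (z g \<triangleleft> U)" if g: "g \<in> carrier G" for g
      proof -
        have "val alpha_cell \<cdot> ((inc g \<cdot> z g) \<bullet> id2 C U) = val
            (vc alpha_cell (wh [] (vc (inc_cell g) (comp_cell z g)) [u]))"
          using g z by (simp add: val_vc[of alpha_cell] val_wh_right[of "vc (inc_cell g) (comp_cell z g)"]
              val_vc[of "inc_cell g"] del: wh_vc)
        also have "vc alpha_cell (wh [] (vc (inc_cell g) (comp_cell z g)) [u]) = vc (invc (ups g))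
            (wh [] (comp_cell z g) [u])"
          by (simp add: vc_head[OF alpha_inc[OF g]])
        also have "val \<dots> = inv2 C U (act R g \<star> U) (upsilon C R S \<epsilon> U \<tau>U g) \<cdot> (z g \<triangleleft> U)"
          using g z by (simp add: val_vc val_wh_right val_invc val_ups whisker_right_def)
        finally show ?thesis .
      qed
      show ?thesis unfolding ups_sum_def
      proof (rule sum.finsum_cong')
        show "(\<lambda>g. inv2 C U (act R g \<star> U) (upsilon C R S \<epsilon> U \<tau>U g) \<cdot> (z g \<triangleleft> U)) \<in> carrier G \<rightarrow> carrier (cell C U U)"
          using e vcomp_closed[OF o U_mor AU U_mor izU al] by (auto simp: hom2_def)
      qed (use e in simp_all)
    qed
    finally show ?thesis by simp
  qed
  show ?thesis
  proof
    assume eq: "U \<triangleright> x = ups_sum y"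
    have "wh [u] ?x [] = vc alpha_cell (wh [] (total_cell y) [u])"
      by (rule tcell_eqI) (use okx y eq Ux sum[OF y] in simp_all)
    also have "\<dots> = unmate [] (total_cell y)" by (simp add: unmate_def U_counit_cell)
    finally have "mate (wh [u] ?x []) = total_cell y"
      using mate_unmate[OF pN, of "total_cell y"] y by simp
    then have "trace_map [] x = total y" by (simp add: trace_map_def)
    then show "y = comps (trace_map [] x)" using comps_total[OF y] by simp
  next
    assume eq: "y = comps (trace_map [] x)"
    have "total_cell y = mate (wh [u] ?x [])"
      using tc total_comps[OF tm] by (simp add: total_cell_def eq)
    then have "vc alpha_cell (wh [] (total_cell y) [u]) = wh [u] ?x []"
      using unmate_x[OF pN okx] by (simp add: U_counit_cell)
    then show "U \<triangleright> x = ups_sum y" using sum[OF y] Ux by simp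
  qed
qed

end


context adjunction
begin

lemma trace_map_Nil_closed: "x \<in> hom2 C (id1 C VG) (id1 C VG) \<Longrightarrow> trace_map [] x \<in> hom2 C (id1 C V) (U \<star> A')"
  using trace_map_closed[of "[]" x] comp1_id[of V VG A'] by simp

lemma trace_iso_eq:
  assumes x: "x \<in> hom2 C (id1 C VG) (id1 C VG)"
  shows "trace_iso x = comps (trace_map [] x)"
  unfolding trace_iso_def
proof (rule the_equality)
  show "comps (trace_map [] x) \<in> carrier twisted \<and> U \<triangleright> x = ups_sum (comps (trace_map [] x))"
    using trace_iso_characterization[OF x, of "comps (trace_map [] x)"] comps_closed[OF trace_map_Nil_closed[OF x]] by
        simp
  show "y = comps (trace_map [] x)" if "y \<in> carrier twisted \<and> U \<triangleright> x = ups_sum y" for y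
    using that trace_iso_characterization[OF x, of y] by simp
qed

lemma twisted_ops:
  "\<zero>\<^bsub>twisted\<^esub> = (\<lambda>g\<in>carrier G. \<zero>\<^bsub>cell C (id1 C V) (act R g)\<^esub>)"
  "x \<oplus>\<^bsub>twisted\<^esub> y = (\<lambda>g\<in>carrier G. x g \<oplus>\<^bsub>cell C (id1 C V) (act R g)\<^esub> y g)"
  "k \<odot>\<^bsub>twisted\<^esub> x = (\<lambda>g\<in>carrier G. k \<odot>\<^bsub>cell C (id1 C V) (act R g)\<^esub> x g)"
  "\<one>\<^bsub>twisted\<^esub> = (\<lambda>g\<in>carrier G. if g = \<one>\<^bsub>G\<^esub> then inv2 C (act R \<one>\<^bsub>G\<^esub>) (id1 C V) (phi1 R) else \<zero>\<^bsub>cell C (id1 C V) (act R g)\<^esub>)"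
  unfolding twisted_group_algebra_def Tr_def by simp_all

lemma comps_linear:
  assumes m: "m \<in> hom2 C (id1 C V) (U \<star> A')" and n: "n \<in> hom2 C (id1 C V) (U \<star> A')" and k: "k \<in> carrier K"
  shows "comps (m \<oplus>\<^bsub>cell C (id1 C V) (U \<star> A')\<^esub> n) = comps m \<oplus>\<^bsub>twisted\<^esub> comps n"
    and "comps (k \<odot>\<^bsub>cell C (id1 C V) (U \<star> A')\<^esub> m) = k \<odot>\<^bsub>twisted\<^esub> comps m"
    and "comps \<zero>\<^bsub>cell C (id1 C V) (U \<star> A')\<^esub> = \<zero>\<^bsub>twisted\<^esub>"
proof -
  note prj = direct_sum_prj[OF sum_UA]
  have b: "prj g \<cdot> (m \<oplus>\<^bsub>cell C (id1 C V) (U \<star> A')\<^esub> n) = (prj g \<cdot> m) \<oplus>\<^bsub>cell C (id1 C V) (act R g)\<^esub> (prj g \<cdot> n)"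
    "prj g \<cdot> (k \<odot>\<^bsub>cell C (id1 C V) (U \<star> A')\<^esub> m) = k \<odot>\<^bsub>cell C (id1 C V) (act R g)\<^esub> (prj g \<cdot> m)"
    "prj g \<cdot> \<zero>\<^bsub>cell C (id1 C V) (U \<star> A')\<^esub> = \<zero>\<^bsub>cell C (id1 C V) (act R g)\<^esub>" if g: "g \<in> carrier G" for g
    using vcomp_bilinear[OF V_obj V_obj id1_mor UA_mor act_mor[OF g] prj[OF g] prj[OF g] m n k]
      vcomp_zero_right[OF V_obj V_obj id1_mor UA_mor act_mor[OF g] prj[OF g]] by auto
  show "comps (m \<oplus>\<^bsub>cell C (id1 C V) (U \<star> A')\<^esub> n) = comps m \<oplus>\<^bsub>twisted\<^esub> comps n"
    "comps (k \<odot>\<^bsub>cell C (id1 C V) (U \<star> A')\<^esub> m) = k \<odot>\<^bsub>twisted\<^esub> comps m"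
    "comps \<zero>\<^bsub>cell C (id1 C V) (U \<star> A')\<^esub> = \<zero>\<^bsub>twisted\<^esub>"
    by (auto simp: comps_def twisted_ops b intro!: restrict_ext)
qed

lemma comps_iota: "comps (val iota) = \<one>\<^bsub>twisted\<^esub>"
  unfolding comps_def twisted_ops
proof (rule restrict_ext)
  fix g assume g: "g \<in> carrier G"
  have p: "inv2 C (act R \<one>\<^bsub>G\<^esub>) (id1 C V) (phi1 R) \<in> hom2 C (id1 C V) (act R \<one>\<^bsub>G\<^esub>)"
    using okD(7)[OF ok_invc[OF invertible_phi1]] by (simp add: val_invc)
  have "prj g \<cdot> val iota = (prj g \<cdot> inc \<one>\<^bsub>G\<^esub>) \<cdot> inv2 C (act R \<one>\<^bsub>G\<^esub>) (id1 C V) (phi1 R)"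
    using vcomp_assoc[OF V_obj V_obj id1_mor act_mor[OF G.one_closed] UA_mor act_mor[OF g] p
        direct_sum_inc[OF sum_UA G.one_closed] direct_sum_prj[OF sum_UA g]]
    by (simp add: iota_def val_vc val_invc)
  then show "prj g \<cdot> val iota = (if g = \<one>\<^bsub>G\<^esub> then inv2 C (act R \<one>\<^bsub>G\<^esub>) (id1 C V) (phi1 R) else \<zero>\<^bsub>cell C (id1 C V)
      (act R g)\<^esub>)"
    using direct_sum_prj_inc[OF sum_UA g, of "\<one>\<^bsub>G\<^esub>"] vcomp_id[OF V_obj V_obj id1_mor act_mor[OF G.one_closed] p]
      vcomp_zero_left[OF V_obj V_obj id1_mor act_mor[OF G.one_closed] act_mor[OF g] p] by auto
qed

lemma total_cell_trace_iso:
  assumes "x \<in> hom2 C (id1 C VG) (id1 C VG)"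
  shows "total_cell (trace_iso x) = mate (wh [u] (TCell VG VG [] [] (Some x)) [])"
  using trace_cell(3)[of "[]" x] total_comps[OF trace_map_Nil_closed[OF assms]] assms
  by (simp add: total_cell_def trace_iso_eq)

lemma trace_iso_image: "trace_iso ` hom2 C (id1 C VG) (id1 C VG) = carrier (twisted_invariants C G V R)"
proof -
  have i: "trace_iso ` hom2 C (id1 C VG) (id1 C VG) = comps ` (trace_map [] ` hom2 C (id1 C VG) (id1 C VG))"
    by (auto simp: trace_iso_eq image_image)
  have m: "trace_map [] ` hom2 C (id1 C VG) (id1 C VG) =
    {m \<in> hom2 C (id1 C V) (U \<star> A'). \<forall>s\<in>carrier G. act_cell [] s (TCell V V [] [u, a] (Some m)) = TCell V V [] [u, a]
        (Some m)}"
    using trace_map_image[of "[]"] comp1_id[of V VG A'] by simp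
  have inv: "(\<forall>s\<in>carrier G. family_action C G V R s y = y) \<longleftrightarrow>
    (\<forall>s\<in>carrier G. act_cell [] s (total_cell y) = total_cell y)" if y: "y \<in> carrier twisted" for y
  proof (rule ball_cong[OF refl])
    fix s assume s: "s \<in> carrier G"
    have ok: "ok (act_cell [] s (total_cell y))"
      using s y by (simp add: act_cell_def UFA_flip_Nil)
    have sel: "tdom (act_cell [] s (total_cell y)) = V" "tcod (act_cell [] s (total_cell y)) = V"
      "tsrc (act_cell [] s (total_cell y)) = []" "ttgt (act_cell [] s (total_cell y)) = [u, a]"
      using s by (simp_all add: act_cell_def)
    have h: "val (act_cell [] s (total_cell y)) \<in> hom2 C (id1 C V) (U \<star> A')"
      using okD(7)[OF ok] sel by simp
    have "family_action C G V R s y = y \<longleftrightarrow> comps (val (act_cell [] s (total_cell y))) = comps (total y)"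
      using family_action_total[OF y s] comps_total[OF y] by simp
    also have "\<dots> \<longleftrightarrow> val (act_cell [] s (total_cell y)) = total y"
      using comps_injective[OF h total_closed[OF y]] by auto
    also have "\<dots> \<longleftrightarrow> act_cell [] s (total_cell y) = total_cell y"
      using tcell_eq_val[OF ok ok_total[OF y]] sel by simp
    finally show "family_action C G V R s y = y \<longleftrightarrow> act_cell [] s (total_cell y) = total_cell y" .
  qed
  show ?thesis unfolding i m
  proof (intro equalityI subsetI)
    fix y assume "y \<in> comps ` {m \<in> hom2 C (id1 C V) (U \<star> A'). \<forall>s\<in>carrier G. act_cell [] s
        (TCell V V [] [u, a] (Some m)) = TCell V V [] [u, a] (Some m)}"
    then obtain m where m: "m \<in> hom2 C (id1 C V) (U \<star> A')" "y = comps m"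
      and a: "\<forall>s\<in>carrier G. act_cell [] s (TCell V V [] [u, a] (Some m)) = TCell V V [] [u, a] (Some m)" by blast
    have y: "y \<in> carrier twisted" using comps_closed m by simp
    have "total_cell y = TCell V V [] [u, a] (Some m)" using total_comps m by (simp add: total_cell_def)
    then show "y \<in> carrier (twisted_invariants C G V R)" using y a inv[OF y] by (simp add: twisted_invariants_def)
  next
    fix y assume "y \<in> carrier (twisted_invariants C G V R)"
    then have y: "y \<in> carrier twisted" and "\<forall>s\<in>carrier G. family_action C G V R s y = y"
      by (simp_all add: twisted_invariants_def)
    then have "\<forall>s\<in>carrier G. act_cell [] s (total_cell y) = total_cell y" using inv by blast
    then have "total y \<in> {m \<in> hom2 C (id1 C V) (U \<star> A'). \<forall>s\<in>carrier G. act_cell [] s (TCell V V [] [u, a] (Some m)) =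
        TCell V V [] [u, a] (Some m)}"
      using total_closed[OF y] by (simp add: total_cell_def)
    then show "y \<in> comps ` {m \<in> hom2 C (id1 C V) (U \<star> A'). \<forall>s\<in>carrier G. act_cell [] s (TCell V V [] [u, a] (Some m))
        = TCell V V [] [u, a] (Some m)}"
      using comps_total[OF y] by (intro image_eqI[of _ _ "total y"]) simp_all
  qed
qed

lemma trace_iso_injective: "inj_on trace_iso (hom2 C (id1 C VG) (id1 C VG))"
proof (rule inj_onI)
  fix x y assume x: "x \<in> hom2 C (id1 C VG) (id1 C VG)" and y: "y \<in> hom2 C (id1 C VG) (id1 C VG)"
    and "trace_iso x = trace_iso y"
  then have "trace_map [] x = trace_map [] y"
    using comps_injective[OF trace_map_Nil_closed[OF x] trace_map_Nil_closed[OF y]] by (simp add: trace_iso_eq)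
  then show "x = y" using inj_onD[OF trace_map_injective[of "[]"]] x y by simp
qed

lemma twisted_invariants_ops:
  "\<zero>\<^bsub>twisted_invariants C G V R\<^esub> = \<zero>\<^bsub>twisted\<^esub>" "\<one>\<^bsub>twisted_invariants C G V R\<^esub> = \<one>\<^bsub>twisted\<^esub>"
  "x \<oplus>\<^bsub>twisted_invariants C G V R\<^esub> y = x \<oplus>\<^bsub>twisted\<^esub> y" "x \<otimes>\<^bsub>twisted_invariants C G V R\<^esub> y = x \<otimes>\<^bsub>twisted\<^esub> y"
  "k \<odot>\<^bsub>twisted_invariants C G V R\<^esub> x = k \<odot>\<^bsub>twisted\<^esub> x"
  by (simp_all add: twisted_invariants_def)

lemma trace_iso_hom:
  shows "trace_iso \<zero>\<^bsub>Dim C VG\<^esub> = \<zero>\<^bsub>twisted_invariants C G V R\<^esub>"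
    and "trace_iso \<one>\<^bsub>Dim C VG\<^esub> = \<one>\<^bsub>twisted_invariants C G V R\<^esub>"
    and "x \<in> carrier (Dim C VG) \<Longrightarrow> y \<in> carrier (Dim C VG) \<Longrightarrow>
      trace_iso (x \<oplus>\<^bsub>Dim C VG\<^esub> y) = trace_iso x \<oplus>\<^bsub>twisted_invariants C G V R\<^esub> trace_iso y"
    and "x \<in> carrier (Dim C VG) \<Longrightarrow> y \<in> carrier (Dim C VG) \<Longrightarrow>
      trace_iso (x \<otimes>\<^bsub>Dim C VG\<^esub> y) = trace_iso x \<otimes>\<^bsub>twisted_invariants C G V R\<^esub> trace_iso y"
    and "k \<in> carrier K \<Longrightarrow> x \<in> carrier (Dim C VG) \<Longrightarrow>
      trace_iso (k \<odot>\<^bsub>Dim C VG\<^esub> x) = k \<odot>\<^bsub>twisted_invariants C G V R\<^esub> trace_iso x"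
proof -
  have pN: "path VG [] VG" by simp
  have iA: "id1 C VG \<star> A' = A'" using comp1_id[of V VG A'] by simp
  have o: "VG \<in> obj C" by simp
  interpret D: algebra K "Dim C VG" using Dim_algebra[OF o] .
  have zc: "\<zero>\<^bsub>cell C (id1 C VG) (id1 C VG)\<^esub> \<in> hom2 C (id1 C VG) (id1 C VG)"
    using D.M.zero_closed by simp
  have "trace_map [] \<zero>\<^bsub>cell C (id1 C VG) (id1 C VG)\<^esub> = \<zero>\<^bsub>cell C (id1 C V) (U \<star> A')\<^esub>"
    using trace_map_zero[OF pN] iA by simp
  moreover obtain n where n: "n \<in> hom2 C (id1 C V) (U \<star> A')" using trace_map_Nil_closed[OF zc] by blast
  ultimately show "trace_iso \<zero>\<^bsub>Dim C VG\<^esub> = \<zero>\<^bsub>twisted_invariants C G V R\<^esub>"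
    using comps_linear(3)[OF n n zero_closed] zc by (simp add: trace_iso_eq twisted_invariants_ops)
  have "trace_map [] (id2 C (id1 C VG)) = val iota"
  proof -
    have "TCell VG VG [] [] (Some (id2 C (id1 C VG))) = idc VG [] VG" by (simp add: idc_def)
    then show ?thesis by (simp add: trace_map_def mate_def)
  qed
  then show "trace_iso \<one>\<^bsub>Dim C VG\<^esub> = \<one>\<^bsub>twisted_invariants C G V R\<^esub>"
    using id2_closed[OF o o S.id1_mor] comps_iota by (simp add: trace_iso_eq twisted_invariants_ops)
  show "trace_iso (k \<odot>\<^bsub>Dim C VG\<^esub> x) = k \<odot>\<^bsub>twisted_invariants C G V R\<^esub> trace_iso x"
    if k: "k \<in> carrier K" and x: "x \<in> carrier (Dim C VG)"
    using trace_map_linear(2)[OF pN, of x x k] comps_linear(2)[OF trace_map_Nil_closed trace_map_Nil_closed, of x x k]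
      x k iA D.smult_closed[OF k x] by (simp add: trace_iso_eq twisted_invariants_ops)
  assume x: "x \<in> carrier (Dim C VG)" and y: "y \<in> carrier (Dim C VG)"
  show "trace_iso (x \<oplus>\<^bsub>Dim C VG\<^esub> y) = trace_iso x \<oplus>\<^bsub>twisted_invariants C G V R\<^esub> trace_iso y"
    using trace_map_linear(1)[OF pN, of x y "\<zero>\<^bsub>K\<^esub>"] comps_linear(1)[OF trace_map_Nil_closed trace_map_Nil_closed, of x y
        "\<zero>\<^bsub>K\<^esub>"]
      x y iA D.M.a_closed[OF x y] by (simp add: trace_iso_eq twisted_invariants_ops)
  have tx: "trace_iso x \<in> carrier twisted" "trace_iso y \<in> carrier twisted"
    using x y comps_closed trace_map_Nil_closed by (simp_all add: trace_iso_eq)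
  let ?x = "TCell VG VG [] [] (Some x)" and ?y = "TCell VG VG [] [] (Some y)"
  have ok: "ok ?x" "ok ?y" using x y by (simp_all add: ok_TCell)
  have xy: "TCell VG VG [] [] (Some (x \<cdot> y)) = vc ?x ?y" using ok by (simp add: vc_def)
  have "trace_iso x \<otimes>\<^bsub>twisted\<^esub> trace_iso y = comps (val (mate (wh [u] (vc ?x ?y) [])))"
    using total_mult[OF tx] mate_left[OF pN ok(1) _ _ _ _ ok(2)] x y ok by (simp add: total_cell_trace_iso)
  also have "\<dots> = trace_iso (x \<cdot> y)"
    using D.m_closed[OF x y] unfolding xy[symmetric] by (simp add: trace_iso_eq trace_map_def)
  finally show "trace_iso (x \<otimes>\<^bsub>Dim C VG\<^esub> y) = trace_iso x \<otimes>\<^bsub>twisted_invariants C G V R\<^esub> trace_iso y"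
    by (simp add: twisted_invariants_ops)
qed

lemma trace_iso_algebra:
  shows "algebra K (twisted_invariants C G V R)"
    and "trace_iso \<in> algebra_iso K (Dim C VG) (twisted_invariants C G V R)"
proof -
  have D: "algebra K (Dim C VG)" using Dim_algebra S.V_obj .
  have im: "trace_iso ` carrier (Dim C VG) = carrier (twisted_invariants C G V R)"
    using trace_iso_image by simp
  show "algebra K (twisted_invariants C G V R)"
    by (rule algebra_transport[OF D im trace_iso_hom])
  have "bij_betw trace_iso (carrier (Dim C VG)) (carrier (twisted_invariants C G V R))"
    using trace_iso_injective im by (simp add: bij_betw_def)
  then show "trace_iso \<in> algebra_iso K (Dim C VG) (twisted_invariants C G V R)"
    using im trace_iso_hom by (auto simp: algebra_iso_def ring_iso_def ring_hom_def)
qed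


context
  fixes F :: 'm
  assumes F: "F \<in> mor C VG VG"
begin

abbreviation f :: "('o, 'm) arrow" where "f \<equiv> (VG, VG, F)"

lemma path_f: "path VG [f] VG" using F by simp

text \<open>
  The flips of \<open>U F A'\<close> as a composite of equivariant 1-morphisms agree with their rewritten form.
\<close>

lemma UFA_flip_val:
  assumes s: "s \<in> carrier G"
  shows "comp_flips C G U \<tau>U (F \<star> A') (comp_flips C G F (endo_fl F) A' \<tau>A') s = val (UFA_flip [f] s)"
    and "ok (UFA_flip [f] s)"
proof -
  let ?e = "vc (wh [f] (eps_cell s) []) (wh [] (invc (eps_cell s)) [f])"
  let ?w = "vc (wh [u] (vc (wh [f] (tauA_cell s) []) (wh [] ?e [a])) []) (wh [] (tau_cell s) [f, a])"
  have oe: "ok ?e" using s F by simp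
  have ve: "endo_fl F s = val ?e"
    using arg_cong[OF endo_flip_cell[OF path_f s], of val] by simp
  have ow: "ok ?w" using s F by simp
  have w: "?w = UFA_flip [f] s"
    using s F by (simp add: UFA_flip_def beta_def ups_def)
  show "ok (UFA_flip [f] s)" unfolding w[symmetric] by (rule ow)
  define e where "e = ?e"
  have e: "ok e" "tdom e = VG" "tcod e = VG" "tsrc e = [S.rho s, f]" "ttgt e = [f, S.rho s]"
    using oe by (simp_all add: e_def)
  have ow': "ok (vc (wh [u] (vc (wh [f] (tauA_cell s) []) (wh [] e [a])) []) (wh [] (tau_cell s) [f, a]))"
    using ow by (simp only: e_def)
  have "val (vc (wh [u] (vc (wh [f] (tauA_cell s) []) (wh [] e [a])) []) (wh [] (tau_cell s) [f, a])) =
    comp_flips C G U \<tau>U (F \<star> A') (comp_flips C G F (endo_fl F) A' \<tau>A') s"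
    using s F e ow' ve
    by (simp add: val_vc val_wh_left val_wh_right comp_flips_def whisker_left_def whisker_right_def e_def[symmetric]
        del: wh_vc)
  then show "comp_flips C G U \<tau>U (F \<star> A') (comp_flips C G F (endo_fl F) A' \<tau>A') s = val (UFA_flip [f] s)"
    using w by (simp only: e_def)
qed

abbreviation trace_cell_of :: "'c \<Rightarrow> ('o, 'm, 'c) tcell" where
  "trace_cell_of m \<equiv> TCell V V [] [u, f, a] (Some m)"

abbreviation UFA_invariants :: "('k, 'c) module" where
  "UFA_invariants \<equiv> UFA_trace_invariants C G V R VG S \<epsilon> U \<tau>U A' \<tau>A' F"

lemma UFA_flip_sel [simp]:
  "tdom (UFA_flip [f] s) = V" "tcod (UFA_flip [f] s) = V" "tsrc (UFA_flip [f] s) = [rho s, u, f, a]"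
  "ttgt (UFA_flip [f] s) = [u, f, a, rho s]"
  by (simp_all add: UFA_flip_def)

lemma trace_action_val:
  assumes s: "s \<in> carrier G" and m: "m \<in> hom2 C (id1 C V) (U \<star> F \<star> A')"
  shows "trace_action C G V R (U \<star> F \<star> A')
      (comp_flips C G U \<tau>U (F \<star> A') (comp_flips C G F (endo_fl F) A' \<tau>A')) s m =
    val (act_cell [f] s (trace_cell_of m))"
    and "ok (act_cell [f] s (trace_cell_of m))"
proof -
  have ok: "ok (trace_cell_of m)" using m F by (simp add: ok_TCell)
  then show "ok (act_cell [f] s (trace_cell_of m))"
    using s F UFA_flip_val(2)[OF s] by (simp add: act_cell_def)
  show "trace_action C G V R (U \<star> F \<star> A')
      (comp_flips C G U \<tau>U (F \<star> A') (comp_flips C G F (endo_fl F) A' \<tau>A')) s m =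
    val (act_cell [f] s (trace_cell_of m))"
    using s F ok UFA_flip_val[OF s]
    by (simp add: act_cell_def val_simps trace_action_def conjugate_def whisker_left_def whisker_right_def)
qed

lemma UFA_invariants_sel:
  "carrier UFA_invariants = trace_map [f] ` hom2 C (id1 C VG) F"
  "x \<oplus>\<^bsub>UFA_invariants\<^esub> y = x \<oplus>\<^bsub>cell C (id1 C V) (U \<star> F \<star> A')\<^esub> y"
  "k \<odot>\<^bsub>UFA_invariants\<^esub> x = k \<odot>\<^bsub>cell C (id1 C V) (U \<star> F \<star> A')\<^esub> x"
  "\<zero>\<^bsub>UFA_invariants\<^esub> = \<zero>\<^bsub>cell C (id1 C V) (U \<star> F \<star> A')\<^esub>"
proof -
  have "trace_action C G V R (U \<star> F \<star> A')
      (comp_flips C G U \<tau>U (F \<star> A') (comp_flips C G F (endo_fl F) A' \<tau>A')) s m = m \<longleftrightarrow>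
    act_cell [f] s (trace_cell_of m) = trace_cell_of m"
    if "s \<in> carrier G" "m \<in> hom2 C (id1 C V) (U \<star> F \<star> A')" for s m
  proof -
    have "ok (trace_cell_of m)" using that F by (simp add: ok_TCell)
    then show ?thesis
      using trace_action_val[OF that] tcell_eq_val[of "act_cell [f] s (trace_cell_of m)" "trace_cell_of m"]
      by (simp add: act_cell_def)
  qed
  then show "carrier UFA_invariants = trace_map [f] ` hom2 C (id1 C VG) F"
    using trace_map_image[OF path_f] by (auto simp: UFA_trace_invariants_def trace_invariants_def Tr_def hom2_def)
qed (simp_all add: UFA_trace_invariants_def trace_invariants_def Tr_def)

lemma trace_map_actions:
  assumes x: "x \<in> hom2 C (id1 C VG) (id1 C VG)" and y: "y \<in> hom2 C (id1 C VG) F"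
  shows "trace_map [f] (x \<bullet> y) = left_action C G V (U \<star> A') inc (alpha_A) A' F (trace_iso x) (trace_map [f] y)"
    and "trace_map [f] (y \<bullet> x) = right_action C G V (U \<star> A') inc U \<alpha>' A' F (trace_map [f] y) (trace_iso x)"
proof -
  let ?x = "TCell VG VG [] [] (Some x)" and ?y = "TCell VG VG [] [f] (Some y)"
  have ok: "ok ?x" "ok ?y" using x y F by (simp_all add: ok_TCell)
  have tx: "trace_iso x \<in> carrier twisted"
    using x comps_closed trace_map_Nil_closed by (simp add: trace_iso_eq)
  define m where "m = mate (wh [u] ?y [])"
  have m: "ok m" "tdom m = V" "tcod m = V" "tsrc m = []" "ttgt m = [u, f, a]" "val m = trace_map [f] y"
    using ok F by (simp_all add: m_def mate_def trace_map_def)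
  have tot: "val (total_cell (trace_iso x)) = total (trace_iso x)" "ok (total_cell (trace_iso x))"
    using tx by simp_all
  have xy: "x \<bullet> y = val (vc (wh [] ?x [f]) ?y)" "y \<bullet> x = val (vc (wh [f] ?x []) ?y)"
    using val_hcomp(1)[of ?x ?y] val_hcomp(2)[of ?y ?x] ok by simp_all
  have w: "TCell VG VG [] [f] (Some (val z)) = z" if "ok z" "tdom z = VG" "tcod z = VG" "tsrc z = []" "ttgt z = [f]"
      for z
    using that okD(8)[OF that(1)] by (simp add: tcell_eq_iff)
  have "trace_map [f] (x \<bullet> y) = val (mate (wh [u] (vc (wh [] ?x [f]) ?y) []))"
    unfolding trace_map_def xy(1) using ok F by (subst w) simp_all
  also have "\<dots> = val (vc (wh [] alpha_cell [f, a]) (vc (wh [] (total_cell (trace_iso x)) [u, f, a]) m))"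
    using mate_left[OF path_f ok(1) _ _ _ _ ok(2)] by (simp add: total_cell_trace_iso[OF x] m_def)
  also have "\<dots> = val (wh [] alpha_cell [f, a]) \<cdot> (total (trace_iso x) \<bullet> trace_map [f] y)"
    using val_hcomp(1)[of "total_cell (trace_iso x)" m] m tot F by (simp add: val_vc[of "wh [] alpha_cell [f, a]"])
  also have "\<dots> = left_action C G V (U \<star> A') inc (alpha_A) A' F (trace_iso x) (trace_map [f] y)"
    using F by (simp add: left_action_def val_wh_right whisker_right_def)
  finally show "trace_map [f] (x \<bullet> y) = left_action C G V (U \<star> A') inc (alpha_A) A' F (trace_iso x) (trace_map [f] y)"
      .
  have "trace_map [f] (y \<bullet> x) = val (mate (wh [u] (vc (wh [f] ?x []) ?y) []))"
    unfolding trace_map_def xy(2) using ok F by (subst w) simp_all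
  also have "\<dots> = val (vc (wh [u, f] counit [a]) (vc (wh [u, f, a] (total_cell (trace_iso x)) []) m))"
    using mate_right[OF path_f ok(1) _ _ _ _ ok(2)] by (simp add: total_cell_trace_iso[OF x] m_def)
  also have "\<dots> = val (wh [u, f] counit [a]) \<cdot> (trace_map [f] y \<bullet> total (trace_iso x))"
    using val_hcomp(2)[of m "total_cell (trace_iso x)"] m tot F by (simp add: val_vc[of "wh [u, f] counit [a]"])
  also have "\<dots> = right_action C G V (U \<star> A') inc U \<alpha>' A' F (trace_map [f] y) (trace_iso x)"
    using F by (simp add: right_action_def val_wh_both whisker_left_def whisker_right_def)
  finally show "trace_map [f] (y \<bullet> x) = right_action C G V (U \<star> A') inc U \<alpha>' A' F (trace_map [f] y) (trace_iso x)" .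
qed

lemma UFA_bimodule:
  defines "l \<equiv> left_action C G V (U \<star> A') inc (alpha_A) A' F"
    and "r \<equiv> right_action C G V (U \<star> A') inc U \<alpha>' A' F"
  shows "bimodule K (twisted_invariants C G V R) UFA_invariants l r"
    and "trace_map [f] \<in> bimodule_iso K (Dim C VG) trace_iso (Tr C VG F) (\<lambda>x y. x \<bullet> y) (\<lambda>y x. y \<bullet> x) UFA_invariants l
        r"
proof -
  have D: "algebra K (Dim C VG)" using Dim_algebra S.V_obj .
  have im: "trace_iso ` carrier (Dim C VG) = carrier (twisted_invariants C G V R)"
    using trace_iso_image by simp
  have TrF: "Tr C VG F = cell C (id1 C VG) F" "carrier (cell C (id1 C VG) F) = hom2 C (id1 C VG) F"
    by (simp_all add: Tr_def hom2_def)
  have b: "bimodule K (Dim C VG) (cell C (id1 C VG) F) (\<lambda>x y. x \<bullet> y) (\<lambda>y x. y \<bullet> x)"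
    using trace_bimodule[OF S.V_obj F] TrF by simp
  have img: "trace_map [f] ` carrier (cell C (id1 C VG) F) = carrier UFA_invariants"
    by (simp add: UFA_invariants_sel TrF)
  have zero: "trace_map [f] \<zero>\<^bsub>cell C (id1 C VG) F\<^esub> = \<zero>\<^bsub>UFA_invariants\<^esub>"
    using trace_map_zero[OF path_f] by (simp add: UFA_invariants_sel)
  have lin: "trace_map [f] (m \<oplus>\<^bsub>cell C (id1 C VG) F\<^esub> n) = trace_map [f] m \<oplus>\<^bsub>UFA_invariants\<^esub> trace_map [f] n"
    if "m \<in> carrier (cell C (id1 C VG) F)" "n \<in> carrier (cell C (id1 C VG) F)" for m n
    using trace_map_linear(1)[OF path_f _ _ zero_closed, of m n] that by (simp add: UFA_invariants_sel TrF)
  have sm: "trace_map [f] (k \<odot>\<^bsub>cell C (id1 C VG) F\<^esub> m) = k \<odot>\<^bsub>UFA_invariants\<^esub> trace_map [f] m"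
    if "k \<in> carrier K" "m \<in> carrier (cell C (id1 C VG) F)" for k m
    using trace_map_linear(2)[OF path_f, of m m k] that by (simp add: UFA_invariants_sel TrF)
  have act: "trace_map [f] (x \<bullet> m) = l (trace_iso x) (trace_map [f] m)"
      "trace_map [f] (m \<bullet> x) = r (trace_map [f] m) (trace_iso x)"
    if "x \<in> carrier (Dim C VG)" "m \<in> carrier (cell C (id1 C VG) F)" for x m
    using trace_map_actions[of x m] that by (simp_all add: TrF l_def r_def)
  show "bimodule K (twisted_invariants C G V R) UFA_invariants l r"
    by (rule bimodule_transport[OF b D, where i = trace_iso and f = "trace_map [f]"];
        (rule im trace_iso_hom img zero lin sm act; assumption))
  show "trace_map [f] \<in> bimodule_iso K (Dim C VG) trace_iso (Tr C VG F) (\<lambda>x y. x \<bullet> y) (\<lambda>y x. y \<bullet> x) UFA_invariants l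
      r"
    using trace_map_injective[OF path_f] img lin sm act
    unfolding bimodule_iso_def bij_betw_def TrF by (simp add: TrF)
qed

end

end

text \<open>
  As \<open>post_U\<close> determines its underlying 1-morphism, \<open>A\<close> is \<open>U A'\<close>.
\<close>

lemma is_adjoint_data_iff:
  assumes "fixed_object K C G V R VG S \<epsilon> U \<tau>U"
  shows "is_adjoint_data C G V R VG S \<epsilon> U \<tau>U A inc prj A' \<tau>A' \<alpha>' \<longleftrightarrow>
    A = comp1 C U A' \<and> adjunction K C G V R VG S \<epsilon> U \<tau>U inc prj A' \<tau>A' \<alpha>'"
proof -
  interpret fixed_object K C G V R VG S \<epsilon> U \<tau>U by (rule assms)
  interpret from_V: representation_pair K C G VG S V R ..
  have UA: "comp1 C U A' \<in> mor C V V" if "(A', \<tau>A') \<in> Ob (equivariant_cat C G V R VG S)"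
    using comp1_closed[OF V_obj S.V_obj V_obj U_mor from_V.equivariant_mor[OF that]] .
  show ?thesis
  proof
    assume ad: "is_adjoint_data C G V R VG S \<epsilon> U \<tau>U A inc prj A' \<tau>A' \<alpha>'"
    then have p: "post_U C G R S \<epsilon> U \<tau>U (A', \<tau>A') = (A, A_flips C G R A inc prj, A_triv C G R A inc prj)"
      by (simp add: is_adjoint_data_def)
    then have "A = comp1 C U A'" by (simp add: post_U_def)
    moreover from this have "adjunction K C G V R VG S \<epsilon> U \<tau>U inc prj A' \<tau>A' \<alpha>'"
      using ad by unfold_locales (simp_all add: is_adjoint_data_def)
    ultimately show "A = comp1 C U A' \<and> adjunction K C G V R VG S \<epsilon> U \<tau>U inc prj A' \<tau>A' \<alpha>'" by simp
  next
    assume A: "A = comp1 C U A' \<and> adjunction K C G V R VG S \<epsilon> U \<tau>U inc prj A' \<tau>A' \<alpha>'"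
    then interpret A: adjunction K C G V R VG S \<epsilon> U \<tau>U inc prj A' \<tau>A' \<alpha>' by simp
    show "is_adjoint_data C G V R VG S \<epsilon> U \<tau>U A inc prj A' \<tau>A' \<alpha>'"
      using A A.sum_UA A.A'_equivariant A.post_U_A' A.counit_hom A.U_counit A.UA_mor
      by (simp add: is_adjoint_data_def)
  qed
qed

theorem theorem5p17:
  fixes K :: "'k ring"
    and C :: "('o, 'm, 'c, 'k) two_cat" (structure)
    and G :: "'g monoid"
  assumes "algebraically_closed K"
    and "group G" and "finite (carrier G)"
    and "linear_two_category K C"
    and "is_two_rep C G V R"
    and "is_fixed_object C G V R VG S \<epsilon> U \<tau>U"
  shows "(\<exists>A inc prj A' \<tau>A' \<alpha>'. is_adjoint_data C G V R VG S \<epsilon> U \<tau>U A inc prj A' \<tau>A' \<alpha>') \<and>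
    (\<exists>i.
      algebra K (Dim C VG) \<and>
      algebra K (twisted_invariants C G V R) \<and>
      i \<in> algebra_iso K (Dim C VG) (twisted_invariants C G V R) \<and>
      (\<forall>A inc prj A' \<tau>A' \<alpha>'. is_adjoint_data C G V R VG S \<epsilon> U \<tau>U A inc prj A' \<tau>A' \<alpha>' \<longrightarrow>
        (\<forall>F \<in> mor C VG VG.
          let TrG = UFA_trace_invariants C G V R VG S \<epsilon> U \<tau>U A' \<tau>A' F;
              l = left_action C G V A inc (alpha C G R S \<epsilon> U \<tau>U A prj) A' F;
              r = right_action C G V A inc U \<alpha>' A' F
          in bimodule K (Dim C VG) (Tr C VG F) (\<lambda>a \<xi>. a \<bullet> \<xi>) (\<lambda>\<xi> a. \<xi> \<bullet> a) \<and>
             bimodule K (twisted_invariants C G V R) TrG l r \<and>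
             (\<exists>i\<^sub>F. i\<^sub>F \<in> bimodule_iso K (Dim C VG) i
                (Tr C VG F) (\<lambda>a \<xi>. a \<bullet> \<xi>) (\<lambda>\<xi> a. \<xi> \<bullet> a) TrG l r))))"
proof -
  interpret linear_two_category K C by fact
  interpret G: group G by fact
  have S: "is_two_rep C G VG S" using assms(6) by (simp add: is_fixed_object_def)
  interpret fixed_object K C G V R VG S \<epsilon> U \<tau>U
    by unfold_locales (use assms S in simp_all)
  note data_iff = is_adjoint_data_iff[OF fixed_object_axioms]
  have ex: "\<exists>A inc prj A' \<tau>A' \<alpha>'. is_adjoint_data C G V R VG S \<epsilon> U \<tau>U A inc prj A' \<tau>A' \<alpha>'"
  proof -
    obtain inc prj A' \<tau>A' where "adjoint_sum K C G V R VG S \<epsilon> U \<tau>U inc prj A' \<tau>A'"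
      using adjoint_sum_exists by blast
    then interpret A: adjoint_sum K C G V R VG S \<epsilon> U \<tau>U inc prj A' \<tau>A' .
    obtain \<alpha>' where "\<alpha>' \<in> hom2 C (A' \<star> U) (id1 C VG)" "U \<triangleright> \<alpha>' = alpha C G R S \<epsilon> U \<tau>U (U \<star> A') prj"
      using A.counit_exists by blast
    then have "adjunction K C G V R VG S \<epsilon> U \<tau>U inc prj A' \<tau>A' \<alpha>'"
      by unfold_locales
    then show ?thesis unfolding data_iff by blast
  qed
  then obtain A inc prj A' \<tau>A' \<alpha>' where "adjunction K C G V R VG S \<epsilon> U \<tau>U inc prj A' \<tau>A' \<alpha>'"
    unfolding data_iff by blast
  then interpret A: adjunction K C G V R VG S \<epsilon> U \<tau>U inc prj A' \<tau>A' \<alpha>' .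
  show ?thesis
  proof (intro conjI exI[of _ trace_iso] allI impI ballI)
    show "\<exists>A inc prj A' \<tau>A' \<alpha>'. is_adjoint_data C G V R VG S \<epsilon> U \<tau>U A inc prj A' \<tau>A' \<alpha>'" by (rule ex)
    show "algebra K (Dim C VG)" using Dim_algebra[OF S.V_obj] .
    show "algebra K (twisted_invariants C G V R)" by (rule A.trace_iso_algebra)
    show "trace_iso \<in> algebra_iso K (Dim C VG) (twisted_invariants C G V R)" by (rule A.trace_iso_algebra)
    fix B inc' prj' B' \<tau>B' \<beta>' F
    assume ad: "is_adjoint_data C G V R VG S \<epsilon> U \<tau>U B inc' prj' B' \<tau>B' \<beta>'" and F: "F \<in> mor C VG VG"
    have B: "B = U \<star> B'" and adj: "adjunction K C G V R VG S \<epsilon> U \<tau>U inc' prj' B' \<tau>B' \<beta>'"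
      using ad unfolding data_iff by simp_all
    show "let TrG = UFA_trace_invariants C G V R VG S \<epsilon> U \<tau>U B' \<tau>B' F;
              l = left_action C G V B inc' (alpha C G R S \<epsilon> U \<tau>U B prj') B' F;
              r = right_action C G V B inc' U \<beta>' B' F
          in bimodule K (Dim C VG) (Tr C VG F) (\<lambda>a \<xi>. a \<bullet> \<xi>) (\<lambda>\<xi> a. \<xi> \<bullet> a) \<and>
             bimodule K (twisted_invariants C G V R) TrG l r \<and>
             (\<exists>i\<^sub>F. i\<^sub>F \<in> bimodule_iso K (Dim C VG) trace_iso
                (Tr C VG F) (\<lambda>a \<xi>. a \<bullet> \<xi>) (\<lambda>\<xi> a. \<xi> \<bullet> a) TrG l r)"
      unfolding Let_def B
      using trace_bimodule[OF S.V_obj F] adjunction.UFA_bimodule[OF adj F] by blast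
  qed
qed

end
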